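(* Let $\Omega\subset\mathbb R^3$ be a bounded domain with connected boundary of class $C^{1,1}$. Let $D$ be an open subset of $\mathbb R^3$ with Lipschitz boundary and $\overline D\subset\Omega$. Let $V\in L^\infty(\Omega)$ be real-valued with $\mathrm{supp}\,V\subset\overline D$, and assume $0$ is not a Dirichlet eigenvalue of $-\Delta+V$ in $\Omega$. Let $x\in\Omega$, $\sigma\in N_x$, $j\in\{1,2,3\}$, and assume either (i) $x\in\overline D$, or (ii) $x\in\Omega\setminus\overline D$ and $\sigma\cap D\neq\emptyset$. Then for any needle sequence $\{v_n^j\}$ for $(x,\sigma)$ and for each of the three indicator sequences $\mathcal I_n(x,\sigma,\{v_n^j\})$ defined in the context, $$\lim_{n\to\infty}\mathcal I_n(x,\sigma,\{v_n^j\})=\begin{cases}+\infty&\text{if }V\text{ has positive jump on }D,\\-\infty&\text{if }V\text{ has negative jump on }D.\end{cases}$$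
   Context: $G(z)=\frac1{4\pi|z|}$. Dirichlet-to-Neumann map: for $f\in H^{1/2}(\partial\Omega)$ let $u\in H^1(\Omega)$ solve $-\Delta u+Vu=0$ in $\Omega$, $u=f$ on $\partial\Omega$; $\langle\Lambda_Vf,g\rangle=\int_\Omega\nabla u\cdot\nabla v+Vuv\,dx$ for any $v\in H^1(\Omega)$ with trace $g$; $\Lambda_0$ is the case $V\equiv0$. $N_x$: piecewise linear injective curves $\sigma:[0,1]\to\overline\Omega$ with $\sigma(0)\in\partial\Omega$, $\sigma(1)=x$, $\sigma(t)\in\Omega$ for $0<t<1$; $\sigma$ also denotes its image. Fix a nonempty open $\Gamma_0\subset\partial\Omega$; a needle sequence for $(x,\sigma)$ (index $j$) is a sequence of harmonic $v_n^j\in H^1(\Omega)$ with $\mathrm{supp}(v_n^j|_{\partial\Omega})\subset\Gamma_0$ and $v_n^j\to\frac{\partial G}{\partial z_j}(\cdot-x)$ in $H^1_{\rm loc}(\Omega\setminus\sigma)$. $G_n^j(z,x)=\frac{\partial G}{\partial z_j}(z-x)-v_n^j(z)$. The three indicator sequences (no summation over $j$) are: (Probe) $\langle(\Lambda_V-\Lambda_0)v_n^j|_{\partial\Omega},v_n^j|_{\partial\Omega}\rangle$; (Singular Sources) $-\langle(\Lambda_V-\Lambda_0)v_n^j|_{\partial\Omega},G_n^j(\cdot,x)|_{\partial\Omega}\rangle$; (Completely Integrated) $\langle(\Lambda_V-\Lambda_0)G_n^j(\cdot,x)|_{\partial\Omega},G_n^j(\cdot,x)|_{\partial\Omega}\rangle$.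 $V$ has positive (resp. negative) jump on $D$ if there is $C>0$ with $V\ge C$ (resp. $-V\ge C$) a.e. on $D$. *)

theory Defs
  imports "HOL-Analysis.Analysis"
begin

definition pd :: "3 \<Rightarrow> (real^3 \<Rightarrow> real) \<Rightarrow> real^3 \<Rightarrow> real" where
  "pd i f y = frechet_derivative f (at y) (axis i 1)"

definition grad3 :: "(real^3 \<Rightarrow> real) \<Rightarrow> real^3 \<Rightarrow> real^3" where
  "grad3 f y = (\<chi> i. pd i f y)"

definition smooth3 :: "(real^3 \<Rightarrow> real) \<Rightarrow> bool" where
  "smooth3 f \<longleftrightarrow> (\<forall>is. continuous_on UNIV (fold pd is f) \<and> (\<forall>y. fold pd is f differentiable (at y)))"

definition tsupp :: "(real^3 \<Rightarrow> real) \<Rightarrow> (real^3) set" where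
  "tsupp f = closure {y. f y \<noteq> 0}"

definition test_fun :: "(real^3) set \<Rightarrow> (real^3 \<Rightarrow> real) \<Rightarrow> bool" where
  "test_fun U \<phi> \<longleftrightarrow> smooth3 \<phi> \<and> compact (tsupp \<phi>) \<and> tsupp \<phi> \<subseteq> U"

definition loc_int :: "(real^3) set \<Rightarrow> (real^3 \<Rightarrow> real) \<Rightarrow> bool" where
  "loc_int U f \<longleftrightarrow> (\<forall>K. compact K \<and> K \<subseteq> U \<longrightarrow> set_integrable lebesgue K f)"

definition L2 :: "(real^3) set \<Rightarrow> (real^3 \<Rightarrow> real) \<Rightarrow> bool" where
  "L2 U f \<longleftrightarrow> set_borel_measurable lebesgue U f \<and> set_integrable lebesgue U (\<lambda>y. (f y)\<^sup>2)"

definition is_wgrad :: "(real^3) set \<Rightarrow> (real^3 \<Rightarrow> real) \<Rightarrow> (real^3 \<Rightarrow> real^3) \<Rightarrow> bool" where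
  "is_wgrad U u Du \<longleftrightarrow> loc_int U u \<and> (\<forall>i. loc_int U (\<lambda>y. Du y $ i)) \<and>
     (\<forall>\<phi> i. test_fun U \<phi> \<longrightarrow>
        (LINT y:U|lebesgue. u y * pd i \<phi> y) = - (LINT y:U|lebesgue. Du y $ i * \<phi> y))"

definition wgrad :: "(real^3) set \<Rightarrow> (real^3 \<Rightarrow> real) \<Rightarrow> real^3 \<Rightarrow> real^3" where
  "wgrad U u = (SOME Du. is_wgrad U u Du)"

definition H1 :: "(real^3) set \<Rightarrow> (real^3 \<Rightarrow> real) \<Rightarrow> bool" where
  "H1 U u \<longleftrightarrow> L2 U u \<and> (\<exists>Du. is_wgrad U u Du \<and> (\<forall>i. L2 U (\<lambda>y. Du y $ i)))"

definition H1dist2 :: "(real^3) set \<Rightarrow> (real^3 \<Rightarrow> real) \<Rightarrow> (real^3 \<Rightarrow> real) \<Rightarrow> real" where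
  "H1dist2 U u w = (LINT y:U|lebesgue. (u y - w y)\<^sup>2 + (norm (wgrad U u y - wgrad U w y))\<^sup>2)"

definition H10 :: "(real^3) set \<Rightarrow> (real^3 \<Rightarrow> real) \<Rightarrow> bool" where
  "H10 U u \<longleftrightarrow> H1 U u \<and>
     (\<exists>\<phi>. (\<forall>k. test_fun U (\<phi> k)) \<and> (\<lambda>k. H1dist2 U u (\<phi> k)) \<longlonglongrightarrow> 0)"

definition H1loc :: "(real^3) set \<Rightarrow> (real^3 \<Rightarrow> real) \<Rightarrow> bool" where
  "H1loc W u \<longleftrightarrow> (\<exists>Du. is_wgrad W u Du) \<and>
     (\<forall>K. compact K \<and> K \<subseteq> W \<longrightarrow> L2 K u \<and> (\<forall>i. L2 K (\<lambda>y. wgrad W u y $ i)))"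

definition H1loc_conv :: "(real^3) set \<Rightarrow> (nat \<Rightarrow> real^3 \<Rightarrow> real) \<Rightarrow> (real^3 \<Rightarrow> real) \<Rightarrow> bool" where
  "H1loc_conv W f g \<longleftrightarrow> (\<forall>n. H1loc W (f n)) \<and> H1loc W g \<and>
     (\<forall>K. compact K \<and> K \<subseteq> W \<longrightarrow>
        (\<lambda>n. LINT y:K|lebesgue. (f n y - g y)\<^sup>2 + (norm (wgrad W (f n) y - wgrad W g y))\<^sup>2) \<longlonglongrightarrow> 0)"

definition weak_sol :: "(real^3) set \<Rightarrow> (real^3 \<Rightarrow> real) \<Rightarrow> (real^3 \<Rightarrow> real) \<Rightarrow> bool" where
  "weak_sol \<Omega> V u \<longleftrightarrow> H1 \<Omega> u \<and>
     (\<forall>\<phi>. test_fun \<Omega> \<phi> \<longrightarrow>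
        (LINT y:\<Omega>|lebesgue. wgrad \<Omega> u y \<bullet> grad3 \<phi> y + V y * u y * \<phi> y) = 0)"

definition weakly_harmonic :: "(real^3) set \<Rightarrow> (real^3 \<Rightarrow> real) \<Rightarrow> bool" where
  "weakly_harmonic \<Omega> u \<longleftrightarrow> weak_sol \<Omega> (\<lambda>_. 0) u"

definition dirichlet_eigenvalue_0 :: "(real^3) set \<Rightarrow> (real^3 \<Rightarrow> real) \<Rightarrow> bool" where
  "dirichlet_eigenvalue_0 \<Omega> V \<longleftrightarrow>
     (\<exists>u. H10 \<Omega> u \<and> weak_sol \<Omega> V u \<and> \<not> (AE y in lebesgue. y \<in> \<Omega> \<longrightarrow> u y = 0))"

definition dir_sol :: "(real^3) set \<Rightarrow> (real^3 \<Rightarrow> real) \<Rightarrow> (real^3 \<Rightarrow> real) \<Rightarrow> (real^3 \<Rightarrow> real) \<Rightarrow> bool" where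
  "dir_sol \<Omega> V f u \<longleftrightarrow> weak_sol \<Omega> V u \<and> H10 \<Omega> (\<lambda>y. u y - f y)"

text \<open>u in H^1(Omega) carries the boundary values of w (a function which is H^1 near the boundary):
  u = w a.e. outside some compact subset of Omega.\<close>
definition bdry_rep :: "(real^3) set \<Rightarrow> (real^3 \<Rightarrow> real) \<Rightarrow> (real^3 \<Rightarrow> real) \<Rightarrow> bool" where
  "bdry_rep \<Omega> w u \<longleftrightarrow> H1 \<Omega> u \<and>
     (\<exists>K. compact K \<and> K \<subseteq> \<Omega> \<and> (AE y in lebesgue. y \<in> \<Omega> - K \<longrightarrow> u y = w y))"

definition DtN_form :: "(real^3) set \<Rightarrow> (real^3 \<Rightarrow> real) \<Rightarrow> (real^3 \<Rightarrow> real) \<Rightarrow> (real^3 \<Rightarrow> real) \<Rightarrow> real" where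
  "DtN_form \<Omega> V f g =
     (let F = (SOME u. bdry_rep \<Omega> f u);
          Gv = (SOME v. bdry_rep \<Omega> g v);
          u = (SOME u. dir_sol \<Omega> V F u)
      in LINT y:\<Omega>|lebesgue. wgrad \<Omega> u y \<bullet> wgrad \<Omega> Gv y + V y * u y * Gv y)"

definition DtN_diff :: "(real^3) set \<Rightarrow> (real^3 \<Rightarrow> real) \<Rightarrow> (real^3 \<Rightarrow> real) \<Rightarrow> (real^3 \<Rightarrow> real) \<Rightarrow> real" where
  "DtN_diff \<Omega> V f g = DtN_form \<Omega> V f g - DtN_form \<Omega> (\<lambda>_. 0) f g"

definition trace_supp_in :: "(real^3) set \<Rightarrow> (real^3) set \<Rightarrow> (real^3 \<Rightarrow> real) \<Rightarrow> bool" where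
  "trace_supp_in \<Omega> \<Gamma> v \<longleftrightarrow>
     (\<exists>U. open U \<and> frontier \<Omega> - \<Gamma> \<subseteq> U \<and> (\<forall>\<psi>. test_fun U \<psi> \<longrightarrow> H10 \<Omega> (\<lambda>y. \<psi> y * v y)))"

definition G :: "real^3 \<Rightarrow> real" where
  "G z = 1 / (4 * pi * norm z)"

definition dG :: "3 \<Rightarrow> real^3 \<Rightarrow> real" where
  "dG j z = frechet_derivative G (at z) (axis j 1)"

definition piecewise_linear :: "(real \<Rightarrow> real^3) \<Rightarrow> bool" where
  "piecewise_linear \<sigma> \<longleftrightarrow> (\<exists>ts::real list. ts \<noteq> [] \<and> hd ts = 0 \<and> last ts = 1 \<and> sorted_wrt (<) ts \<and>
      (\<forall>k < length ts - 1. \<exists>a b. \<forall>t \<in> {ts!k..ts!(k+1)}. \<sigma> t = a + t *\<^sub>R b))"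

definition Ncurves :: "(real^3) set \<Rightarrow> real^3 \<Rightarrow> (real \<Rightarrow> real^3) \<Rightarrow> bool" where
  "Ncurves \<Omega> x \<sigma> \<longleftrightarrow> piecewise_linear \<sigma> \<and> inj_on \<sigma> {0..1} \<and> \<sigma> 0 \<in> frontier \<Omega> \<and>
     \<sigma> 1 = x \<and> (\<forall>t\<in>{0<..<1}. \<sigma> t \<in> \<Omega>)"

definition needle_seq :: "(real^3) set \<Rightarrow> (real^3) set \<Rightarrow> real^3 \<Rightarrow> (real \<Rightarrow> real^3) \<Rightarrow> 3
      \<Rightarrow> (nat \<Rightarrow> real^3 \<Rightarrow> real) \<Rightarrow> bool" where
  "needle_seq \<Omega> \<Gamma>0 x \<sigma> j v \<longleftrightarrow>
     (\<forall>n. weakly_harmonic \<Omega> (v n) \<and> trace_supp_in \<Omega> \<Gamma>0 (v n)) \<and>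
     H1loc_conv (\<Omega> - \<sigma> ` {0..1}) v (\<lambda>z. dG j (z - x))"

definition Gn :: "3 \<Rightarrow> real^3 \<Rightarrow> (nat \<Rightarrow> real^3 \<Rightarrow> real) \<Rightarrow> nat \<Rightarrow> real^3 \<Rightarrow> real" where
  "Gn j x v n z = dG j (z - x) - v n z"

definition probe_ind where
  "probe_ind \<Omega> V v n = DtN_diff \<Omega> V (v n) (v n)"

definition singular_sources_ind where
  "singular_sources_ind \<Omega> V j x v n = - DtN_diff \<Omega> V (v n) (Gn j x v n)"

definition completely_integrated_ind where
  "completely_integrated_ind \<Omega> V j x v n = DtN_diff \<Omega> V (Gn j x v n) (Gn j x v n)"

definition loc_graph_bdry :: "(real \<Rightarrow> (real \<times> real \<Rightarrow> real) \<Rightarrow> bool) \<Rightarrow> (real^3) set \<Rightarrow> bool" where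
  "loc_graph_bdry P \<Omega> \<longleftrightarrow> (\<forall>p \<in> frontier \<Omega>. \<exists>(R::real^3 \<Rightarrow> real^3) r h \<gamma>. orthogonal_transformation R \<and> r > 0 \<and> h > 0 \<and> P r \<gamma> \<and>
      (\<forall>y. let z = R (y - p) in
         norm (z$1, z$2) < r \<and> \<bar>z$3\<bar> < h \<longrightarrow> (y \<in> \<Omega> \<longleftrightarrow> z$3 < \<gamma> (z$1, z$2))))"

definition lipschitz_bdry :: "(real^3) set \<Rightarrow> bool" where
  "lipschitz_bdry = loc_graph_bdry (\<lambda>r \<gamma>. \<exists>L. L-lipschitz_on (ball 0 r) \<gamma>)"

definition C11_bdry :: "(real^3) set \<Rightarrow> bool" where
  "C11_bdry = loc_graph_bdry (\<lambda>r \<gamma>. (\<forall>z\<in>ball 0 r. \<gamma> differentiable (at z)) \<and>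
      (\<exists>L. L-lipschitz_on (ball 0 r)
         (\<lambda>z. (frechet_derivative \<gamma> (at z) (1,0), frechet_derivative \<gamma> (at z) (0,1)))))"

definition Linfty :: "(real^3) set \<Rightarrow> (real^3 \<Rightarrow> real) \<Rightarrow> bool" where
  "Linfty \<Omega> V \<longleftrightarrow> set_borel_measurable lebesgue \<Omega> V \<and> (\<exists>M. AE y in lebesgue. y \<in> \<Omega> \<longrightarrow> \<bar>V y\<bar> \<le> M)"

definition positive_jump :: "(real^3) set \<Rightarrow> (real^3 \<Rightarrow> real) \<Rightarrow> bool" where
  "positive_jump D V \<longleftrightarrow> (\<exists>C>0. AE y in lebesgue. y \<in> D \<longrightarrow> V y \<ge> C)"

definition negative_jump :: "(real^3) set \<Rightarrow> (real^3 \<Rightarrow> real) \<Rightarrow> bool" where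
  "negative_jump D V \<longleftrightarrow> (\<exists>C>0. AE y in lebesgue. y \<in> D \<longrightarrow> - V y \<ge> C)"

end

theory Submission
  imports Defs "HOL-Analysis.Analysis"
begin

text \<open>Let \<open>w n\<close> solve \<open>- \<Delta> w + V w = - V v n\<close> with zero boundary values. By Green's formula each indicator is the
  integral of \<open>V\<close> times a product of two functions, each of them \<open>\<plusminus> v n\<close> up to \<open>w n\<close> and a fixed square-integrable
  function; this fixed function is a regularisation of the dipole \<open>dG j (z - x)\<close> near \<open>x\<close>, which does not affect boundary
  values. Let \<open>a n\<close> be the \<open>L2\<close> norm of \<open>v n\<close> on \<open>closure D\<close>.

  First, \<open>a n\<close> tends to infinity. If \<open>x\<close> lies on the boundary of \<open>D\<close> and the needle avoids \<open>D\<close>, this holds because the dipole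
  is not square-integrable on a cone in \<open>D\<close> with vertex \<open>x\<close>. Otherwise the needle meets \<open>D\<close> before its end \<open>x\<close>; if \<open>a n\<close> were
  bounded along a subsequence, \<open>v n\<close> would converge weakly across that point of the needle, and testing with a function
  supported around the remaining piece of the needle would show that the dipole at \<open>x\<close> is harmonic in the sense of
  distributions.

  Secondly, \<open>v n / a n\<close> tends weakly to zero on \<open>closure D\<close>, because it is bounded there and converges to zero locally off the
  null set \<open>\<sigma>\<close>. Since \<open>0\<close> is not a Dirichlet eigenvalue, Rellich's theorem gives \<open>w n / a n \<longlonglongrightarrow> 0\<close> in \<open>L2\<close>. Divided by
  \<open>(a n)\<^sup>2\<close>, each indicator is therefore asymptotic to the integral of \<open>V * (v n / a n)\<^sup>2\<close>, which is bounded away from zero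
  with the sign of the jump.\<close>

section \<open>Square-integrable functions\<close>

text \<open>The \<open>L2\<close> norm of \<open>v n\<close> can serve as the yardstick because
  \<open>V\<close> is a perturbation of order zero: up to sign, \<open>w n\<close> is the image of
  \<open>V * v n\<close> under a solution operator that is compact on \<open>L2\<close>, whatever
  the size of \<open>V\<close>. Compactness upgrades weak to strong convergence, and weak
  convergence costs little, since the normalised functions can concentrate only on a null curve. The
  order of the singularity decides the boundary case: in dimension three the square of
  \<open>G\<close> is locally integrable, whereas the square of its derivative grows like the
  inverse fourth power of the distance. When the needle passes through \<open>D\<close>, the limit
  may be bounded there and its size says nothing; the contradiction comes from a charge at the tip
  that functions harmonic in all of \<Omega> cannot produce. A second obstacle is formal: boundary
  representatives, weak gradients and solutions are picked by \<open>SOME\<close>. Hence the use of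
  pairs of a function and its gradient in closed subspaces of \<open>L2\<close>, with all choices
  compared modulo \<open>h10\<close> or almost everywhere.\<close>

definition l2 :: "'a measure \<Rightarrow> ('a \<Rightarrow> 'b::euclidean_space) \<Rightarrow> bool" where
  "l2 M f \<longleftrightarrow> f \<in> borel_measurable M \<and> integrable M (\<lambda>x. (norm (f x))\<^sup>2)"

text \<open>Arguments are functions rather than classes, so \<open>ip\<close> is only semidefinite:
  a function of norm zero vanishes almost everywhere and no more. The Euclidean codomain covers
  scalars, gradients and pairs of both.\<close>

definition ip :: "'a measure \<Rightarrow> ('a \<Rightarrow> 'b::euclidean_space) \<Rightarrow> ('a \<Rightarrow> 'b) \<Rightarrow> real" where
  "ip M f g = (LINT x|M. f x \<bullet> g x)"

definition nrm :: "'a measure \<Rightarrow> ('a \<Rightarrow> 'b::euclidean_space) \<Rightarrow> real" where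
  "nrm M f = sqrt (ip M f f)"

lemma null_sandwich:
  fixes a b :: "nat \<Rightarrow> real"
  assumes "\<And>k. \<bar>a k\<bar> \<le> b k" "b \<longlonglongrightarrow> 0" shows "a \<longlonglongrightarrow> 0"
  by (rule Lim_null_comparison[OF _ assms(2)]) (use assms(1) in simp)

lemma l2_meas [measurable_dest]: "l2 M f \<Longrightarrow> f \<in> borel_measurable M"
  by (simp add: l2_def)

lemma l2_inner:
  assumes "l2 M f" "l2 M g" shows "integrable M (\<lambda>x. f x \<bullet> g x)"
proof (rule Bochner_Integration.integrable_bound[of M "\<lambda>x. (norm (f x))\<^sup>2 + (norm (g x))\<^sup>2"])
  show "integrable M (\<lambda>x. (norm (f x))\<^sup>2 + (norm (g x))\<^sup>2)" using assms by (simp add: l2_def)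
  show "(\<lambda>x. f x \<bullet> g x) \<in> borel_measurable M" using assms by (auto simp: l2_def)
  have "\<bar>a \<bullet> b\<bar> \<le> (norm a)\<^sup>2 + (norm b)\<^sup>2" for a b :: 'b
  proof -
    have "2 * norm a * norm b \<le> (norm a)\<^sup>2 + (norm b)\<^sup>2" by (rule sum_squares_bound)
    moreover have "0 \<le> norm a * norm b" by simp
    ultimately show ?thesis using Cauchy_Schwarz_ineq2[of a b] by linarith
  qed
  then show "AE x in M. norm (f x \<bullet> g x) \<le> norm ((norm (f x))\<^sup>2 + (norm (g x))\<^sup>2)" by simp
qed

lemma l2_zero [simp]: "l2 M (\<lambda>_. 0)" by (simp add: l2_def)

lemma l2_lin:
  assumes "l2 M f" "l2 M g" shows "l2 M (\<lambda>x. f x + c *\<^sub>R g x)"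
  unfolding l2_def
proof
  show "(\<lambda>x. f x + c *\<^sub>R g x) \<in> borel_measurable M" using assms by (auto simp: l2_def)
  have "(\<lambda>x. (norm (f x + c *\<^sub>R g x))\<^sup>2) = (\<lambda>x. (f x \<bullet> f x) + 2 * c * (f x \<bullet> g x) + c\<^sup>2 * (g x \<bullet> g x))"
    unfolding power2_norm_eq_inner
    by (rule ext) (simp add: inner_add_left inner_add_right inner_commute[of "g _" "f _"] power2_eq_square algebra_simps)
  then show "integrable M (\<lambda>x. (norm (f x + c *\<^sub>R g x))\<^sup>2)"
    using l2_inner[OF assms(1,1)] l2_inner[OF assms] l2_inner[OF assms(2,2)] by simp
qed

lemma l2_add [simp]: "l2 M f \<Longrightarrow> l2 M g \<Longrightarrow> l2 M (\<lambda>x. f x + g x)"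
  using l2_lin[of M f g 1] by simp
lemma l2_diff [simp]: "l2 M f \<Longrightarrow> l2 M g \<Longrightarrow> l2 M (\<lambda>x. f x - g x)"
  using l2_lin[of M f g "-1"] by simp
lemma l2_scale [simp]: "l2 M g \<Longrightarrow> l2 M (\<lambda>x. c *\<^sub>R g x)"
  using l2_lin[of M "\<lambda>_. 0" g c] by simp

lemma ip_sym: "ip M f g = ip M g f" by (simp add: ip_def inner_commute)
lemma ip_add_left: "l2 M f \<Longrightarrow> l2 M g \<Longrightarrow> l2 M h \<Longrightarrow> ip M (\<lambda>x. f x + g x) h = ip M f h + ip M g h"
  by (simp add: ip_def inner_simps l2_inner)
lemma ip_diff_left: "l2 M f \<Longrightarrow> l2 M g \<Longrightarrow> l2 M h \<Longrightarrow> ip M (\<lambda>x. f x - g x) h = ip M f h - ip M g h"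
  by (simp add: ip_def inner_simps l2_inner)
lemma ip_scale_left: "ip M (\<lambda>x. c *\<^sub>R f x) h = c * ip M f h"
  by (simp add: ip_def)
lemma ip_add_right: "l2 M f \<Longrightarrow> l2 M g \<Longrightarrow> l2 M h \<Longrightarrow> ip M h (\<lambda>x. f x + g x) = ip M h f + ip M h g"
  by (simp add: ip_def inner_simps l2_inner)
lemma ip_diff_right: "l2 M f \<Longrightarrow> l2 M g \<Longrightarrow> l2 M h \<Longrightarrow> ip M h (\<lambda>x. f x - g x) = ip M h f - ip M h g"
  by (simp add: ip_def inner_simps l2_inner)
lemma ip_scale_right: "ip M h (\<lambda>x. c *\<^sub>R f x) = c * ip M h f"
  by (simp add: ip_def)
lemmas ip_simps = ip_add_left ip_diff_left ip_scale_left ip_add_right ip_diff_right ip_scale_right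

lemma ip_zero [simp]: "ip M (\<lambda>_. 0) f = 0" "ip M f (\<lambda>_. 0) = 0" by (simp_all add: ip_def)

lemma ip_nonneg [simp]: "0 \<le> ip M f f" by (simp add: ip_def)
lemma nrm_nonneg [simp]: "0 \<le> nrm M f" by (simp add: nrm_def)
lemma nrm_sq: "(nrm M f)\<^sup>2 = ip M f f" by (simp add: nrm_def)
lemma nrm_zero [simp]: "nrm M (\<lambda>_. 0) = 0" by (simp add: nrm_def)

lemma ip_CS:
  assumes "l2 M f" "l2 M g" shows "\<bar>ip M f g\<bar> \<le> nrm M f * nrm M g"
proof -
  define a b c where "a = ip M f f" and "b = ip M f g" and "c = ip M g g"
  have pos: "0 \<le> a + 2 * t * b + t\<^sup>2 * c" for t
  proof -
    have "0 \<le> ip M (\<lambda>x. f x + t *\<^sub>R g x) (\<lambda>x. f x + t *\<^sub>R g x)" by simp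
    also have "\<dots> = a + 2 * t * b + t\<^sup>2 * c"
      using assms by (simp add: ip_simps a_def b_def c_def ip_sym[of M g f] power2_eq_square algebra_simps)
    finally show ?thesis .
  qed
  have "0 \<le> c" "0 \<le> a" by (simp_all add: c_def a_def)
  have "b\<^sup>2 \<le> a * c"
  proof (cases "c = 0")
    case True
    have "b = 0"
    proof (rule ccontr)
      assume "b \<noteq> 0"
      \<comment> \<open>At this \<open>t\<close> the polynomial, affine because
        \<open>c = 0\<close>, takes the value \<open>-1\<close>.\<close>
      then show False using pos[of "- (a + 1) / (2 * b)"] True by (simp add: field_simps)
    qed
    then show ?thesis using True by simp
  next
    case False
    \<comment> \<open>The polynomial is evaluated at its minimiser.\<close>
    then have "0 \<le> a - b\<^sup>2 / c" using pos[of "- b / c"] by (simp add: power2_eq_square field_simps)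
    then show ?thesis using False \<open>0 \<le> c\<close> by (simp add: field_simps)
  qed
  then have "sqrt (b\<^sup>2) \<le> sqrt (a * c)" by (rule real_sqrt_le_mono)
  then show ?thesis by (simp add: nrm_def a_def b_def c_def real_sqrt_mult)
qed

lemma nrm_scale: "nrm M (\<lambda>x. c *\<^sub>R f x) = \<bar>c\<bar> * nrm M f"
proof -
  have "ip M (\<lambda>x. c *\<^sub>R f x) (\<lambda>x. c *\<^sub>R f x) = c\<^sup>2 * ip M f f" by (simp add: ip_simps power2_eq_square)
  then show ?thesis by (simp add: nrm_def real_sqrt_mult)
qed

lemma nrm_add:
  assumes "l2 M f" "l2 M g" shows "nrm M (\<lambda>x. f x + g x) \<le> nrm M f + nrm M g"
proof (rule power2_le_imp_le)
  have "(nrm M (\<lambda>x. f x + g x))\<^sup>2 = ip M f f + 2 * ip M f g + ip M g g"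
    unfolding nrm_sq using assms by (simp add: ip_simps ip_sym[of M g f])
  also have "\<dots> \<le> (nrm M f)\<^sup>2 + 2 * (nrm M f * nrm M g) + (nrm M g)\<^sup>2"
    using ip_CS[OF assms] by (simp add: nrm_sq)
  finally show "(nrm M (\<lambda>x. f x + g x))\<^sup>2 \<le> (nrm M f + nrm M g)\<^sup>2" by (simp add: power2_sum)
qed simp

lemma nrm_diff_comm: "nrm M (\<lambda>x. f x - g x) = nrm M (\<lambda>x. g x - f x)"
  using nrm_scale[of M "-1" "\<lambda>x. f x - g x"] by simp

lemma nrm_diff:
  assumes "l2 M f" "l2 M g" shows "nrm M (\<lambda>x. f x - g x) \<le> nrm M f + nrm M g"
  using nrm_add[OF assms(1) l2_scale[OF assms(2)], of "-1"] nrm_scale[of M "-1" g] by simp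

lemma nrm_tri:
  assumes "l2 M f" "l2 M g" "l2 M h"
  shows "nrm M (\<lambda>x. f x - h x) \<le> nrm M (\<lambda>x. f x - g x) + nrm M (\<lambda>x. g x - h x)"
  using nrm_add[of M "\<lambda>x. f x - g x" "\<lambda>x. g x - h x"] assms by simp

lemma nrm_tri2:
  assumes "l2 M f" "l2 M g"
  shows "\<bar>nrm M f - nrm M g\<bar> \<le> nrm M (\<lambda>x. f x - g x)"
  using nrm_add[of M "\<lambda>x. f x - g x" g] nrm_add[of M "\<lambda>x. g x - f x" f] nrm_diff_comm[of M f g] assms by simp

lemma nrm_eq_0:
  assumes "l2 M f" shows "nrm M f = 0 \<longleftrightarrow> (AE x in M. f x = 0)"
proof -
  have "nrm M f = 0 \<longleftrightarrow> (LINT x|M. f x \<bullet> f x) = 0" by (simp add: nrm_def ip_def)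
  also have "\<dots> \<longleftrightarrow> (AE x in M. f x \<bullet> f x = 0)"
    using integral_nonneg_eq_0_iff_AE[OF l2_inner[OF assms assms]] by simp
  finally show ?thesis by simp
qed

lemma l2_cong_AE: 
  assumes "l2 M f" "g \<in> borel_measurable M" "AE x in M. f x = g x" shows "l2 M g"
proof -
  have [measurable]: "f \<in> borel_measurable M" "g \<in> borel_measurable M" using assms by (auto simp: l2_def)
  have "integrable M (\<lambda>x. (norm (g x))\<^sup>2)"
    by (rule Bochner_Integration.integrable_cong_AE_imp[of M "\<lambda>x. (norm (f x))\<^sup>2"]) (use assms in \<open>auto simp: l2_def elim!: eventually_mono\<close>)
  then show ?thesis using assms by (simp add: l2_def)
qed

lemma ip_tendsto:
  assumes "\<And>k. l2 M (s k)" "l2 M f" "(\<lambda>k. nrm M (\<lambda>x. s k x - f x)) \<longlonglongrightarrow> 0"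
    and "\<And>k. l2 M (t k)" "l2 M g" "(\<lambda>k. nrm M (\<lambda>x. t k x - g x)) \<longlonglongrightarrow> 0"
  shows "(\<lambda>k. ip M (s k) (t k)) \<longlonglongrightarrow> ip M f g"
proof -
  let ?a = "\<lambda>k. nrm M (\<lambda>x. s k x - f x)" and ?b = "\<lambda>k. nrm M (\<lambda>x. t k x - g x)"
  have "\<bar>ip M (s k) (t k) - ip M f g\<bar> \<le> ?a k * ?b k + ?a k * nrm M g + nrm M f * ?b k" for k
  proof -
    have "ip M (s k) (t k) - ip M f g = ip M (\<lambda>x. s k x - f x) (\<lambda>x. t k x - g x) + ip M (\<lambda>x. s k x - f x) g
        + ip M f (\<lambda>x. t k x - g x)"
      using assms by (simp add: ip_simps)
    then show ?thesis
      using ip_CS[of M "\<lambda>x. s k x - f x" "\<lambda>x. t k x - g x"] ip_CS[of M "\<lambda>x. s k x - f x" g] ip_CS[of M f "\<lambda>x. t k x - g x"] assms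
      by (simp add: abs_le_iff)
  qed
  moreover have "(\<lambda>k. ?a k * ?b k + ?a k * nrm M g + nrm M f * ?b k) \<longlonglongrightarrow> 0 * 0 + 0 * nrm M g + nrm M f * 0"
    by (intro tendsto_intros assms)
  then have "(\<lambda>k. ?a k * ?b k + ?a k * nrm M g + nrm M f * ?b k) \<longlonglongrightarrow> 0" by simp
  ultimately have "(\<lambda>k. ip M (s k) (t k) - ip M f g) \<longlonglongrightarrow> 0" by (rule null_sandwich)
  then show ?thesis by (simp add: LIM_zero_iff)
qed

lemma ip_tendsto_left:
  assumes "\<And>k. l2 M (s k)" "l2 M f" "(\<lambda>k. nrm M (\<lambda>x. s k x - f x)) \<longlonglongrightarrow> 0" "l2 M g"
  shows "(\<lambda>k. ip M (s k) g) \<longlonglongrightarrow> ip M f g"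
  by (rule ip_tendsto) (use assms in auto)

lemma nrm_tendsto:
  assumes "\<And>k. l2 M (s k)" "l2 M f" "(\<lambda>k. nrm M (\<lambda>x. s k x - f x)) \<longlonglongrightarrow> 0"
  shows "(\<lambda>k. nrm M (s k)) \<longlonglongrightarrow> nrm M f"
  unfolding nrm_def by (intro tendsto_real_sqrt ip_tendsto assms)

lemma l2_norm: "l2 M f \<Longrightarrow> l2 M (\<lambda>x. norm (f x))"
  by (auto simp: l2_def)

section \<open>Completeness, closed subspaces and the Riesz representation theorem\<close>

text \<open>On a finite measure space an \<open>L2\<close> Cauchy sequence is Cauchy in
  \<open>L1\<close> by Cauchy-Schwarz, so a subsequence converges almost everywhere and supplies the
  limit.\<close>

lemma l2_complete:
  fixes f :: "nat \<Rightarrow> 'a \<Rightarrow> 'b::euclidean_space"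
  assumes fin: "finite_measure M" and f: "\<And>k. l2 M (f k)"
    and C: "\<And>e. e > 0 \<Longrightarrow> \<exists>N. \<forall>i\<ge>N. \<forall>j\<ge>N. nrm M (\<lambda>x. f i x - f j x) < e"
  obtains g where "l2 M g" "(\<lambda>k. nrm M (\<lambda>x. f k x - g x)) \<longlonglongrightarrow> 0"
proof -
  interpret finite_measure M by fact
  have one: "l2 M (\<lambda>_. 1::real)" by (simp add: l2_def)
  have bd: "(LINT x|M. norm (f i x - f j x)) \<le> nrm M (\<lambda>x. f i x - f j x) * nrm M (\<lambda>_. 1::real)" for i j
  proof -
    have l: "l2 M (\<lambda>x. norm (f i x - f j x))" by (intro l2_norm l2_diff f)
    have "ip M (\<lambda>x. norm (f i x - f j x)) (\<lambda>_. 1) = (LINT x|M. norm (f i x - f j x))" by (simp add: ip_def)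
    moreover have "nrm M (\<lambda>x. norm (f i x - f j x)) = nrm M (\<lambda>x. f i x - f j x)"
      by (simp add: nrm_def ip_def norm_eq_sqrt_inner)
    ultimately show ?thesis using ip_CS[OF l one] by simp
  qed
  have int: "integrable M (f k)" for k
  proof -
    have "integrable M (\<lambda>x. norm (f k x) \<bullet> (1::real))" by (rule l2_inner[OF l2_norm[OF f] one])
    then have "integrable M (\<lambda>x. norm (f k x))" by simp
    then show ?thesis using f[of k] integrable_norm_iff[of "f k" M] by (simp add: l2_def)
  qed
  have L1: "\<exists>N. \<forall>i\<ge>N. \<forall>j\<ge>N. (LINT x|M. norm (f i x - f j x)) < e" if "e > 0" for e
  proof -
    let ?c = "nrm M (\<lambda>_. 1::real) + 1"
    have c: "?c > 0" using nrm_nonneg[of M "\<lambda>_. 1::real"] by linarith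
    have "e / ?c > 0" using that c by (rule divide_pos_pos)
    then obtain N where N: "\<forall>i\<ge>N. \<forall>j\<ge>N. nrm M (\<lambda>x. f i x - f j x) < e / ?c" using C by blast
    have "(LINT x|M. norm (f i x - f j x)) < e" if "i \<ge> N" "j \<ge> N" for i j
    proof -
      have "nrm M (\<lambda>x. f i x - f j x) < e / ?c" using N that by auto
      then have "nrm M (\<lambda>x. f i x - f j x) * ?c < e" using c by (simp add: field_simps)
      then show ?thesis using bd[of i j] nrm_nonneg[of M "\<lambda>x. f i x - f j x"] unfolding distrib_left by linarith
    qed
    then show ?thesis by auto
  qed
  from cauchy_L1_AE_cauchy_subseq[OF int L1] obtain r where r: "strict_mono r" 
    and AEC: "AE x in M. Cauchy (\<lambda>i. f (r i) x)" by blast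
  define g where "g = (\<lambda>x. lim (\<lambda>i. f (r i) x))"
  have [measurable]: "f k \<in> borel_measurable M" for k using f by (simp add: l2_def)
  have gm [measurable]: "g \<in> borel_measurable M" unfolding g_def by measurable
  have lim: "AE x in M. (\<lambda>i. f (r i) x) \<longlonglongrightarrow> g x"
    using AEC by eventually_elim (simp add: g_def Cauchy_convergent_iff convergent_LIMSEQ_iff)
  \<comment> \<open>Fatou's lemma along the subsequence \<open>r\<close>, with \<open>k\<close>
    fixed; it yields square integrability of the difference and the bound at the same time.\<close>
  have null_subsequence: "l2 M (\<lambda>x. f k x - g x) \<and> nrm M (\<lambda>x. f k x - g x) \<le> e"
    if e: "e > 0" and N: "\<forall>i\<ge>N. \<forall>j\<ge>N. nrm M (\<lambda>x. f i x - f j x) < e" and k: "k \<ge> N" for e N k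
  proof -
    have "(\<integral>\<^sup>+x. ennreal ((norm (f k x - g x))\<^sup>2) \<partial>M) = (\<integral>\<^sup>+x. liminf (\<lambda>i. ennreal ((norm (f k x - f (r i) x))\<^sup>2)) \<partial>M)"
    proof (rule nn_integral_cong_AE, use lim in eventually_elim)
      case (elim x)
      have "(\<lambda>i. ennreal ((norm (f k x - f (r i) x))\<^sup>2)) \<longlonglongrightarrow> ennreal ((norm (f k x - g x))\<^sup>2)"
        by (intro tendsto_ennrealI tendsto_intros elim)
      then show ?case by (rule lim_imp_Liminf[OF sequentially_bot, symmetric])
    qed
    also have "\<dots> \<le> liminf (\<lambda>i. \<integral>\<^sup>+x. ennreal ((norm (f k x - f (r i) x))\<^sup>2) \<partial>M)"
      by (rule nn_integral_liminf) measurable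
    also have "\<dots> \<le> liminf (\<lambda>i::nat. ennreal (e\<^sup>2))"
    proof (rule Liminf_mono, rule eventually_sequentiallyI[of N])
      fix i assume "i \<ge> N"
      then have "r i \<ge> N" using seq_suble[OF r, of i] by linarith
      then have "nrm M (\<lambda>x. f k x - f (r i) x) \<le> e" using N k by (auto intro: less_imp_le)
      then have "(nrm M (\<lambda>x. f k x - f (r i) x))\<^sup>2 \<le> e\<^sup>2" by (intro power_mono) auto
      moreover have "l2 M (\<lambda>x. f k x - f (r i) x)" by (intro l2_diff f)
      then have "(\<integral>\<^sup>+x. ennreal ((norm (f k x - f (r i) x))\<^sup>2) \<partial>M) = ennreal ((nrm M (\<lambda>x. f k x - f (r i) x))\<^sup>2)"
        by (subst nn_integral_eq_integral) (auto simp: l2_def nrm_sq ip_def power2_norm_eq_inner)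
      ultimately show "(\<integral>\<^sup>+x. ennreal ((norm (f k x - f (r i) x))\<^sup>2) \<partial>M) \<le> ennreal (e\<^sup>2)"
        by (simp add: ennreal_leI)
    qed
    also have "\<dots> = ennreal (e\<^sup>2)" by (simp add: Liminf_const)
    finally have fin: "(\<integral>\<^sup>+x. ennreal ((norm (f k x - g x))\<^sup>2) \<partial>M) \<le> ennreal (e\<^sup>2)" .
    have l: "l2 M (\<lambda>x. f k x - g x)" unfolding l2_def
      by (intro conjI integrableI_nonneg) (use fin le_less_trans[OF _ ennreal_less_top] in auto)
    then have "(\<integral>\<^sup>+x. ennreal ((norm (f k x - g x))\<^sup>2) \<partial>M) = ennreal ((nrm M (\<lambda>x. f k x - g x))\<^sup>2)"
      by (subst nn_integral_eq_integral) (auto simp: l2_def nrm_sq ip_def power2_norm_eq_inner)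
    then have "(nrm M (\<lambda>x. f k x - g x))\<^sup>2 \<le> e\<^sup>2" using fin by simp
    then show ?thesis using l e power2_le_imp_le by auto
  qed
  obtain N where N: "\<forall>i\<ge>N. \<forall>j\<ge>N. nrm M (\<lambda>x. f i x - f j x) < 1" using C[of 1] by auto
  have "l2 M (\<lambda>x. f N x - g x)" using null_subsequence[of 1 N N] N by auto
  then have "l2 M (\<lambda>x. f N x - (f N x - g x))" by (rule l2_diff[OF f])
  then have g: "l2 M g" by (simp only: diff_diff_eq2 add_diff_cancel_left')
  have "(\<lambda>k. nrm M (\<lambda>x. f k x - g x)) \<longlonglongrightarrow> 0"
  proof (rule LIMSEQ_I)
    fix e :: real assume "e > 0"
    then obtain N where N: "\<forall>i\<ge>N. \<forall>j\<ge>N. nrm M (\<lambda>x. f i x - f j x) < e / 2" using C[of "e / 2"] by auto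
    then have "\<forall>k\<ge>N. norm (nrm M (\<lambda>x. f k x - g x) - 0) < e" using null_subsequence[of "e/2" N] \<open>e > 0\<close> by force
    then show "\<exists>N. \<forall>k\<ge>N. norm (nrm M (\<lambda>x. f k x - g x) - 0) < e" by blast
  qed
  with g show ?thesis by (rule that)
qed

text \<open>Closedness refers to all \<open>l2\<close> limits in the seminorm, so such a set is
  saturated: it contains every measurable function that equals one of its members almost
  everywhere.\<close>

definition clsub :: "'a measure \<Rightarrow> ('a \<Rightarrow> 'b::euclidean_space) set \<Rightarrow> bool" where
  "clsub M H \<longleftrightarrow> (\<lambda>_. 0) \<in> H \<and> (\<forall>f\<in>H. l2 M f) \<and> (\<forall>f\<in>H. \<forall>g\<in>H. \<forall>c. (\<lambda>x. f x + c *\<^sub>R g x) \<in> H) \<and>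
     (\<forall>s f. (\<forall>k. s k \<in> H) \<and> l2 M f \<and> (\<lambda>k. nrm M (\<lambda>x. s k x - f x)) \<longlonglongrightarrow> 0 \<longrightarrow> f \<in> H)"

lemma clsubD:
  assumes "clsub M H"
  shows "(\<lambda>_. 0) \<in> H" "\<And>f. f \<in> H \<Longrightarrow> l2 M f" "\<And>f g c. f \<in> H \<Longrightarrow> g \<in> H \<Longrightarrow> (\<lambda>x. f x + c *\<^sub>R g x) \<in> H"
    "\<And>s f. (\<And>k. s k \<in> H) \<Longrightarrow> l2 M f \<Longrightarrow> (\<lambda>k. nrm M (\<lambda>x. s k x - f x)) \<longlonglongrightarrow> 0 \<Longrightarrow> f \<in> H"
  using assms unfolding clsub_def by blast+

lemma clsub_ops:
  assumes "clsub M H"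
  shows "f \<in> H \<Longrightarrow> g \<in> H \<Longrightarrow> (\<lambda>x. f x + g x) \<in> H" "f \<in> H \<Longrightarrow> g \<in> H \<Longrightarrow> (\<lambda>x. f x - g x) \<in> H"
    "g \<in> H \<Longrightarrow> (\<lambda>x. c *\<^sub>R g x) \<in> H"
  using clsubD(3)[OF assms, of f g 1] clsubD(3)[OF assms, of f g "-1"] clsubD(3)[OF assms clsubD(1)[OF assms], of g c] by auto

lemma clsub_cong_AE:
  assumes H: "clsub M H" and f: "f \<in> H" and g: "g \<in> borel_measurable M" and ae: "AE x in M. f x = g x"
  shows "g \<in> H"
proof -
  have l: "l2 M g" using l2_cong_AE[OF clsubD(2)[OF H f] g ae] .
  have "nrm M (\<lambda>x. f x - g x) = 0"
    using nrm_eq_0[OF l2_diff[OF clsubD(2)[OF H f] l]] ae by simp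
  then show ?thesis using clsubD(4)[OF H, of "\<lambda>_. f" g] f l by simp
qed

text \<open>The first-order condition at a minimum: for small \<open>t\<close> the linear term
  decides the sign, and \<open>t = - b / d\<close> with \<open>d > \<bar>c\<bar>\<close> is small
  enough.\<close>

lemma quad_zero:
  fixes b c :: real assumes "\<And>t. 0 \<le> 2 * t * b + t\<^sup>2 * c" shows "b = 0"
proof (rule ccontr)
  assume b: "b \<noteq> 0"
  define d where "d = \<bar>c\<bar> + 1"
  have d: "d > 0" "c < d" by (auto simp: d_def)
  have "0 \<le> 2 * (- b / d) * b + (- b / d)\<^sup>2 * c" by (rule assms)
  also have "\<dots> = (b\<^sup>2 / d\<^sup>2) * (c - 2 * d)" using d by (simp add: power2_eq_square field_simps)
  finally have "0 \<le> (b\<^sup>2 / d\<^sup>2) * (c - 2 * d)" .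
  moreover have "b\<^sup>2 / d\<^sup>2 > 0" using b d by simp
  ultimately have "0 \<le> c - 2 * d" using mult_pos_neg[of "b\<^sup>2 / d\<^sup>2" "c - 2 * d"] by (meson not_le)
  then show False using d by linarith
qed

text \<open>The representing element is the minimiser of \<open>J f = ip M f f - 2 * F f\<close>.
  Completeness turns a minimising sequence into a minimiser, and the first variation of
  \<open>J\<close> there is the claim.\<close>

lemma riesz:
  assumes fin: "finite_measure M" and H: "clsub M H"
    and lin: "\<And>f g c. f \<in> H \<Longrightarrow> g \<in> H \<Longrightarrow> F (\<lambda>x. f x + c *\<^sub>R g x) = F f + c * F g"
    and bdd: "\<And>f. f \<in> H \<Longrightarrow> \<bar>F f\<bar> \<le> C * nrm M f"
  shows "\<exists>p\<in>H. \<forall>q\<in>H. F q = ip M p q"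
proof -
  note l2H = clsubD(2)[OF H] and lc = clsubD(3)[OF H]
  define J where "J f = ip M f f - 2 * F f" for f
  have Jlow: "- C\<^sup>2 \<le> J f" if "f \<in> H" for f
  proof -
    \<comment> \<open>Completing the square bounds \<open>J\<close> below, so that its infimum
      \<open>m\<close> is meaningful.\<close>
    have "0 \<le> (nrm M f - C)\<^sup>2" by simp
    then have "- C\<^sup>2 \<le> (nrm M f)\<^sup>2 - 2 * (C * nrm M f)" by (simp add: power2_diff algebra_simps)
    then show ?thesis using bdd[OF that] unfolding J_def nrm_sq by linarith
  qed
  define m where "m = Inf (J ` H)"
  have bb: "bdd_below (J ` H)" using Jlow by (auto simp: bdd_below_def)
  have mle: "m \<le> J f" if "f \<in> H" for f unfolding m_def using that bb by (auto intro: cInf_lower)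
  have "\<exists>f\<in>H. J f < m + 1 / (real k + 1)" for k
    using cInf_lessD[of "J ` H" "m + 1 / (real k + 1)"] clsubD(1)[OF H] unfolding m_def by fastforce
  then obtain s where s: "\<And>k. s k \<in> H" "\<And>k. J (s k) < m + 1 / (real k + 1)" by metis
  \<comment> \<open>The parallelogram law for \<open>s i\<close>, \<open>s j\<close> and their
    midpoint \<open>h\<close>: since \<open>J h\<close> is at least \<open>m\<close>, two nearly
    minimal elements are close to each other.\<close>
  have par: "(nrm M (\<lambda>x. s i x - s j x))\<^sup>2 \<le> 2 / (real i + 1) + 2 / (real j + 1)" for i j
  proof -
    define h where "h = (\<lambda>x. s i x + (1/2) *\<^sub>R (s j x + (-1) *\<^sub>R s i x))"
    have h: "h \<in> H" unfolding h_def by (intro lc s)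
    have l: "l2 M (s i)" "l2 M (s j)" using s l2H by auto
    have Fh: "F h = F (s i) + (1/2) * (F (s j) + (-1) * F (s i))" 
      unfolding h_def lin[OF s(1)[of i] lc[OF s(1)[of j] s(1)[of i], of "-1"], of "1/2"] lin[OF s(1)[of j] s(1)[of i], of "-1"] ..
    have Fh': "4 * F h = 2 * F (s i) + 2 * F (s j)" unfolding Fh by (simp add: field_simps)
    have "ip M h h = (1/4) * (ip M (s i) (s i) + 2 * ip M (s i) (s j) + ip M (s j) (s j))"
      unfolding h_def using l by (simp add: ip_simps ip_sym[of M "s j" "s i"] field_simps)
    moreover have "(nrm M (\<lambda>x. s i x - s j x))\<^sup>2 = ip M (s i) (s i) - 2 * ip M (s i) (s j) + ip M (s j) (s j)"
      unfolding nrm_sq using l by (simp add: ip_simps ip_sym[of M "s j" "s i"])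
    \<comment> \<open>The identity is isolated for plain reals, so that linear arithmetic does not
      have to look into the integrals.\<close>
    moreover have gen: "n = 2 * (a - 2 * f) + 2 * (b - 2 * g) - 4 * (c - 2 * h)"
      if "c = (1/4) * (a + 2 * d + b)" "n = a - 2 * d + b" "4 * h = 2 * f + 2 * g" for n a b c d f g h :: real
      using that by argo
    ultimately have "(nrm M (\<lambda>x. s i x - s j x))\<^sup>2 = 2 * J (s i) + 2 * J (s j) - 4 * J h"
      unfolding J_def using gen Fh' by blast
    then show ?thesis using mle[OF h] s(2)[of i] s(2)[of j] by simp
  qed
  have "\<exists>N. \<forall>i\<ge>N. \<forall>j\<ge>N. nrm M (\<lambda>x. s i x - s j x) < e" if e: "e > 0" for e
  proof -
    obtain N where N: "real N > 4 / e\<^sup>2" using reals_Archimedean2 by blast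
    have "nrm M (\<lambda>x. s i x - s j x) < e" if "i \<ge> N" "j \<ge> N" for i j
    proof (rule power2_less_imp_less)
      have p: "4 / e\<^sup>2 > 0" using e by simp
      have "2 / (real k + 1) < e\<^sup>2 / 2" if "k \<ge> N" for k
      proof -
        have "4 / e\<^sup>2 < real k + 1" using N that by (simp add: less_le_trans)
        then have "2 / (real k + 1) < 2 / (4 / e\<^sup>2)" using p by (intro divide_strict_left_mono) (auto intro: mult_pos_pos)
        then show ?thesis by simp
      qed
      then have "2 / (real i + 1) < e\<^sup>2 / 2" "2 / (real j + 1) < e\<^sup>2 / 2" using that by auto
      then show "(nrm M (\<lambda>x. s i x - s j x))\<^sup>2 < e\<^sup>2" using par[of i j] by linarith
    qed (use e in simp)
    then show ?thesis by blast
  qed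
  from l2_complete[OF fin l2H[OF s(1)] this] obtain p where
    p: "l2 M p" and lim: "(\<lambda>k. nrm M (\<lambda>x. s k x - p x)) \<longlonglongrightarrow> 0" by blast
  have pH: "p \<in> H" by (rule clsubD(4)[OF H s(1) p lim])
  have "(\<lambda>k. F (s k)) \<longlonglongrightarrow> F p"
  proof -
    have "\<bar>F (s k) - F p\<bar> \<le> C * nrm M (\<lambda>x. s k x - p x)" for k
      using lin[OF s(1) pH, of k "-1"] bdd[OF lc[OF s(1) pH], of k "-1"] by simp
    moreover have "(\<lambda>k. C * nrm M (\<lambda>x. s k x - p x)) \<longlonglongrightarrow> 0" by (intro tendsto_mult_right_zero lim)
    ultimately have "(\<lambda>k. F (s k) - F p) \<longlonglongrightarrow> 0" by (rule null_sandwich)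
    then show ?thesis by (simp add: LIM_zero_iff)
  qed
  then have "(\<lambda>k. J (s k)) \<longlonglongrightarrow> J p" unfolding J_def
    by (intro tendsto_intros ip_tendsto l2H s p lim)
  moreover have "(\<lambda>k. m + 1 / (real k + 1)) \<longlonglongrightarrow> m + 0"
    by (intro tendsto_intros) (use LIMSEQ_inverse_real_of_nat in \<open>simp add: inverse_eq_divide add.commute\<close>)
  ultimately have Jp: "J p \<le> m" using s(2) by (intro LIMSEQ_le[of "\<lambda>k. J (s k)"]) (auto intro: less_imp_le)
  have "F q = ip M p q" if q: "q \<in> H" for q
  proof -
    have lq: "l2 M q" using l2H q .
    have "ip M p q - F q = 0"
    proof (rule quad_zero)
      fix t :: real
      have "m \<le> J (\<lambda>x. p x + t *\<^sub>R q x)" by (intro mle lc pH q)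
      then have "0 \<le> J (\<lambda>x. p x + t *\<^sub>R q x) - J p" using Jp by linarith
      also have "\<dots> = 2 * t * (ip M p q - F q) + t\<^sup>2 * ip M q q"
        unfolding J_def lin[OF pH q] using p lq by (simp add: ip_simps ip_sym[of M q p] power2_eq_square algebra_simps)
      finally show "0 \<le> 2 * t * (ip M p q - F q) + t\<^sup>2 * ip M q q" .
    qed
    then show ?thesis by simp
  qed
  with pH show ?thesis by blast
qed

definition cl2 :: "'a measure \<Rightarrow> ('a \<Rightarrow> 'b::euclidean_space) set \<Rightarrow> ('a \<Rightarrow> 'b) set" where
  "cl2 M S = {f. l2 M f \<and> (\<forall>e>0. \<exists>s\<in>S. nrm M (\<lambda>x. s x - f x) < e)}"

lemma cl2_seq:
  assumes "f \<in> cl2 M S" obtains s where "\<And>k. s k \<in> S" "(\<lambda>k. nrm M (\<lambda>x. s k x - f x)) \<longlonglongrightarrow> 0"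
proof -
  have "\<exists>s\<in>S. nrm M (\<lambda>x. s x - f x) < 1 / (real k + 1)" for k
    using assms unfolding cl2_def by simp
  then obtain s where s: "\<And>k. s k \<in> S" "\<And>k. nrm M (\<lambda>x. s k x - f x) < 1 / (real k + 1)" by metis
  have "(\<lambda>k. 1 / (real k + 1)) \<longlonglongrightarrow> 0" using LIMSEQ_inverse_real_of_nat by (simp add: inverse_eq_divide add.commute)
  then have "(\<lambda>k. nrm M (\<lambda>x. s k x - f x)) \<longlonglongrightarrow> 0"
    by (rule null_sandwich[rotated]) (use s(2) in \<open>simp add: less_imp_le\<close>)
  with s show ?thesis using that by blast
qed

lemma cl2_seqI:
  assumes "l2 M f" "\<And>k. s k \<in> S" "(\<lambda>k. nrm M (\<lambda>x. s k x - f x)) \<longlonglongrightarrow> 0" shows "f \<in> cl2 M S"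
proof -
  have "\<exists>s\<in>S. nrm M (\<lambda>x. s x - f x) < e" if "e > 0" for e
    using LIMSEQ_D[OF assms(3) that] assms(2) by fastforce
  then show ?thesis using assms(1) by (simp add: cl2_def)
qed

lemma clsub_cl2:
  assumes S: "\<And>f. f \<in> S \<Longrightarrow> l2 M f" "(\<lambda>_. 0) \<in> S" "\<And>f g c. f \<in> S \<Longrightarrow> g \<in> S \<Longrightarrow> (\<lambda>x. f x + c *\<^sub>R g x) \<in> S"
  shows "clsub M (cl2 M S)"
  unfolding clsub_def
proof (intro conjI ballI allI impI)
  show "(\<lambda>_. 0) \<in> cl2 M S" unfolding cl2_def using S(2) by (auto intro!: bexI[of _ "\<lambda>_. 0"])
next
  fix f assume "f \<in> cl2 M S" then show "l2 M f" by (simp add: cl2_def)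
next
  fix f g :: "'a \<Rightarrow> 'b" and c :: real assume f: "f \<in> cl2 M S" and g: "g \<in> cl2 M S"
  then have l: "l2 M f" "l2 M g" by (auto simp: cl2_def)
  obtain s where s: "\<And>k. s k \<in> S" "(\<lambda>k. nrm M (\<lambda>x. s k x - f x)) \<longlonglongrightarrow> 0" by (rule cl2_seq[OF f]) (rule that)
  obtain t where t: "\<And>k. t k \<in> S" "(\<lambda>k. nrm M (\<lambda>x. t k x - g x)) \<longlonglongrightarrow> 0" by (rule cl2_seq[OF g]) (rule that)
  have "nrm M (\<lambda>x. (s k x + c *\<^sub>R t k x) - (f x + c *\<^sub>R g x)) \<le> nrm M (\<lambda>x. s k x - f x) + \<bar>c\<bar> * nrm M (\<lambda>x. t k x - g x)" for k
  proof -
    have "(\<lambda>x. (s k x + c *\<^sub>R t k x) - (f x + c *\<^sub>R g x)) = (\<lambda>x. (s k x - f x) + c *\<^sub>R (t k x - g x))"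
      by (simp add: algebra_simps)
    moreover have "l2 M (\<lambda>x. s k x - f x)" "l2 M (\<lambda>x. c *\<^sub>R (t k x - g x))"
      using l s(1)[of k] t(1)[of k] S(1) by (intro l2_diff l2_scale; simp)+
    ultimately show ?thesis using nrm_add nrm_scale by metis
  qed
  then have "\<bar>nrm M (\<lambda>x. (s k x + c *\<^sub>R t k x) - (f x + c *\<^sub>R g x))\<bar> \<le> nrm M (\<lambda>x. s k x - f x) + \<bar>c\<bar> * nrm M (\<lambda>x. t k x - g x)" for k
    by simp
  moreover have "(\<lambda>k. nrm M (\<lambda>x. s k x - f x) + \<bar>c\<bar> * nrm M (\<lambda>x. t k x - g x)) \<longlonglongrightarrow> 0"
    by (intro tendsto_add_zero tendsto_mult_right_zero s t)
  ultimately have "(\<lambda>k. nrm M (\<lambda>x. (s k x + c *\<^sub>R t k x) - (f x + c *\<^sub>R g x))) \<longlonglongrightarrow> 0" by (rule null_sandwich)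
  then show "(\<lambda>x. f x + c *\<^sub>R g x) \<in> cl2 M S"
    by (intro cl2_seqI[of M _ "\<lambda>k x. s k x + c *\<^sub>R t k x"] l2_lin l S(3) s t)
next
  fix s and f :: "'a \<Rightarrow> 'b" assume a: "(\<forall>k. s k \<in> cl2 M S) \<and> l2 M f \<and> (\<lambda>k. nrm M (\<lambda>x. s k x - f x)) \<longlonglongrightarrow> 0"
  have "\<exists>t\<in>S. nrm M (\<lambda>x. t x - f x) < e" if e: "e > 0" for e
  proof -
    obtain k where k: "nrm M (\<lambda>x. s k x - f x) < e / 2" using LIMSEQ_D[of _ 0 "e/2"] a e by fastforce
    obtain t where t: "t \<in> S" "nrm M (\<lambda>x. t x - s k x) < e / 2"
    proof -
      have "s k \<in> cl2 M S" "e / 2 > 0" using a e by auto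
      then show ?thesis unfolding cl2_def using that by blast
    qed
    have "nrm M (\<lambda>x. t x - f x) \<le> nrm M (\<lambda>x. t x - s k x) + nrm M (\<lambda>x. s k x - f x)"
      by (rule nrm_tri) (use S t a in \<open>auto simp: cl2_def\<close>)
    then show ?thesis using t k by (intro bexI[of _ t]) linarith+
  qed
  then show "f \<in> cl2 M S" using a by (simp add: cl2_def)
qed

lemma cl2_incl: "f \<in> S \<Longrightarrow> l2 M f \<Longrightarrow> f \<in> cl2 M S"
  unfolding cl2_def by (auto intro!: bexI[of _ f])

section \<open>Smooth functions and cutoffs\<close>

lemma pd_eq: "(f has_derivative f') (at y) \<Longrightarrow> pd i f y = f' (axis i 1)"
  unfolding pd_def by (simp add: frechet_derivative_at[symmetric])

lemma diff_works: "f differentiable (at y) \<Longrightarrow> (f has_derivative frechet_derivative f (at y)) (at y)"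
  using frechet_derivative_works by blast

lemma pd_const [simp]: "pd i (\<lambda>_. c) = (\<lambda>_. 0)"
  by (rule ext, rule pd_eq[THEN trans]) (auto intro!: derivative_eq_intros)

lemma pd_add:
  assumes "f differentiable (at y)" "g differentiable (at y)"
  shows "pd i (\<lambda>x. f x + g x) y = pd i f y + pd i g y"
  by (rule pd_eq[THEN trans, OF has_derivative_add[OF diff_works[OF assms(1)] diff_works[OF assms(2)]]])
     (simp add: pd_def)

lemma pd_mult:
  assumes "f differentiable (at y)" "g differentiable (at y)"
  shows "pd i (\<lambda>x. f x * g x) y = f y * pd i g y + pd i f y * g y"
  by (rule pd_eq[THEN trans, OF has_derivative_mult[OF diff_works[OF assms(1)] diff_works[OF assms(2)]]])
     (simp add: pd_def)

lemma pd_comp: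
  fixes h :: "real \<Rightarrow> real"
  assumes "f differentiable (at y)" "(h has_real_derivative h') (at (f y))"
  shows "(\<lambda>x. h (f x)) differentiable (at y)" "pd i (\<lambda>x. h (f x)) y = h' * pd i f y"
proof -
  have "((\<lambda>x. h (f x)) has_derivative (\<lambda>v. frechet_derivative f (at y) v * h')) (at y)"
    by (rule has_derivative_compose[OF diff_works[OF assms(1)] assms(2)[unfolded has_field_derivative_def], unfolded mult.commute[of h']])
  then show "(\<lambda>x. h (f x)) differentiable (at y)" "pd i (\<lambda>x. h (f x)) y = h' * pd i f y"
    by (auto simp: differentiable_def pd_eq pd_def[of i f] mult.commute)
qed

lemma pd_coord: "(\<lambda>y::real^3. y $ k) differentiable (at y)" "pd i (\<lambda>y. y $ k) = (\<lambda>_. if i = k then 1 else 0)"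
proof -
  have d: "((\<lambda>y::real^3. y $ k) has_derivative (\<lambda>v. v $ k)) (at y)" for y
    by (rule bounded_linear.has_derivative[OF bounded_linear_vec_nth]) (rule has_derivative_ident)
  show "(\<lambda>y::real^3. y $ k) differentiable (at y)" using d by (auto simp: differentiable_def)
  show "pd i (\<lambda>y. y $ k) = (\<lambda>_. if i = k then 1 else 0)"
    by (rule ext, rule pd_eq[THEN trans, OF d]) (auto simp: axis_def)
qed

inductive_set alg :: "(real^3 \<Rightarrow> real) set \<Rightarrow> (real^3 \<Rightarrow> real) set" for S where
  alg_const: "(\<lambda>_. c) \<in> alg S"
| alg_gen: "f \<in> S \<Longrightarrow> f \<in> alg S"
| alg_add: "f \<in> alg S \<Longrightarrow> g \<in> alg S \<Longrightarrow> (\<lambda>y. f y + g y) \<in> alg S"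
| alg_mult: "f \<in> alg S \<Longrightarrow> g \<in> alg S \<Longrightarrow> (\<lambda>y. f y * g y) \<in> alg S"

text \<open>Smoothness is obtained coinductively: an algebra whose generators are differentiable with
  partial derivatives in the algebra consists of smooth functions.\<close>
lemma alg_smooth:
  assumes S: "\<And>f y. f \<in> S \<Longrightarrow> f differentiable (at y)" "\<And>f i. f \<in> S \<Longrightarrow> pd i f \<in> alg S"
    and f: "f \<in> alg S"
  shows "smooth3 f"
proof -
  have a: "(\<forall>y. f differentiable (at y)) \<and> (\<forall>i. pd i f \<in> alg S)" if "f \<in> alg S" for f
    using that
  proof induction
    case (alg_const c) then show ?case by (auto intro: alg.intros)
  next
    case (alg_gen f) then show ?case using S by auto
  next
    case (alg_add f g)
    then have "pd i (\<lambda>y. f y + g y) = (\<lambda>y. pd i f y + pd i g y)" for i by (auto simp: pd_add)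
    then show ?case using alg_add by (auto intro: alg.intros)
  next
    case (alg_mult f g)
    then have "pd i (\<lambda>y. f y * g y) = (\<lambda>y. f y * pd i g y + pd i f y * g y)" for i by (auto simp: pd_mult)
    moreover have "(\<lambda>y. f y * pd i g y + pd i f y * g y) \<in> alg S" for i
      by (intro alg.alg_add alg.alg_mult) (use alg_mult in auto)
    ultimately show ?case using alg_mult by (auto intro: differentiable_mult)
  qed
  have b: "fold pd is f \<in> alg S" if "f \<in> alg S" for "is" f
    using that by (induction "is" arbitrary: f) (use a in auto)
  then show ?thesis unfolding smooth3_def using a[OF b[OF f]]
    by (simp add: differentiable_imp_continuous_on differentiable_on_def differentiable_at_withinI)
qed

lemma smooth3_diff: "smooth3 f \<Longrightarrow> f differentiable (at y)"
  unfolding smooth3_def by (drule spec[of _ "[]"]) auto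
lemma smooth3_cont: "smooth3 f \<Longrightarrow> continuous_on UNIV f"
  unfolding smooth3_def by (drule spec[of _ "[]"]) auto
lemma smooth3_pd: "smooth3 f \<Longrightarrow> smooth3 (pd i f)"
  unfolding smooth3_def
proof
  fix "is" assume "\<forall>is. continuous_on UNIV (fold pd is f) \<and> (\<forall>y. fold pd is f differentiable (at y))"
  from spec[OF this, of "i # is"] show "continuous_on UNIV (fold pd is (pd i f)) \<and> (\<forall>y. fold pd is (pd i f) differentiable (at y))"
    by simp
qed

text \<open>With all smooth functions as generators, closure under sums and products comes out at
  once, in place of an iterated Leibniz formula.\<close>

lemma smooth3_alg: "f \<in> alg {g. smooth3 g} \<Longrightarrow> smooth3 f"
  by (rule alg_smooth[of "{g. smooth3 g}"]) (auto intro: smooth3_diff smooth3_pd alg_gen)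

lemma smooth3_const [simp]: "smooth3 (\<lambda>_. c)" by (intro smooth3_alg alg_const)
lemma smooth3_add: "smooth3 f \<Longrightarrow> smooth3 g \<Longrightarrow> smooth3 (\<lambda>y. f y + g y)"
  by (intro smooth3_alg alg.intros) auto
lemma smooth3_mult: "smooth3 f \<Longrightarrow> smooth3 g \<Longrightarrow> smooth3 (\<lambda>y. f y * g y)"
  by (intro smooth3_alg alg_mult alg_gen) auto
lemma smooth3_scale: "smooth3 f \<Longrightarrow> smooth3 (\<lambda>y. c * f y)" by (intro smooth3_mult) auto
lemma smooth3_minus: "smooth3 f \<Longrightarrow> smooth3 g \<Longrightarrow> smooth3 (\<lambda>y. f y - g y)"
  using smooth3_add[OF _ smooth3_scale[of g "-1"], of f] by simp
lemma smooth3_sum: "finite A \<Longrightarrow> (\<And>a. a \<in> A \<Longrightarrow> smooth3 (f a)) \<Longrightarrow> smooth3 (\<lambda>y. \<Sum>a\<in>A. f a y)"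
  by (induction A rule: finite_induct) (auto intro: smooth3_add)
lemma smooth3_coord: "smooth3 (\<lambda>y. y $ k)"
  by (rule alg_smooth[of "{\<lambda>y. y $ k}"]) (auto simp: pd_coord intro: alg.intros)

lemma smooth3_sqdist: "smooth3 (\<lambda>y. (norm (y - p))\<^sup>2)"
proof -
  have "(\<lambda>y. (norm (y - p))\<^sup>2) = (\<lambda>y. \<Sum>k\<in>UNIV. (y $ k - p $ k) * (y $ k - p $ k))"
    by (simp add: power2_norm_eq_inner inner_vec_def)
  then show ?thesis by (auto intro!: smooth3_sum smooth3_mult smooth3_minus smooth3_coord)
qed

text \<open>Adjoining the reciprocal keeps the algebra closed under differentiation, because its
  partial derivatives are \<open>- (1 / f)\<^sup>2 * pd i f\<close>.\<close>

lemma smooth3_inverse: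
  assumes f: "smooth3 f" and nz: "\<And>y. f y \<noteq> 0" shows "smooth3 (\<lambda>y. inverse (f y))"
proof (rule alg_smooth[of "{g. smooth3 g} \<union> {\<lambda>y. inverse (f y)}"])
  let ?S = "{g. smooth3 g} \<union> {\<lambda>y. inverse (f y)}"
  have d: "(\<lambda>y. inverse (f y)) differentiable (at y)"
    "pd i (\<lambda>y. inverse (f y)) y = - (inverse (f y) * inverse (f y)) * pd i f y" for y i
    using pd_comp[OF smooth3_diff[OF f] DERIV_inverse[OF nz]] by (simp_all add: power2_eq_square)
  have "pd i (\<lambda>y. inverse (f y)) = (\<lambda>y. (-1) * (inverse (f y) * inverse (f y)) * pd i f y)" for i
    using d by (intro ext) simp
  moreover have "\<dots> i \<in> alg ?S" for i
    by (intro alg_mult alg_const) (auto intro!: alg_gen smooth3_pd f)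
  ultimately show "pd i g \<in> alg ?S" if "g \<in> ?S" for g i
    using that by (auto intro: alg_gen smooth3_pd)
  show "g differentiable (at y)" if "g \<in> ?S" for g y using that d smooth3_diff by auto
qed (simp add: alg_gen)

section \<open>Flat functions and cutoffs\<close>

text \<open>The case \<open>n = 0\<close> is the classical smooth step. The exponent is a parameter
  because derivatives of the step are combinations of members of this family with larger
  \<open>n\<close>.\<close>

definition flat :: "nat \<Rightarrow> real \<Rightarrow> real" where
  "flat n t = (if t > 0 then inverse t ^ n * exp (- inverse t) else 0)"

text \<open>Exponential decay beats every power: with \<open>m = n + 2\<close> and
  \<open>u = 1 / t\<close> one has \<open>(u / m) ^ m \<le> (1 + u / m) ^ m \<le> exp u\<close>. The
  quadratic order in \<open>t\<close> makes the derivative at the origin vanish.\<close>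

lemma flat_bound: "\<exists>C. \<forall>t. \<bar>flat n t\<bar> \<le> C * t\<^sup>2"
proof -
  define m where "m = n + 2"
  have "\<bar>flat n t\<bar> \<le> real m ^ m * t\<^sup>2" for t
  proof (cases "t > 0")
    case True
    have "(inverse t / real m) ^ m \<le> (1 + inverse t / real m) ^ m"
      using True by (intro power_mono) auto
    also have "\<dots> \<le> exp (inverse t)" by (rule exp_ge_one_plus_x_over_n_power_n) (use True in \<open>auto simp: m_def\<close>, smt (verit) inverse_nonnegative_iff_nonnegative of_nat_0_le_iff)
    finally have "(inverse t / real m) ^ m \<le> exp (inverse t)" .
    moreover have "0 < (inverse t / real m) ^ m" using True by (intro zero_less_power divide_pos_pos) (auto simp: m_def)
    ultimately have "exp (- inverse t) \<le> inverse ((inverse t / real m) ^ m)"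
      unfolding exp_minus by (rule le_imp_inverse_le)
    also have "\<dots> = real m ^ m * t ^ m" by (simp add: power_divide power_inverse field_simps)
    finally have "inverse t ^ n * exp (- inverse t) \<le> inverse t ^ n * (real m ^ m * t ^ m)"
      using True by (intro mult_left_mono) auto
    also have "\<dots> = real m ^ m * t\<^sup>2" using True by (simp add: m_def power_add field_simps power2_eq_square)
    finally show ?thesis using True by (simp add: flat_def)
  qed (simp add: flat_def)
  then show ?thesis by blast
qed

lemma flat_deriv: "(flat n has_real_derivative (flat (n + 2) t - real n * flat (n + 1) t)) (at t)"
proof -
  consider "t > 0" | "t < 0" | "t = 0" by linarith
  then show ?thesis
  proof cases
    case 1
    have "((\<lambda>t. inverse t ^ n * exp (- inverse t)) has_real_derivative (flat (n + 2) t - real n * flat (n + 1) t)) (at t)"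
      using 1 by (auto intro!: derivative_eq_intros simp: flat_def power2_eq_square field_simps) (cases n; simp add: field_simps)
    then show ?thesis
      by (rule has_field_derivative_transform_within_open[of _ _ _ "{0<..}"]) (use 1 in \<open>auto simp: flat_def\<close>)
  next
    case 2
    have "((\<lambda>t. 0) has_real_derivative (flat (n + 2) t - real n * flat (n + 1) t)) (at t)"
      using 2 by (simp add: flat_def)
    then show ?thesis
      by (rule has_field_derivative_transform_within_open[of _ _ _ "{..<0}"]) (use 2 in \<open>auto simp: flat_def\<close>)
  next
    case 3
    obtain C where C: "\<And>t. \<bar>flat n t\<bar> \<le> C * t\<^sup>2" using flat_bound by blast
    have "((\<lambda>h. flat n h / h) \<longlongrightarrow> 0) (at 0)"
    proof (rule Lim_null_comparison)
      show "eventually (\<lambda>h. norm (flat n h / h) \<le> C * \<bar>h\<bar>) (at 0)"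
        unfolding eventually_at
      proof (intro exI[of _ 1] conjI ballI impI)
        fix h :: real assume "h \<noteq> 0 \<and> dist h 0 < 1"
        then show "norm (flat n h / h) \<le> C * \<bar>h\<bar>" using C[of h]
          by (simp add: abs_divide divide_le_eq power2_eq_square abs_mult_self_eq mult.assoc)
      qed simp
      show "((\<lambda>h. C * \<bar>h\<bar>) \<longlongrightarrow> 0) (at 0)" by (rule tendsto_eq_intros refl)+ simp
    qed
    then show ?thesis using 3 by (simp add: DERIV_def flat_def)
  qed
qed

lemma flat_pos: "flat n t > 0 \<longleftrightarrow> t > 0" "flat n t \<ge> 0" "t \<le> 0 \<Longrightarrow> flat n t = 0"
  by (auto simp: flat_def)

text \<open>All exponents are adjoined as generators at once, since differentiation raises
  \<open>n\<close> by one or two.\<close>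

lemma smooth3_flat:
  assumes f: "smooth3 f" shows "smooth3 (\<lambda>y. flat n (f y))"
proof (rule alg_smooth[of "{g. smooth3 g} \<union> range (\<lambda>n y. flat n (f y))"])
  let ?S = "{g. smooth3 g} \<union> range (\<lambda>n y. flat n (f y))"
  note d = pd_comp[OF smooth3_diff[OF f] flat_deriv]
  have "pd i (\<lambda>y. flat n (f y)) = (\<lambda>y. (flat (n + 2) (f y) + (- real n) * flat (n + 1) (f y)) * pd i f y)" for i n
    using d(2) by (intro ext) simp
  moreover have "\<dots> i n \<in> alg ?S" for i n
    by (intro alg_mult alg_add alg_const) (auto intro!: alg_gen smooth3_pd f)
  ultimately have "pd i (\<lambda>y. flat n (f y)) \<in> alg ?S" for i n by simp
  then show "pd i g \<in> alg ?S" if "g \<in> ?S" for g i using that by (auto intro: alg_gen smooth3_pd)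
  show "g differentiable (at y)" if "g \<in> ?S" for g y using that d(1) smooth3_diff by auto
qed (simp add: alg_gen)

lemma tsupp_subset: "closed K \<Longrightarrow> (\<And>y. f y \<noteq> 0 \<Longrightarrow> y \<in> K) \<Longrightarrow> tsupp f \<subseteq> K"
  unfolding tsupp_def by (intro closure_minimal) auto
lemma tsupp_outside: "y \<notin> tsupp f \<Longrightarrow> f y = 0"
  unfolding tsupp_def using closure_subset[of "{y. f y \<noteq> 0}"] by auto

lemma test_funI:
  assumes "smooth3 f" "compact K" "K \<subseteq> U" "\<And>y. f y \<noteq> 0 \<Longrightarrow> y \<in> K" shows "test_fun U f"
proof -
  have s: "tsupp f \<subseteq> K" using assms by (intro tsupp_subset compact_imp_closed)
  have "compact (tsupp f)" 
    using compact_Int_closed[OF assms(2), of "tsupp f"] s by (simp add: tsupp_def Int_absorb1)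
  then show ?thesis using assms s unfolding test_fun_def by blast
qed

lemma test_funD:
  assumes "test_fun U f" shows "smooth3 f" "compact (tsupp f)" "tsupp f \<subseteq> U"
  using assms unfolding test_fun_def by auto

lemma test_lin: assumes f: "test_fun U f" and g: "test_fun U g" shows "test_fun U (\<lambda>y. f y + c * g y)"
proof (rule test_funI[of _ "tsupp f \<union> tsupp g"])
  show "smooth3 (\<lambda>y. f y + c * g y)" by (intro smooth3_add smooth3_scale test_funD(1)[OF f] test_funD(1)[OF g])
  show "compact (tsupp f \<union> tsupp g)" by (intro compact_Un test_funD(2)[OF f] test_funD(2)[OF g])
  show "tsupp f \<union> tsupp g \<subseteq> U" by (intro Un_least test_funD(3)[OF f] test_funD(3)[OF g])
  show "y \<in> tsupp f \<union> tsupp g" if "f y + c * g y \<noteq> 0" for y using that tsupp_outside[of y f] tsupp_outside[of y g] by fastforce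
qed

lemma test_mult: assumes f: "test_fun U f" and g: "smooth3 g" shows "test_fun U (\<lambda>y. f y * g y)"
proof (rule test_funI[OF _ test_funD(2,3)[OF f]])
  show "smooth3 (\<lambda>y. f y * g y)" by (intro smooth3_mult test_funD(1)[OF f] g)
  show "y \<in> tsupp f" if "f y * g y \<noteq> 0" for y using that tsupp_outside[of y f] by fastforce
qed

lemma test_zero: "test_fun U (\<lambda>_. 0)" by (rule test_funI[of _ "{}"]) auto

text \<open>\<open>frechet_derivative\<close> is a choice among derivatives. Both functions have the
  same derivatives at \<open>y\<close>, so the two choices coincide even if there is none.\<close>

lemma pd_local:
  assumes "open V" "\<And>y. y \<in> V \<Longrightarrow> f y = g y" "y \<in> V" shows "pd i f y = pd i g y"
proof -
  have "(f has_derivative f') (at y) \<longleftrightarrow> (g has_derivative f') (at y)" for f'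
    using has_derivative_transform_within_open[of f f' y UNIV V g] has_derivative_transform_within_open[of g f' y UNIV V f] assms
    by auto
  then show ?thesis unfolding pd_def frechet_derivative_def by simp
qed

lemma pd_tsupp: "y \<notin> tsupp f \<Longrightarrow> pd i f y = 0"
proof -
  assume y: "y \<notin> tsupp f"
  have o: "open (- tsupp f)" unfolding tsupp_def by (rule open_Compl) (rule closed_closure)
  have "pd i f y = pd i (\<lambda>_. 0) y"
    by (rule pd_local[OF o]) (use y in \<open>simp_all add: tsupp_outside\<close>)
  then show ?thesis by simp
qed

lemma test_pd: assumes "test_fun U f" shows "test_fun U (pd i f)"
  by (rule test_funI[OF smooth3_pd[OF test_funD(1)[OF assms]] test_funD(2,3)[OF assms]]) (rule contrapos_np[OF _ pd_tsupp])

text \<open>A finite sum \<open>s\<close> of bumps on balls covering \<open>K\<close> is positive on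
  \<open>K\<close> and vanishes outside \<open>U\<close>; the smooth step \<open>a / (a + b)\<close>
  flattens it to one where \<open>s > c\<close>. The value one is attained on an open set so that
  derivatives of products with the cutoff can be computed locally.\<close>

lemma cutoff:
  assumes K: "compact K" and U: "open U" and KU: "K \<subseteq> (U :: (real^3) set)"
  obtains ch V where "test_fun U ch" "open V" "K \<subseteq> V" "V \<subseteq> U" "\<And>y. y \<in> V \<Longrightarrow> ch y = 1" "\<And>y. 0 \<le> ch y" "\<And>y. ch y \<le> 1"
proof (cases "K = {}")
  case True
  then show ?thesis using that[of "\<lambda>_. 0" "{}"] test_zero by simp
next
  case False
  have "\<exists>r>0. cball p r \<subseteq> U" if "p \<in> K" for p using open_contains_cball U KU that by blast
  then obtain r where r: "\<And>p. p \<in> K \<Longrightarrow> r p > 0 \<and> cball p (r p) \<subseteq> U" by metis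
  have "K \<subseteq> (\<Union>p\<in>K. ball p (r p))" using r by force
  then obtain P where P: "P \<subseteq> K" "finite P" "K \<subseteq> (\<Union>p\<in>P. ball p (r p))"
    by (rule compactE_image[OF K, rotated]) auto
  define s where "s = (\<lambda>y. \<Sum>p\<in>P. flat 0 ((r p)\<^sup>2 - (norm (y - p))\<^sup>2))"
  have sm: "smooth3 s" unfolding s_def
    by (intro smooth3_sum P smooth3_flat smooth3_minus smooth3_const smooth3_sqdist)
  have sK: "s y > 0" if y: "y \<in> K" for y
  proof -
    obtain p where p: "p \<in> P" "y \<in> ball p (r p)" using P(3) y by auto
    then have "norm (y - p) < r p" by (simp add: dist_norm norm_minus_commute)
    then have "(norm (y - p))\<^sup>2 < (r p)\<^sup>2" by (intro power_strict_mono) auto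
    then show ?thesis unfolding s_def using p P by (intro sum_pos2[of _ p]) (auto simp: flat_pos)
  qed
  have sU: "y \<in> (\<Union>p\<in>P. cball p (r p))" if "s y > 0" for y
  proof -
    have "\<exists>p\<in>P. flat 0 ((r p)\<^sup>2 - (norm (y - p))\<^sup>2) \<noteq> 0"
    proof (rule ccontr)
      assume "\<not> (\<exists>p\<in>P. flat 0 ((r p)\<^sup>2 - (norm (y - p))\<^sup>2) \<noteq> 0)"
      then have "s y = 0" unfolding s_def by (intro sum.neutral) blast
      with that show False by simp
    qed
    then obtain p where p: "p \<in> P" "flat 0 ((r p)\<^sup>2 - (norm (y - p))\<^sup>2) \<noteq> 0" by blast
    then have "\<not> (r p)\<^sup>2 - (norm (y - p))\<^sup>2 \<le> 0" using flat_pos(3) by blast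
    then have "(norm (y - p))\<^sup>2 \<le> (r p)\<^sup>2" by simp
    then have "norm (y - p) \<le> r p" using r[of p] p P by (auto intro: power2_le_imp_le)
    then show ?thesis using p by (auto simp: dist_norm norm_minus_commute)
  qed
  obtain y0 where y0: "y0 \<in> K" "\<And>y. y \<in> K \<Longrightarrow> s y0 \<le> s y"
    using continuous_attains_inf[OF K False continuous_on_subset[OF smooth3_cont[OF sm]]] by auto
  \<comment> \<open>Half the minimum of \<open>s\<close> on \<open>K\<close>: small enough that
    \<open>s > c\<close> on all of \<open>K\<close>, and positive so that the denominator
    \<open>a + b\<close> never vanishes.\<close>
  define c where "c = s y0 / 2"
  have c: "c > 0" using sK[OF y0(1)] by (simp add: c_def)
  define a where "a = (\<lambda>y. flat 0 (s y))"
  define b where "b = (\<lambda>y. flat 0 (c - s y))"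
  have ab: "a y + b y > 0" for y
  proof (cases "s y > 0")
    case True
    then show ?thesis unfolding a_def b_def by (intro add_pos_nonneg) (simp_all add: flat_pos)
  next
    case False
    then show ?thesis using c unfolding a_def b_def by (intro add_nonneg_pos) (simp_all add: flat_pos)
  qed
  define ch where "ch = (\<lambda>y. a y * inverse (a y + b y))"
  define V where "V = {y. c < s y}"
  have abn: "a y \<ge> 0" "b y \<ge> 0" for y by (auto simp: a_def b_def flat_pos)
  have nz: "a y + b y \<noteq> 0" for y using ab[of y] by simp
  have supp: "y \<in> (\<Union>p\<in>P. cball p (r p))" if "ch y \<noteq> 0" for y
  proof (rule sU)
    have "a y \<noteq> 0" using that by (auto simp: ch_def)
    then show "s y > 0" using flat_pos(3)[of "s y" 0] unfolding a_def by force
  qed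
  show ?thesis
  proof (rule that[of ch V])
    have ss: "smooth3 a" "smooth3 b" unfolding a_def b_def by (intro smooth3_flat smooth3_minus smooth3_const sm)+
    show "test_fun U ch"
    proof (rule test_funI)
      show "smooth3 ch" unfolding ch_def by (intro smooth3_mult smooth3_inverse smooth3_add ss nz)
      show "compact (\<Union>p\<in>P. cball p (r p))" using P by auto
      show "(\<Union>p\<in>P. cball p (r p)) \<subseteq> U" using r P by blast
    qed (rule supp)
    show "open V" unfolding V_def by (rule open_Collect_less) (use smooth3_cont[OF sm] in auto)
    show "K \<subseteq> V" using y0 c by (force simp: V_def c_def)
    show "V \<subseteq> U"
    proof
      fix y assume "y \<in> V"
      then have "s y > 0" using c by (simp add: V_def)
      from sU[OF this] obtain p where "p \<in> P" "y \<in> cball p (r p)" by blast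
      then show "y \<in> U" using r[of p] P(1) by blast
    qed
    show "ch y = 1" if "y \<in> V" for y using that nz[of y] by (simp add: ch_def b_def V_def flat_pos)
    show "0 \<le> ch y" for y using abn ab[of y] by (simp add: ch_def)
    show "ch y \<le> 1" for y using abn[of y] ab[of y] by (simp add: ch_def field_simps)
  qed
qed

section \<open>Integration by parts\<close>

lemma LINT_on:
  fixes f :: "'a::euclidean_space \<Rightarrow> 'b::euclidean_space"
  shows "U \<in> sets lebesgue \<Longrightarrow> (LINT y:U|lebesgue. f y) = integral\<^sup>L (lebesgue_on U) f"
  unfolding set_lebesgue_integral_def by (subst integral_restrict_space) auto
lemma set_int_on:
  fixes f :: "'a::euclidean_space \<Rightarrow> 'b::euclidean_space"
  shows "U \<in> sets lebesgue \<Longrightarrow> set_integrable lebesgue U f \<longleftrightarrow> integrable (lebesgue_on U) f"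
  unfolding set_integrable_def by (subst integrable_restrict_space) auto
lemma set_meas_on:
  fixes f :: "'a::euclidean_space \<Rightarrow> 'b::euclidean_space"
  shows "U \<in> sets lebesgue \<Longrightarrow> set_borel_measurable lebesgue U f \<longleftrightarrow> f \<in> borel_measurable (lebesgue_on U)"
  unfolding set_borel_measurable_def by (subst borel_measurable_restrict_space_iff) auto

lemma L2_on: "U \<in> sets lebesgue \<Longrightarrow> L2 U f \<longleftrightarrow> l2 (lebesgue_on U) f"
  unfolding L2_def l2_def by (simp add: set_int_on set_meas_on)

lemma AE_on: "U \<in> sets lebesgue \<Longrightarrow> (AE y in lebesgue_on U. P y) \<longleftrightarrow> (AE y in lebesgue. y \<in> U \<longrightarrow> P y)"
  by (subst AE_restrict_space_iff) auto

lemma fin_on: "bounded U \<Longrightarrow> U \<in> sets lebesgue \<Longrightarrow> finite_measure (lebesgue_on U)"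
  by (intro finite_measure_lebesgue_on bounded_set_imp_lmeasurable)

lemma cont_meas_leb: 
  fixes g :: "'a::euclidean_space \<Rightarrow> 'b::euclidean_space"
  assumes "continuous_on UNIV g" shows "g \<in> borel_measurable lebesgue" "g \<in> borel_measurable (lebesgue_on U)" "g \<in> borel_measurable lborel"
proof -
  show a: "g \<in> borel_measurable lborel" using borel_measurable_continuous_onI[OF assms] by simp
  show b: "g \<in> borel_measurable lebesgue" by (rule measurable_completion[OF a])
  show "g \<in> borel_measurable (lebesgue_on U)" by (rule measurable_restrict_space1[OF b])
qed

lemma cont_l2:
  fixes g :: "'a::euclidean_space \<Rightarrow> 'b::euclidean_space"
  assumes g: "continuous_on UNIV g" and U: "bounded U" "U \<in> sets lebesgue"
  shows "l2 (lebesgue_on U) g"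
proof -
  interpret finite_measure "lebesgue_on U" by (rule fin_on[OF U])
  have "compact (closure U)" using U(1) by simp
  then have "bounded (g ` closure U)" by (intro compact_imp_bounded compact_continuous_image continuous_on_subset[OF g]) auto
  then obtain B where B: "\<And>y. y \<in> closure U \<Longrightarrow> norm (g y) \<le> B" by (auto simp: bounded_iff)
  have B2: "norm ((norm (g y))\<^sup>2) \<le> B\<^sup>2" if "y \<in> U" for y
  proof -
    have "norm (g y) \<le> B" by (rule B) (use that closure_subset[of U] in blast)
    then show ?thesis by (simp add: power_mono)
  qed
  have "integrable (lebesgue_on U) (\<lambda>x. (norm (g x))\<^sup>2)"
    by (rule integrable_const_bound[of _ "B\<^sup>2"]) (use B2 cont_meas_leb[OF g] in auto)
  then show ?thesis unfolding l2_def using cont_meas_leb(2)[OF g] by simp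
qed

lemma cont_supp_int:
  fixes h :: "'a::euclidean_space \<Rightarrow> real"
  assumes "continuous_on UNIV h" "compact K" "\<And>y. y \<notin> K \<Longrightarrow> h y = 0" shows "integrable lborel h"
proof -
  have "integrable lborel (\<lambda>x. indicator K x *\<^sub>R h x)"
    by (intro borel_integrable_compact assms continuous_on_subset[OF assms(1)]) auto
  moreover have "(\<lambda>x. indicator K x *\<^sub>R h x) = h"
  proof
    fix x show "indicator K x *\<^sub>R h x = h x" using assms(3)[of x] by (cases "x \<in> K") simp_all
  qed
  ultimately show ?thesis by simp
qed

text \<open>Sobolev functions live on \<open>lebesgue_on U\<close>, whereas translation invariance
  and Tonelli are available on \<open>lborel\<close>; this is the passage between the two for Borel
  integrands.\<close>

lemma int_on_eq:
  fixes h :: "'a::euclidean_space \<Rightarrow> real"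
  assumes "U \<in> sets lebesgue" "h \<in> borel_measurable lborel" "\<And>y. y \<notin> U \<Longrightarrow> h y = 0"
  shows "integral\<^sup>L (lebesgue_on U) h = integral\<^sup>L lborel h"
proof -
  have "integral\<^sup>L (lebesgue_on U) h = integral\<^sup>L lebesgue (\<lambda>x. indicator U x *\<^sub>R h x)"
    by (subst integral_restrict_space) (use assms in auto)
  also have "(\<lambda>x. indicator U x *\<^sub>R h x) = h"
  proof
    fix x show "indicator U x *\<^sub>R h x = h x" using assms(3)[of x] by (cases "x \<in> U") simp_all
  qed
  also have "integral\<^sup>L lebesgue h = integral\<^sup>L lborel h" by (rule integral_completion[OF assms(2)])
  finally show ?thesis .
qed

section \<open>Integration by parts against test functions\<close>

text \<open>The regularised dipole constructed later is not smooth; this is the regularity that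
  integration by parts against a test function requires of the other factor.\<close>

definition c1 :: "(real^3 \<Rightarrow> real) \<Rightarrow> bool" where
  "c1 F \<longleftrightarrow> (\<forall>y. F differentiable (at y)) \<and> (\<forall>i. continuous_on UNIV (pd i F))"

lemma c1D: assumes "c1 F" shows "F differentiable (at y)" "continuous_on UNIV (pd i F)" "continuous_on UNIV F"
  using assms by (auto simp: c1_def differentiable_imp_continuous_on differentiable_on_def differentiable_at_withinI)

lemma smooth3_c1: "smooth3 f \<Longrightarrow> c1 f"
  unfolding c1_def using smooth3_diff smooth3_cont[OF smooth3_pd] by blast

lemma c1_mult: assumes "c1 f" "c1 g" shows "c1 (\<lambda>y. f y * g y)"
proof -
  have "pd i (\<lambda>y. f y * g y) = (\<lambda>y. f y * pd i g y + pd i f y * g y)" for i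
    by (intro ext pd_mult c1D assms)
  moreover have "continuous_on UNIV (\<lambda>y. f y * pd i g y + pd i f y * g y)" for i
    by (intro continuous_intros c1D assms)
  ultimately have "continuous_on UNIV (pd i (\<lambda>y. f y * g y))" for i by simp
  moreover have "(\<lambda>y. f y * g y) differentiable (at y)" for y
    by (rule differentiable_mult[OF c1D(1)[OF assms(1)] c1D(1)[OF assms(2)]])
  ultimately show ?thesis unfolding c1_def by blast
qed

lemma grad3_works:
  assumes "F differentiable (at y)" shows "(F has_derivative (\<lambda>v. grad3 F y \<bullet> v)) (at y)"
proof -
  note d = diff_works[OF assms]
  interpret bounded_linear "frechet_derivative F (at y)" using d by (rule has_derivative_bounded_linear)
  have "frechet_derivative F (at y) v = grad3 F y \<bullet> v" for v
  proof -
    have "v = (\<Sum>i\<in>UNIV. v $ i *\<^sub>R axis i 1)" using basis_expansion[of v] by (simp add: scalar_mult_eq_scaleR)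
    then have "frechet_derivative F (at y) v = frechet_derivative F (at y) (\<Sum>i\<in>UNIV. v $ i *\<^sub>R axis i 1)"
      by (rule arg_cong)
    also have "\<dots> = (\<Sum>i\<in>UNIV. v $ i * frechet_derivative F (at y) (axis i 1))"
      by (simp add: sum scale)
    finally have "frechet_derivative F (at y) v = (\<Sum>i\<in>UNIV. v $ i * frechet_derivative F (at y) (axis i 1))" .
    then show ?thesis by (simp add: grad3_def pd_def inner_vec_def mult.commute)
  qed
  then have "frechet_derivative F (at y) = (\<lambda>v. grad3 F y \<bullet> v)" by (rule ext)
  with d show ?thesis by simp
qed

lemma line_deriv:
  assumes "F differentiable (at (y + t *\<^sub>R e))"
  shows "((\<lambda>t. F (y + t *\<^sub>R e)) has_real_derivative (grad3 F (y + t *\<^sub>R e) \<bullet> e)) (at t)"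
proof -
  have "((\<lambda>t. y + t *\<^sub>R e) has_derivative (\<lambda>s. s *\<^sub>R e)) (at t)" by (auto intro!: derivative_eq_intros)
  from has_derivative_compose[OF this grad3_works[OF assms]]
  have "((\<lambda>t. F (y + t *\<^sub>R e)) has_derivative (\<lambda>s. grad3 F (y + t *\<^sub>R e) \<bullet> s *\<^sub>R e)) (at t)" .
  then show ?thesis unfolding has_field_derivative_def
    by (rule has_derivative_eq_rhs) (simp add: fun_eq_iff mult.commute)
qed

lemma grad3_axis: "grad3 F y \<bullet> axis i 1 = pd i F y" by (simp add: grad3_def inner_axis)

text \<open>Difference quotients along a coordinate axis have integral zero by translation
  invariance. They converge pointwise to the derivative and are dominated through the mean value
  theorem.\<close>

lemma integral_pd_0:
  assumes F: "c1 F" and K: "compact K" "\<And>y. y \<notin> K \<Longrightarrow> F y = 0"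
  shows "integral\<^sup>L lborel (pd i F) = 0"
proof -
  define e :: "real^3" where "e = axis i 1"
  have e1: "norm e = 1" by (simp add: e_def)
  obtain R where R: "\<And>y. y \<in> K \<Longrightarrow> norm y \<le> R" using compact_imp_bounded[OF K(1)] by (auto simp: bounded_iff)
  \<comment> \<open>Shifts have length at most one: the quotients vanish beyond radius
    \<open>R + 1\<close>, and the intermediate points of the mean value theorem stay within
    \<open>R + 2\<close>.\<close>
  have "bounded (pd i F ` cball 0 (R + 2))" by (intro compact_imp_bounded compact_continuous_image continuous_on_subset[OF c1D(2)[OF F]]) auto
  then obtain B where "\<forall>y\<in>cball 0 (R + 2). \<bar>pd i F y\<bar> \<le> B" by (auto simp: bounded_iff)
  then have B: "\<bar>pd i F y\<bar> \<le> B" if "norm y \<le> R + 2" for y using that by simp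
  define D where "D k y = (F ((1 / (real k + 1)) *\<^sub>R e + y) - F y) * (real k + 1)" for k y
  have Fint: "integrable lborel F" by (rule cont_supp_int[OF c1D(3)[OF F] K]) 
  have Fm: "F \<in> borel_measurable borel" using borel_measurable_continuous_onI[OF c1D(3)[OF F]] .
  have tr: "integral\<^sup>L lborel (\<lambda>y. F (c + y)) = integral\<^sup>L lborel F" "integrable lborel (\<lambda>y. F (c + y))" for c
  proof -
    have "integral\<^sup>L (distr lborel borel ((+) c)) F = integral\<^sup>L lborel (\<lambda>y. F (c + y))"
      by (rule integral_distr) (use Fm in auto)
    then show "integral\<^sup>L lborel (\<lambda>y. F (c + y)) = integral\<^sup>L lborel F" by (simp add: lborel_distr_plus)
    have "integrable (distr lborel borel ((+) c)) F" using Fint by (simp add: lborel_distr_plus)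
    then show "integrable lborel (\<lambda>y. F (c + y))" by (subst (asm) integrable_distr_eq) (use Fm in auto)
  qed
  have D0: "integral\<^sup>L lborel (D k) = 0" for k unfolding D_def using tr Fint by simp
  have Dm: "D k \<in> borel_measurable lborel" for k unfolding D_def using Fm by simp
  have lim: "(\<lambda>k. D k y) \<longlonglongrightarrow> pd i F y" for y
  proof -
    have "((\<lambda>t. F (y + t *\<^sub>R e)) has_real_derivative pd i F y) (at 0)"
      using line_deriv[of F y 0 e] c1D(1)[OF F] by (simp add: e_def grad3_axis)
    then have "((\<lambda>h. (F (y + h *\<^sub>R e) - F y) / h) \<longlongrightarrow> pd i F y) (at 0)" by (simp add: DERIV_def)
    moreover have "filterlim (\<lambda>k. 1 / (real k + 1)) (at 0) sequentially"
      unfolding filterlim_at using LIMSEQ_inverse_real_of_nat by (auto simp: inverse_eq_divide add.commute)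
    ultimately have "(\<lambda>k. (F (y + (1 / (real k + 1)) *\<^sub>R e) - F y) / (1 / (real k + 1))) \<longlonglongrightarrow> pd i F y"
      by (rule filterlim_compose)
    then show ?thesis by (simp add: D_def add.commute)
  qed
  have bd: "\<bar>D k y\<bar> \<le> indicator (cball 0 (R + 1)) y *\<^sub>R B" for k y
  proof (cases "norm y \<le> R + 1")
    case True
    define h where "h = 1 / (real k + 1)"
    have h: "0 < h" "h \<le> 1" by (auto simp: h_def)
    have "\<exists>z. 0 < z \<and> z < h \<and> F (y + h *\<^sub>R e) - F (y + 0 *\<^sub>R e) = (h - 0) * (grad3 F (y + z *\<^sub>R e) \<bullet> e)"
      by (rule MVT2) (use h line_deriv c1D(1)[OF F] in auto)
    then obtain z where z: "0 < z" "z < h" "F (y + h *\<^sub>R e) - F y = h * pd i F (y + z *\<^sub>R e)"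
      by (auto simp: e_def grad3_axis)
    have "norm (y + z *\<^sub>R e) \<le> norm y + norm (z *\<^sub>R e)" by (rule norm_triangle_ineq)
    also have "\<dots> \<le> R + 2" using True z h e1 by simp
    finally have "\<bar>pd i F (y + z *\<^sub>R e)\<bar> \<le> B" by (rule B)
    moreover have "D k y = pd i F (y + z *\<^sub>R e)"
    proof -
      have "D k y = (F (y + h *\<^sub>R e) - F y) * (real k + 1)" by (simp add: D_def h_def add.commute)
      also have "\<dots> = pd i F (y + z *\<^sub>R e) * (h * (real k + 1))" unfolding z by (simp only: ac_simps)
      also have "h * (real k + 1) = 1" by (simp add: h_def)
      finally show ?thesis by simp
    qed
    ultimately show ?thesis using True by simp
  next
    case False
    have "norm ((1 / (real k + 1)) *\<^sub>R e + y) \<ge> norm y - norm ((1 / (real k + 1)) *\<^sub>R e)"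
      by (metis add.commute norm_diff_ineq)
    moreover have "norm ((1 / (real k + 1)) *\<^sub>R e) \<le> 1" using e1 by simp
    ultimately have "norm ((1 / (real k + 1)) *\<^sub>R e + y) > R" using False by linarith
    then have "(1 / (real k + 1)) *\<^sub>R e + y \<notin> K" "y \<notin> K" using R False by force+
    then show ?thesis using K(2) False by (simp add: D_def)
  qed
  have dom: "integrable lborel (\<lambda>y::real^3. indicator (cball 0 (R + 1)) y *\<^sub>R B)"
    by (intro borel_integrable_compact) auto
  have "(\<lambda>k. integral\<^sup>L lborel (D k)) \<longlonglongrightarrow> integral\<^sup>L lborel (pd i F)"
    by (rule integral_dominated_convergence[OF _ Dm dom])
       (use lim bd cont_meas_leb(3)[OF c1D(2)[OF F]] in auto)
  then have "(\<lambda>k. 0) \<longlonglongrightarrow> integral\<^sup>L lborel (pd i F)" by (simp add: D0)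
  then show ?thesis by (simp add: LIMSEQ_const_iff)
qed

lemma IBP_test:
  assumes F: "c1 F" and phi: "test_fun U \<phi>" and U: "U \<in> sets lebesgue"
  shows "integral\<^sup>L (lebesgue_on U) (\<lambda>y. F y * pd i \<phi> y) = - integral\<^sup>L (lebesgue_on U) (\<lambda>y. pd i F y * \<phi> y)"
proof -
  note s = test_funD(1)[OF phi] and K = test_funD(2)[OF phi] and KU = test_funD(3)[OF phi]
  note c = smooth3_c1[OF s]
  let ?f = "\<lambda>y. F y * pd i \<phi> y" and ?g = "\<lambda>y. pd i F y * \<phi> y"
  have cf: "continuous_on UNIV ?f" and cg: "continuous_on UNIV ?g"
    by (intro continuous_intros c1D F c)+
  have sf: "?f y = 0" and sg: "?g y = 0" if "y \<notin> tsupp \<phi>" for y using that pd_tsupp tsupp_outside by auto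
  have "integral\<^sup>L lborel (pd i (\<lambda>y. F y * \<phi> y)) = 0"
    by (rule integral_pd_0[OF c1_mult[OF F c] K]) (use tsupp_outside in auto)
  also have "pd i (\<lambda>y. F y * \<phi> y) = (\<lambda>y. ?f y + ?g y)" by (intro ext pd_mult c1D F c)
  also have "integral\<^sup>L lborel (\<lambda>y. ?f y + ?g y) = integral\<^sup>L lborel ?f + integral\<^sup>L lborel ?g"
    by (intro Bochner_Integration.integral_add cont_supp_int[OF cf K] cont_supp_int[OF cg K] sf sg)
  also have "integral\<^sup>L lborel ?f = integral\<^sup>L (lebesgue_on U) ?f"
    by (rule int_on_eq[OF U cont_meas_leb(3)[OF cf], symmetric]) (use KU sf in blast)
  also have "integral\<^sup>L lborel ?g = integral\<^sup>L (lebesgue_on U) ?g"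
    by (rule int_on_eq[OF U cont_meas_leb(3)[OF cg], symmetric]) (use KU sg in blast)
  finally show ?thesis by linarith
qed

section \<open>The lemma of du Bois-Reymond\<close>

lemma open_leb: "open U \<Longrightarrow> U \<in> sets lebesgue" by (simp add: borel_open)
lemma compact_leb: "compact (K :: 'a::euclidean_space set) \<Longrightarrow> K \<in> sets lebesgue" using lmeasurable_compact by (auto simp: fmeasurable_def)

text \<open>Cutoffs \<open>c n\<close> that equal one on \<open>K\<close> and live in neighbourhoods
  shrinking to \<open>K\<close> tend pointwise to its indicator. All of them vanish off one compact
  set \<open>K1\<close>, on which \<open>f\<close> is integrable and provides the dominating
  function.\<close>

lemma loc_zero_compact:
  assumes U: "open U" and f: "loc_int U f"
    and z: "\<And>\<phi>. test_fun U \<phi> \<Longrightarrow> (LINT y:U|lebesgue. f y * \<phi> y) = 0"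
    and K: "compact K" "K \<subseteq> U"
  shows "(LINT y:K|lebesgue. f y) = 0"
proof (cases "K = {}")
  case True then show ?thesis by (simp add: set_lebesgue_integral_def)
next
  case False
  obtain c0 V0 where c0: "test_fun U c0" "open V0" "K \<subseteq> V0" "V0 \<subseteq> U" "\<And>y. y \<in> V0 \<Longrightarrow> c0 y = 1"
    by (rule cutoff[OF K(1) U K(2)]) (rule that)
  define K1 where "K1 = tsupp c0"
  have K1: "compact K1" "K1 \<subseteq> U" using test_funD[OF c0(1)] by (auto simp: K1_def)
  have VK: "V0 \<subseteq> K1" unfolding K1_def using tsupp_outside[of _ c0] c0(5) by force
  define W where "W n = V0 \<inter> {y. infdist y K < 1 / (real n + 1)}" for n
  have W: "open (W n)" "K \<subseteq> W n" for n
  proof -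
    have "open {y. infdist y K < 1 / (real n + 1)}" by (intro open_Collect_less continuous_intros)
    then show "open (W n)" unfolding W_def using c0(2) by blast
    show "K \<subseteq> W n" unfolding W_def using c0(3) by auto
  qed
  have "\<exists>c. test_fun (W n) c \<and> (\<forall>y\<in>K. c y = 1) \<and> (\<forall>y. 0 \<le> c y \<and> c y \<le> 1)" for n
  proof -
    obtain c V where "test_fun (W n) c" "open V" "K \<subseteq> V" "V \<subseteq> W n" "\<And>y. y \<in> V \<Longrightarrow> c y = 1" "\<And>y. 0 \<le> c y" "\<And>y. c y \<le> 1"
      by (rule cutoff[OF K(1) W]) (rule that)
    then show ?thesis by blast
  qed
  then obtain c where c: "\<And>n. test_fun (W n) (c n)" "\<And>n y. y \<in> K \<Longrightarrow> c n y = 1" "\<And>n y. 0 \<le> c n y" "\<And>n y. c n y \<le> 1" by metis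
  have cW: "c n y = 0" if "y \<notin> W n" for n y
    using tsupp_outside[of y "c n"] test_funD(3)[OF c(1)[of n]] that by blast
  have ct: "test_fun U (c n)" for n
    unfolding test_fun_def using test_funD[OF c(1)[of n]] c0(4) by (auto simp: W_def)
  have fint: "integrable lebesgue (\<lambda>y. indicator K1 y *\<^sub>R f y)"
    using f K1 unfolding loc_int_def set_integrable_def by blast
  have eq: "(\<lambda>y. indicator U y *\<^sub>R (f y * c n y)) = (\<lambda>y. c n y * (indicator K1 y *\<^sub>R f y))" for n
  proof (rule ext)
    fix y show "indicator U y *\<^sub>R (f y * c n y) = c n y * (indicator K1 y *\<^sub>R f y)"
    proof (cases "y \<in> W n")
      case True
      then have "y \<in> K1" "y \<in> U" using VK K1 by (auto simp: W_def)
      then show ?thesis by simp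
    qed (simp add: cW)
  qed
  have cm: "c n \<in> borel_measurable lebesgue" for n by (rule cont_meas_leb(1)[OF smooth3_cont[OF test_funD(1)[OF ct]]])
  have lim: "(\<lambda>n. c n y * (indicator K1 y *\<^sub>R f y)) \<longlonglongrightarrow> indicator K y *\<^sub>R f y" for y
  proof (cases "y \<in> K")
    case True
    then have "y \<in> K1" using c0(3) VK by blast
    then show ?thesis using True c(2) by simp
  next
    case no: False
    then have d: "infdist y K > 0" using infdist_pos_not_in_closed[OF compact_imp_closed[OF K(1)] False] by blast
    obtain N where N: "1 / (real N + 1) < infdist y K" using reals_Archimedean[OF d] by (auto simp: inverse_eq_divide add.commute)
    have "c n y = 0" if "n \<ge> N" for n
    proof (rule cW)
      have "1 / (real n + 1) \<le> 1 / (real N + 1)" using that by (intro divide_left_mono) auto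
      then show "y \<notin> W n" using N by (auto simp: W_def)
    qed
    then have "eventually (\<lambda>n. c n y * (indicator K1 y *\<^sub>R f y) = 0) sequentially" by (intro eventually_sequentiallyI[of N]) simp
    then show ?thesis using no by (simp add: tendsto_eventually)
  qed
  have "(\<lambda>n. integral\<^sup>L lebesgue (\<lambda>y. c n y * (indicator K1 y *\<^sub>R f y))) \<longlonglongrightarrow> integral\<^sup>L lebesgue (\<lambda>y. indicator K y *\<^sub>R f y)"
  proof (rule integral_dominated_convergence[where w = "\<lambda>y. norm (indicator K1 y *\<^sub>R f y)"])
    show "integrable lebesgue (\<lambda>y. norm (indicator K1 y *\<^sub>R f y))" using fint by (rule integrable_norm)
    show "(\<lambda>y. c n y * (indicator K1 y *\<^sub>R f y)) \<in> borel_measurable lebesgue" for n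
      by (intro borel_measurable_times cm borel_measurable_integrable[OF fint])
    have "integrable lebesgue (\<lambda>y. indicator K y *\<^sub>R f y)" using f K unfolding loc_int_def set_integrable_def by blast
    then show "(\<lambda>y. indicator K y *\<^sub>R f y) \<in> borel_measurable lebesgue" by simp
    have "norm (c n y * (indicator K1 y *\<^sub>R f y)) \<le> norm (indicator K1 y *\<^sub>R f y)" for n y
      using c(3,4)[of n y] by (simp add: abs_mult mult_left_le_one_le)
    then show "AE y in lebesgue. norm (c n y * (indicator K1 y *\<^sub>R f y)) \<le> norm (indicator K1 y *\<^sub>R f y)" for n by simp
  qed (use lim in simp)
  moreover have "integral\<^sup>L lebesgue (\<lambda>y. c n y * (indicator K1 y *\<^sub>R f y)) = 0" for n
    using z[OF ct[of n]] unfolding set_lebesgue_integral_def eq .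
  ultimately have "integral\<^sup>L lebesgue (\<lambda>y. indicator K y *\<^sub>R f y) = 0" using LIMSEQ_unique[OF _ tendsto_const] by simp
  then show ?thesis by (simp add: set_lebesgue_integral_def)
qed

text \<open>If \<open>f\<close> were positive on a non-null part \<open>A\<close> of
  \<open>K\<close>, inner regularity would give a non-null compact subset of \<open>A\<close>, and
  the integral of \<open>f\<close> over it could not vanish.\<close>

lemma loc_zero_nonpos:
  assumes U: "open U" and f: "loc_int U f"
    and z: "\<And>\<phi>. test_fun U \<phi> \<Longrightarrow> (LINT y:U|lebesgue. f y * \<phi> y) = 0"
    and K: "compact K" "K \<subseteq> U"
  shows "AE y in lebesgue. y \<in> K \<longrightarrow> f y \<le> 0"
proof -
  have Kint: "integrable lebesgue (\<lambda>y. indicator K y *\<^sub>R f y)" using f K unfolding loc_int_def set_integrable_def by blast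
  then have m: "(\<lambda>y. indicator K y *\<^sub>R f y) \<in> borel_measurable lebesgue" by (rule borel_measurable_integrable)
  define A where "A = {y. 0 < indicator K y *\<^sub>R f y}"
  have A: "A \<in> sets lebesgue" unfolding A_def using borel_measurable_less[OF borel_measurable_const m, of 0]
    by (simp add: pred_def)
  have AK: "A \<subseteq> K" unfolding A_def by (auto simp: indicator_def split: if_splits)
  have "emeasure lebesgue A = 0"
  proof (rule ccontr)
    assume nz: "emeasure lebesgue A \<noteq> 0"
    have fin: "emeasure lebesgue A < \<infinity>"
      using bounded_set_imp_lmeasurable[OF bounded_subset[OF compact_imp_bounded[OF K(1)] AK] A] by (auto simp: fmeasurable_def)
    define e where "e = measure lebesgue A"
    have e2: "emeasure lebesgue A = ennreal e" unfolding e_def using fin by (intro emeasure_eq_ennreal_measure) simp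
    have "e \<noteq> 0" using e2 nz by force
    moreover have "e \<ge> 0" unfolding e_def by (rule measure_nonneg)
    ultimately have e: "e > 0" "emeasure lebesgue A = ennreal e" using e2 by simp_all
    \<comment> \<open>The part of \<open>A\<close> outside \<open>T\<close> has less than the full
      measure \<open>e\<close>, so \<open>T\<close> itself is not null.\<close>
    obtain T where T: "closed T" "T \<subseteq> A" "A - T \<in> lmeasurable" "emeasure lebesgue (A - T) < ennreal e"
      using sets_lebesgue_inner_closed[OF A e(1)] by blast
    have Tc: "compact T" using compact_Int_closed[OF K(1) T(1)] T(2) AK by (simp add: Int_absorb1 order_trans)
    have "(LINT y:T|lebesgue. f y) = 0"
      by (rule loc_zero_compact[OF U f z Tc]) (use T AK K in auto)
    then have i0: "integral\<^sup>L lebesgue (\<lambda>y. indicator T y *\<^sub>R f y) = 0" by (simp add: set_lebesgue_integral_def)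
    have pos: "0 < f y" if "y \<in> T" for y
    proof -
      have "y \<in> A" "y \<in> K" using that T(2) AK by auto
      then show ?thesis by (simp add: A_def)
    qed
    have Tint: "integrable lebesgue (\<lambda>y. indicator T y *\<^sub>R f y)" using f Tc T AK K unfolding loc_int_def set_integrable_def by blast
    have "AE y in lebesgue. indicator T y *\<^sub>R f y = 0"
    proof (rule integral_nonneg_eq_0_iff_AE[OF Tint, THEN iffD1, OF _ i0])
      have "0 \<le> indicator T y *\<^sub>R f y" for y using pos[of y] by (cases "y \<in> T") simp_all
      then show "AE y in lebesgue. 0 \<le> indicator T y *\<^sub>R f y" by simp
    qed
    then have "AE y in lebesgue. y \<notin> T"
    proof eventually_elim
      case (elim y)
      show ?case
      proof
        assume "y \<in> T"
        with elim pos[of y] show False by simp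
      qed
    qed
    then have "emeasure lebesgue T = 0" using AE_iff_measurable[OF compact_leb[OF Tc], of "\<lambda>y. y \<notin> T"] by simp
    moreover have "emeasure lebesgue A = emeasure lebesgue T + emeasure lebesgue (A - T)"
    proof -
      have "emeasure lebesgue T + emeasure lebesgue (A - T) = emeasure lebesgue (T \<union> (A - T))"
        by (rule plus_emeasure) (use T(3) compact_leb[OF Tc] in \<open>auto simp: fmeasurable_def\<close>)
      also have "T \<union> (A - T) = A" using T(2) by blast
      finally show ?thesis ..
    qed
    ultimately show False using T(4) e(2) by simp
  qed
  then have "AE y in lebesgue. y \<notin> A" using AE_iff_measurable[OF A, of "\<lambda>y. y \<notin> A"] by simp
  then show ?thesis by eventually_elim (auto simp: A_def indicator_def not_less)
qed

text \<open>The one-sided result is applied to \<open>f\<close> and to \<open>- f\<close>; countably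
  many compact boxes exhaust the open set.\<close>

lemma du_bois_reymond:
  assumes U: "open U" and f: "loc_int U f"
    and z: "\<And>\<phi>. test_fun U \<phi> \<Longrightarrow> (LINT y:U|lebesgue. f y * \<phi> y) = 0"
  shows "AE y in lebesgue. y \<in> U \<longrightarrow> f y = 0"
proof -
  have f': "loc_int U (\<lambda>y. - f y)" using f unfolding loc_int_def by (auto simp: set_integrable_def)
  have z': "(LINT y:U|lebesgue. - f y * \<phi> y) = 0" if "test_fun U \<phi>" for \<phi>
    using z[OF that] by (simp add: set_lebesgue_integral_def)
  have comp: "AE y in lebesgue. y \<in> K \<longrightarrow> f y = 0" if K: "compact K" "K \<subseteq> U" for K
  proof -
    have "AE y in lebesgue. y \<in> K \<longrightarrow> f y \<le> 0" by (rule loc_zero_nonpos[OF U f _ K]) (rule z)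
    moreover have "AE y in lebesgue. y \<in> K \<longrightarrow> - f y \<le> 0" by (rule loc_zero_nonpos[OF U f' _ K]) (rule z')
    ultimately show ?thesis by eventually_elim force
  qed
  obtain \<D> where \<D>: "countable \<D>" "\<D> \<subseteq> Pow U" "\<And>X. X \<in> \<D> \<Longrightarrow> \<exists>a b. X = cbox a b" "\<Union>\<D> = U"
    by (rule open_countable_Union_open_cbox[OF U]) (rule that)
  have "AE y in lebesgue. \<forall>X\<in>\<D>. y \<in> X \<longrightarrow> f y = 0"
  proof (subst AE_ball_countable[OF \<D>(1)], intro ballI comp)
    fix X assume X: "X \<in> \<D>"
    obtain a b where "X = cbox a b" using \<D>(3)[OF X] by blast
    then show "compact X" by (simp add: compact_cbox)
    show "X \<subseteq> U" using X \<D>(2) by blast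
  qed
  then show ?thesis by eventually_elim (use \<D>(4) in blast)
qed

section \<open>Sobolev spaces as closed subspaces\<close>

lemma ip_cong_AE:
  assumes "l2 M f" "l2 M f'" "l2 M g" "l2 M g'" "AE x in M. f x = f' x" "AE x in M. g x = g' x"
  shows "ip M f g = ip M f' g'"
  unfolding ip_def
proof (rule integral_cong_AE)
  show "(\<lambda>x. f x \<bullet> g x) \<in> borel_measurable M" "(\<lambda>x. f' x \<bullet> g' x) \<in> borel_measurable M"
    by (intro borel_measurable_integrable l2_inner assms)+
  show "AE x in M. f x \<bullet> g x = f' x \<bullet> g' x" using assms(5,6) by eventually_elim simp
qed

lemma nrm_cong_AE: "l2 M f \<Longrightarrow> l2 M f' \<Longrightarrow> AE x in M. f x = f' x \<Longrightarrow> nrm M f = nrm M f'"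
  unfolding nrm_def by (subst ip_cong_AE[of M f f' f f']) auto

lemma l2_bounded_by:
  assumes "l2 M g" "f \<in> borel_measurable M" "\<And>x. norm (f x) \<le> norm (g x)" shows "l2 M f"
  unfolding l2_def
proof
  have "integrable M (\<lambda>x. (norm (g x))\<^sup>2)" using assms(1) by (simp add: l2_def)
  then show "integrable M (\<lambda>x. (norm (f x))\<^sup>2)"
    by (rule Bochner_Integration.integrable_bound) (use assms(2,3) in \<open>auto intro!: always_eventually power_mono\<close>)
qed (rule assms)

lemma nrm_bounded_by:
  assumes "l2 M g" "l2 M f" "\<And>x. norm (f x) \<le> norm (g x)" shows "nrm M f \<le> nrm M g"
  unfolding nrm_def ip_def
proof (rule real_sqrt_le_mono, rule integral_mono)
  show "f x \<bullet> f x \<le> g x \<bullet> g x" for x using assms(3) by (simp add: norm_le)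
qed (intro l2_inner assms)+

lemma fst_snd_meas:
  fixes w :: "'a \<Rightarrow> 'b::euclidean_space \<times> 'c::euclidean_space"
  assumes "w \<in> borel_measurable M"
  shows "(\<lambda>y. fst (w y)) \<in> borel_measurable M" "(\<lambda>y. snd (w y)) \<in> borel_measurable M"
  by (rule measurable_compose[OF assms]; intro borel_measurable_continuous_onI continuous_intros)+

lemma norm_fst_snd: "norm (fst p) \<le> norm p" "norm (snd p) \<le> norm p"
  using norm_fst_le[of "fst p" "snd p"] norm_snd_le[of "snd p" "fst p"] by simp_all

lemma l2_fst: "l2 M w \<Longrightarrow> l2 M (\<lambda>y. fst (w y))"
  by (rule l2_bounded_by[of M w]) (simp_all add: l2_def norm_fst_snd fst_snd_meas)
lemma l2_snd: "l2 M w \<Longrightarrow> l2 M (\<lambda>y. snd (w y))"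
  by (rule l2_bounded_by[of M w]) (simp_all add: l2_def norm_fst_snd fst_snd_meas)
lemma nrm_fst: "l2 M w \<Longrightarrow> nrm M (\<lambda>y. fst (w y)) \<le> nrm M w"
  by (rule nrm_bounded_by) (simp_all add: l2_fst norm_fst_snd)
lemma nrm_snd: "l2 M w \<Longrightarrow> nrm M (\<lambda>y. snd (w y)) \<le> nrm M w"
  by (rule nrm_bounded_by) (simp_all add: l2_snd norm_fst_snd)

lemma vec_nth_meas: "f \<in> borel_measurable M \<Longrightarrow> (\<lambda>x. (f x :: real^'n::finite) $ i) \<in> borel_measurable M"
proof -
  assume f: "f \<in> borel_measurable M"
  have "(\<lambda>x. f x \<bullet> axis i 1) \<in> borel_measurable M" by (intro borel_measurable_inner f borel_measurable_const)
  then show ?thesis by (simp add: inner_axis)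
qed

lemma l2_nth: "l2 M v \<Longrightarrow> l2 M (\<lambda>y. (v y :: real^'n::finite) $ i)"
  by (rule l2_bounded_by[of M v]) (auto simp: l2_def component_le_norm_cart intro: vec_nth_meas)
lemma nrm_nth: "l2 M v \<Longrightarrow> nrm M (\<lambda>y. (v y :: real^'n::finite) $ i) \<le> nrm M v"
  by (rule nrm_bounded_by) (auto simp: l2_nth component_le_norm_cart)

lemma vec_meas:
  fixes v :: "'a \<Rightarrow> real^'n::finite"
  assumes "\<And>i. (\<lambda>y. v y $ i) \<in> borel_measurable M" shows "v \<in> borel_measurable M"
proof (subst borel_measurable_euclidean_space, intro ballI)
  fix b :: "real^'n" assume "b \<in> Basis"
  then obtain i where "b = axis i 1" by (auto simp: Basis_vec_def)
  then show "(\<lambda>x. v x \<bullet> b) \<in> borel_measurable M" using assms by (simp add: inner_axis)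
qed

lemma l2_vec:
  fixes v :: "'a \<Rightarrow> real^'n::finite"
  assumes "\<And>i. l2 M (\<lambda>y. v y $ i)" shows "l2 M v"
  unfolding l2_def
proof
  show "v \<in> borel_measurable M" by (rule vec_meas) (use assms in \<open>auto simp: l2_def\<close>)
  have "integrable M (\<lambda>x. \<Sum>i\<in>UNIV. (v x $ i) \<bullet> (v x $ i))"
    by (intro Bochner_Integration.integrable_sum l2_inner assms)
  moreover have "(\<lambda>x. \<Sum>i\<in>UNIV. (v x $ i) \<bullet> (v x $ i)) = (\<lambda>x. (norm (v x))\<^sup>2)"
    by (simp add: power2_norm_eq_inner inner_vec_def)
  ultimately show "integrable M (\<lambda>x. (norm (v x))\<^sup>2)" by simp
qed

lemma l2_pair:
  assumes "l2 M f" "l2 M g" shows "l2 M (\<lambda>y. (f y, g y))"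
  unfolding l2_def
proof
  show "(\<lambda>y. (f y, g y)) \<in> borel_measurable M" using assms by (intro borel_measurable_Pair) (auto simp: l2_def)
  have "(\<lambda>x. (norm (f x, g x))\<^sup>2) = (\<lambda>x. (norm (f x))\<^sup>2 + (norm (g x))\<^sup>2)" by (simp add: norm_Pair)
  then show "integrable M (\<lambda>x. (norm (f x, g x))\<^sup>2)" using assms by (simp add: l2_def)
qed

lemma ip_pair: 
  assumes "l2 M w" "l2 M w'"
  shows "ip M w w' = ip M (\<lambda>y. fst (w y)) (\<lambda>y. fst (w' y)) + ip M (\<lambda>y. snd (w y)) (\<lambda>y. snd (w' y))"
proof -
  have "ip M w w' = (LINT y|M. fst (w y) \<bullet> fst (w' y) + snd (w y) \<bullet> snd (w' y))"
    unfolding ip_def by (intro Bochner_Integration.integral_cong refl) (simp add: inner_prod_def)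
  also have "\<dots> = ip M (\<lambda>y. fst (w y)) (\<lambda>y. fst (w' y)) + ip M (\<lambda>y. snd (w y)) (\<lambda>y. snd (w' y))"
    unfolding ip_def by (intro Bochner_Integration.integral_add l2_inner l2_fst l2_snd assms)
  finally show ?thesis .
qed

lemma ip_vec:
  fixes v v' :: "'a \<Rightarrow> real^'n::finite"
  assumes "l2 M v" "l2 M v'"
  shows "ip M v v' = (\<Sum>i\<in>UNIV. ip M (\<lambda>y. v y $ i) (\<lambda>y. v' y $ i))"
proof -
  have "ip M v v' = (LINT y|M. (\<Sum>i\<in>UNIV. (v y $ i) \<bullet> (v' y $ i)))"
    unfolding ip_def by (simp add: inner_vec_def)
  also have "\<dots> = (\<Sum>i\<in>UNIV. ip M (\<lambda>y. v y $ i) (\<lambda>y. v' y $ i))"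
    unfolding ip_def by (intro Bochner_Integration.integral_sum l2_inner l2_nth assms)
  finally show ?thesis .
qed

lemma nrm_pair_le:
  assumes "l2 M w" shows "nrm M w \<le> nrm M (\<lambda>y. fst (w y)) + nrm M (\<lambda>y. snd (w y))"
proof (rule power2_le_imp_le)
  have "(nrm M w)\<^sup>2 = (nrm M (\<lambda>y. fst (w y)))\<^sup>2 + (nrm M (\<lambda>y. snd (w y)))\<^sup>2"
    unfolding nrm_sq by (rule ip_pair[OF assms assms])
  also have "\<dots> \<le> (nrm M (\<lambda>y. fst (w y)) + nrm M (\<lambda>y. snd (w y)))\<^sup>2" by (simp add: power2_sum)
  finally show "(nrm M w)\<^sup>2 \<le> (nrm M (\<lambda>y. fst (w y)) + nrm M (\<lambda>y. snd (w y)))\<^sup>2" .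
qed (simp add: add_nonneg_nonneg)

lemma ip_real: "ip M f g = (LINT y|M. f y * g y)" for f g :: "'a \<Rightarrow> real" by (simp add: ip_def)

lemma l2_integrable:
  fixes f :: "'a \<Rightarrow> real"
  assumes "finite_measure M" "l2 M f" shows "integrable M f"
proof -
  interpret finite_measure M by fact
  have "l2 M (\<lambda>_. 1::real)" by (simp add: l2_def)
  from l2_inner[OF assms(2) this] show ?thesis by simp
qed

lemma l2_loc_int:
  assumes "bounded U" "U \<in> sets lebesgue" "l2 (lebesgue_on U) f" shows "loc_int U f"
  unfolding loc_int_def
proof (intro allI impI)
  fix K assume K: "compact K \<and> K \<subseteq> U"
  have "set_integrable lebesgue U f"
    using l2_integrable[OF fin_on[OF assms(1,2)] assms(3)] by (simp add: set_int_on[OF assms(2)])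
  then show "set_integrable lebesgue K f"
    by (rule set_integrable_subset) (use K compact_leb in auto)
qed

section \<open>Functions paired with their weak gradients\<close>

definition jet :: "(real^3 \<Rightarrow> real) \<Rightarrow> real^3 \<Rightarrow> real \<times> (real^3)" where
  "jet \<phi> y = (\<phi> y, grad3 \<phi> y)"

text \<open>Pairs \<open>(u, Du)\<close> with \<open>u\<close> in \<open>H1\<close> (\<open>h1\<close>) or \<open>H10\<close> (\<open>h10\<close>). Unlike \<open>H1\<close> and \<open>H10\<close>, these sets do not refer to
  the choice in \<open>wgrad\<close>.\<close>
definition h1 :: "(real^3) set \<Rightarrow> (real^3 \<Rightarrow> real \<times> (real^3)) set" where
  "h1 U = {w. l2 (lebesgue_on U) w \<and> (\<forall>\<phi> i. test_fun U \<phi> \<longrightarrow>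
     ip (lebesgue_on U) (\<lambda>y. fst (w y)) (pd i \<phi>) = - ip (lebesgue_on U) (\<lambda>y. snd (w y) $ i) \<phi>)}"

definition h10 :: "(real^3) set \<Rightarrow> (real^3 \<Rightarrow> real \<times> (real^3)) set" where
  "h10 U = cl2 (lebesgue_on U) (jet ` {\<phi>. test_fun U \<phi>})"

lemma jet_cont: "c1 \<phi> \<Longrightarrow> continuous_on UNIV (jet \<phi>)"
  unfolding jet_def grad3_def by (intro continuous_intros continuous_on_vec_lambda c1D)

lemma grad3_lin:
  assumes "c1 f" "c1 g" shows "grad3 (\<lambda>y. f y + c * g y) y = grad3 f y + c *\<^sub>R grad3 g y"
proof -
  have "(\<lambda>y. c * g y) differentiable (at y)" "pd i (\<lambda>y. c * g y) y = c * pd i g y" for i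

    by (rule pd_comp[OF c1D(1)[OF assms(2)], where h = "\<lambda>x. c * x" and h' = c]; auto intro!: derivative_eq_intros)+
  then show ?thesis unfolding grad3_def by (simp add: vec_eq_iff pd_add c1D(1)[OF assms(1)])
qed

text \<open>Boundedness makes \<open>M\<close> finite, so that continuous functions on the whole
  space are in \<open>l2\<close> and \<open>l2\<close> functions are integrable; openness provides
  enough test functions.\<close>

locale bdom =
  fixes U :: "(real^3) set"
  assumes op: "open U" and bd: "bounded U"
begin

abbreviation "M \<equiv> lebesgue_on U"

lemma leb: "U \<in> sets lebesgue" by (rule open_leb[OF op])
lemma fin: "finite_measure M" by (rule fin_on[OF bd leb])

lemma c1_l2: "c1 f \<Longrightarrow> l2 M f" by (rule cont_l2[OF _ bd leb]) (rule c1D)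
lemma c1_l2_pd: "c1 f \<Longrightarrow> l2 M (pd i f)" by (rule cont_l2[OF _ bd leb]) (rule c1D)
lemma c1_l2_jet: "c1 f \<Longrightarrow> l2 M (jet f)" by (rule cont_l2[OF jet_cont bd leb])
lemma test_c1: "test_fun U \<phi> \<Longrightarrow> c1 \<phi>" by (intro smooth3_c1 test_funD)
lemmas test_l2 = c1_l2[OF test_c1] c1_l2_pd[OF test_c1] c1_l2_jet[OF test_c1]

lemma c1_h1: assumes "c1 F" shows "jet F \<in> h1 U"
  unfolding h1_def
proof (intro CollectI conjI allI impI)
  show "l2 M (jet F)" by (rule c1_l2_jet[OF assms])
  fix \<phi> i assume "test_fun U \<phi>"
  from IBP_test[OF assms this leb] show "ip M (\<lambda>y. fst (jet F y)) (pd i \<phi>) = - ip M (\<lambda>y. snd (jet F y) $ i) \<phi>"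
    by (simp add: ip_real jet_def grad3_def)
qed

lemma clsub_h10: "clsub M (h10 U)"
  unfolding h10_def
proof (rule clsub_cl2)
  show "l2 M f" if "f \<in> jet ` {\<phi>. test_fun U \<phi>}" for f using that test_l2 by auto
  have "jet (\<lambda>_. 0) = (\<lambda>_. 0)" by (auto simp: jet_def grad3_def vec_eq_iff zero_prod_def)
  then show "(\<lambda>_. 0) \<in> jet ` {\<phi>. test_fun U \<phi>}" using test_zero by (metis (no_types, lifting) image_eqI mem_Collect_eq)
  show "(\<lambda>x. f x + c *\<^sub>R g x) \<in> jet ` {\<phi>. test_fun U \<phi>}" if f: "f \<in> jet ` {\<phi>. test_fun U \<phi>}" and g: "g \<in> jet ` {\<phi>. test_fun U \<phi>}" for f g c
  proof -
    obtain a b where a: "test_fun U a" "f = jet a" and b: "test_fun U b" "g = jet b" using f g by auto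
    have "(\<lambda>x. f x + c *\<^sub>R g x) = jet (\<lambda>x. a x + c * b x)"
      unfolding a b jet_def grad3_lin[OF test_c1[OF a(1)] test_c1[OF b(1)]] by auto
    then show ?thesis using test_lin[OF a(1) b(1), of c] by auto
  qed
qed

lemma h1_l2: "w \<in> h1 U \<Longrightarrow> l2 M w" by (simp add: h1_def)
lemma h10_l2: "w \<in> h10 U \<Longrightarrow> l2 M w" by (simp add: h10_def cl2_def)
lemma h1_ibp: "w \<in> h1 U \<Longrightarrow> test_fun U \<phi> \<Longrightarrow> ip M (\<lambda>y. fst (w y)) (pd i \<phi>) = - ip M (\<lambda>y. snd (w y) $ i) \<phi>"
  by (simp add: h1_def)

lemma test_h10: "test_fun U \<phi> \<Longrightarrow> jet \<phi> \<in> h10 U"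
  unfolding h10_def by (rule cl2_incl) (auto intro: test_l2)

lemma h10_seq:
  assumes "w \<in> h10 U"
  obtains \<phi> where "\<And>k. test_fun U (\<phi> k)" "(\<lambda>k. nrm M (\<lambda>y. jet (\<phi> k) y - w y)) \<longlonglongrightarrow> 0"
proof -
  obtain s where s: "\<And>k. s k \<in> jet ` {\<phi>. test_fun U \<phi>}" "(\<lambda>k. nrm M (\<lambda>x. s k x - w x)) \<longlonglongrightarrow> 0"
    by (rule cl2_seq[OF assms[unfolded h10_def]]) (rule that)
  have "\<exists>\<phi>. test_fun U \<phi> \<and> s k = jet \<phi>" for k using s(1)[of k] by auto
  then obtain \<phi> where "\<And>k. test_fun U (\<phi> k) \<and> s k = jet (\<phi> k)" by metis
  then show ?thesis using that[of \<phi>] s(2) by simp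
qed

lemma comp_tendsto:
  assumes "\<And>k. l2 M (s k)" "l2 M w" "(\<lambda>k. nrm M (\<lambda>y. s k y - w y)) \<longlonglongrightarrow> 0"
  shows "(\<lambda>k. nrm M (\<lambda>y. fst (s k y) - fst (w y))) \<longlonglongrightarrow> 0" "(\<lambda>k. nrm M (\<lambda>y. snd (s k y) - snd (w y))) \<longlonglongrightarrow> 0"
proof -
  have l: "l2 M (\<lambda>y. s k y - w y)" for k by (intro l2_diff assms)
  show "(\<lambda>k. nrm M (\<lambda>y. fst (s k y) - fst (w y))) \<longlonglongrightarrow> 0"
    by (rule null_sandwich[OF _ assms(3)]) (use nrm_fst[OF l] in simp)
  show "(\<lambda>k. nrm M (\<lambda>y. snd (s k y) - snd (w y))) \<longlonglongrightarrow> 0"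
    by (rule null_sandwich[OF _ assms(3)]) (use nrm_snd[OF l] in simp)
qed

lemma h10_h1: assumes w: "w \<in> h10 U" shows "w \<in> h1 U"
  unfolding h1_def
proof (intro CollectI conjI allI impI)
  show lw: "l2 M w" by (rule h10_l2[OF w])
  fix \<psi> i assume t: "test_fun U \<psi>"
  obtain \<phi> where \<phi>: "\<And>k. test_fun U (\<phi> k)" "(\<lambda>k. nrm M (\<lambda>y. jet (\<phi> k) y - w y)) \<longlonglongrightarrow> 0"
    by (rule h10_seq[OF w]) (rule that)
  note l = test_l2(3)[OF \<phi>(1)] and lt = test_l2[OF t]
  note ct = comp_tendsto[OF l lw \<phi>(2)]
  have ct2: "(\<lambda>k. nrm M (\<lambda>y. snd (jet (\<phi> k) y) $ i - snd (w y) $ i)) \<longlonglongrightarrow> 0"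
    by (rule null_sandwich[OF _ ct(2)]) (use nrm_nth[OF l2_diff[OF l2_snd[OF l] l2_snd[OF lw]]] in simp)
  have a: "(\<lambda>k. ip M (\<lambda>y. fst (jet (\<phi> k) y)) (pd i \<psi>)) \<longlonglongrightarrow> ip M (\<lambda>y. fst (w y)) (pd i \<psi>)"
    by (rule ip_tendsto_left[OF l2_fst[OF l] l2_fst[OF lw] ct(1) lt(2)])
  have b: "(\<lambda>k. ip M (\<lambda>y. snd (jet (\<phi> k) y) $ i) \<psi>) \<longlonglongrightarrow> ip M (\<lambda>y. snd (w y) $ i) \<psi>"
    by (rule ip_tendsto_left[OF l2_nth[OF l2_snd[OF l]] l2_nth[OF l2_snd[OF lw]] ct2 lt(1)])
  have "ip M (\<lambda>y. fst (jet (\<phi> k) y)) (pd i \<psi>) = - ip M (\<lambda>y. snd (jet (\<phi> k) y) $ i) \<psi>" for k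
    by (rule h1_ibp[OF c1_h1[OF test_c1[OF \<phi>(1)]] t])
  then show "ip M (\<lambda>y. fst (w y)) (pd i \<psi>) = - ip M (\<lambda>y. snd (w y) $ i) \<psi>"
    using a tendsto_minus[OF b] LIMSEQ_unique by simp
qed

lemma h1_lin: assumes "w \<in> h1 U" "w' \<in> h1 U" shows "(\<lambda>y. w y + c *\<^sub>R w' y) \<in> h1 U"
  unfolding h1_def
proof (intro CollectI conjI allI impI)
  note l = h1_l2[OF assms(1)] h1_l2[OF assms(2)]
  note ll = l2_fst[OF l(1)] l2_fst[OF l(2)] l2_nth[OF l2_snd[OF l(1)]] l2_nth[OF l2_snd[OF l(2)]]
  show "l2 M (\<lambda>y. w y + c *\<^sub>R w' y)" by (intro l2_lin l)
  fix \<psi> i assume t: "test_fun U \<psi>"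
  note lt = test_l2[OF t]
  have "ip M (\<lambda>y. fst (w y) + c *\<^sub>R fst (w' y)) (pd i \<psi>) = - ip M (\<lambda>y. snd (w y) $ i + c *\<^sub>R snd (w' y) $ i) \<psi>"
    unfolding ip_add_left[OF ll(1) l2_scale[OF ll(2)] lt(2)] ip_add_left[OF ll(3) l2_scale[OF ll(4)] lt(1)] ip_scale_left
    using h1_ibp[OF assms(1) t] h1_ibp[OF assms(2) t] by simp
  then show "ip M (\<lambda>y. fst (w y + c *\<^sub>R w' y)) (pd i \<psi>) = - ip M (\<lambda>y. snd (w y + c *\<^sub>R w' y) $ i) \<psi>" by simp
qed

lemma h1_diff: assumes "w \<in> h1 U" "w' \<in> h1 U" shows "(\<lambda>y. w y - w' y) \<in> h1 U"
  using h1_lin[OF assms, of "-1"] by simp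

lemma zero_ae:
  assumes "l2 M f" "\<And>\<phi>. test_fun U \<phi> \<Longrightarrow> ip M f \<phi> = 0" shows "AE y in M. f y = (0::real)"
proof -
  have "AE y in lebesgue. y \<in> U \<longrightarrow> f y = 0"
    by (rule du_bois_reymond[OF op l2_loc_int[OF bd leb assms(1)]]) (simp add: LINT_on[OF leb] ip_real[symmetric] assms(2))
  then show ?thesis by (simp add: AE_on[OF leb])
qed

lemma h1_snd_zero: assumes w: "w \<in> h1 U" and z: "AE y in M. fst (w y) = 0" shows "AE y in M. snd (w y) = 0"
proof -
  have "AE y in M. snd (w y) $ i = 0" for i
  proof (rule zero_ae)
    show l: "l2 M (\<lambda>y. snd (w y) $ i)" by (intro l2_nth l2_snd h1_l2[OF w])
    fix \<phi> assume t: "test_fun U \<phi>"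
    have "ip M (\<lambda>y. fst (w y)) (pd i \<phi>) = ip M (\<lambda>y. 0) (pd i \<phi>)"
      by (rule ip_cong_AE) (use z test_l2[OF t] l2_fst[OF h1_l2[OF w]] in auto)
    then show "ip M (\<lambda>y. snd (w y) $ i) \<phi> = 0" using h1_ibp[OF w t, of i] by simp
  qed
  then have "AE y in M. \<forall>i. snd (w y) $ i = 0" by (simp add: AE_all_countable)
  then show ?thesis by eventually_elim (simp add: vec_eq_iff)
qed

text \<open>Values determine gradients, so identities in \<open>h1\<close> are checked on first
  components. In this way a concrete gradient is identified with the one chosen by
  \<open>wgrad\<close>.\<close>

lemma h1_unique: assumes "w \<in> h1 U" "w' \<in> h1 U" "AE y in M. fst (w y) = fst (w' y)" shows "AE y in M. w y = w' y"
proof -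
  have "AE y in M. snd (w y - w' y) = 0"
    by (rule h1_snd_zero[OF h1_diff[OF assms(1,2)]]) (use assms(3) in simp)
  with assms(3) show ?thesis by eventually_elim (simp add: prod_eq_iff)
qed

lemma wgrad_iff:
  assumes "l2 M u" "\<And>i. l2 M (\<lambda>y. Du y $ i)"
  shows "is_wgrad U u Du \<longleftrightarrow> (\<lambda>y. (u y, Du y)) \<in> h1 U"
  unfolding is_wgrad_def h1_def
  using l2_loc_int[OF bd leb assms(1)] l2_loc_int[OF bd leb assms(2)] l2_pair[OF assms(1) l2_vec[OF assms(2)]]
  by (simp add: LINT_on[OF leb] ip_real)

definition "pr u = (\<lambda>y. (u y, wgrad U u y))"

text \<open>\<open>wgrad\<close> is some weak gradient, a priori only locally integrable. The lemma
  of du Bois-Reymond identifies it almost everywhere with the square-integrable gradient that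
  \<open>H1\<close> provides.\<close>

lemma H1_pr: assumes "H1 U u" shows "pr u \<in> h1 U" "l2 M u" "l2 M (\<lambda>y. wgrad U u y)"
proof -
  obtain Du where Du: "is_wgrad U u Du" "\<And>i. l2 M (\<lambda>y. Du y $ i)" and u: "l2 M u"
    using assms unfolding H1_def L2_on[OF leb] by blast
  have w: "is_wgrad U u (wgrad U u)" unfolding wgrad_def by (rule someI[of "is_wgrad U u"]) (rule Du)
  have "AE y in M. Du y $ i = wgrad U u y $ i" for i
  proof -
    let ?d = "\<lambda>y. Du y $ i - wgrad U u y $ i"
    have li: "loc_int U (\<lambda>y. Du y $ i)" "loc_int U (\<lambda>y. wgrad U u y $ i)" using Du(1) w by (auto simp: is_wgrad_def)
    have "AE y in lebesgue. y \<in> U \<longrightarrow> ?d y = 0"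
    proof (rule du_bois_reymond[OF op])
      show "loc_int U ?d" using li unfolding loc_int_def by (auto intro: set_integral_diff)
      fix \<phi> assume t: "test_fun U \<phi>"
      \<comment> \<open>Both integrals must exist before they may be subtracted; for a locally
        integrable factor this follows from boundedness and compact support of
        \<open>\<phi>\<close>.\<close>
      have int: "set_integrable lebesgue U (\<lambda>y. g y * \<phi> y)" if g: "loc_int U g" for g
      proof -
        have c: "continuous_on UNIV \<phi>" by (intro smooth3_cont test_funD(1)[OF t])
        have K: "compact (tsupp \<phi>)" "tsupp \<phi> \<subseteq> U" using test_funD[OF t] by auto
        have "bounded (\<phi> ` tsupp \<phi>)" by (intro compact_imp_bounded compact_continuous_image continuous_on_subset[OF c] K) auto
        then obtain B where B: "\<And>y. y \<in> tsupp \<phi> \<Longrightarrow> norm (\<phi> y) \<le> B" by (auto simp: bounded_iff)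
        have B2: "norm (\<phi> y) \<le> \<bar>B\<bar>" for y using B[of y] tsupp_outside[of y \<phi>] by (cases "y \<in> tsupp \<phi>") auto
        have gi: "integrable lebesgue (\<lambda>y. indicator (tsupp \<phi>) y *\<^sub>R g y)" using g K unfolding loc_int_def set_integrable_def by blast
        have "integrable lebesgue (\<lambda>y. \<phi> y * (indicator (tsupp \<phi>) y *\<^sub>R g y))"
        proof (rule Bochner_Integration.integrable_bound[where f = "\<lambda>y. \<bar>B\<bar> * (indicator (tsupp \<phi>) y *\<^sub>R g y)"])
          show "integrable lebesgue (\<lambda>y. \<bar>B\<bar> * (indicator (tsupp \<phi>) y *\<^sub>R g y))" by (rule integrable_mult_right) (rule gi)
          show "(\<lambda>y. \<phi> y * (indicator (tsupp \<phi>) y *\<^sub>R g y)) \<in> borel_measurable lebesgue"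
            by (intro borel_measurable_times cont_meas_leb[OF c] borel_measurable_integrable[OF gi])
          have "norm (\<phi> y * (indicator (tsupp \<phi>) y *\<^sub>R g y)) \<le> norm (\<bar>B\<bar> * (indicator (tsupp \<phi>) y *\<^sub>R g y))" for y
            unfolding norm_mult using B2[of y] by (intro mult_right_mono) auto
          then show "AE y in lebesgue. norm (\<phi> y * (indicator (tsupp \<phi>) y *\<^sub>R g y)) \<le> norm (\<bar>B\<bar> * (indicator (tsupp \<phi>) y *\<^sub>R g y))" by simp
        qed
        also have "(\<lambda>y. \<phi> y * (indicator (tsupp \<phi>) y *\<^sub>R g y)) = (\<lambda>y. indicator U y *\<^sub>R (g y * \<phi> y))"
        proof
          fix y show "\<phi> y * (indicator (tsupp \<phi>) y *\<^sub>R g y) = indicator U y *\<^sub>R (g y * \<phi> y)"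
            using K tsupp_outside[of y \<phi>] by (cases "y \<in> tsupp \<phi>") (auto simp: indicator_def)
        qed
        finally show ?thesis by (simp add: set_integrable_def)
      qed
      have e: "(LINT y:U|lebesgue. Du y $ i * \<phi> y) = (LINT y:U|lebesgue. wgrad U u y $ i * \<phi> y)"
      proof -
        have "(LINT y:U|lebesgue. u y * pd i \<phi> y) = - (LINT y:U|lebesgue. Du y $ i * \<phi> y)"
          using Du(1) t unfolding is_wgrad_def by blast
        moreover have "(LINT y:U|lebesgue. u y * pd i \<phi> y) = - (LINT y:U|lebesgue. wgrad U u y $ i * \<phi> y)"
          using w t unfolding is_wgrad_def by blast
        ultimately show ?thesis by linarith
      qed
      have "(LINT y:U|lebesgue. ?d y * \<phi> y) = (LINT y:U|lebesgue. Du y $ i * \<phi> y - wgrad U u y $ i * \<phi> y)"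
        by (simp only: left_diff_distrib)
      also have "\<dots> = (LINT y:U|lebesgue. Du y $ i * \<phi> y) - (LINT y:U|lebesgue. wgrad U u y $ i * \<phi> y)"
        by (rule set_integral_diff(2)[OF int[OF li(1)] int[OF li(2)]])
      finally show "(LINT y:U|lebesgue. ?d y * \<phi> y) = 0" using e by simp
    qed
    then show ?thesis by (simp add: AE_on[OF leb])
  qed
  note ae = this
  \<comment> \<open>Measurability on all of \<open>U\<close> passes over from \<open>Du\<close>
    because Lebesgue measure is complete.\<close>
  have m: "(\<lambda>y. wgrad U u y $ i) \<in> borel_measurable M" for i
  proof -
    have "AE y in M. Du y $ i = wgrad U u y $ i" by (rule ae)
    then have "AE y in lebesgue. y \<in> U \<longrightarrow> Du y $ i = wgrad U u y $ i" by (simp add: AE_on[OF leb])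
    then have a: "AE y in lebesgue. indicator U y *\<^sub>R Du y $ i = indicator U y *\<^sub>R wgrad U u y $ i"
      by eventually_elim (simp add: indicator_def)
    have "(\<lambda>y. indicator U y *\<^sub>R Du y $ i) \<in> borel_measurable lebesgue"
      using l2_meas[OF Du(2)[of i]] by (subst (asm) borel_measurable_restrict_space_iff) (use leb in auto)
    then have "(\<lambda>y. indicator U y *\<^sub>R wgrad U u y $ i) \<in> borel_measurable lebesgue"
      by (rule borel_measurable_AE[OF _ a])
    then show ?thesis by (subst borel_measurable_restrict_space_iff) (use leb in auto)
  qed
  have l: "l2 M (\<lambda>y. wgrad U u y $ i)" for i by (rule l2_cong_AE[OF Du(2) m ae])
  show "pr u \<in> h1 U" unfolding pr_def using w wgrad_iff[OF u l] by simp
  show "l2 M u" by (rule u)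
  show "l2 M (\<lambda>y. wgrad U u y)" by (rule l2_vec[OF l])
qed

lemma h1_H1: assumes w: "w \<in> h1 U" shows "H1 U (\<lambda>y. fst (w y))" "AE y in M. pr (\<lambda>y. fst (w y)) y = w y"
proof -
  have l: "l2 M (\<lambda>y. fst (w y))" "\<And>i. l2 M (\<lambda>y. snd (w y) $ i)" by (intro l2_fst l2_nth l2_snd h1_l2[OF w])+
  have "is_wgrad U (\<lambda>y. fst (w y)) (\<lambda>y. snd (w y))" using wgrad_iff[OF l] w by simp
  then show H: "H1 U (\<lambda>y. fst (w y))" unfolding H1_def L2_on[OF leb] using l by blast
  show "AE y in M. pr (\<lambda>y. fst (w y)) y = w y"
    by (rule h1_unique[OF H1_pr(1)[OF H] w]) (simp add: pr_def)
qed

end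

section \<open>Bounded potentials and the energy form\<close>

lemma nrm_bounded_AE:
  fixes f g :: "'a \<Rightarrow> real"
  assumes f: "l2 M f" and Vm: "V \<in> borel_measurable M" and B: "0 \<le> B" "AE y in M. \<bar>V y\<bar> \<le> B"
  shows "l2 M (\<lambda>y. V y * f y)" "nrm M (\<lambda>y. V y * f y) \<le> B * nrm M f"
proof -
  have fm: "f \<in> borel_measurable M" by (rule l2_meas[OF f])
  have int: "integrable M (\<lambda>y. B\<^sup>2 * (f y)\<^sup>2)" using f by (simp add: l2_def)
  have ae: "AE y in M. (V y * f y)\<^sup>2 \<le> B\<^sup>2 * (f y)\<^sup>2"
    using B(2)
  proof eventually_elim
    case (elim y)
    then have "(V y)\<^sup>2 \<le> B\<^sup>2" using B(1) by (simp add: abs_le_square_iff[symmetric])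
    then show ?case by (simp add: power_mult_distrib mult_right_mono)
  qed
  have m: "(\<lambda>y. V y * f y) \<in> borel_measurable M" by (intro borel_measurable_times Vm fm)
  have int2: "integrable M (\<lambda>y. (V y * f y)\<^sup>2)"
    by (rule Bochner_Integration.integrable_bound[OF int]) (use ae m in auto)
  then show l: "l2 M (\<lambda>y. V y * f y)" unfolding l2_def using m by simp
  show "nrm M (\<lambda>y. V y * f y) \<le> B * nrm M f"
  proof (rule power2_le_imp_le)
    have "(nrm M (\<lambda>y. V y * f y))\<^sup>2 = (LINT y|M. (V y * f y)\<^sup>2)" unfolding nrm_sq ip_real by (simp only: power2_eq_square)
    also have "\<dots> \<le> (LINT y|M. B\<^sup>2 * (f y)\<^sup>2)" by (rule integral_mono_AE[OF int2 int ae])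
    also have "\<dots> = B\<^sup>2 * (nrm M f)\<^sup>2" unfolding nrm_sq ip_real by (simp add: power2_eq_square)
    finally show "(nrm M (\<lambda>y. V y * f y))\<^sup>2 \<le> (B * nrm M f)\<^sup>2" by (simp add: power_mult_distrib)
  qed (use B in simp)
qed

definition ess_bdd :: "'a measure \<Rightarrow> ('a \<Rightarrow> real) \<Rightarrow> bool" where
  "ess_bdd M V \<longleftrightarrow> V \<in> borel_measurable M \<and> (\<exists>B. AE y in M. \<bar>V y\<bar> \<le> B)"

lemma ess_bdd_bound:
  assumes "ess_bdd M V"
  obtains B where "0 \<le> B" "AE y in M. \<bar>V y\<bar> \<le> B" "\<And>f. l2 M f \<Longrightarrow> nrm M (\<lambda>y. V y * f y) \<le> B * nrm M f"
proof -
  obtain B where B: "AE y in M. \<bar>V y\<bar> \<le> B" using assms by (auto simp: ess_bdd_def)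
  have a: "AE y in M. \<bar>V y\<bar> \<le> \<bar>B\<bar>" using B by eventually_elim linarith
  show ?thesis
    by (rule that[of "\<bar>B\<bar>"]) (use a assms nrm_bounded_AE(2)[of M _ V "\<bar>B\<bar>"] in \<open>auto simp: ess_bdd_def\<close>)
qed

lemma ess_bdd_l2: assumes "ess_bdd M V" "l2 M f" shows "l2 M (\<lambda>y. V y * f y)"
proof -
  obtain B where "0 \<le> B" "AE y in M. \<bar>V y\<bar> \<le> B" by (rule ess_bdd_bound[OF assms(1)]) (rule that)
  then show ?thesis using nrm_bounded_AE(1)[OF assms(2)] assms(1) by (simp add: ess_bdd_def)
qed

lemma ess_bdd_0 [simp]: "ess_bdd M (\<lambda>_. 0)" by (auto simp: ess_bdd_def)

text \<open>The energy form of \<open>- \<Delta> + V\<close>. It is defined on arbitrary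
  square-integrable pairs, which makes its bilinearity and continuity independent of Sobolev
  spaces.\<close>

definition aform :: "'a measure \<Rightarrow> ('a \<Rightarrow> real) \<Rightarrow> ('a \<Rightarrow> real \<times> (real^3)) \<Rightarrow> ('a \<Rightarrow> real \<times> (real^3)) \<Rightarrow> real" where
  "aform M V w w' = ip M (\<lambda>y. snd (w y)) (\<lambda>y. snd (w' y)) + ip M (\<lambda>y. V y * fst (w y)) (\<lambda>y. fst (w' y))"

lemma aform_sym: "aform M V w w' = aform M V w' w"
  unfolding aform_def ip_sym[of M "\<lambda>y. snd (w y)"] by (simp add: ip_real mult.commute mult.left_commute)

lemma aform_lin:
  assumes V: "ess_bdd M V" and l: "l2 M w" "l2 M w'" "l2 M x"
  shows "aform M V (\<lambda>y. w y + c *\<^sub>R w' y) x = aform M V w x + c * aform M V w' x"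
proof -
  note a = l2_snd[OF l(1)] l2_snd[OF l(2)] l2_snd[OF l(3)]
  note b = ess_bdd_l2[OF V l2_fst[OF l(1)]] ess_bdd_l2[OF V l2_fst[OF l(2)]] l2_fst[OF l(3)]
  have 1: "ip M (\<lambda>y. snd (w y) + c *\<^sub>R snd (w' y)) (\<lambda>y. snd (x y)) = ip M (\<lambda>y. snd (w y)) (\<lambda>y. snd (x y)) + c * ip M (\<lambda>y. snd (w' y)) (\<lambda>y. snd (x y))"
    unfolding ip_add_left[OF a(1) l2_scale[OF a(2)] a(3)] ip_scale_left ..
  have 2: "ip M (\<lambda>y. V y * fst (w y) + c *\<^sub>R (V y * fst (w' y))) (\<lambda>y. fst (x y)) = ip M (\<lambda>y. V y * fst (w y)) (\<lambda>y. fst (x y)) + c * ip M (\<lambda>y. V y * fst (w' y)) (\<lambda>y. fst (x y))"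
    unfolding ip_add_left[OF b(1) l2_scale[OF b(2)] b(3)] ip_scale_left ..
  have "(\<lambda>y. V y * fst (w y + c *\<^sub>R w' y)) = (\<lambda>y. V y * fst (w y) + c *\<^sub>R (V y * fst (w' y)))"
    by (simp add: algebra_simps)
  moreover have "(\<lambda>y. snd (w y + c *\<^sub>R w' y)) = (\<lambda>y. snd (w y) + c *\<^sub>R snd (w' y))" by simp
  ultimately show ?thesis unfolding aform_def using 1 2 by (simp add: distrib_left)
qed

lemma aform_diff:
  assumes V: "ess_bdd M V" and l: "l2 M w" "l2 M w'" "l2 M x"
  shows "aform M V (\<lambda>y. w y - w' y) x = aform M V w x - aform M V w' x"
  using aform_lin[OF assms, of "-1"] by simp

lemma aform_lin_right:
  assumes "ess_bdd M V" "l2 M w" "l2 M w'" "l2 M x"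
  shows "aform M V x (\<lambda>y. w y + c *\<^sub>R w' y) = aform M V x w + c * aform M V x w'"
  using aform_lin[OF assms] by (simp add: aform_sym[of M V x])

lemma aform_diff_right:
  assumes "ess_bdd M V" "l2 M w" "l2 M w'" "l2 M x"
  shows "aform M V x (\<lambda>y. w y - w' y) = aform M V x w - aform M V x w'"
  using aform_diff[OF assms] by (simp add: aform_sym[of M V x])

lemma aform_bound:
  assumes V: "ess_bdd M V"
  obtains C where "0 \<le> C" "\<And>w x. l2 M w \<Longrightarrow> l2 M x \<Longrightarrow> \<bar>aform M V w x\<bar> \<le> C * nrm M w * nrm M x"
proof -
  obtain B where B: "0 \<le> B" "\<And>f. l2 M f \<Longrightarrow> nrm M (\<lambda>y. V y * f y) \<le> B * nrm M f" by (rule ess_bdd_bound[OF V]) (rule that)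
  have "\<bar>aform M V w x\<bar> \<le> (1 + B) * nrm M w * nrm M x" if l: "l2 M w" "l2 M x" for w x
  proof -
    have "\<bar>ip M (\<lambda>y. snd (w y)) (\<lambda>y. snd (x y))\<bar> \<le> nrm M (\<lambda>y. snd (w y)) * nrm M (\<lambda>y. snd (x y))"
      by (intro ip_CS l2_snd l)
    also have "\<dots> \<le> nrm M w * nrm M x" by (intro mult_mono nrm_snd l) simp_all
    finally have 1: "\<bar>ip M (\<lambda>y. snd (w y)) (\<lambda>y. snd (x y))\<bar> \<le> nrm M w * nrm M x" .
    have "\<bar>ip M (\<lambda>y. V y * fst (w y)) (\<lambda>y. fst (x y))\<bar> \<le> nrm M (\<lambda>y. V y * fst (w y)) * nrm M (\<lambda>y. fst (x y))"
      by (intro ip_CS ess_bdd_l2 V l2_fst l)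
    also have "\<dots> \<le> (B * nrm M w) * nrm M x"
    proof (intro mult_mono nrm_fst l)
      have "nrm M (\<lambda>y. V y * fst (w y)) \<le> B * nrm M (\<lambda>y. fst (w y))" by (intro B l2_fst l)
      also have "\<dots> \<le> B * nrm M w" by (intro mult_left_mono nrm_fst l B)
      finally show "nrm M (\<lambda>y. V y * fst (w y)) \<le> B * nrm M w" .
    qed (use B in simp_all)
    finally have 2: "\<bar>ip M (\<lambda>y. V y * fst (w y)) (\<lambda>y. fst (x y))\<bar> \<le> (B * nrm M w) * nrm M x" .
    have "(1 + B) * nrm M w * nrm M x = nrm M w * nrm M x + (B * nrm M w) * nrm M x" by (simp add: algebra_simps)
    then show ?thesis unfolding aform_def using 1 2 by linarith
  qed
  with B show ?thesis using that[of "1 + B"] by simp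
qed

lemma aform_tendsto:
  assumes V: "ess_bdd M V" and s: "\<And>k. l2 M (s k)" "l2 M w" "(\<lambda>k. nrm M (\<lambda>y. s k y - w y)) \<longlonglongrightarrow> 0" and x: "l2 M x"
  shows "(\<lambda>k. aform M V (s k) x) \<longlonglongrightarrow> aform M V w x"
proof -
  obtain C where C: "\<And>w x. l2 M w \<Longrightarrow> l2 M x \<Longrightarrow> \<bar>aform M V w x\<bar> \<le> C * nrm M w * nrm M x" by (rule aform_bound[OF V]) (rule that)
  have "\<bar>aform M V (s k) x - aform M V w x\<bar> \<le> (C * nrm M x) * nrm M (\<lambda>y. s k y - w y)" for k
    using C[OF l2_diff[OF s(1) s(2)] x, of k] aform_diff[OF V s(1) s(2) x, of k] by (simp add: ac_simps)
  moreover have "(\<lambda>k. (C * nrm M x) * nrm M (\<lambda>y. s k y - w y)) \<longlonglongrightarrow> 0" by (intro tendsto_mult_right_zero s)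
  ultimately have "(\<lambda>k. aform M V (s k) x - aform M V w x) \<longlonglongrightarrow> 0" by (rule null_sandwich)
  then show ?thesis by (simp add: LIM_zero_iff)
qed

lemma aform_cong_AE:
  assumes V: "ess_bdd M V" and l: "l2 M w" "l2 M w'" "l2 M x" and ae: "AE y in M. w y = w' y"
  shows "aform M V w x = aform M V w' x"
proof -
  have "ip M (\<lambda>y. snd (w y)) (\<lambda>y. snd (x y)) = ip M (\<lambda>y. snd (w' y)) (\<lambda>y. snd (x y))"
    by (intro ip_cong_AE l2_snd l) (use ae in auto)
  moreover have "ip M (\<lambda>y. V y * fst (w y)) (\<lambda>y. fst (x y)) = ip M (\<lambda>y. V y * fst (w' y)) (\<lambda>y. fst (x y))"
    by (intro ip_cong_AE ess_bdd_l2 V l2_fst l) (use ae in auto)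
  ultimately show ?thesis by (simp add: aform_def)
qed

section \<open>Weak solutions, the Poincare inequality and density of test functions\<close>

context bdom begin

lemma Linfty_ess_bdd: "Linfty U V \<longleftrightarrow> ess_bdd M V"
  unfolding Linfty_def ess_bdd_def by (simp add: set_meas_on[OF leb] AE_on[OF leb])

lemma H1dist2_eq: "H1dist2 U u u' = (nrm M (\<lambda>y. pr u y - pr u' y))\<^sup>2"
  unfolding H1dist2_def LINT_on[OF leb] nrm_sq ip_def
  by (rule arg_cong[where f = "integral\<^sup>L M"]) (simp add: fun_eq_iff pr_def inner_prod_def power2_norm_eq_inner power2_eq_square[of "_ - _ :: real"])

lemma test_H1: assumes "test_fun U \<phi>" shows "H1 U \<phi>" "AE y in M. pr \<phi> y = jet \<phi> y"
  using h1_H1[OF c1_h1[OF test_c1[OF assms]]] by (simp_all add: jet_def)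

lemma H1dist2_test:
  assumes u: "H1 U u" and t: "test_fun U \<phi>"
  shows "H1dist2 U u \<phi> = (nrm M (\<lambda>y. jet \<phi> y - pr u y))\<^sup>2"
proof -
  have l: "l2 M (pr u)" "l2 M (pr \<phi>)" "l2 M (jet \<phi>)"
    using h1_l2[OF H1_pr(1)[OF u]] h1_l2[OF H1_pr(1)[OF test_H1(1)[OF t]]] test_l2[OF t] by auto
  have "nrm M (\<lambda>y. pr u y - pr \<phi> y) = nrm M (\<lambda>y. pr u y - jet \<phi> y)"
    by (rule nrm_cong_AE) (use l test_H1(2)[OF t] in auto)
  then show ?thesis unfolding H1dist2_eq by (simp add: nrm_diff_comm[of M "pr u"])
qed

text \<open>For a test function the chosen gradient agrees almost everywhere with the classical one,
  so \<open>H1dist2\<close> is the squared \<open>L2\<close> distance of pairs.\<close>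

lemma H10_iff: "H10 U u \<longleftrightarrow> H1 U u \<and> pr u \<in> h10 U"
proof
  assume H: "H10 U u"
  then have u: "H1 U u" by (simp add: H10_def)
  obtain \<phi> where \<phi>: "\<And>k. test_fun U (\<phi> k)" "(\<lambda>k. H1dist2 U u (\<phi> k)) \<longlonglongrightarrow> 0" using H unfolding H10_def by blast
  have "(\<lambda>k. sqrt (H1dist2 U u (\<phi> k))) \<longlonglongrightarrow> 0" using tendsto_real_sqrt[OF \<phi>(2)] by simp
  then have "(\<lambda>k. nrm M (\<lambda>y. jet (\<phi> k) y - pr u y)) \<longlonglongrightarrow> 0" by (simp add: H1dist2_test[OF u \<phi>(1)])
  then have "pr u \<in> h10 U" unfolding h10_def
    by (intro cl2_seqI[of M _ "\<lambda>k. jet (\<phi> k)"] h1_l2 H1_pr u) (use \<phi>(1) in auto)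
  with u show "H1 U u \<and> pr u \<in> h10 U" by blast
next
  assume a: "H1 U u \<and> pr u \<in> h10 U"
  then obtain \<phi> where \<phi>: "\<And>k. test_fun U (\<phi> k)" "(\<lambda>k. nrm M (\<lambda>y. jet (\<phi> k) y - pr u y)) \<longlonglongrightarrow> 0"
    using h10_seq by blast
  have "(\<lambda>k. H1dist2 U u (\<phi> k)) \<longlonglongrightarrow> 0\<^sup>2"
    unfolding H1dist2_test[OF conjunct1[OF a] \<phi>(1)] by (intro tendsto_power \<phi>)
  then show "H10 U u" unfolding H10_def using a \<phi>(1) by auto
qed

lemma h10_pr: assumes w: "w \<in> h10 U" shows "pr (\<lambda>y. fst (w y)) \<in> h10 U" "H10 U (\<lambda>y. fst (w y))"
proof -
  note h = h1_H1[OF h10_h1[OF w]]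
  show p: "pr (\<lambda>y. fst (w y)) \<in> h10 U"
    by (rule clsub_cong_AE[OF clsub_h10 w l2_meas[OF h1_l2[OF H1_pr(1)[OF h(1)]]]]) (use h(2) in auto)
  show "H10 U (\<lambda>y. fst (w y))" using p h(1) by (simp add: H10_iff)
qed

text \<open>Jets of test functions are dense in \<open>h10\<close> and the form is continuous. The
  equation may therefore be tested with any element of \<open>h10\<close>, in particular with
  differences of functions that have the same boundary values.\<close>

lemma weak_sol_iff:
  assumes V: "ess_bdd M V"
  shows "weak_sol U V u \<longleftrightarrow> H1 U u \<and> (\<forall>w\<in>h10 U. aform M V (pr u) w = 0)"
proof -
  have eq: "(LINT y:U|lebesgue. wgrad U u y \<bullet> grad3 \<phi> y + V y * u y * \<phi> y) = aform M V (pr u) (jet \<phi>)"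
    if u: "H1 U u" and t: "test_fun U \<phi>" for \<phi>
  proof -
    note l = h1_l2[OF H1_pr(1)[OF u]] test_l2(3)[OF t]
    have i1: "integrable M (\<lambda>y. snd (pr u y) \<bullet> snd (jet \<phi> y))" by (intro l2_inner l2_snd l)
    have i2: "integrable M (\<lambda>y. (V y * fst (pr u y)) \<bullet> fst (jet \<phi> y))" by (intro l2_inner ess_bdd_l2 V l2_fst l)
    have "aform M V (pr u) (jet \<phi>) = (LINT y|M. snd (pr u y) \<bullet> snd (jet \<phi> y) + (V y * fst (pr u y)) \<bullet> fst (jet \<phi> y))"
      unfolding aform_def ip_def by (rule Bochner_Integration.integral_add[OF i1 i2, symmetric])
    then show ?thesis unfolding LINT_on[OF leb] by (simp add: pr_def jet_def mult.assoc)
  qed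
  show ?thesis
  proof
    assume ws: "weak_sol U V u"
    then have u: "H1 U u" by (simp add: weak_sol_def)
    have "aform M V (pr u) w = 0" if w: "w \<in> h10 U" for w
    proof -
      obtain \<phi> where \<phi>: "\<And>k. test_fun U (\<phi> k)" "(\<lambda>k. nrm M (\<lambda>y. jet (\<phi> k) y - w y)) \<longlonglongrightarrow> 0"
        by (rule h10_seq[OF w]) (rule that)
      have "(\<lambda>k. aform M V (jet (\<phi> k)) (pr u)) \<longlonglongrightarrow> aform M V w (pr u)"
        by (rule aform_tendsto[OF V test_l2(3)[OF \<phi>(1)] h10_l2[OF w] \<phi>(2) h1_l2[OF H1_pr(1)[OF u]]])
      moreover have "aform M V (jet (\<phi> k)) (pr u) = 0" for k
        using ws eq[OF u \<phi>(1)[of k]] \<phi>(1)[of k] unfolding weak_sol_def by (simp add: aform_sym[of M V _ "pr u"])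
      ultimately have "aform M V w (pr u) = 0" by (simp add: LIMSEQ_const_iff)
      then show ?thesis by (simp add: aform_sym)
    qed
    with u show "H1 U u \<and> (\<forall>w\<in>h10 U. aform M V (pr u) w = 0)" by blast
  next
    assume a: "H1 U u \<and> (\<forall>w\<in>h10 U. aform M V (pr u) w = 0)"
    then show "weak_sol U V u" unfolding weak_sol_def using eq test_h10 by auto
  qed
qed

text \<open>Integrating \<open>y $ i * \<phi>\<close> against \<open>pd i \<phi>\<close> by parts
  shows that the squared norm of \<open>\<phi>\<close> is
  \<open>- 2 * ip M (\<lambda>y. y $ i * pd i \<phi> y) \<phi>\<close>, and the coordinate is at
  most \<open>R\<close> on the bounded domain. Density carries the estimate over to
  \<open>h10\<close>.\<close>

lemma poincare: obtains C where "0 \<le> C" "\<And>w. w \<in> h10 U \<Longrightarrow> nrm M (\<lambda>y. fst (w y)) \<le> C * nrm M (\<lambda>y. snd (w y))"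
proof -
  obtain R where R: "R > 0" "\<And>y. y \<in> U \<Longrightarrow> norm y \<le> R" using bd bounded_pos by blast
  have test: "nrm M \<phi> \<le> 2 * R * nrm M (grad3 \<phi>)" if t: "test_fun U \<phi>" for \<phi>
  proof -
    define i :: 3 where "i = 1"
    have c: "c1 \<phi>" by (rule test_c1[OF t])
    have cc: "c1 (\<lambda>y. y $ i)" by (intro smooth3_c1 smooth3_coord)
    note l = test_l2(1,2)[OF t]
    let ?F = "\<lambda>y. y $ i * \<phi> y"
    have F: "c1 ?F" by (rule c1_mult[OF cc c])
    have pF: "pd i ?F y = y $ i * pd i \<phi> y + \<phi> y" for y
      by (subst pd_mult[OF c1D(1)[OF cc] c1D(1)[OF c]]) (simp add: pd_coord)
    have yl: "l2 M (\<lambda>y. y $ i * pd i \<phi> y)" by (rule cont_l2[OF _ bd leb]) (intro continuous_intros c1D[OF c])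
    have "ip M (\<lambda>y. y $ i * pd i \<phi> y) \<phi> = - ip M (\<lambda>y. y $ i * pd i \<phi> y + \<phi> y) \<phi>"
      using IBP_test[OF F t leb, of i] unfolding pF ip_real by (simp only: ac_simps)
    also have "\<dots> = - ip M (\<lambda>y. y $ i * pd i \<phi> y) \<phi> - ip M \<phi> \<phi>"
      by (subst ip_add_left[OF yl l(1) l(1)]) simp
    finally have "(nrm M \<phi>)\<^sup>2 = - 2 * ip M (\<lambda>y. y $ i * pd i \<phi> y) \<phi>" unfolding nrm_sq by linarith
    also have "\<dots> \<le> 2 * (nrm M (\<lambda>y. y $ i * pd i \<phi> y) * nrm M \<phi>)" using ip_CS[OF yl l(1)] by linarith
    also have "\<dots> \<le> 2 * ((R * nrm M (pd i \<phi>)) * nrm M \<phi>)"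
    proof (intro mult_left_mono mult_right_mono)
      have "AE y in M. \<bar>y $ i\<bar> \<le> R"
      proof (rule AE_I2)
        fix y assume "y \<in> space M"
        then have "norm y \<le> R" using R by simp
        then show "\<bar>y $ i\<bar> \<le> R" using component_le_norm_cart[of y i] by linarith
      qed
      then show "nrm M (\<lambda>y. y $ i * pd i \<phi> y) \<le> R * nrm M (pd i \<phi>)"
        by (intro nrm_bounded_AE(2)[OF l(2)] cont_meas_leb continuous_intros) (use R in auto)
    qed simp_all
    finally have "nrm M \<phi> * nrm M \<phi> \<le> (2 * R * nrm M (pd i \<phi>)) * nrm M \<phi>" by (simp add: power2_eq_square)
    then have a: "nrm M \<phi> \<le> 2 * R * nrm M (pd i \<phi>)"
      using R by (cases "nrm M \<phi> = 0") (simp_all add: less_le)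
    have "nrm M (\<lambda>y. grad3 \<phi> y $ i) \<le> nrm M (grad3 \<phi>)"
      using nrm_nth[OF l2_snd[OF test_l2(3)[OF t]], of i] by (simp add: jet_def)
    then have "nrm M (pd i \<phi>) \<le> nrm M (grad3 \<phi>)" by (simp add: grad3_def)
    then have "2 * R * nrm M (pd i \<phi>) \<le> 2 * R * nrm M (grad3 \<phi>)" using R by (intro mult_left_mono) auto
    with a show ?thesis by linarith
  qed
  have "nrm M (\<lambda>y. fst (w y)) \<le> 2 * R * nrm M (\<lambda>y. snd (w y))" if w: "w \<in> h10 U" for w
  proof -
    obtain \<phi> where \<phi>: "\<And>k. test_fun U (\<phi> k)" "(\<lambda>k. nrm M (\<lambda>y. jet (\<phi> k) y - w y)) \<longlonglongrightarrow> 0"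
      by (rule h10_seq[OF w]) (rule that)
    note l = test_l2(3)[OF \<phi>(1)] h10_l2[OF w]
    note ct = comp_tendsto[OF l \<phi>(2)]
    have 1: "(\<lambda>k. nrm M (\<lambda>y. fst (jet (\<phi> k) y))) \<longlonglongrightarrow> nrm M (\<lambda>y. fst (w y))" by (intro nrm_tendsto l2_fst l ct)
    have 2: "(\<lambda>k. 2 * R * nrm M (\<lambda>y. snd (jet (\<phi> k) y))) \<longlonglongrightarrow> 2 * R * nrm M (\<lambda>y. snd (w y))"
      by (intro tendsto_mult_left nrm_tendsto l2_snd l ct)
    show ?thesis by (rule LIMSEQ_le[OF 1 2]) (use test[OF \<phi>(1)] in \<open>auto simp: jet_def\<close>)
  qed
  then show ?thesis using that[of "2 * R"] R by auto
qed

text \<open>By Riesz, \<open>f\<close> has a projection \<open>p\<close> onto the closure of the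
  test functions. The difference is orthogonal to every test function, hence zero almost everywhere
  by the lemma of du Bois-Reymond.\<close>

lemma test_dense:
  fixes f :: "real^3 \<Rightarrow> real"
  assumes f: "l2 M f" and e: "e > 0" obtains \<phi> where "test_fun U \<phi>" "nrm M (\<lambda>y. \<phi> y - f y) < e"
proof -
  define H where "H = cl2 M {\<phi>. test_fun U \<phi>}"
  have H: "clsub M H" unfolding H_def
  proof (rule clsub_cl2)
    show "(\<lambda>x. a x + c *\<^sub>R b x) \<in> {\<phi>. test_fun U \<phi>}" if "a \<in> {\<phi>. test_fun U \<phi>}" "b \<in> {\<phi>. test_fun U \<phi>}" for a b and c :: real
      using test_lin that by simp
  qed (auto intro: test_l2 test_zero)
  have "\<exists>p\<in>H. \<forall>q\<in>H. ip M f q = ip M p q"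
  proof (rule riesz[OF fin H])
    show "ip M f (\<lambda>x. a x + c *\<^sub>R b x) = ip M f a + c * ip M f b" if "a \<in> H" "b \<in> H" for a b c
      using ip_add_right[OF clsubD(2)[OF H that(1)] l2_scale[OF clsubD(2)[OF H that(2)]] f] unfolding ip_scale_right .
    show "\<bar>ip M f a\<bar> \<le> nrm M f * nrm M a" if "a \<in> H" for a using ip_CS[OF f clsubD(2)[OF H that]] .
  qed
  then obtain p where p: "p \<in> H" "\<And>q. q \<in> H \<Longrightarrow> ip M f q = ip M p q" by blast
  have lp: "l2 M p" using clsubD(2)[OF H p(1)] .
  have "AE y in M. f y - p y = 0"
  proof (rule zero_ae[OF l2_diff[OF f lp]])
    fix \<phi> assume t: "test_fun U \<phi>"
    then have "\<phi> \<in> H" unfolding H_def by (intro cl2_incl) (auto intro: test_l2)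
    then show "ip M (\<lambda>y. f y - p y) \<phi> = 0" using p(2) ip_diff_left[OF f lp test_l2(1)[OF t]] by simp
  qed
  then have "AE y in M. p y = f y" by eventually_elim simp
  then have "f \<in> H" by (rule clsub_cong_AE[OF H p(1) l2_meas[OF f]])
  then show ?thesis unfolding H_def cl2_def using e that by blast
qed

end

section \<open>Mollification\<close>

lemma test_bdd: assumes t: "test_fun U \<rho>" obtains B where "B \<ge> 0" "\<And>y. \<bar>\<rho> y\<bar> \<le> B"
proof -
  have c: "continuous_on UNIV \<rho>" by (intro smooth3_cont test_funD(1)[OF t])
  have "bounded (\<rho> ` tsupp \<rho>)" by (intro compact_imp_bounded compact_continuous_image continuous_on_subset[OF c] test_funD(2)[OF t]) auto
  then obtain B where B: "\<And>y. y \<in> tsupp \<rho> \<Longrightarrow> norm (\<rho> y) \<le> B" by (auto simp: bounded_iff)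
  have "\<bar>\<rho> y\<bar> \<le> \<bar>B\<bar>" for y using B[of y] tsupp_outside[of y \<rho>] by (cases "y \<in> tsupp \<rho>") auto
  then show ?thesis using that[of "\<bar>B\<bar>"] by simp
qed

text \<open>Compactness gives uniform continuity on the ball of radius \<open>R + 1\<close>. If one
  of two points at distance less than one lies outside it, both lie where \<open>g\<close>
  vanishes.\<close>

lemma supp_uniform:
  fixes g :: "real^3 \<Rightarrow> 'b::real_normed_vector"
  assumes c: "continuous_on UNIV g" and R: "\<And>y. norm y > R \<Longrightarrow> g y = 0" and e: "e > 0"
  obtains d where "d > 0" "\<And>a b. norm (a - b) < d \<Longrightarrow> norm (g a - g b) \<le> e"
proof -
  have "uniformly_continuous_on (cball 0 (R + 1)) g"
    by (intro compact_uniformly_continuous continuous_on_subset[OF c]) auto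
  then obtain d where d: "d > 0" "\<And>a b. a \<in> cball 0 (R + 1) \<Longrightarrow> b \<in> cball 0 (R + 1) \<Longrightarrow> dist b a < d \<Longrightarrow> dist (g b) (g a) < e"
    using e unfolding uniformly_continuous_on_def by blast
  have "norm (g a - g b) \<le> e" if ab: "norm (a - b) < min d 1" for a b
  proof (cases "a \<in> cball 0 (R + 1) \<and> b \<in> cball 0 (R + 1)")
    case True
    then have "dist (g a) (g b) < e" using ab by (intro d(2)) (auto simp: dist_norm)
    then show ?thesis by (simp add: dist_norm)
  next
    case False
    have "norm a \<le> norm b + norm (a - b)" "norm b \<le> norm a + norm (a - b)"
      using norm_triangle_sub[of a b] norm_triangle_sub[of b a] by (simp_all add: norm_minus_commute)
    then have "norm a > R" "norm b > R" using False ab by auto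
    then show ?thesis using R e by simp
  qed
  then show ?thesis using that[of "min d 1"] d(1) by simp
qed

lemma test_radius: assumes t: "test_fun U \<rho>" obtains R where "\<And>y. norm y > R \<Longrightarrow> \<rho> y = 0" "\<And>y i. norm y > R \<Longrightarrow> pd i \<rho> y = 0"
proof -
  obtain R where R: "\<And>y. y \<in> tsupp \<rho> \<Longrightarrow> norm y \<le> R" using compact_imp_bounded[OF test_funD(2)[OF t]] by (auto simp: bounded_iff)
  have "y \<notin> tsupp \<rho>" if "norm y > R" for y using R[of y] that by auto
  then show ?thesis using that[of R] tsupp_outside pd_tsupp by blast
qed

lemma int_prod:
  fixes f :: "'a::euclidean_space \<Rightarrow> real"
  assumes f: "integrable lborel f" and g: "continuous_on UNIV g" "\<And>z. \<bar>g z\<bar> \<le> B"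
  shows "integrable lborel (\<lambda>z. f z * g z)"
proof (rule Bochner_Integration.integrable_bound[where f = "\<lambda>z. B * f z"])
  show "integrable lborel (\<lambda>z. B * f z)" using f by simp
  show "(\<lambda>z. f z * g z) \<in> borel_measurable lborel" by (intro borel_measurable_times borel_measurable_integrable[OF f] cont_meas_leb(3)[OF g(1)])
  have "norm (f z * g z) \<le> norm (B * f z)" for z
  proof -
    have "\<bar>g z\<bar> \<le> \<bar>B\<bar>" using g(2)[of z] by linarith
    then have "\<bar>g z\<bar> * \<bar>f z\<bar> \<le> \<bar>B\<bar> * \<bar>f z\<bar>" by (rule mult_right_mono) simp
    then show ?thesis by (simp add: abs_mult mult.commute)
  qed
  then show "AE z in lborel. norm (f z * g z) \<le> norm (B * f z)" by simp
qed

definition convol :: "(real^3 \<Rightarrow> real) \<Rightarrow> (real^3 \<Rightarrow> real) \<Rightarrow> real^3 \<Rightarrow> real" where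
  "convol f \<rho> y = (LINT z|lborel. f z * \<rho> (y - z))"

lemma cont_refl: "continuous_on UNIV g \<Longrightarrow> continuous_on UNIV (\<lambda>z. g (y - z))" for g :: "real^3 \<Rightarrow> real"
  by (rule continuous_on_compose2[of UNIV g]) (auto intro!: continuous_intros)

lemma convol_int:
  assumes f: "integrable lborel f" and t: "test_fun U \<rho>"
  shows "integrable lborel (\<lambda>z. f z * \<rho> (y - z))"
proof -
  obtain B where B: "\<And>y. \<bar>\<rho> y\<bar> \<le> B" by (rule test_bdd[OF t]) (rule that)
  show ?thesis by (rule int_prod[OF f cont_refl[OF smooth3_cont[OF test_funD(1)[OF t]]] B])
qed

lemma taylor_bound:
  assumes F: "\<And>y. F differentiable (at y)" and w: "\<And>b. norm (b - a) \<le> norm v \<Longrightarrow> norm (grad3 F b - grad3 F a) \<le> e"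
  shows "\<bar>F (a + v) - F a - grad3 F a \<bullet> v\<bar> \<le> e * norm v"
proof -
  have "\<exists>z. 0 < z \<and> z < 1 \<and> F (a + 1 *\<^sub>R v) - F (a + 0 *\<^sub>R v) = (1 - 0) * (grad3 F (a + z *\<^sub>R v) \<bullet> v)"
    by (rule MVT2) (use line_deriv F in auto)
  then obtain z where z: "0 < z" "z < 1" "F (a + v) - F a = grad3 F (a + z *\<^sub>R v) \<bullet> v" by auto
  have "F (a + v) - F a - grad3 F a \<bullet> v = (grad3 F (a + z *\<^sub>R v) - grad3 F a) \<bullet> v" using z(3) by (simp add: inner_diff_left)
  also have "\<bar>\<dots>\<bar> \<le> norm (grad3 F (a + z *\<^sub>R v) - grad3 F a) * norm v" by (rule Cauchy_Schwarz_ineq2)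
  also have "\<dots> \<le> e * norm v" by (intro mult_right_mono w) (use z in \<open>auto simp: mult_left_le_one_le\<close>)
  finally show ?thesis .
qed

lemma grad3_cont: "c1 F \<Longrightarrow> continuous_on UNIV (grad3 F)"
  unfolding grad3_def by (intro continuous_intros continuous_on_vec_lambda c1D)

text \<open>The gradient of \<open>\<rho>\<close> is uniformly continuous, so the first-order
  remainder of \<open>\<rho> (y - z)\<close> is small uniformly in \<open>z\<close> and can be
  integrated against \<open>\<bar>f\<bar>\<close>. Dividing by \<open>I + 1\<close> instead of
  \<open>I\<close> covers the case \<open>I = 0\<close>.\<close>

lemma convol_deriv:
  assumes f: "integrable lborel f" and t: "test_fun U \<rho>"
  shows "(convol f \<rho> has_derivative (\<lambda>v. \<Sum>i\<in>UNIV. convol f (pd i \<rho>) y * v $ i)) (at y)"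
  unfolding has_derivative_at_alt
proof (intro conjI allI impI)
  note c = smooth3_c1[OF test_funD(1)[OF t]]
  show "bounded_linear (\<lambda>v. \<Sum>i\<in>UNIV. convol f (pd i \<rho>) y * v $ i)"
    by (intro bounded_linear_sum bounded_linear_mult_right[THEN bounded_linear_compose] bounded_linear_vec_nth)
  fix e :: real assume e: "e > 0"
  define I where "I = (LINT z|lborel. \<bar>f z\<bar>)"
  have I: "I \<ge> 0" by (simp add: I_def)
  obtain R where R: "\<And>y. norm y > R \<Longrightarrow> \<rho> y = 0" "\<And>y i. norm y > R \<Longrightarrow> pd i \<rho> y = 0" by (rule test_radius[OF t]) (rule that)
  have g0: "grad3 \<rho> y = 0" if "norm y > R" for y using R(2)[OF that] by (simp add: grad3_def vec_eq_iff)
  have eI: "e / (I + 1) > 0" using e I by simp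
  obtain d where d: "d > 0" "\<And>a b. norm (a - b) < d \<Longrightarrow> norm (grad3 \<rho> a - grad3 \<rho> b) \<le> e / (I + 1)"
    by (rule supp_uniform[OF grad3_cont[OF c] g0 eI]) (assumption, rule that)
  show "\<exists>d>0. \<forall>x. norm (x - y) < d \<longrightarrow> norm (convol f \<rho> x - convol f \<rho> y - (\<Sum>i\<in>UNIV. convol f (pd i \<rho>) y * (x - y) $ i)) \<le> e * norm (x - y)"
  proof (intro exI[of _ d] conjI allI impI d(1))
    fix x assume x: "norm (x - y) < d"
    define v where "v = x - y"
    have i1: "integrable lborel (\<lambda>z. f z * \<rho> (u - z))" for u by (rule convol_int[OF f t])
    have i2: "integrable lborel (\<lambda>z. f z * pd i \<rho> (y - z) * v $ i)" for i by (intro integrable_mult_left convol_int[OF f test_pd[OF t]])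
    have s: "(\<Sum>i\<in>UNIV. convol f (pd i \<rho>) y * v $ i) = (LINT z|lborel. (\<Sum>i\<in>UNIV. f z * pd i \<rho> (y - z) * v $ i))"
      unfolding convol_def by (subst Bochner_Integration.integral_sum[OF i2]) simp
    have "convol f \<rho> x - convol f \<rho> y - (\<Sum>i\<in>UNIV. convol f (pd i \<rho>) y * v $ i)
        = (LINT z|lborel. f z * \<rho> (x - z) - f z * \<rho> (y - z) - (\<Sum>i\<in>UNIV. f z * pd i \<rho> (y - z) * v $ i))"
      unfolding s unfolding convol_def
      by (subst Bochner_Integration.integral_diff, intro Bochner_Integration.integrable_diff i1, intro Bochner_Integration.integrable_sum i2)
         (subst Bochner_Integration.integral_diff[OF i1 i1], rule refl)
    also have "norm \<dots> \<le> (LINT z|lborel. (e / (I + 1) * norm v) * \<bar>f z\<bar>)"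
    proof (rule Bochner_Integration.integral_norm_bound_integral)
      show "integrable lborel (\<lambda>z. f z * \<rho> (x - z) - f z * \<rho> (y - z) - (\<Sum>i\<in>UNIV. f z * pd i \<rho> (y - z) * v $ i))"
        by (intro Bochner_Integration.integrable_diff Bochner_Integration.integrable_sum i1 i2)
      show "integrable lborel (\<lambda>z. (e / (I + 1) * norm v) * \<bar>f z\<bar>)" by (intro integrable_mult_right integrable_abs f)
      fix z
      have "(\<Sum>i\<in>UNIV. f z * pd i \<rho> (y - z) * v $ i) = f z * (grad3 \<rho> (y - z) \<bullet> v)"
        by (simp add: grad3_def inner_vec_def sum_distrib_left mult.assoc)
      then have "f z * \<rho> (x - z) - f z * \<rho> (y - z) - (\<Sum>i\<in>UNIV. f z * pd i \<rho> (y - z) * v $ i)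
          = f z * (\<rho> ((y - z) + v) - \<rho> (y - z) - grad3 \<rho> (y - z) \<bullet> v)" by (simp add: v_def algebra_simps)
      moreover have "\<bar>\<rho> ((y - z) + v) - \<rho> (y - z) - grad3 \<rho> (y - z) \<bullet> v\<bar> \<le> e / (I + 1) * norm v"
        by (rule taylor_bound[OF c1D(1)[OF c]]) (use d(2) x in \<open>auto simp: v_def\<close>)
      ultimately show "norm (f z * \<rho> (x - z) - f z * \<rho> (y - z) - (\<Sum>i\<in>UNIV. f z * pd i \<rho> (y - z) * v $ i)) \<le> (e / (I + 1) * norm v) * \<bar>f z\<bar>"
        by (simp only: real_norm_def abs_mult mult.commute[of "\<bar>f z\<bar>"]) (rule mult_right_mono; simp)
    qed
    also have "\<dots> = (e * (I / (I + 1))) * norm v" by (simp add: I_def)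
    also have "\<dots> \<le> (e * 1) * norm v" using I e by (intro mult_right_mono mult_left_mono) auto
    finally show "norm (convol f \<rho> x - convol f \<rho> y - (\<Sum>i\<in>UNIV. convol f (pd i \<rho>) y * (x - y) $ i)) \<le> e * norm (x - y)"
      by (simp add: v_def)
  qed
qed

lemma convol_pd:
  assumes f: "integrable lborel f" and t: "test_fun U \<rho>"
  shows "convol f \<rho> differentiable (at y)" "pd i (convol f \<rho>) = convol f (pd i \<rho>)"
proof -
  show "convol f \<rho> differentiable (at y)" using convol_deriv[OF f t] by (auto simp: differentiable_def)
  have "pd i (convol f \<rho>) y = convol f (pd i \<rho>) y" for y
    by (rule pd_eq[OF convol_deriv[OF f t], THEN trans]) (simp add: axis_def if_distrib cong: if_cong)
  then show "pd i (convol f \<rho>) = convol f (pd i \<rho>)" by (rule ext)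
qed

text \<open>Convolutions of \<open>f\<close> with all test functions form a family closed under
  partial derivatives, because the derivative falls on the kernel.\<close>

lemma convol_smooth:
  assumes f: "integrable lborel f" and t: "test_fun U \<rho>"
  shows "smooth3 (convol f \<rho>)"
proof (rule alg_smooth[of "{convol f \<rho> | \<rho>. test_fun U \<rho>}"])
  show "g differentiable (at y)" if "g \<in> {convol f \<rho> | \<rho>. test_fun U \<rho>}" for g y using that convol_pd(1)[OF f] by auto
  show "pd i g \<in> alg {convol f \<rho> | \<rho>. test_fun U \<rho>}" if g: "g \<in> {convol f \<rho> | \<rho>. test_fun U \<rho>}" for g i
  proof -
    obtain \<rho>' where r: "g = convol f \<rho>'" "test_fun U \<rho>'" using g by auto
    have "convol f (pd i \<rho>') \<in> {convol f \<rho> | \<rho>. test_fun U \<rho>}" using test_pd[OF r(2)] by blast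
    then show ?thesis unfolding r(1) convol_pd(2)[OF f r(2)] by (rule alg_gen)
  qed
  show "convol f \<rho> \<in> alg {convol f \<rho> | \<rho>. test_fun U \<rho>}" by (rule alg_gen) (use t in blast)
qed

section \<open>Mollifiers\<close>

definition mollifier :: "real \<Rightarrow> (real^3 \<Rightarrow> real) \<Rightarrow> bool" where
  "mollifier e \<rho> \<longleftrightarrow> test_fun UNIV \<rho> \<and> (\<forall>z. 0 \<le> \<rho> z) \<and> (\<forall>z. \<rho> z \<noteq> 0 \<longrightarrow> norm z \<le> e) \<and> integral\<^sup>L lborel \<rho> = 1"

lemma test_int: "test_fun U \<rho> \<Longrightarrow> integrable lborel \<rho>"
  by (rule cont_supp_int[OF smooth3_cont[OF test_funD(1)] test_funD(2)]) (auto intro: tsupp_outside)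

text \<open>A nonnegative cutoff that is one near the origin has positive integral, since non-empty
  open sets are not null, and can be normalised.\<close>

lemma mollifier_ex: assumes "e > 0" obtains \<rho> where "mollifier e \<rho>"
proof -
  obtain c V where c: "test_fun (ball 0 e) c" "open V" "{0} \<subseteq> V" "V \<subseteq> ball 0 e" "\<And>y. y \<in> V \<Longrightarrow> c y = 1" "\<And>y. 0 \<le> c y" "\<And>y. c y \<le> 1"
    by (rule cutoff[of "{0::real^3}" "ball 0 e"]) (use assms in auto)
  define J where "J = integral\<^sup>L lborel c"
  have int: "integrable lborel c" by (rule test_int[OF c(1)])
  have "J \<noteq> 0"
  proof
    assume "J = 0"
    then have "AE y in lborel. c y = 0" using integral_nonneg_eq_0_iff_AE[OF int] c(6) by (simp add: J_def)
    then have "AE y in lebesgue. c y = 0" by (rule AE_completion)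
    then have "AE y in lebesgue. y \<notin> V" by eventually_elim (use c(5) in force)
    then have "emeasure lebesgue V = 0" using AE_iff_measurable[OF open_leb[OF c(2)], of "\<lambda>y. y \<notin> V"] by simp
    then have "negligible V" unfolding negligible_iff_null_sets using open_leb[OF c(2)] by auto
    then show False using open_not_negligible[OF c(2)] c(3) by auto
  qed
  moreover have "J \<ge> 0" unfolding J_def by (rule Bochner_Integration.integral_nonneg) (rule c(6))
  ultimately have J: "J > 0" by simp
  have cz: "norm z \<le> e" if "c z \<noteq> 0" for z
    using tsupp_outside[of z c] test_funD(3)[OF c(1)] that by force
  have "mollifier e (\<lambda>z. inverse J * c z)"
    unfolding mollifier_def
  proof (intro conjI allI impI)
    show "test_fun UNIV (\<lambda>z. inverse J * c z)"
      by (rule test_funI[of _ "tsupp c"]) (use c(1) test_funD[OF c(1)] tsupp_outside[of _ c] in \<open>auto intro!: smooth3_scale\<close>)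
    show "0 \<le> inverse J * c z" for z using J c(6) by simp
    show "norm z \<le> e" if "inverse J * c z \<noteq> 0" for z using that cz by auto
    show "integral\<^sup>L lborel (\<lambda>z. inverse J * c z) = 1" using J int by (simp add: J_def)
  qed
  then show ?thesis by (rule that)
qed

lemma lborel_refl: "distr lborel borel (\<lambda>z. y - z) = (lborel :: (real^3) measure)"
proof -
  have "(lborel :: (real^3) measure) = density (distr lborel borel (\<lambda>x. y + (-1) *\<^sub>R x)) (\<lambda>_. ennreal (\<bar>-1\<bar>^DIM(real^3)))"
    using lborel_affine[of "-1::real" y] by simp
  also have "\<dots> = distr lborel borel (\<lambda>x. y - x)" by (simp add: density_1)
  finally show ?thesis ..
qed

lemma int_refl:
  fixes g :: "real^3 \<Rightarrow> real"
  assumes "g \<in> borel_measurable borel"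
  shows "(LINT z|lborel. g (y - z)) = integral\<^sup>L lborel g"
proof -
  have "integral\<^sup>L (distr lborel borel (\<lambda>z. y - z)) g = (LINT z|lborel. g (y - z))"
    by (rule integral_distr) (use assms in auto)
  then show ?thesis by (simp add: lborel_refl)
qed

lemma mollifierD:
  assumes "mollifier e \<rho>"
  shows "test_fun UNIV \<rho>" "0 \<le> \<rho> z" "norm z > e \<Longrightarrow> \<rho> z = 0" "integral\<^sup>L lborel \<rho> = 1" "(LINT z|lborel. \<rho> (y - z)) = 1"
    "continuous_on UNIV \<rho>" "\<rho> \<in> borel_measurable borel"
proof -
  show t: "test_fun UNIV \<rho>" "0 \<le> \<rho> z" "integral\<^sup>L lborel \<rho> = 1" using assms by (auto simp: mollifier_def)
  show "\<rho> z = 0" if "norm z > e" using assms that unfolding mollifier_def by force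
  show c: "continuous_on UNIV \<rho>" by (rule smooth3_cont[OF test_funD(1)[OF t(1)]])
  show m: "\<rho> \<in> borel_measurable borel" using borel_measurable_continuous_onI[OF c] .
  show "(LINT z|lborel. \<rho> (y - z)) = 1" using int_refl[OF m] t(3) by simp
qed

lemma nrm_sq_real: "(nrm M f)\<^sup>2 = (LINT y|M. (f y)\<^sup>2)" for f :: "'a \<Rightarrow> real"
  unfolding nrm_sq ip_real by (simp only: power2_eq_square)

text \<open>Cauchy-Schwarz for the splitting
  \<open>g * \<rho> = (g * sqrt \<rho>) * sqrt \<rho>\<close>; the second factor has norm one
  because the kernel has mass one.\<close>

lemma mollifier_jensen:
  assumes m: "mollifier e \<rho>" and g: "g \<in> borel_measurable borel" and i1: "integrable lborel (\<lambda>z. (g z)\<^sup>2 * \<rho> (y - z))"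
  shows "ennreal ((LINT z|lborel. g z * \<rho> (y - z))\<^sup>2) \<le> (\<integral>\<^sup>+z. ennreal ((g z)\<^sup>2 * \<rho> (y - z)) \<partial>lborel)"
proof -
  note md = mollifierD[OF m]
  let ?r = "\<lambda>z. sqrt (\<rho> (y - z))"
  have [measurable]: "\<rho> \<in> borel_measurable borel" "g \<in> borel_measurable borel" by (rule md g)+
  \<comment> \<open>The integral of a non-integrable function is zero by convention, so mass one
    implies integrability.\<close>
  have i2: "integrable lborel (\<lambda>z. \<rho> (y - z))"
  proof (rule ccontr)
    assume "\<not> ?thesis"
    then have "(LINT z|lborel. \<rho> (y - z)) = 0" by (rule not_integrable_integral_eq)
    then show False using md(5) by simp
  qed
  have e1: "(\<lambda>z. (norm (g z * ?r z))\<^sup>2) = (\<lambda>z. (g z)\<^sup>2 * \<rho> (y - z))"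
    using md(2) by (simp add: power_mult_distrib abs_mult)
  have e2: "(\<lambda>z. (norm (?r z))\<^sup>2) = (\<lambda>z. \<rho> (y - z))" using md(2) by simp
  have l1: "l2 lborel (\<lambda>z. g z * ?r z)" unfolding l2_def e1 using i1 by simp
  have l2': "l2 lborel ?r" unfolding l2_def e2 using i2 by simp
  have n1: "(nrm lborel (\<lambda>z. g z * ?r z))\<^sup>2 = (LINT z|lborel. (g z)\<^sup>2 * \<rho> (y - z))"
    unfolding nrm_sq ip_def by (simp only: e1[symmetric] power2_norm_eq_inner)
  have n2: "(nrm lborel ?r)\<^sup>2 = 1"
    unfolding nrm_sq ip_def using md(2) by (simp add: md(5))
  have "(LINT z|lborel. g z * \<rho> (y - z)) = ip lborel (\<lambda>z. g z * ?r z) ?r" unfolding ip_def using md(2) by (simp add: mult.assoc)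
  then have "\<bar>LINT z|lborel. g z * \<rho> (y - z)\<bar> \<le> nrm lborel (\<lambda>z. g z * ?r z) * nrm lborel ?r" using ip_CS[OF l1 l2'] by simp
  then have "\<bar>LINT z|lborel. g z * \<rho> (y - z)\<bar>\<^sup>2 \<le> (nrm lborel (\<lambda>z. g z * ?r z) * nrm lborel ?r)\<^sup>2" by (rule power_mono) simp
  then have "(LINT z|lborel. g z * \<rho> (y - z))\<^sup>2 \<le> (nrm lborel (\<lambda>z. g z * ?r z) * nrm lborel ?r)\<^sup>2" by simp
  also have "\<dots> = (LINT z|lborel. (g z)\<^sup>2 * \<rho> (y - z))" unfolding power_mult_distrib n1 n2 by simp
  finally have "ennreal ((LINT z|lborel. g z * \<rho> (y - z))\<^sup>2) \<le> ennreal (LINT z|lborel. (g z)\<^sup>2 * \<rho> (y - z))" by (rule ennreal_leI)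
  also have "\<dots> = (\<integral>\<^sup>+z. ennreal ((g z)\<^sup>2 * \<rho> (y - z)) \<partial>lborel)"
    by (rule nn_integral_eq_integral[OF i1, symmetric]) (use md(2) in simp)
  finally show ?thesis .
qed

text \<open>Young's inequality for a kernel of mass one: Jensen pointwise, then Tonelli and
  translation invariance. The bound is the same for every radius.\<close>

lemma convol_l2_le:
  assumes f: "l2 lborel f" "integrable lborel f" and m: "mollifier e \<rho>"
  shows "(\<integral>\<^sup>+y. ennreal ((convol f \<rho> y)\<^sup>2) \<partial>lborel) \<le> ennreal ((nrm lborel f)\<^sup>2)"
proof -
  note md = mollifierD[OF m]
  have fm: "f \<in> borel_measurable borel" using l2_meas[OF f(1)] by simp
  have rm: "\<rho> \<in> borel_measurable borel" by (rule md)
  note [measurable] = fm rm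
  obtain B where B: "\<And>y. \<bar>\<rho> y\<bar> \<le> B" by (rule test_bdd[OF md(1)]) (rule that)
  have f2: "integrable lborel (\<lambda>z. (f z)\<^sup>2)" using f(1) by (simp add: l2_def)
  have pt: "ennreal ((convol f \<rho> y)\<^sup>2) \<le> (\<integral>\<^sup>+z. ennreal ((f z)\<^sup>2 * \<rho> (y - z)) \<partial>lborel)" for y
    unfolding convol_def by (rule mollifier_jensen[OF m fm int_prod[OF f2 cont_refl[OF md(6)] B]])
  have "(\<integral>\<^sup>+y. ennreal ((convol f \<rho> y)\<^sup>2) \<partial>lborel) \<le> (\<integral>\<^sup>+y. (\<integral>\<^sup>+z. ennreal ((f z)\<^sup>2 * \<rho> (y - z)) \<partial>lborel) \<partial>lborel)"
    by (rule nn_integral_mono) (rule pt)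
  also have "\<dots> = (\<integral>\<^sup>+z. (\<integral>\<^sup>+y. ennreal ((f z)\<^sup>2 * \<rho> (y - z)) \<partial>lborel) \<partial>lborel)"
    by (rule lborel_pair.Fubini') measurable
  also have "\<dots> = (\<integral>\<^sup>+z. ennreal ((f z)\<^sup>2) \<partial>lborel)"
  proof (rule nn_integral_cong)
    fix z
    have "(\<integral>\<^sup>+y. ennreal ((f z)\<^sup>2 * \<rho> (y - z)) \<partial>lborel) = ennreal ((f z)\<^sup>2) * (\<integral>\<^sup>+y. ennreal (\<rho> (y - z)) \<partial>lborel)"
      by (subst nn_integral_cmult[symmetric]) (auto simp: ennreal_mult md(2))
    also have "(\<integral>\<^sup>+y. ennreal (\<rho> (y - z)) \<partial>lborel) = (\<integral>\<^sup>+y. ennreal (\<rho> y) \<partial>(distr lborel borel ((+) (- z))))"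
      by (subst nn_integral_distr) auto
    also have "\<dots> = (\<integral>\<^sup>+y. ennreal (\<rho> y) \<partial>lborel)" by (simp add: lborel_distr_plus)
    also have "\<dots> = 1" using nn_integral_eq_integral[OF test_int[OF md(1)]] md(2,4) by simp
    finally show "(\<integral>\<^sup>+y. ennreal ((f z)\<^sup>2 * \<rho> (y - z)) \<partial>lborel) = ennreal ((f z)\<^sup>2)" by simp
  qed
  also have "\<dots> = ennreal ((nrm lborel f)\<^sup>2)"
    using nn_integral_eq_integral[OF f2] by (simp add: nrm_sq_real)
  finally show ?thesis .
qed

lemma int_on_iff:
  fixes h :: "'a::euclidean_space \<Rightarrow> real"
  assumes "U \<in> sets lebesgue" "h \<in> borel_measurable lborel" "\<And>y. y \<notin> U \<Longrightarrow> h y = 0"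
  shows "integrable (lebesgue_on U) h \<longleftrightarrow> integrable lborel h"
proof -
  have "integrable (lebesgue_on U) h \<longleftrightarrow> integrable lebesgue (\<lambda>x. indicator U x *\<^sub>R h x)"
    by (rule integrable_restrict_space) (use assms in auto)
  also have "(\<lambda>x. indicator U x *\<^sub>R h x) = h"
  proof
    fix x show "indicator U x *\<^sub>R h x = h x" using assms(3)[of x] by (cases "x \<in> U") simp_all
  qed
  also have "integrable lebesgue h \<longleftrightarrow> integrable lborel h" by (rule integrable_completion[OF assms(2)])
  finally show ?thesis .
qed

lemma int_on_iff_l2:
  fixes h :: "'a::euclidean_space \<Rightarrow> real"
  assumes "U \<in> sets lebesgue" "h \<in> borel_measurable lborel" "\<And>y. y \<notin> U \<Longrightarrow> h y = 0"
  shows "l2 (lebesgue_on U) h \<longleftrightarrow> l2 lborel h" "nrm (lebesgue_on U) h = nrm lborel h"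
proof -
  have "h \<in> borel_measurable (lebesgue_on U)"
    by (rule measurable_restrict_space1[OF measurable_completion[OF assms(2)]])
  moreover have "integrable (lebesgue_on U) (\<lambda>x. (norm (h x))\<^sup>2) \<longleftrightarrow> integrable lborel (\<lambda>x. (norm (h x))\<^sup>2)"
    by (rule int_on_iff[OF assms(1)]) (use assms(2,3) in auto)
  ultimately show "l2 (lebesgue_on U) h \<longleftrightarrow> l2 lborel h" unfolding l2_def using assms(2) by simp
  have "integral\<^sup>L (lebesgue_on U) (\<lambda>x. h x * h x) = integral\<^sup>L lborel (\<lambda>x. h x * h x)"
    by (rule int_on_eq[OF assms(1)]) (use assms(2,3) in auto)
  then show "nrm (lebesgue_on U) h = nrm lborel h" unfolding nrm_def ip_real by simp
qed

lemma smooth3_refl: assumes "smooth3 \<rho>" shows "smooth3 (\<lambda>z. \<rho> (y - z))" "pd i (\<lambda>z. \<rho> (y - z)) z = - pd i \<rho> (y - z)"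
proof -
  have d: "((\<lambda>z. g (y - z)) has_derivative (\<lambda>v. frechet_derivative g (at (y - z)) (- v))) (at z)" if "smooth3 g" for g z
  proof -
    have "((\<lambda>z. y - z) has_derivative (\<lambda>v. - v)) (at z)" by (auto intro!: derivative_eq_intros)
    from has_derivative_compose[OF this diff_works[OF smooth3_diff[OF that]]] show ?thesis .
  qed
  have p: "pd i (\<lambda>z. g (y - z)) z = - pd i g (y - z)" if "smooth3 g" for g i z
  proof -
    interpret bounded_linear "frechet_derivative g (at (y - z))" by (rule has_derivative_bounded_linear[OF diff_works[OF smooth3_diff[OF that]]])
    show ?thesis using pd_eq[OF d[OF that]] by (simp add: pd_def neg)
  qed
  show "pd i (\<lambda>z. \<rho> (y - z)) z = - pd i \<rho> (y - z)" by (rule p[OF assms])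
  show "smooth3 (\<lambda>z. \<rho> (y - z))"
  proof (rule alg_smooth[of "{\<lambda>z. g (y - z) | g. smooth3 g}"])
    show "f differentiable (at z)" if "f \<in> {\<lambda>z. g (y - z) | g. smooth3 g}" for f z
      using that d unfolding differentiable_def by blast
    show "pd i f \<in> alg {\<lambda>z. g (y - z) | g. smooth3 g}" if f: "f \<in> {\<lambda>z. g (y - z) | g. smooth3 g}" for f i
    proof -
      obtain g where g: "f = (\<lambda>z. g (y - z))" "smooth3 g" using f by blast
      have e: "pd i f = (\<lambda>z. (-1) * pd i g (y - z))" unfolding g(1) by (rule ext) (simp add: p[OF g(2)])
      have "(\<lambda>z. pd i g (y - z)) \<in> {\<lambda>z. g (y - z) | g. smooth3 g}" using smooth3_pd[OF g(2)] by blast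
      then show ?thesis unfolding e by (rule alg_mult[OF alg_const alg_gen])
    qed
    show "(\<lambda>z. \<rho> (y - z)) \<in> alg {\<lambda>z. g (y - z) | g. smooth3 g}" by (rule alg_gen) (use assms in blast)
  qed
qed

section \<open>Approximation of compactly supported Sobolev functions\<close>

context bdom begin

text \<open>Convolution and Tonelli call for Borel functions on the whole space, whereas members of
  \<open>l2 M\<close> are Lebesgue measurable on \<open>U\<close>. A Borel version for the
  completion, cut off by the indicator of \<open>K\<close>, differs only on a null set.\<close>

lemma borel_representative:
  fixes f :: "real^3 \<Rightarrow> real"
  assumes f: "l2 M f" and K: "compact K" "K \<subseteq> U" and z: "AE y in M. y \<notin> K \<longrightarrow> f y = 0"
  obtains f' where "f' \<in> borel_measurable borel" "\<And>y. y \<notin> K \<Longrightarrow> f' y = 0" "AE y in M. f y = f' y" "l2 lborel f'" "integrable lborel f'"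
proof -
  have "(\<lambda>y. indicator U y *\<^sub>R f y) \<in> borel_measurable lebesgue"
    using l2_meas[OF f] by (subst (asm) borel_measurable_restrict_space_iff) (use leb in auto)
  then obtain g where g: "g \<in> borel_measurable lborel" "AE y in lborel. indicator U y *\<^sub>R f y = g y"
    using completion_ex_borel_measurable_real by blast
  define f' where "f' y = indicator K y * g y" for y
  have Kb: "K \<in> sets borel" using borel_compact[OF K(1)] .
  have m: "f' \<in> borel_measurable borel" unfolding f'_def using g(1) Kb by simp
  have f0: "f' y = 0" if "y \<notin> K" for y using that by (simp add: f'_def)
  have f0': "f' y = 0" if "y \<notin> U" for y using that K f0 by blast
  have "AE y in lebesgue. indicator U y *\<^sub>R f y = g y" using g(2) by (rule AE_completion)
  then have "AE y in lebesgue. y \<in> U \<longrightarrow> f y = g y" by eventually_elim auto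
  then have "AE y in M. f y = g y" by (simp add: AE_on[OF leb])
  with z have ae: "AE y in M. f y = f' y" by eventually_elim (auto simp: f'_def indicator_def)
  have m': "f' \<in> borel_measurable lborel" using m by simp
  have "f' \<in> borel_measurable M" by (rule measurable_restrict_space1[OF measurable_completion[OF m']])
  then have "l2 M f'" by (rule l2_cong_AE[OF f _ ae])
  then have l: "l2 lborel f'" "integrable lborel f'"
    using int_on_iff_l2(1)[OF leb m' f0'] int_on_iff[OF leb m' f0'] l2_integrable[OF fin] by auto
  show ?thesis by (rule that[OF m f0 ae l])
qed

lemma ip_borel_representative:
  assumes f: "l2 M f" "AE y in M. f y = f' y" "f' \<in> borel_measurable borel" "\<And>y. y \<notin> U \<Longrightarrow> f' y = 0" "l2 lborel f'"
    and g: "continuous_on UNIV g"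
  shows "ip M f g = (LINT y|lborel. f' y * g y)"
proof -
  have m': "f' \<in> borel_measurable lborel" using f(3) by simp
  have l: "l2 M f'" using int_on_iff_l2(1)[OF leb m' f(4)] f(5) by simp
  have "ip M f g = ip M f' g" by (rule ip_cong_AE[OF f(1) l]) (use f(2) cont_l2[OF g bd leb] in auto)
  also have "\<dots> = (LINT y|lborel. f' y * g y)" unfolding ip_real
    by (rule int_on_eq[OF leb]) (use m' cont_meas_leb(3)[OF g] f(4) in auto)
  finally show ?thesis .
qed

lemma convol_bound:
  assumes f: "l2 lborel f" "integrable lborel f" and m: "mollifier e \<rho>"
  shows "nrm M (convol f \<rho>) \<le> nrm lborel f"
proof (rule power2_le_imp_le)
  have c: "continuous_on UNIV (convol f \<rho>)" by (rule smooth3_cont[OF convol_smooth[OF f(2) mollifierD(1)[OF m]]])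
  have l: "l2 M (convol f \<rho>)" by (rule cont_l2[OF c bd leb])
  have i: "integrable M (\<lambda>y. (convol f \<rho> y)\<^sup>2)" using l by (simp add: l2_def)
  have "ennreal ((nrm M (convol f \<rho>))\<^sup>2) = (\<integral>\<^sup>+y. ennreal ((convol f \<rho> y)\<^sup>2) \<partial>M)"
    using nn_integral_eq_integral[OF i] by (simp add: nrm_sq_real)
  also have "\<dots> = (\<integral>\<^sup>+y. ennreal ((convol f \<rho> y)\<^sup>2) * indicator U y \<partial>lebesgue)"
    by (rule nn_integral_restrict_space) (use leb in auto)
  also have "\<dots> \<le> (\<integral>\<^sup>+y. ennreal ((convol f \<rho> y)\<^sup>2) \<partial>lebesgue)"
    by (rule nn_integral_mono) (simp add: indicator_def)
  also have "\<dots> = (\<integral>\<^sup>+y. ennreal ((convol f \<rho> y)\<^sup>2) \<partial>lborel)" by (rule nn_integral_completion)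
  also have "\<dots> \<le> ennreal ((nrm lborel f)\<^sup>2)" by (rule convol_l2_le[OF f m])
  finally show "(nrm M (convol f \<rho>))\<^sup>2 \<le> (nrm lborel f)\<^sup>2" by simp
qed simp

text \<open>Replace \<open>f\<close> by a nearby test function: contraction handles the difference,
  uniform continuity the test function itself. The threshold refers to the radius and not to the
  kernel, so that one kernel can serve several functions.\<close>

lemma mollifier_conv:
  assumes f: "f \<in> borel_measurable borel" "\<And>y. y \<notin> U \<Longrightarrow> f y = 0" "l2 lborel f" "integrable lborel f" and \<eta>: "\<eta> > 0"
  shows "\<exists>\<delta>>0. \<forall>e \<rho>. e \<le> \<delta> \<longrightarrow> mollifier e \<rho> \<longrightarrow> nrm M (\<lambda>y. convol f \<rho> y - f y) < \<eta>"
proof -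
  have m': "f \<in> borel_measurable lborel" using f(1) by simp
  have lf: "l2 M f" using int_on_iff_l2(1)[OF leb m' f(2)] f(3) by simp
  have e3: "\<eta> / 3 > 0" using \<eta> by simp
  obtain \<psi> where \<psi>: "test_fun U \<psi>" "nrm M (\<lambda>y. \<psi> y - f y) < \<eta> / 3" by (rule test_dense[OF lf e3]) (rule that)
  define mU where "mU = nrm M (\<lambda>_. 1::real)"
  have mU: "mU \<ge> 0" by (simp add: mU_def)
  \<comment> \<open>A uniform error \<open>e'\<close> costs \<open>e' * mU\<close> in
    \<open>L2\<close>, where \<open>mU\<close> is the norm of the constant one; this stays below a
    third of \<open>\<eta>\<close>.\<close>
  define e' where "e' = \<eta> / (3 * (mU + 1))"
  have e': "e' > 0" using \<eta> mU by (simp add: e'_def)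
  have pc: "continuous_on UNIV \<psi>" by (rule smooth3_cont[OF test_funD(1)[OF \<psi>(1)]])
  obtain R where R: "\<And>y. norm y > R \<Longrightarrow> \<psi> y = 0" by (rule test_radius[OF \<psi>(1)]) (rule that)
  obtain d where d: "d > 0" "\<And>a b. norm (a - b) < d \<Longrightarrow> norm (\<psi> a - \<psi> b) \<le> e'"
    by (rule supp_uniform[OF pc R e']) (assumption, rule that)
  have ip: "integrable lborel \<psi>" by (rule test_int[OF \<psi>(1)])
  have one: "l2 M (\<lambda>_. 1::real)" by (rule cont_l2[OF _ bd leb]) simp
  have "nrm M (\<lambda>y. convol f \<rho> y - f y) < \<eta>" if e: "e \<le> d / 2" and m: "mollifier e \<rho>" for e \<rho>
  proof -
    note md = mollifierD[OF m]
    obtain B where B: "\<And>y. \<bar>\<rho> y\<bar> \<le> B" by (rule test_bdd[OF md(1)]) (rule that)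
    have lc: "l2 M (convol f \<rho>)" "l2 M (convol \<psi> \<rho>)" "l2 M \<psi>"
      using cont_l2[OF smooth3_cont[OF convol_smooth[OF f(4) md(1)]] bd leb]
        cont_l2[OF smooth3_cont[OF convol_smooth[OF ip md(1)]] bd leb] cont_l2[OF pc bd leb] by simp_all
    define g where "g = (\<lambda>y. \<psi> y - f y)"
    have gm: "g \<in> borel_measurable lborel" unfolding g_def using m' cont_meas_leb(3)[OF pc] by simp
    have g0: "g y = 0" if "y \<notin> U" for y
      using f(2)[OF that] tsupp_outside[of y \<psi>] test_funD(3)[OF \<psi>(1)] that by (auto simp: g_def)
    have "l2 M g" unfolding g_def by (intro l2_diff lc lf)
    then have lg': "l2 lborel g" "nrm lborel g = nrm M g" using int_on_iff_l2[OF leb gm g0] by auto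
    have ig: "integrable lborel g" unfolding g_def by (intro Bochner_Integration.integrable_diff ip f(4))
    have 1: "nrm M (\<lambda>y. convol f \<rho> y - convol \<psi> \<rho> y) < \<eta> / 3"
    proof -
      have cg: "convol g \<rho> y = convol \<psi> \<rho> y - convol f \<rho> y" for y
        unfolding convol_def g_def left_diff_distrib
        by (rule Bochner_Integration.integral_diff[OF convol_int[OF ip md(1)] convol_int[OF f(4) md(1)]])
      have "convol g \<rho> = (\<lambda>y. convol \<psi> \<rho> y - convol f \<rho> y)" by (rule ext) (rule cg)
      then have "nrm M (\<lambda>y. convol f \<rho> y - convol \<psi> \<rho> y) = nrm M (convol g \<rho>)"
        using nrm_diff_comm[of M "convol f \<rho>" "convol \<psi> \<rho>"] by simp
      also have "\<dots> \<le> nrm M g" using convol_bound[OF lg'(1) ig m] lg'(2) by simp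
      also have "\<dots> < \<eta> / 3" using \<psi>(2) by (simp add: g_def)
      finally show ?thesis .
    qed
    have 2: "nrm M (\<lambda>y. convol \<psi> \<rho> y - \<psi> y) < \<eta> / 3"
    proof -
      have pt: "\<bar>convol \<psi> \<rho> y - \<psi> y\<bar> \<le> e'" for y
      proof -
        have ir: "integrable lborel (\<lambda>z. \<rho> (y - z))"
        proof (rule ccontr)
          assume "\<not> ?thesis"
          then have "(LINT z|lborel. \<rho> (y - z)) = 0" by (rule not_integrable_integral_eq)
          then show False using md(5) by simp
        qed
        have "convol \<psi> \<rho> y - \<psi> y = (LINT z|lborel. \<psi> z * \<rho> (y - z)) - (LINT z|lborel. \<psi> y * \<rho> (y - z))"
          unfolding convol_def by (simp add: md(5))
        also have "\<dots> = (LINT z|lborel. \<psi> z * \<rho> (y - z) - \<psi> y * \<rho> (y - z))"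
          by (rule Bochner_Integration.integral_diff[symmetric, OF convol_int[OF ip md(1)]]) (simp add: ir)
        also have "norm \<dots> \<le> (LINT z|lborel. e' * \<rho> (y - z))"
        proof (rule Bochner_Integration.integral_norm_bound_integral)
          show "integrable lborel (\<lambda>z. \<psi> z * \<rho> (y - z) - \<psi> y * \<rho> (y - z))"
            by (intro Bochner_Integration.integrable_diff convol_int[OF ip md(1)] integrable_mult_right ir)
          show "integrable lborel (\<lambda>z. e' * \<rho> (y - z))" by (intro integrable_mult_right ir)
          fix z
          show "norm (\<psi> z * \<rho> (y - z) - \<psi> y * \<rho> (y - z)) \<le> e' * \<rho> (y - z)"
          proof (cases "norm (y - z) > e")
            case True then show ?thesis using md(3) by simp
          next
            case False
            then have "norm (z - y) < d" using e d(1) by (simp add: norm_minus_commute)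
            then have "\<bar>\<psi> z - \<psi> y\<bar> \<le> e'" using d(2) by simp
            then have "\<bar>\<psi> z - \<psi> y\<bar> * \<rho> (y - z) \<le> e' * \<rho> (y - z)" by (rule mult_right_mono) (rule md(2))
            moreover have "norm (\<psi> z * \<rho> (y - z) - \<psi> y * \<rho> (y - z)) = \<bar>\<psi> z - \<psi> y\<bar> * \<rho> (y - z)"
              using md(2)[of "y - z"] by (simp add: left_diff_distrib[symmetric] abs_mult)
            ultimately show ?thesis by simp
          qed
        qed
        also have "\<dots> = e'" by (simp add: md(5))
        finally show ?thesis by simp
      qed
      have "nrm M (\<lambda>y. convol \<psi> \<rho> y - \<psi> y) \<le> nrm M (\<lambda>y. e' *\<^sub>R (1::real))"
        by (rule nrm_bounded_by[OF l2_scale[OF one] l2_diff[OF lc(2,3)]]) (use pt e' in simp)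
      also have "\<dots> = e' * mU" unfolding nrm_scale mU_def using e' by simp
      also have "\<dots> = (\<eta> / 3) * (mU / (mU + 1))" by (simp add: e'_def)
      also have "\<dots> < (\<eta> / 3) * 1" using \<eta> mU by (intro mult_strict_left_mono) auto
      finally show ?thesis by simp
    qed
    have "nrm M (\<lambda>y. convol f \<rho> y - f y) \<le> nrm M (\<lambda>y. convol f \<rho> y - convol \<psi> \<rho> y) + nrm M (\<lambda>y. convol \<psi> \<rho> y - f y)"
      by (intro nrm_tri lc lf)
    moreover have "nrm M (\<lambda>y. convol \<psi> \<rho> y - f y) \<le> nrm M (\<lambda>y. convol \<psi> \<rho> y - \<psi> y) + nrm M (\<lambda>y. \<psi> y - f y)"
      by (intro nrm_tri lc lf)
    ultimately show ?thesis using 1 2 \<psi>(2) by linarith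
  qed
  \<comment> \<open>Half of \<open>d\<close>, because the kernel lives on a closed ball of radius
    \<open>e\<close> while \<open>d\<close> controls distances strictly below it.\<close>
  then show ?thesis using d(1) by (intro exI[of _ "d / 2"]) auto
qed

text \<open>Test functions supported in \<open>U - K\<close> meet only zero values of the first
  component, so the lemma of du Bois-Reymond applies on \<open>U - K\<close>.\<close>

lemma h1_snd_zero_off:
  assumes w: "w \<in> h1 U" and K: "compact K" "K \<subseteq> U" and z: "AE y in M. y \<notin> K \<longrightarrow> fst (w y) = 0"
  shows "AE y in M. y \<notin> K \<longrightarrow> snd (w y) $ i = 0"
proof -
  note lw = h1_l2[OF w]
  have o: "open (U - K)" using op compact_imp_closed[OF K(1)] by (rule open_Diff)
  have li: "loc_int U (\<lambda>y. snd (w y) $ i)" by (rule l2_loc_int[OF bd leb l2_nth[OF l2_snd[OF lw]]])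
  have "AE y in lebesgue. y \<in> U - K \<longrightarrow> snd (w y) $ i = 0"
  proof (rule du_bois_reymond[OF o])
    show "loc_int (U - K) (\<lambda>y. snd (w y) $ i)" using li unfolding loc_int_def by blast
    fix \<phi> assume t: "test_fun (U - K) \<phi>"
    then have tU: "test_fun U \<phi>" unfolding test_fun_def by blast
    have off: "\<phi> y = 0" "pd i \<phi> y = 0" if "y \<notin> U - K" for y using test_funD(3)[OF t] that tsupp_outside[of y \<phi>] pd_tsupp[of y \<phi> i] by auto
    have "(\<lambda>y. indicator (U - K) y *\<^sub>R (snd (w y) $ i * \<phi> y)) = (\<lambda>y. indicator U y *\<^sub>R (snd (w y) $ i * \<phi> y))"
      using off(1) by (auto simp: fun_eq_iff indicator_def)
    then have "(LINT y:U - K|lebesgue. snd (w y) $ i * \<phi> y) = ip M (\<lambda>y. snd (w y) $ i) \<phi>"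
      unfolding ip_real LINT_on[OF leb, symmetric] set_lebesgue_integral_def by simp
    also have "\<dots> = - ip M (\<lambda>y. fst (w y)) (pd i \<phi>)" using h1_ibp[OF w tU, of i] by simp
    also have "ip M (\<lambda>y. fst (w y)) (pd i \<phi>) = 0"
    proof -
      have "AE y in M. fst (w y) * pd i \<phi> y = 0" using z by eventually_elim (use off(2) in auto)
      then show ?thesis unfolding ip_real by (rule integral_eq_zero_AE)
    qed
    finally show "(LINT y:U - K|lebesgue. snd (w y) $ i * \<phi> y) = 0" by simp
  qed
  then have "AE y in lebesgue. y \<in> U \<longrightarrow> (y \<notin> K \<longrightarrow> snd (w y) $ i = 0)" by eventually_elim blast
  then show ?thesis by (simp add: AE_on[OF leb])
qed

text \<open>One kernel mollifies value and gradient; the weak derivative, tested with the reflected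
  kernel, shows that mollification commutes with differentiation. A small radius keeps the support
  inside \<open>U\<close>. The lemma makes boundary values comparable: functions in
  \<open>H1\<close> that agree off a compact subset of \<open>U\<close> differ by an element of
  \<open>h10\<close>.\<close>

lemma compact_h10:
  assumes w: "w \<in> h1 U" and K: "compact K" "K \<subseteq> U" and z: "AE y in M. y \<notin> K \<longrightarrow> fst (w y) = 0"
  shows "w \<in> h10 U"
proof -
  note lw = h1_l2[OF w]
  let ?u = "\<lambda>y. fst (w y)" and ?D = "\<lambda>i y. snd (w y) $ i"
  obtain u' where u': "u' \<in> borel_measurable borel" "\<And>y. y \<notin> K \<Longrightarrow> u' y = 0" "AE y in M. ?u y = u' y" "l2 lborel u'" "integrable lborel u'"
    by (rule borel_representative[OF l2_fst[OF lw] K z]) (rule that)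
  have "\<exists>D'. D' \<in> borel_measurable borel \<and> (\<forall>y. y \<notin> K \<longrightarrow> D' y = 0) \<and> (AE y in M. ?D i y = D' y) \<and> l2 lborel D' \<and> integrable lborel D'" for i
  proof -
    obtain D' where "D' \<in> borel_measurable borel" "\<And>y. y \<notin> K \<Longrightarrow> D' y = 0" "AE y in M. ?D i y = D' y" "l2 lborel D'" "integrable lborel D'"
      by (rule borel_representative[OF l2_nth[OF l2_snd[OF lw]] K h1_snd_zero_off[OF w K z]]) (rule that)
    then show ?thesis by blast
  qed
  then have "\<forall>i. \<exists>D'. D' \<in> borel_measurable borel \<and> (\<forall>y. y \<notin> K \<longrightarrow> D' y = 0) \<and> (AE y in M. ?D i y = D' y) \<and> l2 lborel D' \<and> integrable lborel D'" ..
  from choice[OF this] obtain D' where DD: "\<forall>i. D' i \<in> borel_measurable borel \<and> (\<forall>y. y \<notin> K \<longrightarrow> D' i y = 0) \<and> (AE y in M. ?D i y = D' i y) \<and> l2 lborel (D' i) \<and> integrable lborel (D' i)" ..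
  have D': "D' i \<in> borel_measurable borel" "y \<notin> K \<Longrightarrow> D' i y = 0" "AE y in M. ?D i y = D' i y"
     "l2 lborel (D' i)" "integrable lborel (D' i)" for i y using spec[OF DD, of i] by auto
  have u0: "u' y = 0" if "y \<notin> U" for y using that K u'(2) by blast
  have D0: "D' i y = 0" if "y \<notin> U" for i y using that K D'(2) by blast
  obtain c V where c: "test_fun U c" "open V" "K \<subseteq> V" "V \<subseteq> U" "\<And>y. y \<in> V \<Longrightarrow> c y = 1"
    by (rule cutoff[OF K(1) op K(2)]) (rule that)
  \<comment> \<open>The reflected kernel need not have its support in \<open>U\<close>. The factor
    \<open>c\<close>, which is one near \<open>K\<close>, turns it into a test function without
    changing the integrals.\<close>
  have grad: "convol u' (pd i \<rho>) y = convol (D' i) \<rho> y" if m: "mollifier e \<rho>" for e \<rho> i y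
  proof -
    note s = test_funD(1)[OF mollifierD(1)[OF m]]
    let ?p = "\<lambda>z. c z * \<rho> (y - z)"
    have t: "test_fun U ?p" by (rule test_mult[OF c(1) smooth3_refl(1)[OF s]])
    have p: "pd i ?p z = - pd i \<rho> (y - z)" if "z \<in> K" for z
    proof -
      have "pd i ?p z = pd i (\<lambda>z. \<rho> (y - z)) z"
        by (rule pd_local[OF c(2)]) (use c(3,5) that in auto)
      then show ?thesis using smooth3_refl(2)[OF s] by simp
    qed
    have "ip M ?u (pd i ?p) = (LINT z|lborel. u' z * pd i ?p z)"
      by (rule ip_borel_representative[OF l2_fst[OF lw] u'(3,1) u0 u'(4)]) (assumption, intro smooth3_cont smooth3_pd test_funD(1)[OF t])
    also have "\<dots> = (LINT z|lborel. - (u' z * pd i \<rho> (y - z)))"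
    proof (rule Bochner_Integration.integral_cong)
      fix z show "u' z * pd i ?p z = - (u' z * pd i \<rho> (y - z))"
        using p[of z] u'(2)[of z] by (cases "z \<in> K") simp_all
    qed simp
    also have "\<dots> = - convol u' (pd i \<rho>) y" by (simp add: convol_def)
    finally have 1: "ip M ?u (pd i ?p) = - convol u' (pd i \<rho>) y" .
    have "ip M (?D i) ?p = (LINT z|lborel. D' i z * ?p z)"
      by (rule ip_borel_representative[OF l2_nth[OF l2_snd[OF lw]] D'(3,1) D0 D'(4)]) (assumption, intro smooth3_cont test_funD(1)[OF t])
    also have "\<dots> = convol (D' i) \<rho> y" unfolding convol_def
    proof (rule Bochner_Integration.integral_cong)
      fix z show "D' i z * ?p z = D' i z * \<rho> (y - z)"
      proof (cases "z \<in> K")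
        case True
        then have "c z = 1" using c(3,5) by blast
        then show ?thesis by simp
      qed (simp add: D'(2))
    qed simp
    finally have 2: "ip M (?D i) ?p = convol (D' i) \<rho> y" .
    show ?thesis using h1_ibp[OF w t, of i] 1 2 by simp
  qed
  obtain d0 where d0: "d0 > 0" "(\<Union>p\<in>K. cball p d0) \<subseteq> U"
    by (rule compact_subset_open_imp_cball_epsilon_subset[OF K(1) op K(2)]) (rule that)
  have close: "\<exists>s\<in>jet ` {\<phi>. test_fun U \<phi>}. nrm M (\<lambda>y. s y - w y) < \<eta>" if \<eta>: "\<eta> > 0" for \<eta>
  proof -
    \<comment> \<open>Fifths: one for the value and three for the partial derivatives leave a
      margin.\<close>
    have e5: "\<eta> / 5 > 0" using \<eta> by simp
    obtain d1 where d1: "d1 > 0" "\<And>e \<rho>. e \<le> d1 \<Longrightarrow> mollifier e \<rho> \<Longrightarrow> nrm M (\<lambda>y. convol u' \<rho> y - u' y) < \<eta> / 5"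
      using mollifier_conv[OF u'(1) u0 u'(4,5) e5] by blast
    have "\<exists>d2>0. \<forall>e \<rho>. e \<le> d2 \<longrightarrow> mollifier e \<rho> \<longrightarrow> nrm M (\<lambda>y. convol (D' i) \<rho> y - D' i y) < \<eta> / 5" for i
      by (rule mollifier_conv[OF D'(1) D0 D'(4,5) e5])
    then have "\<forall>i. \<exists>d2>0. \<forall>e \<rho>. e \<le> d2 \<longrightarrow> mollifier e \<rho> \<longrightarrow> nrm M (\<lambda>y. convol (D' i) \<rho> y - D' i y) < \<eta> / 5" ..
    from choice[OF this] obtain d2 where dd2: "\<forall>i. d2 i > 0 \<and> (\<forall>e \<rho>. e \<le> d2 i \<longrightarrow> mollifier e \<rho> \<longrightarrow> nrm M (\<lambda>y. convol (D' i) \<rho> y - D' i y) < \<eta> / 5)" ..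
    have d2: "d2 i > 0" "e \<le> d2 i \<Longrightarrow> mollifier e \<rho> \<Longrightarrow> nrm M (\<lambda>y. convol (D' i) \<rho> y - D' i y) < \<eta> / 5" for i e \<rho>
      using spec[OF dd2, of i] by auto
    \<comment> \<open>\<open>d0\<close> keeps the support in \<open>U\<close>, \<open>d1\<close>
      controls the value and \<open>d2 i\<close> the partial derivatives.\<close>
    define e where "e = min d0 (min d1 (Min (range d2)))"
    have e: "e > 0" "e \<le> d0" "e \<le> d1" "\<And>i. e \<le> d2 i"
    proof -
      have "Min (range d2) > 0" using d2(1) by (subst Min_gr_iff) auto
      then show "e > 0" using d0 d1 by (simp add: e_def)
      have "Min (range d2) \<le> d2 i" for i by (rule Min_le) auto
      then show "e \<le> d2 i" for i unfolding e_def by (meson min.coboundedI2)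
    qed (simp_all add: e_def)
    obtain \<rho> where m: "mollifier e \<rho>" by (rule mollifier_ex[OF e(1)]) (rule that)
    define \<phi> where "\<phi> = convol u' \<rho>"
    have t: "test_fun U \<phi>"
    proof (rule test_funI)
      show "smooth3 \<phi>" unfolding \<phi>_def by (rule convol_smooth[OF u'(5) mollifierD(1)[OF m]])
      show "compact {a + b | a b. a \<in> K \<and> b \<in> cball 0 e}" by (intro compact_sums K compact_cball)
      show "{a + b | a b. a \<in> K \<and> b \<in> cball 0 e} \<subseteq> U"
      proof clarify
        fix a b :: "real^3" assume "a \<in> K" "b \<in> cball 0 e"
        then have "a + b \<in> cball a d0" using e(2) by (simp add: dist_norm)
        then show "a + b \<in> U" using \<open>a \<in> K\<close> d0(2) by blast
      qed
      fix y assume y: "\<phi> y \<noteq> 0"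
      have "\<exists>z. u' z * \<rho> (y - z) \<noteq> 0"
      proof (rule ccontr)
        assume "\<not> ?thesis"
        then have "(\<lambda>z. u' z * \<rho> (y - z)) = (\<lambda>z. 0)" by blast
        then have "convol u' \<rho> y = 0" unfolding convol_def by (simp only: Bochner_Integration.integral_zero)
        then show False using y by (simp add: \<phi>_def)
      qed
      then obtain z where z: "u' z * \<rho> (y - z) \<noteq> 0" by blast
      then have "z \<in> K" using u'(2) by fastforce
      moreover have "norm (y - z) \<le> e" using z mollifierD(3)[OF m, of "y - z"] by force
      ultimately show "y \<in> {a + b | a b. a \<in> K \<and> b \<in> cball 0 e}"
        by (intro CollectI exI[of _ z] exI[of _ "y - z"]) auto
    qed
    have pd\<phi>: "pd i \<phi> = convol (D' i) \<rho>" for i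
      unfolding \<phi>_def convol_pd(2)[OF u'(5) mollifierD(1)[OF m]] by (rule ext) (rule grad[OF m])
    have lt: "l2 M (jet \<phi>)" by (rule test_l2(3)[OF t])
    have ld: "l2 M (\<lambda>y. jet \<phi> y - w y)" by (intro l2_diff lt lw)
    have lu': "l2 M u'" using int_on_iff_l2(1)[OF leb, of u'] u'(1,4) u0 by simp
    have lD': "l2 M (D' i)" for i using int_on_iff_l2(1)[OF leb, of "D' i"] D'(1,4) D0 by simp
    have n1: "nrm M (\<lambda>y. fst (jet \<phi> y - w y)) < \<eta> / 5"
    proof -
      have "nrm M (\<lambda>y. fst (jet \<phi> y - w y)) = nrm M (\<lambda>y. convol u' \<rho> y - u' y)"
        by (rule nrm_cong_AE[OF l2_fst[OF ld] l2_diff[OF test_l2(1)[OF t, unfolded \<phi>_def] lu']])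
           (use u'(3) in \<open>auto simp: jet_def \<phi>_def elim!: eventually_mono\<close>)
      then show ?thesis using d1(2)[OF e(3) m] by simp
    qed
    have n2: "nrm M (\<lambda>y. snd (jet \<phi> y - w y) $ i) < \<eta> / 5" for i
    proof -
      have "nrm M (\<lambda>y. snd (jet \<phi> y - w y) $ i) = nrm M (\<lambda>y. convol (D' i) \<rho> y - D' i y)"
        by (rule nrm_cong_AE[OF l2_nth[OF l2_snd[OF ld]] l2_diff[OF test_l2(2)[OF t, of i, unfolded pd\<phi>] lD']])
           (use D'(3)[of i] in \<open>auto simp: jet_def grad3_def pd\<phi> elim!: eventually_mono\<close>)
      then show ?thesis using d2(2)[OF e(4) m] by simp
    qed
    have n3: "nrm M (\<lambda>y. snd (jet \<phi> y - w y)) \<le> (\<Sum>i\<in>UNIV. nrm M (\<lambda>y. snd (jet \<phi> y - w y) $ i))"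
    proof -
      let ?a = "\<lambda>i. nrm M (\<lambda>y. snd (jet \<phi> y - w y) $ i)"
      have "nrm M (\<lambda>y. snd (jet \<phi> y - w y)) = sqrt (\<Sum>i\<in>UNIV. (?a i)\<^sup>2)"
        unfolding nrm_def[of M "\<lambda>y. snd (jet \<phi> y - w y)"] ip_vec[OF l2_snd[OF ld] l2_snd[OF ld]] nrm_sq ..
      also have "\<dots> = L2_set ?a UNIV" by (simp add: L2_set_def)
      also have "\<dots> \<le> (\<Sum>i\<in>UNIV. ?a i)" by (rule L2_set_le_sum) simp
      finally show ?thesis .
    qed
    have "(\<Sum>i\<in>UNIV. nrm M (\<lambda>y. snd (jet \<phi> y - w y) $ i)) \<le> (\<Sum>i\<in>(UNIV::3 set). \<eta> / 5)"
      by (rule sum_mono) (use n2 in \<open>simp add: less_imp_le\<close>)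
    then have "nrm M (\<lambda>y. snd (jet \<phi> y - w y)) \<le> 3 * (\<eta> / 5)" using n3 by simp
    then have "nrm M (\<lambda>y. jet \<phi> y - w y) < \<eta>" using nrm_pair_le[OF ld] n1 \<eta> by simp
    then show ?thesis using t by blast
  qed
  show ?thesis unfolding h10_def cl2_def using lw close by blast
qed

end

section \<open>The Rellich compactness theorem\<close>

text \<open>The fundamental theorem of calculus along the segment from \<open>y\<close> to
  \<open>y + h\<close>, followed by Cauchy-Schwarz against the indicator of the unit interval, whose
  norm is one.\<close>

lemma increment_sq_le:
  assumes c: "c1 F"
  shows "ennreal ((F (y + h) - F y)\<^sup>2) \<le> (\<integral>\<^sup>+t. ennreal ((norm h)\<^sup>2 * (norm (grad3 F (y + t *\<^sub>R h)))\<^sup>2 * indicator {0..1::real} t) \<partial>lborel)"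
proof -
  let ?p = "\<lambda>t. grad3 F (y + t *\<^sub>R h) \<bullet> h" and ?I = "indicator {0..1::real} :: real \<Rightarrow> real"
  have cg: "continuous_on UNIV (\<lambda>t. grad3 F (y + t *\<^sub>R h))"
    by (rule continuous_on_compose2[OF grad3_cont[OF c]]) (auto intro!: continuous_intros)
  have cp: "continuous_on UNIV ?p" by (intro continuous_intros cg)
  have comp: "integrable lborel (\<lambda>t. q t * ?I t)" if "continuous_on UNIV q" for q :: "real \<Rightarrow> real"
    using borel_integrable_compact[of "{0..1::real}" q] continuous_on_subset[OF that] by (simp add: mult.commute)
  have sqI: "(norm (q * ?I t))\<^sup>2 = q\<^sup>2 * ?I t" for q t by (simp add: indicator_def)
  have lq: "l2 lborel (\<lambda>t. q t * ?I t)" if "continuous_on UNIV q" for q :: "real \<Rightarrow> real"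
    unfolding l2_def sqI by (intro conjI comp continuous_intros that borel_measurable_integrable)
  have "(LINT t|lborel. ?p t * ?I t) = F (y + 1 *\<^sub>R h) - F (y + 0 *\<^sub>R h)"
  proof (rule integral_FTC_Icc_real)
    show "((\<lambda>t. F (y + t *\<^sub>R h)) has_real_derivative ?p t) (at t)" for t by (rule line_deriv) (rule c1D[OF c])
    show "isCont ?p t" for t using cp by (simp add: continuous_on_eq_continuous_at)
  qed simp
  moreover have "(\<lambda>t. (?p t * ?I t) * (1 * ?I t)) = (\<lambda>t. ?p t * ?I t)" by (auto simp: fun_eq_iff indicator_def)
  ultimately have "F (y + h) - F y = ip lborel (\<lambda>t. ?p t * ?I t) (\<lambda>t. 1 * ?I t)"
    unfolding ip_real by (simp only: scaleR_one scaleR_zero_left add_0_right)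
  then have "\<bar>F (y + h) - F y\<bar> \<le> nrm lborel (\<lambda>t. ?p t * ?I t) * nrm lborel (\<lambda>t. 1 * ?I t)"
    using ip_CS[OF lq[OF cp] lq[of "\<lambda>_. 1"]] by simp
  also have "nrm lborel (\<lambda>t. 1 * ?I t) = 1"
  proof -
    have "(nrm lborel (\<lambda>t. 1 * ?I t))\<^sup>2 = (LINT t|lborel. ?I t)" unfolding nrm_sq_real
      by (rule Bochner_Integration.integral_cong) (auto simp: indicator_def)
    then have "(nrm lborel (\<lambda>t. 1 * ?I t))\<^sup>2 = 1\<^sup>2" by simp
    then show ?thesis by (rule power2_eq_imp_eq) simp_all
  qed
  finally have "\<bar>F (y + h) - F y\<bar>\<^sup>2 \<le> (nrm lborel (\<lambda>t. ?p t * ?I t))\<^sup>2" by (intro power_mono) simp_all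
  then have "(F (y + h) - F y)\<^sup>2 \<le> (LINT t|lborel. (?p t)\<^sup>2 * ?I t)"
    unfolding nrm_sq_real using sqI by simp
  also have "\<dots> \<le> (LINT t|lborel. ((norm h)\<^sup>2 * (norm (grad3 F (y + t *\<^sub>R h)))\<^sup>2) * ?I t)"
  proof (rule integral_mono)
    fix t
    have "\<bar>?p t\<bar>\<^sup>2 \<le> (norm (grad3 F (y + t *\<^sub>R h)) * norm h)\<^sup>2" by (intro power_mono Cauchy_Schwarz_ineq2) simp
    then have "(?p t)\<^sup>2 \<le> (norm h)\<^sup>2 * (norm (grad3 F (y + t *\<^sub>R h)))\<^sup>2" by (simp add: power_mult_distrib mult.commute)
    then show "(?p t)\<^sup>2 * ?I t \<le> ((norm h)\<^sup>2 * (norm (grad3 F (y + t *\<^sub>R h)))\<^sup>2) * ?I t" by (rule mult_right_mono) simp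
  qed (intro comp continuous_intros cg cp)+
  finally have "ennreal ((F (y + h) - F y)\<^sup>2) \<le> ennreal (LINT t|lborel. ((norm h)\<^sup>2 * (norm (grad3 F (y + t *\<^sub>R h)))\<^sup>2) * ?I t)"
    by (rule ennreal_leI)
  also have "\<dots> = (\<integral>\<^sup>+t. ennreal (((norm h)\<^sup>2 * (norm (grad3 F (y + t *\<^sub>R h)))\<^sup>2) * ?I t) \<partial>lborel)"
    by (rule nn_integral_eq_integral[symmetric], intro comp continuous_intros cg) simp
  finally show ?thesis .
qed

text \<open>Tonelli exchanges the integral along the segment with the one over space; for each
  \<open>t\<close> the shift by \<open>t *\<^sub>R h\<close> then disappears by translation
  invariance.\<close>

lemma translation_estimate:
  assumes c: "c1 F"
  shows "(\<integral>\<^sup>+y. ennreal ((F (y + h) - F y)\<^sup>2) \<partial>lborel) \<le> ennreal ((norm h)\<^sup>2) * (\<integral>\<^sup>+y. ennreal ((norm (grad3 F y))\<^sup>2) \<partial>lborel)"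
proof -
  have [measurable]: "grad3 F \<in> borel_measurable borel" by (rule borel_measurable_continuous_onI[OF grad3_cont[OF c]])
  let ?G = "\<integral>\<^sup>+y. ennreal ((norm (grad3 F y))\<^sup>2) \<partial>lborel"
  have "(\<integral>\<^sup>+y. ennreal ((F (y + h) - F y)\<^sup>2) \<partial>lborel)
      \<le> (\<integral>\<^sup>+y. (\<integral>\<^sup>+t. ennreal ((norm h)\<^sup>2 * (norm (grad3 F (y + t *\<^sub>R h)))\<^sup>2 * indicator {0..1::real} t) \<partial>lborel) \<partial>lborel)"
    by (rule nn_integral_mono) (rule increment_sq_le[OF c])
  also have "\<dots> = (\<integral>\<^sup>+t. (\<integral>\<^sup>+y. ennreal ((norm h)\<^sup>2 * (norm (grad3 F (y + t *\<^sub>R h)))\<^sup>2 * indicator {0..1::real} t) \<partial>lborel) \<partial>lborel)"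
    by (rule lborel_pair.Fubini') measurable
  also have "\<dots> = (\<integral>\<^sup>+t. (ennreal ((norm h)\<^sup>2) * ?G) * indicator {0..1::real} t \<partial>lborel)"
  proof (rule nn_integral_cong)
    fix t :: real
    have "(\<integral>\<^sup>+y. ennreal ((norm h)\<^sup>2 * (norm (grad3 F (y + t *\<^sub>R h)))\<^sup>2 * indicator {0..1::real} t) \<partial>lborel)
        = (\<integral>\<^sup>+y. (ennreal ((norm h)\<^sup>2) * indicator {0..1::real} t) * ennreal ((norm (grad3 F (y + t *\<^sub>R h)))\<^sup>2) \<partial>lborel)"
      by (rule nn_integral_cong) (auto simp: ennreal_mult indicator_def)
    also have "\<dots> = (ennreal ((norm h)\<^sup>2) * indicator {0..1::real} t) * (\<integral>\<^sup>+y. ennreal ((norm (grad3 F (y + t *\<^sub>R h)))\<^sup>2) \<partial>lborel)"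
      by (rule nn_integral_cmult) measurable
    also have "(\<integral>\<^sup>+y. ennreal ((norm (grad3 F (y + t *\<^sub>R h)))\<^sup>2) \<partial>lborel) = (\<integral>\<^sup>+y. ennreal ((norm (grad3 F y))\<^sup>2) \<partial>(distr lborel borel ((+) (t *\<^sub>R h))))"
      by (subst nn_integral_distr) (auto simp: add.commute)
    also have "\<dots> = ?G" by (simp add: lborel_distr_plus)
    finally show "(\<integral>\<^sup>+y. ennreal ((norm h)\<^sup>2 * (norm (grad3 F (y + t *\<^sub>R h)))\<^sup>2 * indicator {0..1::real} t) \<partial>lborel) = (ennreal ((norm h)\<^sup>2) * ?G) * indicator {0..1::real} t"
      by (simp add: ac_simps)
  qed
  also have "\<dots> = ennreal ((norm h)\<^sup>2) * ?G" by (subst nn_integral_cmult_indicator) auto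
  finally show ?thesis .
qed

text \<open>Jensen bounds the error by an average of squared increments with
  \<open>norm h \<le> e\<close>, to which the translation estimate applies. The rate depends on the
  gradient norm alone; this uniformity is the source of compactness.\<close>

lemma mollifier_est:
  assumes t: "test_fun U \<phi>" and m: "mollifier e \<rho>" and e: "e \<ge> 0"
  shows "(\<integral>\<^sup>+y. ennreal ((convol \<phi> \<rho> y - \<phi> y)\<^sup>2) \<partial>lborel) \<le> ennreal (e\<^sup>2) * (\<integral>\<^sup>+y. ennreal ((norm (grad3 \<phi> y))\<^sup>2) \<partial>lborel)"
proof -
  note md = mollifierD[OF m] and c = smooth3_c1[OF test_funD(1)[OF t]]
  have pc: "continuous_on UNIV \<phi>" by (rule c1D(3)[OF c])
  let ?G = "\<integral>\<^sup>+y. ennreal ((norm (grad3 \<phi> y))\<^sup>2) \<partial>lborel"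
  have [measurable]: "\<rho> \<in> borel_measurable borel" "\<phi> \<in> borel_measurable borel"
    by (rule md, rule borel_measurable_continuous_onI[OF pc])
  have ip: "integrable lborel \<phi>" by (rule test_int[OF t])
  obtain B where B: "\<And>y. \<bar>\<phi> y\<bar> \<le> B" by (rule test_bdd[OF t]) (rule that)
  have ir: "integrable lborel (\<lambda>z. \<rho> (y - z))" for y
  proof (rule ccontr)
    assume "\<not> ?thesis"
    then have "(LINT z|lborel. \<rho> (y - z)) = 0" by (rule not_integrable_integral_eq)
    then show False using md(5) by simp
  qed
  have pt: "ennreal ((convol \<phi> \<rho> y - \<phi> y)\<^sup>2) \<le> (\<integral>\<^sup>+h. ennreal ((\<phi> (y + h) - \<phi> y)\<^sup>2 * \<rho> (- h)) \<partial>lborel)" for y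
  proof -
    have i1: "integrable lborel (\<lambda>z. \<rho> (y - z) * (\<phi> z - \<phi> y)\<^sup>2)"
    proof (rule int_prod[OF ir])
      show "continuous_on UNIV (\<lambda>z. (\<phi> z - \<phi> y)\<^sup>2)" by (intro continuous_intros pc)
      fix z
      have "\<bar>\<phi> z - \<phi> y\<bar> \<le> 2 * B" using B[of z] B[of y] by linarith
      then have "\<bar>\<phi> z - \<phi> y\<bar>\<^sup>2 \<le> (2 * B)\<^sup>2" by (intro power_mono) simp_all
      then show "\<bar>(\<phi> z - \<phi> y)\<^sup>2\<bar> \<le> (2 * B)\<^sup>2" by simp
    qed
    have "convol \<phi> \<rho> y - \<phi> y = (LINT z|lborel. \<phi> z * \<rho> (y - z)) - (LINT z|lborel. \<phi> y * \<rho> (y - z))"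
      unfolding convol_def by (simp add: md(5))
    also have "\<dots> = (LINT z|lborel. (\<phi> z - \<phi> y) * \<rho> (y - z))" unfolding left_diff_distrib
      by (rule Bochner_Integration.integral_diff[symmetric, OF convol_int[OF ip md(1)]]) (simp add: ir)
    finally have "ennreal ((convol \<phi> \<rho> y - \<phi> y)\<^sup>2) \<le> (\<integral>\<^sup>+z. ennreal ((\<phi> z - \<phi> y)\<^sup>2 * \<rho> (y - z)) \<partial>lborel)"
      using mollifier_jensen[OF m, of "\<lambda>z. \<phi> z - \<phi> y" y] i1 by (simp add: mult.commute)
    also have "\<dots> = (\<integral>\<^sup>+z. ennreal ((\<phi> z - \<phi> y)\<^sup>2 * \<rho> (y - z)) \<partial>(distr lborel borel ((+) y)))" by (simp add: lborel_distr_plus)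
    also have "\<dots> = (\<integral>\<^sup>+h. ennreal ((\<phi> (y + h) - \<phi> y)\<^sup>2 * \<rho> (- h)) \<partial>lborel)"
      by (subst nn_integral_distr) auto
    finally show ?thesis .
  qed
  have "(\<integral>\<^sup>+y. ennreal ((convol \<phi> \<rho> y - \<phi> y)\<^sup>2) \<partial>lborel) \<le> (\<integral>\<^sup>+y. (\<integral>\<^sup>+h. ennreal ((\<phi> (y + h) - \<phi> y)\<^sup>2 * \<rho> (- h)) \<partial>lborel) \<partial>lborel)"
    by (rule nn_integral_mono) (rule pt)
  also have "\<dots> = (\<integral>\<^sup>+h. (\<integral>\<^sup>+y. ennreal ((\<phi> (y + h) - \<phi> y)\<^sup>2 * \<rho> (- h)) \<partial>lborel) \<partial>lborel)"
    by (rule lborel_pair.Fubini') measurable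
  also have "\<dots> \<le> (\<integral>\<^sup>+h. (ennreal (e\<^sup>2) * ?G) * ennreal (\<rho> (- h)) \<partial>lborel)"
  proof (rule nn_integral_mono)
    fix h
    have "(\<integral>\<^sup>+y. ennreal ((\<phi> (y + h) - \<phi> y)\<^sup>2 * \<rho> (- h)) \<partial>lborel) = (\<integral>\<^sup>+y. ennreal ((\<phi> (y + h) - \<phi> y)\<^sup>2) \<partial>lborel) * ennreal (\<rho> (- h))"
      by (subst nn_integral_multc[symmetric]) (auto simp: ennreal_mult md(2))
    also have "\<dots> \<le> (ennreal (e\<^sup>2) * ?G) * ennreal (\<rho> (- h))"
    proof (cases "norm h > e")
      case True
      then have "\<rho> (- h) = 0" by (intro md(3)) simp
      then show ?thesis by simp
    next
      case False
      have "(\<integral>\<^sup>+y. ennreal ((\<phi> (y + h) - \<phi> y)\<^sup>2) \<partial>lborel) \<le> ennreal ((norm h)\<^sup>2) * ?G" by (rule translation_estimate[OF c])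
      also have "\<dots> \<le> ennreal (e\<^sup>2) * ?G" using False by (intro mult_right_mono ennreal_leI power_mono) auto
      finally show ?thesis by (rule mult_right_mono) simp
    qed
    finally show "(\<integral>\<^sup>+y. ennreal ((\<phi> (y + h) - \<phi> y)\<^sup>2 * \<rho> (- h)) \<partial>lborel) \<le> (ennreal (e\<^sup>2) * ?G) * ennreal (\<rho> (- h))" .
  qed
  also have "\<dots> = (ennreal (e\<^sup>2) * ?G) * (\<integral>\<^sup>+h. ennreal (\<rho> (- h)) \<partial>lborel)"
    by (rule nn_integral_cmult) measurable
  also have "(\<integral>\<^sup>+h. ennreal (\<rho> (- h)) \<partial>lborel) = 1"
    using nn_integral_eq_integral[OF ir[of 0]] md(2) md(5)[of 0] by simp
  finally show ?thesis by simp
qed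

context bdom begin

lemma nn_M_le:
  fixes f :: "real^3 \<Rightarrow> real"
  assumes "continuous_on UNIV f" "(\<integral>\<^sup>+y. ennreal ((f y)\<^sup>2) \<partial>lborel) \<le> ennreal (C\<^sup>2)" "C \<ge> 0"
  shows "nrm M f \<le> C"
proof (rule power2_le_imp_le)
  have l: "l2 M f" by (rule cont_l2[OF assms(1) bd leb])
  have i: "integrable M (\<lambda>y. (f y)\<^sup>2)" using l by (simp add: l2_def)
  have "ennreal ((nrm M f)\<^sup>2) = (\<integral>\<^sup>+y. ennreal ((f y)\<^sup>2) \<partial>M)"
    using nn_integral_eq_integral[OF i] by (simp add: nrm_sq_real)
  also have "\<dots> = (\<integral>\<^sup>+y. ennreal ((f y)\<^sup>2) * indicator U y \<partial>lebesgue)"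
    by (rule nn_integral_restrict_space) (use leb in auto)
  also have "\<dots> \<le> (\<integral>\<^sup>+y. ennreal ((f y)\<^sup>2) \<partial>lebesgue)"
    by (rule nn_integral_mono) (simp add: indicator_def)
  also have "\<dots> = (\<integral>\<^sup>+y. ennreal ((f y)\<^sup>2) \<partial>lborel)" by (rule nn_integral_completion)
  also have "\<dots> \<le> ennreal (C\<^sup>2)" by (rule assms)
  finally show "(nrm M f)\<^sup>2 \<le> C\<^sup>2" by simp
qed (rule assms)

lemma mollifier_est_M:
  assumes t: "test_fun U \<phi>" and m: "mollifier e \<rho>" and e: "e \<ge> 0"
  shows "nrm M (\<lambda>y. convol \<phi> \<rho> y - \<phi> y) \<le> e * nrm M (grad3 \<phi>)"
proof (rule nn_M_le)
  note c = test_c1[OF t]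
  have gc: "continuous_on UNIV (\<lambda>y. (norm (grad3 \<phi> y))\<^sup>2)" by (intro continuous_intros grad3_cont[OF c])
  show "continuous_on UNIV (\<lambda>y. convol \<phi> \<rho> y - \<phi> y)"
    by (intro continuous_intros smooth3_cont convol_smooth[OF test_int[OF t] mollifierD(1)[OF m]] c1D(3)[OF c])
  have g0: "(norm (grad3 \<phi> y))\<^sup>2 = 0" if "y \<notin> tsupp \<phi>" for y
    using pd_tsupp[OF that] by (simp add: grad3_def vec_eq_iff)
  have gi: "integrable lborel (\<lambda>y. (norm (grad3 \<phi> y))\<^sup>2)" by (rule cont_supp_int[OF gc test_funD(2)[OF t] g0])
  have "(\<integral>\<^sup>+y. ennreal ((norm (grad3 \<phi> y))\<^sup>2) \<partial>lborel) = ennreal (integral\<^sup>L lborel (\<lambda>y. (norm (grad3 \<phi> y))\<^sup>2))"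
    by (rule nn_integral_eq_integral[OF gi]) simp
  also have "integral\<^sup>L lborel (\<lambda>y. (norm (grad3 \<phi> y))\<^sup>2) = integral\<^sup>L M (\<lambda>y. (norm (grad3 \<phi> y))\<^sup>2)"
    by (rule int_on_eq[OF leb cont_meas_leb(3)[OF gc], symmetric]) (use g0 test_funD(3)[OF t] in blast)
  also have "\<dots> = (nrm M (grad3 \<phi>))\<^sup>2" unfolding nrm_sq ip_def by (simp add: power2_norm_eq_inner)
  finally show "(\<integral>\<^sup>+y. ennreal ((convol \<phi> \<rho> y - \<phi> y)\<^sup>2) \<partial>lborel) \<le> ennreal ((e * nrm M (grad3 \<phi>))\<^sup>2)"
    using mollifier_est[OF t m e] by (simp add: power_mult_distrib ennreal_mult)
qed (use e in simp)

end

text \<open>The diagonal argument as compactness: the product of the intervals is compact by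
  Tychonoff, and sequentially compact because it has countably many factors.\<close>

lemma pointwise_subseq:
  fixes x :: "nat \<Rightarrow> nat \<Rightarrow> real"
  assumes "\<And>n p. \<bar>x n p\<bar> \<le> C p"
  obtains r where "strict_mono r" "\<And>p. convergent (\<lambda>n. x (r n) p)"
proof -
  define S where "S = (PiE UNIV (\<lambda>p. {- C p .. C p}) :: (nat \<Rightarrow> real) set)"
  have "compactin (product_topology (\<lambda>i. euclidean) UNIV) S"
    unfolding S_def compactin_PiE by auto
  then have "compact S" by (simp add: euclidean_product_topology)
  then have sc: "seq_compact S" by (rule compact_imp_seq_compact)
  have xS: "\<forall>n. x n \<in> S" unfolding S_def using assms by (auto simp: abs_le_iff minus_le_iff)
  obtain l r where lr: "strict_mono r" "(x \<circ> r) \<longlonglongrightarrow> l" by (rule seq_compactE[OF sc xS]) (rule that)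
  have "(\<lambda>n. x (r n) p) \<longlonglongrightarrow> l p" for p
    using continuous_on_tendsto_compose[OF continuous_on_product_coordinates[of p] lr(2)] by simp
  then show ?thesis using that[OF lr(1)] convergentI by blast
qed

context bdom begin

lemma one_l2: "l2 M (\<lambda>_. c)" by (rule cont_l2[OF _ bd leb]) simp

lemma sup_nrm:
  fixes f :: "real^3 \<Rightarrow> real"
  assumes "l2 M f" "\<And>y. \<bar>f y\<bar> \<le> c" "c \<ge> 0" shows "nrm M f \<le> c * nrm M (\<lambda>_. 1::real)"
proof -
  have "nrm M f \<le> nrm M (\<lambda>y. c *\<^sub>R (1::real))"
    by (rule nrm_bounded_by[OF l2_scale[OF one_l2] assms(1)]) (use assms in simp)
  then show ?thesis unfolding nrm_scale using assms(3) by simp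
qed

lemma convol_ip: 
  assumes t: "test_fun U \<phi>" and c: "continuous_on UNIV \<rho>"
  shows "convol \<phi> \<rho> y = ip M \<phi> (\<lambda>z. \<rho> (y - z))"
proof -
  have m: "(\<lambda>z. \<phi> z * \<rho> (y - z)) \<in> borel_measurable lborel"
    by (intro borel_measurable_times cont_meas_leb(3) cont_refl c smooth3_cont test_funD(1)[OF t])
  have "integral\<^sup>L M (\<lambda>z. \<phi> z * \<rho> (y - z)) = (LINT z|lborel. \<phi> z * \<rho> (y - z))"
    by (rule int_on_eq[OF leb m]) (use test_funD(3)[OF t] tsupp_outside[of _ \<phi>] in auto)
  then show ?thesis by (simp add: convol_def ip_real)
qed

text \<open>For a fixed kernel the mollified sequence is bounded and equicontinuous, so convergence
  at countably many dense points spreads to all points, and dominated convergence gives it in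
  \<open>L2\<close>. The mollified functions are close to the original ones uniformly in
  \<open>n\<close>.\<close>

lemma rellich_test:
  assumes t: "\<And>n::nat. test_fun U (\<phi> n)" and B: "\<And>n. nrm M (jet (\<phi> n)) \<le> B"
  obtains r :: "nat \<Rightarrow> nat" where "strict_mono r" "\<And>e. e > 0 \<Longrightarrow> \<exists>N. \<forall>i\<ge>N. \<forall>j\<ge>N. nrm M (\<lambda>y. \<phi> (r i) y - \<phi> (r j) y) < e"
proof -
  define mU where "mU = nrm M (\<lambda>_. 1::real)"
  have mU: "mU \<ge> 0" by (simp add: mU_def)
  have B0: "B \<ge> 0" using B[of 0] nrm_nonneg[of M "jet (\<phi> 0)"] by linarith
  have lt: "l2 M (\<phi> n)" for n by (rule test_l2(1)[OF t])
  have B1: "nrm M (\<phi> n) \<le> B" for n using nrm_fst[OF test_l2(3)[OF t]] B[of n] by (simp add: jet_def) (meson order_trans)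
  have B2: "nrm M (grad3 (\<phi> n)) \<le> B" for n using nrm_snd[OF test_l2(3)[OF t]] B[of n] by (simp add: jet_def) (meson order_trans)
  have "\<forall>k. \<exists>\<rho>. mollifier (1 / (real k + 1)) \<rho>"
  proof
    fix k :: nat
    obtain \<rho> where "mollifier (1 / (real k + 1)) \<rho>" by (rule mollifier_ex[of "1 / (real k + 1)"]) (simp, rule that)
    then show "\<exists>\<rho>. mollifier (1 / (real k + 1)) \<rho>" by blast
  qed
  from choice[OF this] obtain \<rho> where "\<forall>k. mollifier (1 / (real k + 1)) (\<rho> k)" ..
  then have \<rho>: "mollifier (1 / (real k + 1)) (\<rho> k)" for k by blast
  note md = mollifierD[OF \<rho>]
  have "\<forall>k. \<exists>b\<ge>0. \<forall>y. \<bar>\<rho> k y\<bar> \<le> b"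
  proof
    fix k
    obtain b where "b \<ge> 0" "\<And>y. \<bar>\<rho> k y\<bar> \<le> b" by (rule test_bdd[OF md(1)]) (rule that)
    then show "\<exists>b\<ge>0. \<forall>y. \<bar>\<rho> k y\<bar> \<le> b" by blast
  qed
  from choice[OF this] obtain b where "\<forall>k. b k \<ge> 0 \<and> (\<forall>y. \<bar>\<rho> k y\<bar> \<le> b k)" ..
  then have b: "b k \<ge> 0" "\<bar>\<rho> k y\<bar> \<le> b k" for k y by auto
  have lr: "l2 M (\<lambda>z. \<rho> k (y - z))" for k y by (rule cont_l2[OF cont_refl[OF md(6)] bd leb])
  define C where "C k = B * (b k * mU)" for k
  have C: "\<bar>convol (\<phi> n) (\<rho> k) y\<bar> \<le> C k" for n k y
  proof -
    have "\<bar>convol (\<phi> n) (\<rho> k) y\<bar> \<le> nrm M (\<phi> n) * nrm M (\<lambda>z. \<rho> k (y - z))"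
      unfolding convol_ip[OF t md(6)] by (rule ip_CS[OF lt lr])
    also have "\<dots> \<le> B * (b k * mU)" unfolding mU_def
      by (intro mult_mono B1 sup_nrm lr b B0) simp
    finally show ?thesis by (simp add: C_def)
  qed
  obtain D :: "(real^3) set" where D: "countable D" "\<And>X. open X \<Longrightarrow> X \<noteq> {} \<Longrightarrow> \<exists>d\<in>D. d \<in> X"
    by (rule countable_dense_setE) (rule that)
  have Dne: "D \<noteq> {}" using D(2)[of UNIV] by auto
  define d where "d = from_nat_into D"
  \<comment> \<open>\<open>p\<close> codes a pair of a kernel index and an index of a dense point,
    so a single extraction serves all of them.\<close>
  define x where "x n p = convol (\<phi> n) (\<rho> (fst (prod_decode p))) (d (snd (prod_decode p)))" for n p
  obtain r where r: "strict_mono r" "\<And>p. convergent (\<lambda>n. x (r n) p)"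
    by (rule pointwise_subseq[of x "\<lambda>p. C (fst (prod_decode p))"]) (simp add: x_def C, rule that)
  have conv1: "convergent (\<lambda>n. convol (\<phi> (r n)) (\<rho> k) (d i))" for k i
    using r(2)[of "prod_encode (k, i)"] by (simp add: x_def)
  have conv: "convergent (\<lambda>n. convol (\<phi> (r n)) (\<rho> k) y)" for k y
  proof -
    have "Cauchy (\<lambda>n. convol (\<phi> (r n)) (\<rho> k) y)"
    proof (rule metric_CauchyI)
      fix \<eta> :: real assume \<eta>: "\<eta> > 0"
      define \<omega> where "\<omega> = \<eta> / (3 * (B * mU + 1))"
      have BU: "B * mU \<ge> 0" using B0 mU by simp
      have \<omega>: "\<omega> > 0" using \<eta> BU by (simp add: \<omega>_def)
      obtain R where R: "\<And>y. norm y > R \<Longrightarrow> \<rho> k y = 0" by (rule test_radius[OF md(1)]) (rule that)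
      obtain \<delta> where \<delta>: "\<delta> > 0" "\<And>a b. norm (a - b) < \<delta> \<Longrightarrow> norm (\<rho> k a - \<rho> k b) \<le> \<omega>"
        by (rule supp_uniform[OF md(6) R \<omega>]) (assumption, rule that)
      obtain p where p: "p \<in> D" "p \<in> ball y \<delta>" using D(2)[of "ball y \<delta>"] \<delta>(1) by auto
      obtain i where i: "d i = p" using from_nat_into_surj[OF D(1) p(1)] by (auto simp: d_def)
      \<comment> \<open>Equicontinuity: the estimate is the same for every \<open>n\<close>, since
        \<open>\<phi> n\<close> enters only through its norm bound \<open>B\<close>.\<close>
      have near: "\<bar>convol (\<phi> n) (\<rho> k) y - convol (\<phi> n) (\<rho> k) p\<bar> < \<eta> / 3" for n
      proof -
        have l: "l2 M (\<lambda>z. \<rho> k (y - z) - \<rho> k (p - z))" by (intro l2_diff lr)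
        have pt: "\<bar>\<rho> k (y - z) - \<rho> k (p - z)\<bar> \<le> \<omega>" for z using \<delta>(2)[of "y - z" "p - z"] p(2) by (simp add: dist_norm)
        have "convol (\<phi> n) (\<rho> k) y - convol (\<phi> n) (\<rho> k) p = ip M (\<phi> n) (\<lambda>z. \<rho> k (y - z) - \<rho> k (p - z))"
          unfolding convol_ip[OF t md(6)] ip_diff_right[OF lr lr lt] ..
        then have "\<bar>convol (\<phi> n) (\<rho> k) y - convol (\<phi> n) (\<rho> k) p\<bar> \<le> nrm M (\<phi> n) * nrm M (\<lambda>z. \<rho> k (y - z) - \<rho> k (p - z))"
          using ip_CS[OF lt l] by simp
        also have "\<dots> \<le> B * (\<omega> * mU)" unfolding mU_def
          by (intro mult_mono B1 sup_nrm l pt B0) (use \<omega> in simp_all)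
        also have "\<dots> = (\<eta> / 3) * ((B * mU) / (B * mU + 1))" by (simp add: \<omega>_def)
        also have "\<dots> < (\<eta> / 3) * 1" using \<eta> BU by (intro mult_strict_left_mono) auto
        finally show ?thesis by simp
      qed
      have "Cauchy (\<lambda>n. convol (\<phi> (r n)) (\<rho> k) p)" using conv1[of k i] i by (simp add: Cauchy_convergent_iff)
      then obtain N where N: "\<And>m n. m \<ge> N \<Longrightarrow> n \<ge> N \<Longrightarrow> \<bar>convol (\<phi> (r m)) (\<rho> k) p - convol (\<phi> (r n)) (\<rho> k) p\<bar> < \<eta> / 3"
        using \<eta> metric_CauchyD[of "\<lambda>n. convol (\<phi> (r n)) (\<rho> k) p" "\<eta> / 3"] by (auto simp: dist_real_def)
      have "dist (convol (\<phi> (r m)) (\<rho> k) y) (convol (\<phi> (r n)) (\<rho> k) y) < \<eta>" if "m \<ge> N" "n \<ge> N" for m n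
        using N[OF that] near[of "r m"] near[of "r n"] unfolding dist_real_def by linarith
      then show "\<exists>N. \<forall>m\<ge>N. \<forall>n\<ge>N. dist (convol (\<phi> (r m)) (\<rho> k) y) (convol (\<phi> (r n)) (\<rho> k) y) < \<eta>" by blast
    qed
    then show ?thesis by (simp add: Cauchy_convergent_iff)
  qed
  define g where "g k y = lim (\<lambda>n. convol (\<phi> (r n)) (\<rho> k) y)" for k y
  have glim: "(\<lambda>n. convol (\<phi> (r n)) (\<rho> k) y) \<longlonglongrightarrow> g k y" for k y
    unfolding g_def using conv by (simp add: convergent_LIMSEQ_iff)
  have cm: "convol (\<phi> n) (\<rho> k) \<in> borel_measurable M" for n k
    by (rule cont_meas_leb(2)[OF smooth3_cont[OF convol_smooth[OF test_int[OF t] md(1)]]])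
  have lcv: "l2 M (convol (\<phi> n) (\<rho> k))" for n k
    by (rule cont_l2[OF smooth3_cont[OF convol_smooth[OF test_int[OF t] md(1)]] bd leb])
  have gm: "g k \<in> borel_measurable M" for k
    by (rule borel_measurable_LIMSEQ_real[OF glim cm])
  have gC: "\<bar>g k y\<bar> \<le> C k" for k y
    by (rule LIMSEQ_le_const2[OF tendsto_rabs[OF glim]]) (use C in blast)
  have Ck: "C k \<ge> 0" for k unfolding C_def using B0 mU b by simp
  have lg: "l2 M (g k)" for k
    by (rule l2_bounded_by[OF one_l2[of "C k"] gm]) (use gC Ck in simp)
  have L2: "(\<lambda>n. nrm M (\<lambda>y. convol (\<phi> (r n)) (\<rho> k) y - g k y)) \<longlonglongrightarrow> 0" for k
  proof -
    have "(\<lambda>n. (LINT y|M. (convol (\<phi> (r n)) (\<rho> k) y - g k y)\<^sup>2)) \<longlonglongrightarrow> (LINT y|M. 0)"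
    proof (rule integral_dominated_convergence[where w = "\<lambda>_. (2 * C k)\<^sup>2"])
      show "integrable M (\<lambda>_. (2 * C k)\<^sup>2)" by (rule l2_integrable[OF fin one_l2])
      show "(\<lambda>y. (convol (\<phi> (r n)) (\<rho> k) y - g k y)\<^sup>2) \<in> borel_measurable M" for n
        by (intro borel_measurable_power borel_measurable_diff cm gm)
      have "(\<lambda>n. (convol (\<phi> (r n)) (\<rho> k) y - g k y)\<^sup>2) \<longlonglongrightarrow> (g k y - g k y)\<^sup>2" for y by (intro tendsto_intros glim)
      then show "AE y in M. (\<lambda>n. (convol (\<phi> (r n)) (\<rho> k) y - g k y)\<^sup>2) \<longlonglongrightarrow> 0" by simp
      have "norm ((convol (\<phi> (r n)) (\<rho> k) y - g k y)\<^sup>2) \<le> (2 * C k)\<^sup>2" for n y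
      proof -
        have "\<bar>convol (\<phi> (r n)) (\<rho> k) y - g k y\<bar> \<le> 2 * C k" using C[of "r n" k y] gC[of k y] by linarith
        then have "\<bar>convol (\<phi> (r n)) (\<rho> k) y - g k y\<bar>\<^sup>2 \<le> (2 * C k)\<^sup>2" by (intro power_mono) simp_all
        then show ?thesis by simp
      qed
      then show "AE y in M. norm ((convol (\<phi> (r n)) (\<rho> k) y - g k y)\<^sup>2) \<le> (2 * C k)\<^sup>2" for n by simp
    qed simp
    then have "(\<lambda>n. (nrm M (\<lambda>y. convol (\<phi> (r n)) (\<rho> k) y - g k y))\<^sup>2) \<longlonglongrightarrow> 0" by (simp add: nrm_sq_real)
    from tendsto_real_sqrt[OF this] show ?thesis by simp
  qed
  have "\<exists>N. \<forall>i\<ge>N. \<forall>j\<ge>N. nrm M (\<lambda>y. \<phi> (r i) y - \<phi> (r j) y) < e" if e: "e > 0" for e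
  proof -
    \<comment> \<open>The kernel radius is \<open>1 / (k + 1)\<close>; with this \<open>k\<close>
      the mollification error is below \<open>e / 4\<close> for every \<open>n\<close>.\<close>
    obtain k where k: "real k > 4 * B / e" using reals_Archimedean2 by blast
    have small: "1 / (real k + 1) * B < e / 4"
    proof -
      have "4 * B < real k * e" using k e by (simp add: field_simps)
      also have "\<dots> \<le> (real k + 1) * e" using e by simp
      finally show ?thesis by (simp add: field_simps)
    qed
    have est: "nrm M (\<lambda>y. convol (\<phi> n) (\<rho> k) y - \<phi> n y) < e / 4" for n
    proof -
      have "nrm M (\<lambda>y. convol (\<phi> n) (\<rho> k) y - \<phi> n y) \<le> 1 / (real k + 1) * nrm M (grad3 (\<phi> n))"
        by (rule mollifier_est_M[OF t \<rho>]) simp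
      also have "\<dots> \<le> 1 / (real k + 1) * B" by (intro mult_left_mono B2) simp
      finally show ?thesis using small by linarith
    qed
    have e4: "e / 4 > 0" using e by simp
    obtain N where N: "\<forall>n\<ge>N. norm (nrm M (\<lambda>y. convol (\<phi> (r n)) (\<rho> k) y - g k y) - 0) < e / 4"
      using LIMSEQ_D[OF L2[of k] e4] by blast
    have "nrm M (\<lambda>y. \<phi> (r i) y - \<phi> (r j) y) < e" if ij: "i \<ge> N" "j \<ge> N" for i j
    proof -
      let ?c = "\<lambda>n. convol (\<phi> (r n)) (\<rho> k)"
      have "nrm M (\<lambda>y. \<phi> (r i) y - \<phi> (r j) y) \<le> nrm M (\<lambda>y. \<phi> (r i) y - ?c i y) + nrm M (\<lambda>y. ?c i y - \<phi> (r j) y)"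
        by (intro nrm_tri lt lcv)
      moreover have "nrm M (\<lambda>y. ?c i y - \<phi> (r j) y) \<le> nrm M (\<lambda>y. ?c i y - g k y) + nrm M (\<lambda>y. g k y - \<phi> (r j) y)"
        by (intro nrm_tri lt lcv lg)
      moreover have "nrm M (\<lambda>y. g k y - \<phi> (r j) y) \<le> nrm M (\<lambda>y. g k y - ?c j y) + nrm M (\<lambda>y. ?c j y - \<phi> (r j) y)"
        by (intro nrm_tri lt lcv lg)
      moreover have "nrm M (\<lambda>y. \<phi> (r i) y - ?c i y) < e / 4" using est[of "r i"] by (simp add: nrm_diff_comm[of M "\<phi> (r i)"])
      moreover have "nrm M (\<lambda>y. g k y - ?c j y) < e / 4" using N ij(2) by (simp add: nrm_diff_comm[of M "g k"])
      moreover have "nrm M (\<lambda>y. ?c i y - g k y) < e / 4" using N ij(1) by simp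
      moreover have "nrm M (\<lambda>y. ?c j y - \<phi> (r j) y) < e / 4" by (rule est)
      ultimately show ?thesis by linarith
    qed
    then show ?thesis by blast
  qed
  then show ?thesis using that[OF r(1)] by blast
qed

text \<open>Each \<open>w n\<close> is replaced by a test function at distance below
  \<open>1 / (n + 1)\<close>, which does not affect Cauchy subsequences. Only first components
  become Cauchy; gradients will require an equation.\<close>

lemma rellich:
  assumes w: "\<And>n::nat. w n \<in> h10 U" and B: "\<And>n. nrm M (w n) \<le> B"
  obtains r :: "nat \<Rightarrow> nat" where "strict_mono r" "\<And>e. e > 0 \<Longrightarrow> \<exists>N. \<forall>i\<ge>N. \<forall>j\<ge>N. nrm M (\<lambda>y. fst (w (r i) y - w (r j) y)) < e"
proof -
  have lw: "l2 M (w n)" for n by (rule h10_l2[OF w])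
  have "\<forall>n. \<exists>\<phi>. test_fun U \<phi> \<and> nrm M (\<lambda>y. jet \<phi> y - w n y) < 1 / (real n + 1)"
  proof
    fix n
    have "(1 / (real n + 1)) > 0" by simp
    then have "\<exists>s\<in>jet ` {\<phi>. test_fun U \<phi>}. nrm M (\<lambda>y. s y - w n y) < 1 / (real n + 1)"
      using w[of n] unfolding h10_def cl2_def by blast
    then show "\<exists>\<phi>. test_fun U \<phi> \<and> nrm M (\<lambda>y. jet \<phi> y - w n y) < 1 / (real n + 1)" by blast
  qed
  from choice[OF this] obtain \<phi> where "\<forall>n. test_fun U (\<phi> n) \<and> nrm M (\<lambda>y. jet (\<phi> n) y - w n y) < 1 / (real n + 1)" ..
  then have t: "test_fun U (\<phi> n)" and near: "nrm M (\<lambda>y. jet (\<phi> n) y - w n y) < 1 / (real n + 1)" for n by auto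
  note lt = test_l2(3)[OF t]
  have tB: "nrm M (jet (\<phi> n)) \<le> B + 1" for n
  proof -
    have "nrm M (jet (\<phi> n)) - nrm M (w n) \<le> nrm M (\<lambda>y. jet (\<phi> n) y - w n y)" using nrm_tri2[OF lt lw, of n n] by linarith
    moreover have "1 / (real n + 1) \<le> 1" by simp
    ultimately show ?thesis using near[of n] B[of n] by linarith
  qed
  obtain r :: "nat \<Rightarrow> nat" where r: "strict_mono r" and C: "\<And>e. e > 0 \<Longrightarrow> \<exists>N. \<forall>i\<ge>N. \<forall>j\<ge>N. nrm M (\<lambda>y. \<phi> (r i) y - \<phi> (r j) y) < e"
    by (rule rellich_test[OF t tB]) (rule that)
  have "\<exists>N. \<forall>i\<ge>N. \<forall>j\<ge>N. nrm M (\<lambda>y. fst (w (r i) y - w (r j) y)) < e" if e: "e > 0" for e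
  proof -
    obtain N1 where N1: "\<forall>i\<ge>N1. \<forall>j\<ge>N1. nrm M (\<lambda>y. \<phi> (r i) y - \<phi> (r j) y) < e / 3" using C[of "e / 3"] e by auto
    obtain N2 where N2: "real N2 > 3 / e" using reals_Archimedean2 by blast
    have f: "nrm M (\<lambda>y. \<phi> (r i) y - fst (w (r i) y)) < e / 3" if "i \<ge> N2" for i
    proof -
      have "nrm M (\<lambda>y. \<phi> (r i) y - fst (w (r i) y)) \<le> nrm M (\<lambda>y. jet (\<phi> (r i)) y - w (r i) y)"
        using nrm_fst[OF l2_diff[OF lt lw], of "r i" "r i"] by (simp add: jet_def)
      also have "\<dots> < 1 / (real (r i) + 1)" by (rule near)
      also have "\<dots> \<le> e / 3"
      proof -
        have "real N2 \<le> real (r i)" using that seq_suble[OF r, of i] by simp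
        then have "3 / e < real (r i) + 1" using N2 by linarith
        then show ?thesis using e by (simp add: field_simps)
      qed
      finally show ?thesis .
    qed
    have "nrm M (\<lambda>y. fst (w (r i) y - w (r j) y)) < e" if ij: "i \<ge> max N1 N2" "j \<ge> max N1 N2" for i j
    proof -
      note l = l2_fst[OF lw] test_l2(1)[OF t]
      have "nrm M (\<lambda>y. fst (w (r i) y) - fst (w (r j) y)) \<le> nrm M (\<lambda>y. fst (w (r i) y) - \<phi> (r i) y) + nrm M (\<lambda>y. \<phi> (r i) y - fst (w (r j) y))"
        by (intro nrm_tri l)
      moreover have "nrm M (\<lambda>y. \<phi> (r i) y - fst (w (r j) y)) \<le> nrm M (\<lambda>y. \<phi> (r i) y - \<phi> (r j) y) + nrm M (\<lambda>y. \<phi> (r j) y - fst (w (r j) y))"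
        by (intro nrm_tri l)
      moreover have "nrm M (\<lambda>y. fst (w (r i) y) - \<phi> (r i) y) < e / 3"
        using f[of i] ij by (subst nrm_diff_comm) simp
      moreover have "nrm M (\<lambda>y. \<phi> (r i) y - \<phi> (r j) y) < e / 3" using N1 ij by simp
      moreover have "nrm M (\<lambda>y. \<phi> (r j) y - fst (w (r j) y)) < e / 3" using f[of j] ij by simp
      ultimately show ?thesis by simp
    qed
    then show ?thesis by blast
  qed
  then show ?thesis using that[OF r] by blast
qed

end

section \<open>The Dirichlet problem\<close>

lemma subseq_null:
  fixes a :: "nat \<Rightarrow> real"
  assumes "\<And>s :: nat \<Rightarrow> nat. strict_mono s \<Longrightarrow> \<exists>r :: nat \<Rightarrow> nat. strict_mono r \<and> (\<lambda>k. a (s (r k))) \<longlonglongrightarrow> 0"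
  shows "a \<longlonglongrightarrow> 0"
proof (rule ccontr)
  assume "\<not> a \<longlonglongrightarrow> 0"
  then obtain e where e: "e > 0" "\<forall>N. \<exists>n\<ge>N. \<not> norm (a n - 0) < e" unfolding LIMSEQ_iff by blast
  define S where "S = {n. \<not> norm (a n - 0) < e}"
  have inf: "infinite S" unfolding infinite_nat_iff_unbounded_le S_def using e(2) by blast
  define s where "s = enumerate S"
  have s: "strict_mono s" unfolding s_def by (rule strict_mono_enumerate[OF inf])
  obtain r :: "nat \<Rightarrow> nat" where r: "strict_mono r" "(\<lambda>k. a (s (r k))) \<longlonglongrightarrow> 0" using assms[OF s] by blast
  obtain N where "\<forall>k\<ge>N. norm (a (s (r k)) - 0) < e" using LIMSEQ_D[OF r(2) e(1)] by blast
  then have "norm (a (s (r N)) - 0) < e" by simp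
  moreover have "s (r N) \<in> S" unfolding s_def by (rule enumerate_in_set[OF inf])
  ultimately show False by (simp add: S_def)
qed

context bdom begin

text \<open>Uniqueness for the homogeneous Dirichlet problem, phrased with the norm because members
  of \<open>h10\<close> are functions and vanish only almost everywhere.\<close>

definition no_kernel :: "(real^3 \<Rightarrow> real) \<Rightarrow> bool" where
  "no_kernel V \<longleftrightarrow> (\<forall>w\<in>h10 U. (\<forall>\<phi>\<in>h10 U. aform M V w \<phi> = 0) \<longrightarrow> nrm M w = 0)"

text \<open>One compactness argument for two uses: the a priori bound, with \<open>f = 0\<close> and
  \<open>q\<close> strongly null, and the needle corrections, with \<open>q = 0\<close> and
  \<open>f\<close> only weakly null. Rellich makes the values Cauchy, the equation for differences
  then makes the gradients Cauchy, and the limit solves the homogeneous problem.\<close>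

lemma null_subsequence:
  assumes V: "ess_bdd M V" and no_kernel: "no_kernel V" and w: "\<And>n::nat. w n \<in> h10 U" and B: "\<And>n. nrm M (w n) \<le> B"
    and f: "\<And>n. l2 M (f n)" "\<And>n. nrm M (f n) \<le> Bf"
    and q: "\<And>n. l2 M (q n)" "(\<lambda>n. nrm M (q n)) \<longlonglongrightarrow> 0"
    and eq: "\<And>n \<phi>. \<phi> \<in> h10 U \<Longrightarrow> aform M V (w n) \<phi> = ip M (f n) (\<lambda>y. fst (\<phi> y)) + ip M (q n) \<phi>"
    and weak: "\<And>\<phi>. \<phi> \<in> h10 U \<Longrightarrow> (\<lambda>n. ip M (f n) (\<lambda>y. fst (\<phi> y))) \<longlonglongrightarrow> 0"
  shows "\<exists>r::nat \<Rightarrow> nat. strict_mono r \<and> (\<lambda>n. nrm M (w (r n))) \<longlonglongrightarrow> 0"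
proof -
  have lw: "l2 M (w n)" for n by (rule h10_l2[OF w])
  obtain r :: "nat \<Rightarrow> nat" where r: "strict_mono r"
    and C: "\<And>e. e > 0 \<Longrightarrow> \<exists>N. \<forall>i\<ge>N. \<forall>j\<ge>N. nrm M (\<lambda>y. fst (w (r i) y - w (r j) y)) < e"
    by (rule rellich[OF w B]) (rule that)
  obtain BV where BV: "BV \<ge> 0" "\<And>f. l2 M f \<Longrightarrow> nrm M (\<lambda>y. V y * f y) \<le> BV * nrm M f" by (rule ess_bdd_bound[OF V]) (rule that)
  have B0: "B \<ge> 0" using B[of 0] nrm_nonneg[of M "w 0"] by linarith
  have Bf0: "Bf \<ge> 0" using f(2)[of 0] nrm_nonneg[of M "f 0"] by linarith
  \<comment> \<open>Collects the bounds below: the difference \<open>d\<close> has norm at most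
    \<open>2 * B\<close>, the potential contributes \<open>BV\<close>, and the right-hand sides
    contribute \<open>2 * Bf\<close> and \<open>2 * B\<close>.\<close>
  define K where "K = 2 * B * (1 + BV) + 2 * Bf + 2 * B"
  have K: "K \<ge> 0" unfolding K_def using B0 Bf0 BV(1) by simp
  have est: "(nrm M (\<lambda>y. w i y - w j y))\<^sup>2 \<le> K * (nrm M (\<lambda>y. fst (w i y - w j y)) + nrm M (q i) + nrm M (q j))" for i j
  proof -
    define d where "d = (\<lambda>y. w i y - w j y)"
    define a where "a = nrm M (\<lambda>y. fst (d y))"
    have d: "d \<in> h10 U" unfolding d_def by (rule clsub_ops(2)[OF clsub_h10 w w])
    have ld: "l2 M d" by (rule h10_l2[OF d])
    note lfs = l2_fst[OF ld] l2_snd[OF ld]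
    have nd: "nrm M d \<le> 2 * B" using nrm_diff[OF lw lw, of i j] B[of i] B[of j] unfolding d_def by linarith
    have a0: "a \<ge> 0" by (simp add: a_def)
    have a2: "a \<le> 2 * B" using nrm_fst[OF ld] nd unfolding a_def by linarith
    have e: "aform M V d d = ip M (\<lambda>y. f i y - f j y) (\<lambda>y. fst (d y)) + ip M (\<lambda>y. q i y - q j y) d"
    proof -
      have "aform M V d d = aform M V (w i) d - aform M V (w j) d"
        using aform_diff[OF V lw lw ld, of i j] unfolding d_def by simp
      also have "\<dots> = (ip M (f i) (\<lambda>y. fst (d y)) - ip M (f j) (\<lambda>y. fst (d y))) + (ip M (q i) d - ip M (q j) d)"
        unfolding eq[OF d] by simp
      finally show ?thesis unfolding ip_diff_left[OF f(1) f(1) lfs(1)] ip_diff_left[OF q(1) q(1) ld] .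
    qed
    have s1: "\<bar>ip M (\<lambda>y. f i y - f j y) (\<lambda>y. fst (d y))\<bar> \<le> 2 * Bf * a"
    proof -
      have "\<bar>ip M (\<lambda>y. f i y - f j y) (\<lambda>y. fst (d y))\<bar> \<le> nrm M (\<lambda>y. f i y - f j y) * a"
        unfolding a_def by (intro ip_CS l2_diff f lfs)
      also have "\<dots> \<le> (2 * Bf) * a"
      proof (rule mult_right_mono[OF _ a0])
        show "nrm M (\<lambda>y. f i y - f j y) \<le> 2 * Bf" using nrm_diff[OF f(1) f(1), of i j] f(2)[of i] f(2)[of j] by linarith
      qed
      finally show ?thesis by simp
    qed
    have s2: "\<bar>ip M (\<lambda>y. q i y - q j y) d\<bar> \<le> 2 * B * (nrm M (q i) + nrm M (q j))"
    proof -
      have "\<bar>ip M (\<lambda>y. q i y - q j y) d\<bar> \<le> nrm M (\<lambda>y. q i y - q j y) * nrm M d" by (intro ip_CS l2_diff q ld)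
      also have "\<dots> \<le> (nrm M (q i) + nrm M (q j)) * (2 * B)"
        by (intro mult_mono nrm_diff q nd) (simp_all add: add_nonneg_nonneg)
      finally show ?thesis by (simp add: mult.commute)
    qed
    have s3: "\<bar>ip M (\<lambda>y. V y * fst (d y)) (\<lambda>y. fst (d y))\<bar> \<le> BV * a * a"
    proof -
      have "\<bar>ip M (\<lambda>y. V y * fst (d y)) (\<lambda>y. fst (d y))\<bar> \<le> nrm M (\<lambda>y. V y * fst (d y)) * a"
        unfolding a_def by (intro ip_CS ess_bdd_l2 V lfs)
      also have "\<dots> \<le> (BV * a) * a" unfolding a_def by (intro mult_right_mono BV(2) lfs) simp
      finally show ?thesis by simp
    qed
    have "(nrm M d)\<^sup>2 = a\<^sup>2 + ip M (\<lambda>y. snd (d y)) (\<lambda>y. snd (d y))"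
      unfolding a_def nrm_sq by (rule ip_pair[OF ld ld])
    \<comment> \<open>Garding's inequality in the form used here: the gradient part is the form
      minus the potential term, and the latter involves values only.\<close>
    also have "ip M (\<lambda>y. snd (d y)) (\<lambda>y. snd (d y)) = aform M V d d - ip M (\<lambda>y. V y * fst (d y)) (\<lambda>y. fst (d y))"
      by (simp add: aform_def)
    finally have n: "(nrm M d)\<^sup>2 \<le> a * a + BV * a * a + 2 * Bf * a + 2 * B * (nrm M (q i) + nrm M (q j))"
      using e s1 s2 s3 unfolding power2_eq_square[of a] by linarith
    have "a * a \<le> (2 * B) * a" using a0 a2 by (rule mult_right_mono[rotated])
    moreover have "BV * a * a \<le> BV * (2 * B) * a" using BV(1) a0 a2 by (intro mult_right_mono mult_left_mono) auto
    ultimately have "(nrm M d)\<^sup>2 \<le> (2 * B * (1 + BV) + 2 * Bf) * a + 2 * B * (nrm M (q i) + nrm M (q j))"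
      using n by (simp add: algebra_simps)
    also have "\<dots> \<le> K * a + K * (nrm M (q i) + nrm M (q j))"
    proof (intro add_mono mult_right_mono a0)
      have "0 \<le> 2 * B * (1 + BV)" using B0 BV(1) by simp
      then show "2 * B * (1 + BV) + 2 * Bf \<le> K" "2 * B \<le> K" unfolding K_def using B0 Bf0 by linarith+
    qed (simp add: add_nonneg_nonneg)
    finally show ?thesis unfolding a_def d_def by (simp add: algebra_simps)
  qed
  have Cau: "\<exists>N. \<forall>i\<ge>N. \<forall>j\<ge>N. nrm M (\<lambda>y. w (r i) y - w (r j) y) < e" if e: "e > 0" for e
  proof -
    define h where "h = e\<^sup>2 / (3 * (K + 1))"
    have h: "h > 0" using e K by (simp add: h_def)
    obtain N1 where N1: "\<forall>i\<ge>N1. \<forall>j\<ge>N1. nrm M (\<lambda>y. fst (w (r i) y - w (r j) y)) < h" using C[OF h] by blast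
    obtain N2 where N2: "\<forall>n\<ge>N2. norm (nrm M (q n) - 0) < h" using LIMSEQ_D[OF q(2) h] by blast
    have "nrm M (\<lambda>y. w (r i) y - w (r j) y) < e" if ij: "i \<ge> max N1 N2" "j \<ge> max N1 N2" for i j
    proof (rule power2_less_imp_less)
      have "r i \<ge> N2" "r j \<ge> N2" using ij seq_suble[OF r, of i] seq_suble[OF r, of j] by auto
      then have "nrm M (q (r i)) < h" "nrm M (q (r j)) < h" using N2 by auto
      moreover have "nrm M (\<lambda>y. fst (w (r i) y - w (r j) y)) < h" using N1 ij by simp
      ultimately have "K * (nrm M (\<lambda>y. fst (w (r i) y - w (r j) y)) + nrm M (q (r i)) + nrm M (q (r j))) \<le> K * (3 * h)"
        by (intro mult_left_mono K) linarith
      also have "\<dots> = e\<^sup>2 * (K / (K + 1))"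
      proof -
        have "K + 1 \<noteq> 0" using K by simp
        then have "3 * h = e\<^sup>2 / (K + 1)" unfolding h_def by (simp add: divide_simps)
        then show ?thesis by simp
      qed
      also have "\<dots> < e\<^sup>2 * 1" using e K by (intro mult_strict_left_mono) auto
      finally show "(nrm M (\<lambda>y. w (r i) y - w (r j) y))\<^sup>2 < e\<^sup>2" using est[of "r i" "r j"] by simp
    qed (use e in simp)
    then show ?thesis by blast
  qed
  obtain W where W: "l2 M W" "(\<lambda>k. nrm M (\<lambda>y. w (r k) y - W y)) \<longlonglongrightarrow> 0"
    by (rule l2_complete[OF fin lw Cau]) (assumption, rule that)
  have Wh: "W \<in> h10 U" by (rule clsubD(4)[OF clsub_h10 w W])
  have "aform M V W \<phi> = 0" if \<phi>: "\<phi> \<in> h10 U" for \<phi>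
  proof -
    have l\<phi>: "l2 M \<phi>" by (rule h10_l2[OF \<phi>])
    have 1: "(\<lambda>k. aform M V (w (r k)) \<phi>) \<longlonglongrightarrow> aform M V W \<phi>" by (rule aform_tendsto[OF V lw W l\<phi>])
    have "(\<lambda>n. ip M (q n) \<phi>) \<longlonglongrightarrow> 0"
      by (rule null_sandwich[where b = "\<lambda>n. nrm M (q n) * nrm M \<phi>"])
         (use ip_CS[OF q(1) l\<phi>] tendsto_mult_left_zero[OF q(2)] in auto)
    then have "(\<lambda>n. aform M V (w n) \<phi>) \<longlonglongrightarrow> 0"
      unfolding eq[OF \<phi>] by (intro tendsto_add_zero weak \<phi>)
    then have "(\<lambda>k. aform M V (w (r k)) \<phi>) \<longlonglongrightarrow> 0" using LIMSEQ_subseq_LIMSEQ[OF _ r] by (auto simp: o_def)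
    with 1 show ?thesis by (rule LIMSEQ_unique)
  qed
  then have "nrm M W = 0" using no_kernel Wh unfolding no_kernel_def by blast
  moreover have "(\<lambda>k. nrm M (w (r k))) \<longlonglongrightarrow> nrm M W" by (rule nrm_tendsto[OF lw W])
  ultimately show ?thesis using r by auto
qed

text \<open>If no constant worked, solutions normalised to norm one would have right-hand sides
  tending to zero, and the compactness argument would send a subsequence of them to zero.\<close>

lemma bounded_below:
  assumes V: "ess_bdd M V" and no_kernel: "no_kernel V"
  obtains C where "C \<ge> 0" "\<And>w q. w \<in> h10 U \<Longrightarrow> l2 M q \<Longrightarrow> \<forall>\<phi>\<in>h10 U. aform M V w \<phi> = ip M q \<phi> \<Longrightarrow> nrm M w \<le> C * nrm M q"
proof -
  have "\<exists>C\<ge>0. \<forall>w q. w \<in> h10 U \<longrightarrow> l2 M q \<longrightarrow> (\<forall>\<phi>\<in>h10 U. aform M V w \<phi> = ip M q \<phi>) \<longrightarrow> nrm M w \<le> C * nrm M q"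
  proof (rule ccontr)
    assume a: "\<not> ?thesis"
    have "\<exists>w q. w \<in> h10 U \<and> l2 M q \<and> (\<forall>\<phi>\<in>h10 U. aform M V w \<phi> = ip M q \<phi>) \<and> nrm M w > (real k + 1) * nrm M q" for k :: nat
    proof (rule ccontr)
      assume "\<not> ?thesis"
      then have "\<forall>w q. w \<in> h10 U \<longrightarrow> l2 M q \<longrightarrow> (\<forall>\<phi>\<in>h10 U. aform M V w \<phi> = ip M q \<phi>) \<longrightarrow> nrm M w \<le> (real k + 1) * nrm M q"
        by (meson not_le)
      then show False using a by (meson add_nonneg_nonneg of_nat_0_le_iff zero_le_one)
    qed
    then have "\<forall>k::nat. \<exists>p. fst p \<in> h10 U \<and> l2 M (snd p) \<and> (\<forall>\<phi>\<in>h10 U. aform M V (fst p) \<phi> = ip M (snd p) \<phi>) \<and> nrm M (fst p) > (real k + 1) * nrm M (snd p)"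
      by (metis fst_conv snd_conv)
    from choice[OF this] obtain p where p: "\<forall>k::nat. fst (p k) \<in> h10 U \<and> l2 M (snd (p k)) \<and> (\<forall>\<phi>\<in>h10 U. aform M V (fst (p k)) \<phi> = ip M (snd (p k)) \<phi>) \<and> nrm M (fst (p k)) > (real k + 1) * nrm M (snd (p k))" ..
    define w where "w k = fst (p k)" for k
    define q where "q k = snd (p k)" for k
    have w: "w k \<in> h10 U" and q: "l2 M (q k)" and eq: "\<phi> \<in> h10 U \<Longrightarrow> aform M V (w k) \<phi> = ip M (q k) \<phi>"
      and big: "nrm M (w k) > (real k + 1) * nrm M (q k)" for k \<phi> using p by (auto simp: w_def q_def)
    define c where "c k = 1 / nrm M (w k)" for k
    have np: "nrm M (w k) > 0" for k
      by (rule le_less_trans[OF mult_nonneg_nonneg big]) simp_all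
    have c0: "c k \<ge> 0" for k using np[of k] by (simp add: c_def)
    have n1: "nrm M (\<lambda>y. c k *\<^sub>R w k y) = 1" for k unfolding nrm_scale using np[of k] by (simp add: c_def)
    have n2: "nrm M (\<lambda>y. c k *\<^sub>R q k y) \<le> 1 / (real k + 1)" for k
    proof -
      have "nrm M (\<lambda>y. c k *\<^sub>R q k y) = nrm M (q k) / nrm M (w k)" unfolding nrm_scale using c0[of k] by (simp add: c_def)
      also have "\<dots> \<le> 1 / (real k + 1)" using big[of k] np[of k] by (simp add: field_simps)
      finally show ?thesis .
    qed
    have q0: "(\<lambda>k. nrm M (\<lambda>y. c k *\<^sub>R q k y)) \<longlonglongrightarrow> 0"
      by (rule null_sandwich[of _ "\<lambda>k. 1 / (real k + 1)"]) (use n2 LIMSEQ_inverse_real_of_nat in \<open>auto simp: inverse_eq_divide add.commute\<close>)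
    have wh: "(\<lambda>y. c k *\<^sub>R w k y) \<in> h10 U" for k by (rule clsub_ops(3)[OF clsub_h10 w])
    have "\<exists>r::nat \<Rightarrow> nat. strict_mono r \<and> (\<lambda>n. nrm M (\<lambda>y. c (r n) *\<^sub>R w (r n) y)) \<longlonglongrightarrow> 0"
    proof (rule null_subsequence[where w = "\<lambda>k y. c k *\<^sub>R w k y" and f = "\<lambda>k y. 0" and q = "\<lambda>k y. c k *\<^sub>R q k y" and B = 1 and Bf = 0, OF V no_kernel wh])
      fix n \<phi> assume \<phi>: "\<phi> \<in> h10 U"
      have "aform M V (\<lambda>y. c n *\<^sub>R w n y) \<phi> = c n * aform M V (w n) \<phi>"
        using aform_lin[OF V l2_zero h10_l2[OF w] h10_l2[OF \<phi>], of "c n" n] by (simp add: aform_def)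
      then show "aform M V (\<lambda>y. c n *\<^sub>R w n y) \<phi> = ip M (\<lambda>y. 0) (\<lambda>y. fst (\<phi> y)) + ip M (\<lambda>y. c n *\<^sub>R q n y) \<phi>"
        by (simp add: eq[OF \<phi>] ip_scale_left)
    qed (use n1 q q0 in auto)
    then show False by (simp add: n1 LIMSEQ_const_iff)
  qed
  then show ?thesis using that by blast
qed

text \<open>The Fredholm alternative by hand. The a priori bound makes the space \<open>H\<close> of
  attained right-hand sides closed. The functional is represented by \<open>f\<close>, and
  \<open>f\<close> is projected to \<open>p\<close> in \<open>H\<close>; by symmetry of the form the
  rest \<open>f - p\<close> solves the homogeneous problem and hence has norm zero.\<close>

lemma aform_solution:
  assumes V: "ess_bdd M V" and no_kernel: "no_kernel V"
    and lin: "\<And>a b c. a \<in> h10 U \<Longrightarrow> b \<in> h10 U \<Longrightarrow> F (\<lambda>x. a x + c *\<^sub>R b x) = F a + c * F b"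
    and bdd: "\<And>a. a \<in> h10 U \<Longrightarrow> \<bar>F a\<bar> \<le> C * nrm M a"
  shows "\<exists>w\<in>h10 U. \<forall>\<phi>\<in>h10 U. aform M V w \<phi> = F \<phi>"
proof -
  note ch = clsub_h10
  define H where "H = {q\<in>h10 U. \<exists>w\<in>h10 U. \<forall>\<phi>\<in>h10 U. aform M V w \<phi> = ip M q \<phi>}"
  obtain Cb where Cb: "Cb \<ge> 0" "\<And>w q. w \<in> h10 U \<Longrightarrow> l2 M q \<Longrightarrow> \<forall>\<phi>\<in>h10 U. aform M V w \<phi> = ip M q \<phi> \<Longrightarrow> nrm M w \<le> Cb * nrm M q"
    by (rule bounded_below[OF V no_kernel]) (rule that)
  obtain f where f: "f \<in> h10 U" "\<And>\<phi>. \<phi> \<in> h10 U \<Longrightarrow> F \<phi> = ip M f \<phi>" using riesz[OF fin ch lin bdd] by blast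
  have z: "(\<lambda>_. 0) \<in> h10 U" by (rule clsubD(1)[OF ch])
  have H: "clsub M H"
    unfolding clsub_def
  proof (intro conjI ballI allI impI)
    have "aform M V (\<lambda>_. 0) \<phi> = ip M (\<lambda>_. 0) \<phi>" for \<phi> by (simp add: aform_def)
    then show "(\<lambda>_. 0) \<in> H" unfolding H_def using z by blast
    show "l2 M q" if "q \<in> H" for q using that h10_l2 by (auto simp: H_def)
    show "(\<lambda>x. a x + c *\<^sub>R b x) \<in> H" if a: "a \<in> H" and b: "b \<in> H" for a b c
    proof -
      obtain wa where wa: "wa \<in> h10 U" "\<And>\<phi>. \<phi> \<in> h10 U \<Longrightarrow> aform M V wa \<phi> = ip M a \<phi>" using a by (auto simp: H_def)
      obtain wb where wb: "wb \<in> h10 U" "\<And>\<phi>. \<phi> \<in> h10 U \<Longrightarrow> aform M V wb \<phi> = ip M b \<phi>" using b by (auto simp: H_def)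
      have ab: "a \<in> h10 U" "b \<in> h10 U" using a b by (auto simp: H_def)
      have "aform M V (\<lambda>x. wa x + c *\<^sub>R wb x) \<phi> = ip M (\<lambda>x. a x + c *\<^sub>R b x) \<phi>" if \<phi>: "\<phi> \<in> h10 U" for \<phi>
        unfolding aform_lin[OF V h10_l2[OF wa(1)] h10_l2[OF wb(1)] h10_l2[OF \<phi>]]
          ip_add_left[OF h10_l2[OF ab(1)] l2_scale[OF h10_l2[OF ab(2)]] h10_l2[OF \<phi>]] ip_scale_left wa(2)[OF \<phi>] wb(2)[OF \<phi>] ..
      then show ?thesis unfolding H_def using clsubD(3)[OF ch ab] clsubD(3)[OF ch wa(1) wb(1)] by blast
    qed
    fix s and q :: "real^3 \<Rightarrow> real \<times> (real^3)"
    assume as: "(\<forall>k. s k \<in> H) \<and> l2 M q \<and> (\<lambda>k. nrm M (\<lambda>x. s k x - q x)) \<longlonglongrightarrow> 0"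
    then have s: "\<And>k. s k \<in> h10 U" and lq: "l2 M q" and lim: "(\<lambda>k. nrm M (\<lambda>x. s k x - q x)) \<longlonglongrightarrow> 0" by (auto simp: H_def)
    have qh: "q \<in> h10 U" by (rule clsubD(4)[OF ch s lq lim])
    have "\<forall>k. \<exists>w. w \<in> h10 U \<and> (\<forall>\<phi>\<in>h10 U. aform M V w \<phi> = ip M (s k) \<phi>)" using as by (auto simp: H_def)
    from choice[OF this] obtain w where "\<forall>k. w k \<in> h10 U \<and> (\<forall>\<phi>\<in>h10 U. aform M V (w k) \<phi> = ip M (s k) \<phi>)" ..
    then have w: "w k \<in> h10 U" and we: "\<phi> \<in> h10 U \<Longrightarrow> aform M V (w k) \<phi> = ip M (s k) \<phi>" for k \<phi> by auto
    note lw = h10_l2[OF w] and ls = h10_l2[OF s]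
    \<comment> \<open>The a priori bound for differences: solutions with Cauchy right-hand sides
      form a Cauchy sequence.\<close>
    have dd: "nrm M (\<lambda>y. w i y - w j y) \<le> Cb * nrm M (\<lambda>y. s i y - s j y)" for i j
    proof (rule Cb(2))
      show "(\<lambda>y. w i y - w j y) \<in> h10 U" by (rule clsub_ops(2)[OF ch w w])
      show "l2 M (\<lambda>y. s i y - s j y)" by (intro l2_diff ls)
      have "aform M V (\<lambda>y. w i y - w j y) \<phi> = ip M (\<lambda>y. s i y - s j y) \<phi>" if \<phi>: "\<phi> \<in> h10 U" for \<phi>
        unfolding aform_diff[OF V lw lw h10_l2[OF \<phi>]] ip_diff_left[OF ls ls h10_l2[OF \<phi>]] we[OF \<phi>] ..
      then show "\<forall>\<phi>\<in>h10 U. aform M V (\<lambda>y. w i y - w j y) \<phi> = ip M (\<lambda>y. s i y - s j y) \<phi>" by blast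
    qed
    have Cau: "\<exists>N. \<forall>i\<ge>N. \<forall>j\<ge>N. nrm M (\<lambda>y. w i y - w j y) < e" if e: "e > 0" for e
    proof -
      have h: "e / (2 * (Cb + 1)) > 0" using e Cb(1) by simp
      obtain N where N: "\<forall>n\<ge>N. norm (nrm M (\<lambda>x. s n x - q x) - 0) < e / (2 * (Cb + 1))" using LIMSEQ_D[OF lim h] by blast
      have "nrm M (\<lambda>y. w i y - w j y) < e" if "i \<ge> N" "j \<ge> N" for i j
      proof -
        have "nrm M (\<lambda>y. s i y - s j y) \<le> nrm M (\<lambda>y. s i y - q y) + nrm M (\<lambda>y. q y - s j y)" by (intro nrm_tri ls lq)
        also have "nrm M (\<lambda>y. q y - s j y) = nrm M (\<lambda>y. s j y - q y)" by (rule nrm_diff_comm)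
        also have "nrm M (\<lambda>y. s i y - q y) + nrm M (\<lambda>y. s j y - q y) \<le> 2 * (e / (2 * (Cb + 1)))"
        proof -
          have "nrm M (\<lambda>y. s n y - q y) < e / (2 * (Cb + 1))" if "n \<ge> N" for n using N that by simp
          from this[OF that(1)] this[OF that(2)] show ?thesis by linarith
        qed
        also have "2 * (e / (2 * (Cb + 1))) = e / (Cb + 1)" using Cb(1) by (simp add: divide_simps)
        finally have "Cb * nrm M (\<lambda>y. s i y - s j y) \<le> Cb * (e / (Cb + 1))" by (rule mult_left_mono) (rule Cb(1))
        also have "\<dots> = e * (Cb / (Cb + 1))" by simp
        also have "\<dots> < e * 1" using e Cb(1) by (intro mult_strict_left_mono) auto
        finally show ?thesis using dd[of i j] by simp
      qed
      then show ?thesis by blast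
    qed
    obtain W where W: "l2 M W" "(\<lambda>k. nrm M (\<lambda>y. w k y - W y)) \<longlonglongrightarrow> 0"
      by (rule l2_complete[OF fin lw Cau]) (assumption, rule that)
    have Wh: "W \<in> h10 U" by (rule clsubD(4)[OF ch w W])
    have "aform M V W \<phi> = ip M q \<phi>" if \<phi>: "\<phi> \<in> h10 U" for \<phi>
    proof (rule LIMSEQ_unique)
      show "(\<lambda>k. aform M V (w k) \<phi>) \<longlonglongrightarrow> aform M V W \<phi>" by (rule aform_tendsto[OF V lw W h10_l2[OF \<phi>]])
      show "(\<lambda>k. aform M V (w k) \<phi>) \<longlonglongrightarrow> ip M q \<phi>" unfolding we[OF \<phi>] by (rule ip_tendsto_left[OF ls lq lim h10_l2[OF \<phi>]])
    qed
    then show "q \<in> H" unfolding H_def using qh Wh by blast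
  qed
  have "\<exists>p\<in>H. \<forall>q\<in>H. ip M f q = ip M p q"
  proof (rule riesz[OF fin H])
    show "ip M f (\<lambda>x. a x + c *\<^sub>R b x) = ip M f a + c * ip M f b" if "a \<in> H" "b \<in> H" for a b c
      using ip_add_right[OF clsubD(2)[OF H that(1)] l2_scale[OF clsubD(2)[OF H that(2)]] h10_l2[OF f(1)]] unfolding ip_scale_right .
    show "\<bar>ip M f a\<bar> \<le> nrm M f * nrm M a" if "a \<in> H" for a using ip_CS[OF h10_l2[OF f(1)] clsubD(2)[OF H that]] .
  qed
  then obtain p where p: "p \<in> H" "\<And>q. q \<in> H \<Longrightarrow> ip M f q = ip M p q" by blast
  have ph: "p \<in> h10 U" using p(1) by (simp add: H_def)
  obtain w where w: "w \<in> h10 U" "\<And>\<phi>. \<phi> \<in> h10 U \<Longrightarrow> aform M V w \<phi> = ip M p \<phi>" using p(1) by (auto simp: H_def)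
  define e where "e = (\<lambda>y. f y - p y)"
  have e: "e \<in> h10 U" unfolding e_def by (rule clsub_ops(2)[OF ch f(1) ph])
  obtain CV where CV: "CV \<ge> 0" "\<And>w x. l2 M w \<Longrightarrow> l2 M x \<Longrightarrow> \<bar>aform M V w x\<bar> \<le> CV * nrm M w * nrm M x" by (rule aform_bound[OF V]) (rule that)
  \<comment> \<open>The functional \<open>aform M V \<phi>\<close> is represented by some
    \<open>q\<close>, which lies in \<open>H\<close> by construction and is therefore orthogonal to
    \<open>e\<close>.\<close>
  have "aform M V e \<phi> = 0" if \<phi>: "\<phi> \<in> h10 U" for \<phi>
  proof -
    have "\<exists>q\<in>h10 U. \<forall>x\<in>h10 U. aform M V \<phi> x = ip M q x"
    proof (rule riesz[OF fin ch])
      show "aform M V \<phi> (\<lambda>x. a x + c *\<^sub>R b x) = aform M V \<phi> a + c * aform M V \<phi> b" if "a \<in> h10 U" "b \<in> h10 U" for a b c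
        by (rule aform_lin_right[OF V h10_l2[OF that(1)] h10_l2[OF that(2)] h10_l2[OF \<phi>]])
      show "\<bar>aform M V \<phi> a\<bar> \<le> (CV * nrm M \<phi>) * nrm M a" if "a \<in> h10 U" for a
        by (rule CV(2)[OF h10_l2[OF \<phi>] h10_l2[OF that]])
    qed
    then obtain q where q: "q \<in> h10 U" "\<And>x. x \<in> h10 U \<Longrightarrow> aform M V \<phi> x = ip M q x" by blast
    have qH: "q \<in> H" unfolding H_def using q \<phi> by blast
    have "aform M V e \<phi> = ip M q e" using q(2)[OF e] by (simp add: aform_sym)
    also have "\<dots> = ip M f q - ip M p q" unfolding e_def
      by (subst ip_diff_right[OF h10_l2[OF f(1)] h10_l2[OF ph] h10_l2[OF q(1)]]) (simp add: ip_sym[of M q])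
    also have "\<dots> = 0" using p(2)[OF qH] by simp
    finally show ?thesis .
  qed
  then have e0: "nrm M e = 0" using no_kernel e unfolding no_kernel_def by blast
  have "aform M V w \<phi> = F \<phi>" if \<phi>: "\<phi> \<in> h10 U" for \<phi>
  proof -
    have "\<bar>ip M e \<phi>\<bar> \<le> 0" using ip_CS[OF h10_l2[OF e] h10_l2[OF \<phi>]] e0 by simp
    then have "ip M f \<phi> = ip M p \<phi>" unfolding e_def ip_diff_left[OF h10_l2[OF f(1)] h10_l2[OF ph] h10_l2[OF \<phi>]] by simp
    then show ?thesis using f(2)[OF \<phi>] w(2)[OF \<phi>] by simp
  qed
  with w(1) show ?thesis by blast
qed

lemma no_kernel_0: "no_kernel (\<lambda>_. 0)"
  unfolding no_kernel_def
proof (intro ballI impI)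
  fix w assume w: "w \<in> h10 U" and z: "\<forall>\<phi>\<in>h10 U. aform M (\<lambda>_. 0) w \<phi> = 0"
  obtain C where C: "C \<ge> 0" "\<And>w. w \<in> h10 U \<Longrightarrow> nrm M (\<lambda>y. fst (w y)) \<le> C * nrm M (\<lambda>y. snd (w y))" by (rule poincare) (rule that)
  have "aform M (\<lambda>_. 0) w w = 0" using z w by blast
  then have s: "nrm M (\<lambda>y. snd (w y)) = 0" by (simp add: aform_def nrm_def)
  then have "nrm M (\<lambda>y. fst (w y)) \<le> 0" using C(2)[OF w] by simp
  then show "nrm M w = 0" using nrm_pair_le[OF h10_l2[OF w]] s nrm_nonneg[of M w] by linarith
qed

lemma no_kernel_if_no_eigenvalue:
  assumes V: "ess_bdd M V" and ne: "\<not> dirichlet_eigenvalue_0 U V" shows "no_kernel V"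
  unfolding no_kernel_def
proof (intro ballI impI)
  fix w assume w: "w \<in> h10 U" and z: "\<forall>\<phi>\<in>h10 U. aform M V w \<phi> = 0"
  note h = h1_H1[OF h10_h1[OF w]]
  have "weak_sol U V (\<lambda>y. fst (w y))"
    unfolding weak_sol_iff[OF V]
  proof (intro conjI h(1) ballI)
    fix \<phi> assume \<phi>: "\<phi> \<in> h10 U"
    have "aform M V (pr (\<lambda>y. fst (w y))) \<phi> = aform M V w \<phi>"
      by (rule aform_cong_AE[OF V h1_l2[OF H1_pr(1)[OF h(1)]] h10_l2[OF w] h10_l2[OF \<phi>] h(2)])
    then show "aform M V (pr (\<lambda>y. fst (w y))) \<phi> = 0" using z \<phi> by simp
  qed
  then have "AE y in lebesgue. y \<in> U \<longrightarrow> fst (w y) = 0" using ne h10_pr(2)[OF w] unfolding dirichlet_eigenvalue_0_def by blast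
  then have f: "AE y in M. fst (w y) = 0" by (simp add: AE_on[OF leb])
  have "AE y in M. snd (w y) = 0" by (rule h1_snd_zero[OF h10_h1[OF w] f])
  with f have "AE y in M. w y = 0" by eventually_elim (simp add: prod_eq_iff)
  then show "nrm M w = 0" using nrm_eq_0[OF h10_l2[OF w]] by simp
qed

section \<open>The indicator sequences\<close>

lemma h10_cong: "a \<in> h10 U \<Longrightarrow> l2 M b \<Longrightarrow> AE y in M. a y = b y \<Longrightarrow> b \<in> h10 U"
  by (rule clsub_cong_AE[OF clsub_h10 _ l2_meas])

lemma diff_h10:
  assumes a: "a \<in> h1 U" and b: "b \<in> h1 U" and d: "H10 U (\<lambda>y. fst (a y) - fst (b y))"
  shows "(\<lambda>y. a y - b y) \<in> h10 U"
proof -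
  let ?u = "\<lambda>y. fst (a y) - fst (b y)"
  have p: "pr ?u \<in> h10 U" "H1 U ?u" using d by (auto simp: H10_iff)
  have "AE y in M. pr ?u y = a y - b y"
    by (rule h1_unique[OF H1_pr(1)[OF p(2)] h1_diff[OF a b]]) (simp add: pr_def)
  then show ?thesis by (rule h10_cong[OF p(1) l2_diff[OF h1_l2[OF a] h1_l2[OF b]]])
qed

lemma bdry_rep_h10:
  assumes F: "bdry_rep U f F" and F': "bdry_rep U f F'"
  shows "(\<lambda>y. pr F y - pr F' y) \<in> h10 U"
proof -
  obtain K where K: "compact K" "K \<subseteq> U" "AE y in lebesgue. y \<in> U - K \<longrightarrow> F y = f y" using F by (auto simp: bdry_rep_def)
  obtain K' where K': "compact K'" "K' \<subseteq> U" "AE y in lebesgue. y \<in> U - K' \<longrightarrow> F' y = f y" using F' by (auto simp: bdry_rep_def)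
  have H: "H1 U F" "H1 U F'" using F F' by (auto simp: bdry_rep_def)
  show ?thesis
  proof (rule compact_h10[OF h1_diff[OF H1_pr(1)[OF H(1)] H1_pr(1)[OF H(2)]] compact_Un[OF K(1) K'(1)]])
    show "K \<union> K' \<subseteq> U" using K K' by blast
    have "AE y in lebesgue. y \<in> U \<longrightarrow> y \<notin> K \<union> K' \<longrightarrow> fst (pr F y - pr F' y) = 0"
      using K(3) K'(3) by eventually_elim (auto simp: pr_def)
    then show "AE y in M. y \<notin> K \<union> K' \<longrightarrow> fst (pr F y - pr F' y) = 0" by (simp add: AE_on[OF leb])
  qed
qed

text \<open>Adding \<open>w\<close> to a pair \<open>a\<close> from \<open>h1\<close> yields the
  solution with the boundary values of \<open>a\<close>.\<close>

lemma dirichlet_correction: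
  assumes V: "ess_bdd M V" and no_kernel: "no_kernel V" and a: "l2 M a"
  obtains w where "w \<in> h10 U" "\<And>\<phi>. \<phi> \<in> h10 U \<Longrightarrow> aform M V w \<phi> = - aform M V a \<phi>"
proof -
  obtain C where C: "\<And>w x. l2 M w \<Longrightarrow> l2 M x \<Longrightarrow> \<bar>aform M V w x\<bar> \<le> C * nrm M w * nrm M x" by (rule aform_bound[OF V]) (rule that)
  have "\<exists>w\<in>h10 U. \<forall>\<phi>\<in>h10 U. aform M V w \<phi> = - aform M V a \<phi>"
  proof (rule aform_solution[OF V no_kernel])
    show "- aform M V a (\<lambda>y. x y + c *\<^sub>R z y) = - aform M V a x + c * - aform M V a z" if "x \<in> h10 U" "z \<in> h10 U" for x z c
      using aform_lin_right[OF V h10_l2[OF that(1)] h10_l2[OF that(2)] a] by simp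
    show "\<bar>- aform M V a x\<bar> \<le> (C * nrm M a) * nrm M x" if "x \<in> h10 U" for x using C[OF a h10_l2[OF that]] by simp
  qed
  then show ?thesis using that by blast
qed

lemma h1_add: "a \<in> h1 U \<Longrightarrow> b \<in> h1 U \<Longrightarrow> (\<lambda>y. a y + b y) \<in> h1 U"
  using h1_lin[of a b 1] by simp

lemma aform_add:
  assumes "ess_bdd M V" "l2 M w" "l2 M w'" "l2 M x"
  shows "aform M V (\<lambda>y. w y + w' y) x = aform M V w x + aform M V w' x"
  using aform_lin[OF assms, of 1] by simp

lemma dir_sol_ex:
  assumes V: "ess_bdd M V" and no_kernel: "no_kernel V" and f: "H1 U f" shows "\<exists>u. dir_sol U V f u"
proof -
  note pf = H1_pr(1)[OF f]
  obtain w where w: "w \<in> h10 U" "\<And>\<phi>. \<phi> \<in> h10 U \<Longrightarrow> aform M V w \<phi> = - aform M V (pr f) \<phi>"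
    by (rule dirichlet_correction[OF V no_kernel h1_l2[OF pf]]) (rule that)
  have s: "(\<lambda>y. pr f y + w y) \<in> h1 U" by (rule h1_add[OF pf h10_h1[OF w(1)]])
  let ?u = "\<lambda>y. f y + fst (w y)"
  have H: "H1 U ?u" and ae: "AE y in M. pr ?u y = pr f y + w y" using h1_H1[OF s] by (simp_all add: pr_def)
  have "weak_sol U V ?u" unfolding weak_sol_iff[OF V]
  proof (intro conjI H ballI)
    fix \<phi> assume \<phi>: "\<phi> \<in> h10 U"
    have "aform M V (pr ?u) \<phi> = aform M V (\<lambda>y. pr f y + w y) \<phi>"
      by (rule aform_cong_AE[OF V h1_l2[OF H1_pr(1)[OF H]] h1_l2[OF s] h10_l2[OF \<phi>] ae])
    also have "\<dots> = 0" using aform_add[OF V h1_l2[OF pf] h10_l2[OF w(1)] h10_l2[OF \<phi>]] w(2)[OF \<phi>] by simp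
    finally show "aform M V (pr ?u) \<phi> = 0" .
  qed
  moreover have "H10 U (\<lambda>y. ?u y - f y)" using h10_pr(2)[OF w(1)] by simp
  ultimately show ?thesis unfolding dir_sol_def by blast
qed

lemma LINT_aform:
  assumes V: "ess_bdd M V" and u: "H1 U u" and g: "H1 U g"
  shows "(LINT y:U|lebesgue. wgrad U u y \<bullet> wgrad U g y + V y * u y * g y) = aform M V (pr u) (pr g)"
proof -
  note l = h1_l2[OF H1_pr(1)[OF u]] h1_l2[OF H1_pr(1)[OF g]]
  have i1: "integrable M (\<lambda>y. snd (pr u y) \<bullet> snd (pr g y))" by (intro l2_inner l2_snd l)
  have i2: "integrable M (\<lambda>y. (V y * fst (pr u y)) \<bullet> fst (pr g y))" by (intro l2_inner ess_bdd_l2 V l2_fst l)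
  have "aform M V (pr u) (pr g) = (LINT y|M. snd (pr u y) \<bullet> snd (pr g y) + (V y * fst (pr u y)) \<bullet> fst (pr g y))"
    unfolding aform_def ip_def by (rule Bochner_Integration.integral_add[OF i1 i2, symmetric])
  then show ?thesis unfolding LINT_on[OF leb] by (simp add: pr_def)
qed

text \<open>The choices inside \<open>DtN_form\<close> do not influence the value: representatives
  of the same boundary values differ by elements of \<open>h10\<close>, the solution is unique
  because the kernel is trivial, and changing the second argument within \<open>h10\<close> has no
  effect since the first one solves the equation.\<close>

lemma DtN_form_eq:
  assumes V: "ess_bdd M V" and no_kernel: "no_kernel V" and F0: "bdry_rep U f F0" and G0: "bdry_rep U g G0"
    and a: "a \<in> h1 U" "(\<lambda>y. a y - pr F0 y) \<in> h10 U" "\<And>\<phi>. \<phi> \<in> h10 U \<Longrightarrow> aform M V a \<phi> = 0"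
    and e: "e \<in> h1 U" "(\<lambda>y. e y - pr G0 y) \<in> h10 U"
  shows "DtN_form U V f g = aform M V a e"
proof -
  note ch = clsub_h10
  define F where "F = (SOME u. bdry_rep U f u)"
  define Gv where "Gv = (SOME v. bdry_rep U g v)"
  define u where "u = (SOME u. dir_sol U V F u)"
  have F: "bdry_rep U f F" unfolding F_def by (rule someI[of "bdry_rep U f"]) (rule F0)
  have G: "bdry_rep U g Gv" unfolding Gv_def by (rule someI[of "bdry_rep U g"]) (rule G0)
  have HF: "H1 U F" "H1 U F0" "H1 U Gv" "H1 U G0" using F G F0 G0 by (auto simp: bdry_rep_def)
  obtain u' where "dir_sol U V F u'" using dir_sol_ex[OF V no_kernel HF(1)] by blast
  then have u: "dir_sol U V F u" unfolding u_def by (rule someI[of "dir_sol U V F"])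
  then have ws: "H1 U u" "\<And>\<phi>. \<phi> \<in> h10 U \<Longrightarrow> aform M V (pr u) \<phi> = 0" and h: "H10 U (\<lambda>y. u y - F y)"
    using weak_sol_iff[OF V] by (auto simp: dir_sol_def)
  note pu = H1_pr(1)[OF ws(1)] and pF = H1_pr(1)[OF HF(1)] and pF0 = H1_pr(1)[OF HF(2)] and pG = H1_pr(1)[OF HF(3)] and pG0 = H1_pr(1)[OF HF(4)]
  have 1: "(\<lambda>y. pr u y - pr F y) \<in> h10 U" by (rule diff_h10[OF pu pF]) (use h in \<open>simp add: pr_def\<close>)
  have 2: "(\<lambda>y. pr F y - pr F0 y) \<in> h10 U" by (rule bdry_rep_h10[OF F F0])
  have "(\<lambda>y. ((pr u y - pr F y) + (pr F y - pr F0 y)) - (a y - pr F0 y)) \<in> h10 U"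
    by (rule clsub_ops(2)[OF ch clsub_ops(1)[OF ch 1 2] a(2)])
  then have 3: "(\<lambda>y. pr u y - a y) \<in> h10 U" by simp
  have "\<forall>\<phi>\<in>h10 U. aform M V (\<lambda>y. pr u y - a y) \<phi> = 0"
    using aform_diff[OF V h1_l2[OF pu] h1_l2[OF a(1)] h10_l2] ws(2) a(3) by simp
  then have "nrm M (\<lambda>y. pr u y - a y) = 0" using no_kernel 3 unfolding no_kernel_def by blast
  then have "AE y in M. pr u y - a y = 0" using nrm_eq_0[OF h10_l2[OF 3]] by simp
  then have ae: "AE y in M. pr u y = a y" by eventually_elim simp
  have 4: "(\<lambda>y. pr G0 y - pr Gv y) \<in> h10 U" by (rule bdry_rep_h10[OF G0 G])
  have "(\<lambda>y. (e y - pr G0 y) + (pr G0 y - pr Gv y)) \<in> h10 U" by (rule clsub_ops(1)[OF ch e(2) 4])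
  then have 5: "(\<lambda>y. e y - pr Gv y) \<in> h10 U" by simp
  have "DtN_form U V f g = aform M V (pr u) (pr Gv)"
    unfolding DtN_form_def Let_def F_def[symmetric] Gv_def[symmetric] u_def[symmetric] by (rule LINT_aform[OF V ws(1) HF(3)])
  also have "\<dots> = aform M V (pr u) e"
    using ws(2)[OF 5] aform_diff_right[OF V h1_l2[OF e(1)] h1_l2[OF pG] h1_l2[OF pu]] by simp
  also have "\<dots> = aform M V a e" by (rule aform_cong_AE[OF V h1_l2[OF pu] h1_l2[OF a(1)] h1_l2[OF e(1)] ae])
  finally show ?thesis .
qed

text \<open>Alessandrini's identity. Here \<open>a\<close> solves the equation with
  \<open>V\<close>, \<open>b\<close> is harmonic with the same boundary values, and \<open>e\<close>
  is harmonic with the boundary values of \<open>g\<close>. The gradient terms cancel because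
  \<open>a - b\<close> lies in \<open>h10\<close>.\<close>

lemma DtN_diff_eq:
  assumes V: "ess_bdd M V" and no_kernel: "no_kernel V" and F0: "bdry_rep U f F0" and G0: "bdry_rep U g G0"
    and a: "a \<in> h1 U" "(\<lambda>y. a y - pr F0 y) \<in> h10 U" "\<And>\<phi>. \<phi> \<in> h10 U \<Longrightarrow> aform M V a \<phi> = 0"
    and b: "b \<in> h1 U" "(\<lambda>y. b y - pr F0 y) \<in> h10 U" "\<And>\<phi>. \<phi> \<in> h10 U \<Longrightarrow> aform M (\<lambda>_. 0) b \<phi> = 0"
    and e: "e \<in> h1 U" "(\<lambda>y. e y - pr G0 y) \<in> h10 U" "\<And>\<phi>. \<phi> \<in> h10 U \<Longrightarrow> aform M (\<lambda>_. 0) e \<phi> = 0"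
  shows "DtN_diff U V f g = ip M (\<lambda>y. V y * fst (a y)) (\<lambda>y. fst (e y))"
proof -
  have d1: "DtN_form U V f g = aform M V a e" by (rule DtN_form_eq[OF V no_kernel F0 G0 a e(1,2)])
  have d2: "DtN_form U (\<lambda>_. 0) f g = aform M (\<lambda>_. 0) b e" by (rule DtN_form_eq[OF ess_bdd_0 no_kernel_0 F0 G0 b e(1,2)])
  have "(\<lambda>y. (a y - pr F0 y) - (b y - pr F0 y)) \<in> h10 U" by (rule clsub_ops(2)[OF clsub_h10 a(2) b(2)])
  then have "(\<lambda>y. a y - b y) \<in> h10 U" by simp
  from e(3)[OF this] have "aform M (\<lambda>_. 0) a e = aform M (\<lambda>_. 0) b e"
    using aform_diff_right[OF ess_bdd_0 h1_l2[OF a(1)] h1_l2[OF b(1)] h1_l2[OF e(1)]] by (simp add: aform_sym[of M _ e])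
  then show ?thesis unfolding DtN_diff_def d1 d2 by (simp add: aform_def)
qed

text \<open>\<open>Gn\<close> need not be an \<open>H1\<close> function on \<open>U\<close>; its
  boundary values are represented by \<open>E - v n\<close>, where \<open>E\<close> agrees with the
  dipole off \<open>K\<close>. The pairs \<open>e\<close> and \<open>q\<close> are the harmonic
  function and the solution for \<open>V\<close> with the boundary values of \<open>E\<close>; they
  do not depend on \<open>n\<close>.\<close>

lemma indicator_formulas:
  assumes V: "ess_bdd M V" and no_kernel: "no_kernel V" and harm: "\<And>n. weakly_harmonic U (v n)"
    and E: "c1 E" and K: "compact K" "K \<subseteq> U" "\<And>y. y \<notin> K \<Longrightarrow> E y = dG j (y - x)"
  obtains w e0 uE where "\<And>n::nat. w n \<in> h10 U"
    "\<And>n \<phi>. \<phi> \<in> h10 U \<Longrightarrow> aform M V (w n) \<phi> = - ip M (\<lambda>y. V y * v n y) (\<lambda>y. fst (\<phi> y))"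
    "l2 M e0" "l2 M uE" "\<And>n. l2 M (v n)"
    "\<And>n. probe_ind U V v n = ip M (\<lambda>y. V y * (v n y + fst (w n y))) (v n)"
    "\<And>n. singular_sources_ind U V j x v n = - ip M (\<lambda>y. V y * (v n y + fst (w n y))) (\<lambda>y. e0 y - v n y)"
    "\<And>n. completely_integrated_ind U V j x v n = ip M (\<lambda>y. V y * (uE y - (v n y + fst (w n y)))) (\<lambda>y. e0 y - v n y)"
proof -
  note ch = clsub_h10
  have Hv: "H1 U (v n)" and hz: "\<phi> \<in> h10 U \<Longrightarrow> aform M (\<lambda>_. 0) (pr (v n)) \<phi> = 0" for n \<phi>
    using harm[of n] unfolding weakly_harmonic_def weak_sol_iff[OF ess_bdd_0] by auto
  have pv: "pr (v n) \<in> h1 U" for n by (rule H1_pr(1)[OF Hv])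
  note lpv = h1_l2[OF pv]
  have "\<forall>n. \<exists>w. w \<in> h10 U \<and> (\<forall>\<phi>\<in>h10 U. aform M V w \<phi> = - aform M V (pr (v n)) \<phi>)"
  proof
    fix n
    obtain w where "w \<in> h10 U" "\<And>\<phi>. \<phi> \<in> h10 U \<Longrightarrow> aform M V w \<phi> = - aform M V (pr (v n)) \<phi>"
      by (rule dirichlet_correction[OF V no_kernel lpv]) (rule that)
    then show "\<exists>w. w \<in> h10 U \<and> (\<forall>\<phi>\<in>h10 U. aform M V w \<phi> = - aform M V (pr (v n)) \<phi>)" by blast
  qed
  from choice[OF this] obtain w where ww: "\<forall>n. w n \<in> h10 U \<and> (\<forall>\<phi>\<in>h10 U. aform M V (w n) \<phi> = - aform M V (pr (v n)) \<phi>)" ..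
  have w: "w n \<in> h10 U" and weq: "\<phi> \<in> h10 U \<Longrightarrow> aform M V (w n) \<phi> = - aform M V (pr (v n)) \<phi>" for n \<phi>
    using spec[OF ww, of n] by auto
  note lw = h10_l2[OF w] and w1 = h10_h1[OF w]
  have tE: "jet E \<in> h1 U" by (rule c1_h1[OF E])
  obtain w0 where w0: "w0 \<in> h10 U" "\<And>\<phi>. \<phi> \<in> h10 U \<Longrightarrow> aform M (\<lambda>_. 0) w0 \<phi> = - aform M (\<lambda>_. 0) (jet E) \<phi>"
    by (rule dirichlet_correction[OF ess_bdd_0 no_kernel_0 h1_l2[OF tE]]) (rule that)
  define e where "e = (\<lambda>y. jet E y + w0 y)"
  have e: "e \<in> h1 U" unfolding e_def by (rule h1_add[OF tE h10_h1[OF w0(1)]])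
  have eh: "aform M (\<lambda>_. 0) e \<phi> = 0" if "\<phi> \<in> h10 U" for \<phi>
    unfolding e_def aform_add[OF ess_bdd_0 h1_l2[OF tE] h10_l2[OF w0(1)] h10_l2[OF that]] w0(2)[OF that] by simp
  obtain wE where wE: "wE \<in> h10 U" "\<And>\<phi>. \<phi> \<in> h10 U \<Longrightarrow> aform M V wE \<phi> = - aform M V e \<phi>"
    by (rule dirichlet_correction[OF V no_kernel h1_l2[OF e]]) (rule that)
  define q where "q = (\<lambda>y. e y + wE y)"
  have q: "q \<in> h1 U" unfolding q_def by (rule h1_add[OF e h10_h1[OF wE(1)]])
  have qh: "aform M V q \<phi> = 0" if "\<phi> \<in> h10 U" for \<phi>
    unfolding q_def aform_add[OF V h1_l2[OF e] h10_l2[OF wE(1)] h10_l2[OF that]] wE(2)[OF that] by simp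
  define a where "a n = (\<lambda>y. pr (v n) y + w n y)" for n
  have a: "a n \<in> h1 U" for n unfolding a_def by (rule h1_add[OF pv w1])
  have ah: "aform M V (a n) \<phi> = 0" if "\<phi> \<in> h10 U" for \<phi> n
    unfolding a_def aform_add[OF V lpv lw h10_l2[OF that]] weq[OF that] by simp
  have rv: "bdry_rep U (v n) (v n)" for n unfolding bdry_rep_def using Hv by (intro conjI exI[of _ "{}"]) auto
  define g where "g n = (\<lambda>y. E y - v n y)" for n
  have tg: "(\<lambda>y. jet E y - pr (v n) y) \<in> h1 U" for n by (rule h1_diff[OF tE pv])
  have Hg: "H1 U (g n)" and gae: "AE y in M. pr (g n) y = jet E y - pr (v n) y" for n
    using h1_H1[OF tg, of n] by (simp_all add: g_def jet_def pr_def)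
  have rg: "bdry_rep U (Gn j x v n) (g n)" for n
    unfolding bdry_rep_def
  proof (intro conjI Hg exI[of _ K] K)
    show "AE y in lebesgue. y \<in> U - K \<longrightarrow> g n y = Gn j x v n y" by (rule AE_I2) (auto simp: g_def Gn_def K(3))
  qed
  have av: "(\<lambda>y. a n y - pr (v n) y) \<in> h10 U" for n using w[of n] by (simp add: a_def)
  have vv: "(\<lambda>y. pr (v n) y - pr (v n) y) \<in> h10 U" for n using clsubD(1)[OF ch] by simp
  note lpg = h1_l2[OF H1_pr(1)[OF Hg]]
  \<comment> \<open>The harmonic pair with the boundary values of \<open>Gn\<close>; its counterpart
    for \<open>V\<close> is \<open>q - a n\<close>.\<close>
  have eg1: "(\<lambda>y. e y - pr (v n) y) \<in> h1 U" for n by (rule h1_diff[OF e pv])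
  have eg2: "(\<lambda>y. (e y - pr (v n) y) - pr (g n) y) \<in> h10 U" for n
    by (rule h10_cong[OF w0(1) l2_diff[OF h1_l2[OF eg1] lpg]]) (use gae[of n] in \<open>auto simp: e_def elim!: eventually_mono\<close>)
  have eg3: "aform M (\<lambda>_. 0) (\<lambda>y. e y - pr (v n) y) \<phi> = 0" if "\<phi> \<in> h10 U" for n \<phi>
    unfolding aform_diff[OF ess_bdd_0 h1_l2[OF e] lpv h10_l2[OF that]] eh[OF that] hz[OF that] by simp
  have qa1: "(\<lambda>y. q y - a n y) \<in> h1 U" for n by (rule h1_diff[OF q a])
  have qa2: "(\<lambda>y. (q y - a n y) - pr (g n) y) \<in> h10 U" for n
    by (rule h10_cong[OF clsub_ops(2)[OF ch clsub_ops(1)[OF ch w0(1) wE(1)] w] l2_diff[OF h1_l2[OF qa1] lpg]])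
       (use gae[of n] in \<open>auto simp: e_def q_def a_def elim!: eventually_mono\<close>)
  have qa3: "aform M V (\<lambda>y. q y - a n y) \<phi> = 0" if "\<phi> \<in> h10 U" for n \<phi>
    unfolding aform_diff[OF V h1_l2[OF q] h1_l2[OF a] h10_l2[OF that]] qh[OF that] ah[OF that] by simp
  have P: "probe_ind U V v n = ip M (\<lambda>y. V y * fst (a n y)) (\<lambda>y. fst (pr (v n) y))" for n
    unfolding probe_ind_def by (rule DtN_diff_eq[OF V no_kernel rv rv a av ah pv vv hz pv vv hz])
  have S: "DtN_diff U V (v n) (Gn j x v n) = ip M (\<lambda>y. V y * fst (a n y)) (\<lambda>y. fst (e y - pr (v n) y))" for n
    by (rule DtN_diff_eq[OF V no_kernel rv rg a av ah pv vv hz eg1 eg2 eg3])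
  have C: "DtN_diff U V (Gn j x v n) (Gn j x v n) = ip M (\<lambda>y. V y * fst (q y - a n y)) (\<lambda>y. fst (e y - pr (v n) y))" for n
    by (rule DtN_diff_eq[OF V no_kernel rg rg qa1 qa2 qa3 eg1 eg2 eg3 eg1 eg2 eg3])
  show ?thesis
  proof (rule that[of w "\<lambda>y. fst (e y)" "\<lambda>y. fst (q y)"])
    show "w n \<in> h10 U" for n by (rule w)
    show "l2 M (\<lambda>y. fst (e y))" "l2 M (\<lambda>y. fst (q y))" by (intro l2_fst h1_l2 e q)+
    show "l2 M (v n)" for n by (rule H1_pr(2)[OF Hv])
    show "aform M V (w n) \<phi> = - ip M (\<lambda>y. V y * v n y) (\<lambda>y. fst (\<phi> y))" if "\<phi> \<in> h10 U" for n \<phi>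
      using weq[OF that, of n] hz[OF that, of n] by (simp add: aform_def pr_def)
    show "probe_ind U V v n = ip M (\<lambda>y. V y * (v n y + fst (w n y))) (v n)" for n
      unfolding P by (simp add: a_def pr_def)
    show "singular_sources_ind U V j x v n = - ip M (\<lambda>y. V y * (v n y + fst (w n y))) (\<lambda>y. fst (e y) - v n y)" for n
      unfolding singular_sources_ind_def S by (simp add: a_def pr_def)
    show "completely_integrated_ind U V j x v n = ip M (\<lambda>y. V y * (fst (q y) - (v n y + fst (w n y)))) (\<lambda>y. fst (e y) - v n y)" for n
      unfolding completely_integrated_ind_def C by (simp add: a_def pr_def)
  qed
qed

text \<open>All three expressions equal \<open>P n\<close>, the integral of
  \<open>V * (vD n)\<^sup>2\<close>, up to terms that are either quadratic in \<open>a n\<close>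
  with a factor \<open>\<epsilon> n\<close> tending to zero or of at most linear growth in
  \<open>a n\<close>. The factor \<open>s\<close> is the sign of the jump, so both signs are treated
  together.\<close>

lemma indicator_limits:
  fixes v :: "nat \<Rightarrow> real^3 \<Rightarrow> real" and D :: "(real^3) set"
  defines "vD \<equiv> \<lambda>n y. indicator D y * v n y"
  defines "a \<equiv> \<lambda>n. nrm M (vD n)"
  assumes V: "ess_bdd M V" and no_kernel: "no_kernel V"
    and w: "\<And>n. w n \<in> h10 U"
    and weq: "\<And>n \<phi>. \<phi> \<in> h10 U \<Longrightarrow> aform M V (w n) \<phi> = - ip M (\<lambda>y. V y * v n y) (\<lambda>y. fst (\<phi> y))"
    and le: "l2 M e0" and lq: "l2 M uE" and lv: "\<And>n. l2 M (v n)"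
    and D: "D \<in> sets lebesgue" and V0: "AE y in M. y \<notin> D \<longrightarrow> V y = 0"
    and s: "\<bar>s\<bar> = 1" and C: "C > 0" and VC: "AE y in M. y \<in> D \<longrightarrow> C \<le> s * V y"
    and ainf: "filterlim a at_top sequentially"
    and weak: "\<And>\<phi>. l2 M \<phi> \<Longrightarrow> (\<lambda>n. ip M (vD n) \<phi> / a n) \<longlonglongrightarrow> 0"
  shows "filterlim (\<lambda>n. s * ip M (\<lambda>y. V y * (v n y + fst (w n y))) (v n)) at_top sequentially"
    "filterlim (\<lambda>n. s * (- ip M (\<lambda>y. V y * (v n y + fst (w n y))) (\<lambda>y. e0 y - v n y))) at_top sequentially"
    "filterlim (\<lambda>n. s * ip M (\<lambda>y. V y * (uE y - (v n y + fst (w n y)))) (\<lambda>y. e0 y - v n y)) at_top sequentially"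
proof -
  obtain B where B: "B \<ge> 0" "\<And>f. l2 M f \<Longrightarrow> nrm M (\<lambda>y. V y * f y) \<le> B * nrm M f" by (rule ess_bdd_bound[OF V]) (rule that)
  have iD: "(indicator D :: real^3 \<Rightarrow> real) \<in> borel_measurable M" using D by (intro measurable_restrict_space1 borel_measurable_indicator)
  have lD: "l2 M (\<lambda>y. indicator D y * f y)" if "l2 M f" for f :: "real^3 \<Rightarrow> real"
  proof (rule l2_bounded_by[OF that])
    show "(\<lambda>y. indicator D y * f y) \<in> borel_measurable M" by (intro borel_measurable_times iD l2_meas[OF that])
    show "norm (indicator D y * f y) \<le> norm (f y)" for y by (simp add: indicator_def)
  qed
  have lvD: "l2 M (vD n)" for n unfolding vD_def by (rule lD[OF lv])
  have cutl: "ip M (\<lambda>y. V y * f y) g = ip M (\<lambda>y. V y * (indicator D y * f y)) g"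
    and cutr: "ip M (\<lambda>y. V y * f y) g = ip M (\<lambda>y. V y * f y) (\<lambda>y. indicator D y * g y)" if "l2 M f" "l2 M g" for f g
  proof -
    show "ip M (\<lambda>y. V y * f y) g = ip M (\<lambda>y. V y * (indicator D y * f y)) g"
      by (rule ip_cong_AE[OF ess_bdd_l2[OF V that(1)] ess_bdd_l2[OF V lD[OF that(1)]] that(2,2)]) (use V0 in \<open>auto simp: indicator_def elim!: eventually_mono\<close>)
    have "ip M (\<lambda>y. V y * f y) g = (LINT y|M. (V y * f y) * g y)" by (simp add: ip_real)
    also have "\<dots> = (LINT y|M. (V y * f y) * (indicator D y * g y))"
    proof (rule integral_cong_AE)
      show "(\<lambda>y. (V y * f y) * g y) \<in> borel_measurable M" "(\<lambda>y. (V y * f y) * (indicator D y * g y)) \<in> borel_measurable M"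
        using l2_meas[OF ess_bdd_l2[OF V that(1)]] l2_meas[OF that(2)] l2_meas[OF lD[OF that(2)]] by (auto intro: borel_measurable_times)
      show "AE y in M. (V y * f y) * g y = (V y * f y) * (indicator D y * g y)" using V0 by eventually_elim (auto simp: indicator_def)
    qed
    finally show "ip M (\<lambda>y. V y * f y) g = ip M (\<lambda>y. V y * f y) (\<lambda>y. indicator D y * g y)" by (simp add: ip_real)
  qed
  have lw: "l2 M (w n)" for n by (rule h10_l2[OF w])
  have lfw: "l2 M (\<lambda>y. fst (w n y))" for n by (rule l2_fst[OF lw])
  have Vv: "ip M (\<lambda>y. V y * v n y) g = ip M (\<lambda>y. V y * vD n y) g" if "l2 M g" for n g
    unfolding vD_def by (rule cutl[OF lv that])
  have a0: "a n \<ge> 0" for n by (simp add: a_def)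
  \<comment> \<open>Division by zero gives zero, so \<open>c n * a n \<le> 1\<close> holds for every
    \<open>n\<close>, also where \<open>a n\<close> vanishes.\<close>
  define c where "c n = 1 / a n" for n
  have c0: "c n \<ge> 0" for n by (simp add: c_def a0)
  have ca: "c n * a n \<le> 1" for n by (cases "a n = 0") (auto simp: c_def)
  define f where "f n = (\<lambda>y. (- c n) *\<^sub>R (V y * vD n y))" for n
  have lf: "l2 M (f n)" for n unfolding f_def by (intro l2_scale ess_bdd_l2 V lvD)
  have nf: "nrm M (f n) \<le> B" for n
  proof -
    have "nrm M (f n) = c n * nrm M (\<lambda>y. V y * vD n y)" unfolding f_def nrm_scale using c0[of n] by simp
    also have "\<dots> \<le> c n * (B * a n)" unfolding a_def by (intro mult_left_mono B lvD c0)
    also have "\<dots> = B * (c n * a n)" by simp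
    also have "\<dots> \<le> B * 1" by (intro mult_left_mono ca B)
    finally show ?thesis by simp
  qed
  define W where "W n = (\<lambda>y. c n *\<^sub>R w n y)" for n
  have W: "W n \<in> h10 U" for n unfolding W_def by (rule clsub_ops(3)[OF clsub_h10 w])
  have Weq: "aform M V (W n) \<phi> = ip M (f n) (\<lambda>y. fst (\<phi> y))" if \<phi>: "\<phi> \<in> h10 U" for n \<phi>
  proof -
    have "aform M V (W n) \<phi> = c n * aform M V (w n) \<phi>"
      using aform_lin[OF V l2_zero lw h10_l2[OF \<phi>], of "c n" n] unfolding W_def by (simp add: aform_def)
    also have "\<dots> = - c n * ip M (\<lambda>y. V y * vD n y) (\<lambda>y. fst (\<phi> y))"
      unfolding weq[OF \<phi>] Vv[OF l2_fst[OF h10_l2[OF \<phi>]]] by simp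
    finally show ?thesis unfolding f_def ip_scale_left .
  qed
  obtain Cb where Cb: "Cb \<ge> 0" "\<And>w q. w \<in> h10 U \<Longrightarrow> l2 M q \<Longrightarrow> \<forall>\<phi>\<in>h10 U. aform M V w \<phi> = ip M q \<phi> \<Longrightarrow> nrm M w \<le> Cb * nrm M q"
    by (rule bounded_below[OF V no_kernel]) (rule that)
  \<comment> \<open>The a priori bound expects a pair on the right-hand side; one acting on values
    only has second component zero.\<close>
  have nW: "nrm M (W n) \<le> Cb * B" for n
  proof -
    have lp: "l2 M (\<lambda>y. (f n y, 0::real^3))" by (intro l2_pair lf l2_zero)
    have "nrm M (W n) \<le> Cb * nrm M (\<lambda>y. (f n y, 0::real^3))"
      by (rule Cb(2)[OF W lp]) (simp add: Weq, simp add: ip_def inner_prod_def)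
    also have "nrm M (\<lambda>y. (f n y, 0::real^3)) = nrm M (f n)" by (simp add: nrm_def ip_def inner_prod_def)
    also have "Cb * nrm M (f n) \<le> Cb * B" by (intro mult_left_mono nf Cb)
    finally show ?thesis .
  qed
  have fweak: "(\<lambda>n. ip M (f n) (\<lambda>y. fst (\<phi> y))) \<longlonglongrightarrow> 0" if \<phi>: "\<phi> \<in> h10 U" for \<phi>
  proof -
    have l: "l2 M (\<lambda>y. V y * fst (\<phi> y))" by (intro ess_bdd_l2 V l2_fst h10_l2[OF \<phi>])
    have "ip M (f n) (\<lambda>y. fst (\<phi> y)) = - (ip M (vD n) (\<lambda>y. V y * fst (\<phi> y)) / a n)" for n
      unfolding f_def ip_scale_left by (simp add: c_def ip_real ac_simps)
    then show ?thesis using tendsto_minus[OF weak[OF l]] by simp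
  qed
  \<comment> \<open>Every subsequence has a further one along which the normalised corrections tend
    to zero, by the compactness argument with weakly null \<open>f\<close>.\<close>
  have "(\<lambda>n. nrm M (W n)) \<longlonglongrightarrow> 0"
  proof (rule subseq_null)
    fix t :: "nat \<Rightarrow> nat" assume t: "strict_mono t"
    show "\<exists>r::nat \<Rightarrow> nat. strict_mono r \<and> (\<lambda>k. nrm M (W (t (r k)))) \<longlonglongrightarrow> 0"
    proof (rule null_subsequence[where w = "\<lambda>n. W (t n)" and f = "\<lambda>n. f (t n)" and q = "\<lambda>n y. 0" and Bf = B and B = "Cb * B", OF V no_kernel])
      show "(\<lambda>n. ip M (f (t n)) (\<lambda>y. fst (\<phi> y))) \<longlonglongrightarrow> 0" if "\<phi> \<in> h10 U" for \<phi>
        using LIMSEQ_subseq_LIMSEQ[OF fweak[OF that] t] by (simp add: o_def)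
    qed (use W nW lf nf Weq in auto)
  qed
  note W0 = this
  define \<epsilon> where "\<epsilon> n = nrm M (W n)" for n
  have e0: "\<epsilon> n \<ge> 0" for n by (simp add: \<epsilon>_def)
  have we: "nrm M (\<lambda>y. fst (w n y)) \<le> \<epsilon> n * a n" if "a n > 0" for n
  proof -
    have "\<epsilon> n = c n * nrm M (w n)" unfolding \<epsilon>_def W_def nrm_scale using c0[of n] by simp
    then have "\<epsilon> n * a n = nrm M (w n)" using that by (simp add: c_def)
    then show ?thesis using nrm_fst[OF lw, of n] by simp
  qed
  define P where "P n = ip M (\<lambda>y. V y * vD n y) (vD n)" for n
  have sP: "C * (a n)\<^sup>2 \<le> s * P n" for n
  proof -
    have i1: "integrable M (\<lambda>y. C * (vD n y * vD n y))" using l2_inner[OF lvD lvD, of n n] by simp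
    have i2: "integrable M (\<lambda>y. s * ((V y * vD n y) * vD n y))" using l2_inner[OF ess_bdd_l2[OF V lvD] lvD, of n n] by simp
    have "(LINT y|M. C * (vD n y * vD n y)) \<le> (LINT y|M. s * ((V y * vD n y) * vD n y))"
    proof (rule integral_mono_AE[OF i1 i2])
      show "AE y in M. C * (vD n y * vD n y) \<le> s * ((V y * vD n y) * vD n y)" using VC
      proof eventually_elim
        case (elim y)
        show ?case
        proof (cases "y \<in> D")
          case True
          then have "C * (vD n y * vD n y) \<le> (s * V y) * (vD n y * vD n y)" using elim by (intro mult_right_mono) auto
          then show ?thesis by (simp add: ac_simps)
        qed (simp add: vD_def)
      qed
    qed
    then show ?thesis unfolding P_def a_def nrm_sq ip_real by simp
  qed
  \<comment> \<open>One constant for all pairings with the fixed functions \<open>e0\<close> and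
    \<open>uE\<close>.\<close>
  define K where "K = B * nrm M e0 + B * nrm M uE + B * nrm M uE * nrm M e0"
  have K0: "K \<ge> 0" unfolding K_def using B by (simp add: add_nonneg_nonneg)
  have prodb: "\<bar>ip M (\<lambda>y. V y * f y) g\<bar> \<le> B * nrm M f * nrm M g" if "l2 M f" "l2 M g" for f g
  proof -
    have "\<bar>ip M (\<lambda>y. V y * f y) g\<bar> \<le> nrm M (\<lambda>y. V y * f y) * nrm M g" by (intro ip_CS ess_bdd_l2 V that)
    also have "\<dots> \<le> (B * nrm M f) * nrm M g" by (intro mult_right_mono B that) simp
    finally show ?thesis .
  qed
  have dist: "ip M (\<lambda>y. V y * (f y + g y)) h = ip M (\<lambda>y. V y * f y) h + ip M (\<lambda>y. V y * g y) h"
    "ip M (\<lambda>y. V y * (f y - g y)) h = ip M (\<lambda>y. V y * f y) h - ip M (\<lambda>y. V y * g y) h" if "l2 M f" "l2 M g" "l2 M h" for f g h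
    unfolding distrib_left right_diff_distrib
    by (rule ip_add_left[OF ess_bdd_l2[OF V that(1)] ess_bdd_l2[OF V that(2)] that(3)], rule ip_diff_left[OF ess_bdd_l2[OF V that(1)] ess_bdd_l2[OF V that(2)] that(3)])
  define bnd where "bnd n = B * \<epsilon> n * (a n)\<^sup>2 + K * (1 + a n) * (1 + \<epsilon> n)" for n
  have final: "filterlim (\<lambda>n. s * (P n + R n)) at_top sequentially" if R: "\<And>n. a n > 0 \<Longrightarrow> \<bar>R n\<bar> \<le> bnd n" for R
  proof (rule filterlim_at_top_mono[OF ainf])
    \<comment> \<open>The bound on \<open>\<epsilon> n\<close> caps the quadratic error by
      \<open>C / 4 * (a n)\<^sup>2\<close>. The lower bound on \<open>a n\<close> below makes the
      linear error plus \<open>a n\<close> at most \<open>C / 2 * (a n)\<^sup>2\<close>, so a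
      quarter of the main term is left over.\<close>
    have h: "min 1 (C / (4 * (B + 1))) > 0" using C B by simp
    have ev1: "eventually (\<lambda>n. \<epsilon> n < min 1 (C / (4 * (B + 1)))) sequentially"
      using order_tendstoD(2)[OF W0 h] by (simp add: \<epsilon>_def)
    have ev2: "eventually (\<lambda>n. a n \<ge> max 1 (2 * (4 * K + 1) / C)) sequentially"
      using ainf unfolding filterlim_at_top by blast
    show "eventually (\<lambda>n. a n \<le> s * (P n + R n)) sequentially" using ev1 ev2
    proof eventually_elim
      case (elim n)
      then have a1: "a n \<ge> 1" "a n > 0" and aC: "2 * (4 * K + 1) \<le> C * a n" and e1: "\<epsilon> n \<le> 1" and eC: "\<epsilon> n * (4 * (B + 1)) \<le> C"
        using C B by (auto simp: field_simps)
      have "B * \<epsilon> n \<le> C / 4" using eC B(1) e0[of n] by (simp add: algebra_simps)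
      then have 1: "B * \<epsilon> n * (a n)\<^sup>2 \<le> C / 4 * (a n)\<^sup>2" by (rule mult_right_mono) simp
      have "K * (1 + a n) * (1 + \<epsilon> n) \<le> K * (2 * a n) * 2"
        using K0 a1 e1 e0[of n] by (intro mult_mono mult_left_mono) auto
      then have 2: "K * (1 + a n) * (1 + \<epsilon> n) \<le> 4 * K * a n" by simp
      have 3: "(4 * K + 1) * a n \<le> C / 2 * (a n)\<^sup>2"
        using mult_right_mono[OF aC, of "a n"] a1 by (simp add: power2_eq_square)
      have "s * R n \<ge> - \<bar>R n\<bar>"
      proof -
        have "\<bar>s * R n\<bar> = \<bar>R n\<bar>" using s by (simp add: abs_mult)
        then show ?thesis by linarith
      qed
      moreover have "\<bar>R n\<bar> \<le> C / 4 * (a n)\<^sup>2 + 4 * K * a n" using R[OF a1(2)] 1 2 unfolding bnd_def by linarith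
      ultimately have "s * (P n + R n) \<ge> C * (a n)\<^sup>2 - C / 4 * (a n)\<^sup>2 - 4 * K * a n" using sP[of n] by (simp add: distrib_left)
      moreover have "C * (a n)\<^sup>2 - C / 4 * (a n)\<^sup>2 - 4 * K * a n \<ge> a n"
      proof -
        have q: "C / 2 * (a n)\<^sup>2 = (C * (a n)\<^sup>2) / 2" "C / 4 * (a n)\<^sup>2 = (C * (a n)\<^sup>2) / 4" by simp_all
        have "C * (a n)\<^sup>2 \<ge> 0" using C by simp
        moreover have "4 * K * a n + a n \<le> (C * (a n)\<^sup>2) / 2" using 3 unfolding q by (simp only: distrib_right mult_1_left)
        ultimately show ?thesis unfolding q by linarith
      qed
      ultimately show ?case by linarith
    qed
  qed
  define R1 where "R1 n = ip M (\<lambda>y. V y * fst (w n y)) (vD n)" for n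
  define R2 where "R2 n = ip M (\<lambda>y. V y * vD n y) e0 + ip M (\<lambda>y. V y * fst (w n y)) e0" for n
  define R3 where "R3 n = ip M (\<lambda>y. V y * uE y) e0 - ip M (\<lambda>y. V y * uE y) (vD n)" for n
  have b1: "\<bar>R1 n\<bar> \<le> B * \<epsilon> n * (a n)\<^sup>2" if "a n > 0" for n
  proof -
    have "\<bar>R1 n\<bar> \<le> B * nrm M (\<lambda>y. fst (w n y)) * a n" unfolding R1_def a_def by (rule prodb[OF lfw lvD])
    also have "\<dots> \<le> B * (\<epsilon> n * a n) * a n" using we[OF that] B a0[of n] by (intro mult_right_mono mult_left_mono) auto
    finally show ?thesis by (simp add: power2_eq_square ac_simps)
  qed
  have b2: "\<bar>R2 n\<bar> \<le> B * nrm M e0 * (1 + a n) * (1 + \<epsilon> n)" if "a n > 0" for n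
  proof -
    have "\<bar>ip M (\<lambda>y. V y * vD n y) e0\<bar> \<le> B * a n * nrm M e0" unfolding a_def by (rule prodb[OF lvD le])
    moreover have "\<bar>ip M (\<lambda>y. V y * fst (w n y)) e0\<bar> \<le> B * (\<epsilon> n * a n) * nrm M e0"
    proof -
      have "\<bar>ip M (\<lambda>y. V y * fst (w n y)) e0\<bar> \<le> B * nrm M (\<lambda>y. fst (w n y)) * nrm M e0" by (rule prodb[OF lfw le])
      also have "\<dots> \<le> B * (\<epsilon> n * a n) * nrm M e0" using we[OF that] B by (intro mult_right_mono mult_left_mono) auto
      finally show ?thesis .
    qed
    ultimately have "\<bar>R2 n\<bar> \<le> B * a n * nrm M e0 + B * (\<epsilon> n * a n) * nrm M e0" unfolding R2_def by linarith
    also have "\<dots> = (B * nrm M e0) * (a n * (1 + \<epsilon> n))" by (simp add: algebra_simps)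
    also have "\<dots> \<le> (B * nrm M e0) * ((1 + a n) * (1 + \<epsilon> n))" using B e0[of n] by (intro mult_left_mono mult_right_mono) auto
    finally show ?thesis by (simp add: mult.assoc)
  qed
  have b3: "\<bar>R3 n\<bar> \<le> (B * nrm M uE + B * nrm M uE * nrm M e0) * (1 + a n) * (1 + \<epsilon> n)" for n
  proof -
    have "\<bar>ip M (\<lambda>y. V y * uE y) e0\<bar> \<le> B * nrm M uE * nrm M e0" by (rule prodb[OF lq le])
    moreover have "\<bar>ip M (\<lambda>y. V y * uE y) (vD n)\<bar> \<le> B * nrm M uE * a n" unfolding a_def by (rule prodb[OF lq lvD])
    ultimately have "\<bar>R3 n\<bar> \<le> B * nrm M uE * nrm M e0 + B * nrm M uE * a n" unfolding R3_def by linarith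
    also have "\<dots> \<le> (B * nrm M uE + B * nrm M uE * nrm M e0) * (1 + a n)"
      using B a0[of n] by (simp add: algebra_simps)
    also have "\<dots> \<le> (B * nrm M uE + B * nrm M uE * nrm M e0) * (1 + a n) * (1 + \<epsilon> n)"
      using mult_left_mono[of 1 "1 + \<epsilon> n" "(B * nrm M uE + B * nrm M uE * nrm M e0) * (1 + a n)"] B a0[of n] e0[of n] by simp
    finally show ?thesis .
  qed
  have Kb: "0 \<le> K * (1 + a n) * (1 + \<epsilon> n)" for n using K0 a0[of n] e0[of n] by simp
  have split: "K * (1 + a n) * (1 + \<epsilon> n) = B * nrm M e0 * (1 + a n) * (1 + \<epsilon> n) + (B * nrm M uE + B * nrm M uE * nrm M e0) * (1 + a n) * (1 + \<epsilon> n)" for n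
    unfolding K_def by (simp add: algebra_simps)
  have p3: "0 \<le> (B * nrm M uE + B * nrm M uE * nrm M e0) * (1 + a n) * (1 + \<epsilon> n)" for n using B a0[of n] e0[of n] by simp
  have lvw: "l2 M (\<lambda>y. v n y + fst (w n y))" for n by (intro l2_add lv lfw)
  have F1: "ip M (\<lambda>y. V y * (v n y + fst (w n y))) (v n) = P n + R1 n" for n
    unfolding dist(1)[OF lv lfw lv] Vv[OF lv] P_def R1_def
    using cutr[OF lvD lv, of n n] cutr[OF lfw lv, of n n] by (simp add: vD_def)
  have F2: "ip M (\<lambda>y. V y * (v n y + fst (w n y))) e0 = R2 n" for n
    unfolding dist(1)[OF lv lfw le] Vv[OF le] R2_def ..
  have F3: "- ip M (\<lambda>y. V y * (v n y + fst (w n y))) (\<lambda>y. e0 y - v n y) = P n + (R1 n - R2 n)" for n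
    unfolding ip_diff_right[OF le lv ess_bdd_l2[OF V lvw]] F1 F2 by simp
  have F4: "ip M (\<lambda>y. V y * uE y) (\<lambda>y. e0 y - v n y) = R3 n" for n
    unfolding ip_diff_right[OF le lv ess_bdd_l2[OF V lq]] R3_def using cutr[OF lq lv, of n] by (simp add: vD_def)
  have F5: "ip M (\<lambda>y. V y * (uE y - (v n y + fst (w n y)))) (\<lambda>y. e0 y - v n y) = P n + (R1 n - R2 n + R3 n)" for n
    unfolding dist(2)[OF lq lvw l2_diff[OF le lv]] F4 using F3[of n] by simp
  show "filterlim (\<lambda>n. s * ip M (\<lambda>y. V y * (v n y + fst (w n y))) (v n)) at_top sequentially"
    unfolding F1
  proof (rule final)
    show "\<bar>R1 n\<bar> \<le> bnd n" if "a n > 0" for n using b1[OF that] Kb[of n] unfolding bnd_def by linarith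
  qed
  show "filterlim (\<lambda>n. s * (- ip M (\<lambda>y. V y * (v n y + fst (w n y))) (\<lambda>y. e0 y - v n y))) at_top sequentially"
    unfolding F3
  proof (rule final)
    show "\<bar>R1 n - R2 n\<bar> \<le> bnd n" if "a n > 0" for n using b1[OF that] b2[OF that] split[of n] p3[of n] unfolding bnd_def by linarith
  qed
  show "filterlim (\<lambda>n. s * ip M (\<lambda>y. V y * (uE y - (v n y + fst (w n y)))) (\<lambda>y. e0 y - v n y)) at_top sequentially"
    unfolding F5
  proof (rule final)
    show "\<bar>R1 n - R2 n + R3 n\<bar> \<le> bnd n" if "a n > 0" for n using b1[OF that] b2[OF that] b3[of n] split[of n] unfolding bnd_def by linarith
  qed
qed

end

section \<open>Needles and Lipschitz boundaries\<close>

text \<open>\<open>m\<close> is the first breakpoint that is not below \<open>t\<close>, so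
  \<open>t\<close> lies in the interval ending there; \<open>m = 0\<close> forces
  \<open>t = 0\<close>, which belongs to the first interval.\<close>

lemma piecewise_cover:
  fixes ts :: "real list"
  assumes ts: "ts \<noteq> []" "hd ts = 0" "last ts = 1" "sorted_wrt (<) ts" and t: "t \<in> {0..1}"
  shows "\<exists>k < length ts - 1. t \<in> {ts!k..ts!(k+1)}"
proof -
  define n where "n = length ts"
  have n: "n > 0" using ts(1) by (simp add: n_def)
  have l: "ts ! (n - 1) = 1" using ts(1,3) by (simp add: last_conv_nth n_def)
  have h: "ts ! 0 = 0" using ts(1,2) by (simp add: hd_conv_nth)
  have n1: "n > 1"
  proof (rule ccontr)
    assume "\<not> n > 1"
    then have "n - 1 = 0" using n by simp
    then show False using l h by simp
  qed
  define m where "m = (LEAST k. k < n \<and> t \<le> ts ! k)"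
  have ex: "n - 1 < n \<and> t \<le> ts ! (n - 1)" using n l t by simp
  have m: "m < n" "t \<le> ts ! m" using LeastI[of "\<lambda>k. k < n \<and> t \<le> ts ! k", OF ex] by (auto simp: m_def)
  show ?thesis
  proof (cases m)
    case 0
    then have t0: "t = 0" using m(2) h t by simp
    have "ts ! 0 < ts ! 1" using ts(4) n1 by (simp add: sorted_wrt_iff_nth_less n_def)
    then show ?thesis using t0 h n1 by (intro exI[of _ 0]) (simp add: n_def)
  next
    case (Suc k)
    have "\<not> (k < n \<and> t \<le> ts ! k)" using not_less_Least[of k "\<lambda>k. k < n \<and> t \<le> ts ! k"] Suc by (simp add: m_def)
    then have "ts ! k \<le> t" using m(1) Suc by simp
    then show ?thesis using m Suc by (intro exI[of _ k]) (auto simp: n_def)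
  qed
qed

text \<open>A straight piece lies in a plane whose normal is a nonzero vector orthogonal to its
  direction \<open>b\<close>, and planes are null.\<close>

lemma piecewise_linear_facts:
  assumes "piecewise_linear \<sigma>"
  shows "continuous_on {0..1} \<sigma>" "negligible (\<sigma> ` {0..1})"
proof -
  obtain ts :: "real list" where ts: "ts \<noteq> []" "hd ts = 0" "last ts = 1" "sorted_wrt (<) ts"
    and lin: "\<forall>k < length ts - 1. \<exists>a b. \<forall>t \<in> {ts!k..ts!(k+1)}. \<sigma> t = a + t *\<^sub>R b"
    using assms unfolding piecewise_linear_def by blast
  define P where "P k = {ts!k..ts!(k+1)}" for k
  have cov: "{0..1} \<subseteq> (\<Union>k\<in>{..<length ts - 1}. P k)" using piecewise_cover[OF ts] unfolding P_def by blast
  have piece: "continuous_on (P k) \<sigma> \<and> negligible (\<sigma> ` P k)" if k: "k < length ts - 1" for k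
  proof -
    obtain a b where ab: "\<forall>t\<in>P k. \<sigma> t = a + t *\<^sub>R b" using lin k unfolding P_def by blast
    have "continuous_on (P k) (\<lambda>t. a + t *\<^sub>R b)" by (intro continuous_intros)
    then have c: "continuous_on (P k) \<sigma>" using ab by (simp cong: continuous_on_cong)
    obtain n :: "real^3" where n: "n \<noteq> 0" "orthogonal b n"
      using orthogonal_to_vector_exists[of b] by auto
    have "\<sigma> ` P k \<subseteq> {y. n \<bullet> y = n \<bullet> a}" using ab n(2) by (auto simp: inner_add_right orthogonal_def inner_commute)
    then have "negligible (\<sigma> ` P k)" using negligible_hyperplane[of n "n \<bullet> a"] n(1) negligible_subset by blast
    with c show ?thesis by blast
  qed
  have "continuous_on (\<Union>k\<in>{..<length ts - 1}. P k) \<sigma>"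
    by (rule continuous_on_closed_Union) (use piece in \<open>auto simp: P_def\<close>)
  then show "continuous_on {0..1} \<sigma>" using cov by (rule continuous_on_subset)
  have "negligible (\<Union>k\<in>{..<length ts - 1}. \<sigma> ` P k)" by (rule negligible_Union) (use piece in auto)
  then show "negligible (\<sigma> ` {0..1})" by (rule negligible_subset) (use cov in blast)
qed

text \<open>If infinitely many translates of a compact set along one direction are pairwise disjoint and
  stay in a bounded region, the set is null.\<close>
lemma translates_negligible:
  fixes S :: "(real^3) set"
  assumes S: "compact S" and dis: "\<And>y y' t t'. y \<in> S \<Longrightarrow> y' \<in> S \<Longrightarrow> y + t *\<^sub>R u = y' + t' *\<^sub>R u \<Longrightarrow> t = t'"
  shows "negligible S"
proof -
  obtain R where R: "\<And>y. y \<in> S \<Longrightarrow> norm y \<le> R" using compact_imp_bounded[OF S] by (auto simp: bounded_iff)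
  define c where "c = measure lebesgue (cball (0::real^3) (R + norm u))"
  have meas: "compact ((+) (t *\<^sub>R u) ` S)" for t using compact_translation[OF S] by simp
  have "real N * measure lebesgue S \<le> c" for N
  proof (cases "N = 0")
    case True then show ?thesis by (simp add: c_def)
  next
    case False
    \<comment> \<open>The shifts stay between zero and \<open>u\<close>, so a single ball contains
      the copies for every \<open>N\<close>.\<close>
    define A where "A k = (+) ((real k / real N) *\<^sub>R u) ` S" for k
    have Ac: "compact (A k)" for k unfolding A_def by (rule meas)
    have Al: "A k \<in> lmeasurable" for k by (rule lmeasurable_compact[OF Ac])
    have dj: "disjoint_family_on A {..<N}"
      unfolding disjoint_family_on_def
    proof (intro ballI impI)
      fix k l :: nat assume "k \<noteq> l"
      show "A k \<inter> A l = {}"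
      proof (rule ccontr)
        assume "A k \<inter> A l \<noteq> {}"
        then obtain z where "z \<in> A k" "z \<in> A l" by blast
        then obtain y y' where "y \<in> S" "y' \<in> S" "z = (real k / real N) *\<^sub>R u + y" "z = (real l / real N) *\<^sub>R u + y'"
          unfolding A_def by blast
        then have "real k / real N = real l / real N" using dis[of y y' "real k / real N" "real l / real N"] by (simp add: add.commute)
        then show False using \<open>k \<noteq> l\<close> False by simp
      qed
    qed
    have "measure lebesgue (\<Union>k\<in>{..<N}. A k) = (\<Sum>k<N. measure lebesgue (A k))"
      by (rule measure_finite_Union[OF _ _ dj]) (use fmeasurableD[OF Al] fmeasurableD2[OF Al] in auto)
    also have "\<dots> = real N * measure lebesgue S" by (simp add: A_def measure_translation)
    finally have e: "measure lebesgue (\<Union>k\<in>{..<N}. A k) = real N * measure lebesgue S" .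
    have "(\<Union>k\<in>{..<N}. A k) \<subseteq> cball 0 (R + norm u)"
    proof
      fix z assume "z \<in> (\<Union>k\<in>{..<N}. A k)"
      then obtain k y where k: "k < N" "y \<in> S" "z = (real k / real N) *\<^sub>R u + y" unfolding A_def by blast
      have "norm z \<le> norm ((real k / real N) *\<^sub>R u) + norm y" unfolding k(3) by (rule norm_triangle_ineq)
      also have "norm ((real k / real N) *\<^sub>R u) \<le> 1 * norm u" unfolding norm_scaleR using k(1) by (intro mult_right_mono) auto
      finally show "z \<in> cball 0 (R + norm u)" using R[OF k(2)] by simp
    qed
    then have "measure lebesgue (\<Union>k\<in>{..<N}. A k) \<le> c" unfolding c_def
    proof (rule measure_mono_fmeasurable)
      show "(\<Union>k\<in>{..<N}. A k) \<in> sets lebesgue" by (intro sets.finite_UN fmeasurableD[OF Al]) simp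
      show "cball 0 (R + norm u) \<in> lmeasurable" by (rule lmeasurable_cball)
    qed
    then show ?thesis using e by simp
  qed
  then have bnd: "real N * measure lebesgue S \<le> c" for N .
  have "measure lebesgue S = 0"
  proof (rule ccontr)
    assume "measure lebesgue S \<noteq> 0"
    then have p: "measure lebesgue S > 0" by (simp add: order_less_le)
    obtain N where "real N > c / measure lebesgue S" using reals_Archimedean2 by blast
    then have "c < real N * measure lebesgue S" using p by (simp add: field_simps)
    then show False using bnd[of N] by linarith
  qed
  then show ?thesis using lmeasurable_compact[OF S] negligible_iff_measure by blast
qed

section \<open>Charts of a Lipschitz boundary\<close>

definition cyl :: "(real^3 \<Rightarrow> real^3) \<Rightarrow> real^3 \<Rightarrow> real \<Rightarrow> real \<Rightarrow> (real^3) set" where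
  "cyl R p r h = {y. norm (R (y - p) $ 1, R (y - p) $ 2) < r \<and> \<bar>R (y - p) $ 3\<bar> < h}"

lemma chart_cont:
  fixes R :: "real^3 \<Rightarrow> real^3"
  assumes "orthogonal_transformation R"
  shows "continuous_on UNIV (\<lambda>y. R (y - p) $ i)"
proof -
  have "bounded_linear R" using orthogonal_transformation_linear[OF assms] linear_conv_bounded_linear[of R] by simp
  then have "continuous_on UNIV (\<lambda>y. R (y - p))"
    by (intro bounded_linear.continuous_on[of R] continuous_intros)
  then show ?thesis by (intro continuous_intros)
qed

lemma open_cyl: assumes "orthogonal_transformation R" shows "open (cyl R p r h)"
proof -
  note c = chart_cont[OF assms]
  have "cyl R p r h = {y. norm (R (y - p) $ 1, R (y - p) $ 2) < r} \<inter> {y. \<bar>R (y - p) $ 3\<bar> < h}" by (auto simp: cyl_def)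
  moreover have "open {y. norm (R (y - p) $ 1, R (y - p) $ 2) < r}" by (intro open_Collect_less continuous_intros c)
  moreover have "open {y. \<bar>R (y - p) $ 3\<bar> < h}" by (intro open_Collect_less continuous_intros c)
  ultimately show ?thesis by auto
qed

text \<open>The chart points strictly below and strictly above the graph form open sets, one inside
  \<open>D\<close> and one inside its complement, so neither contains a frontier point.\<close>

lemma frontier_graph:
  assumes R: "orthogonal_transformation R" and \<gamma>: "L-lipschitz_on (ball 0 r) \<gamma>"
    and D: "\<And>y. y \<in> cyl R p r h \<Longrightarrow> y \<in> D \<longleftrightarrow> R (y - p) $ 3 < \<gamma> (R (y - p) $ 1, R (y - p) $ 2)"
    and q: "q \<in> frontier D" "q \<in> cyl R p r h"
  shows "R (q - p) $ 3 = \<gamma> (R (q - p) $ 1, R (q - p) $ 2)"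
proof -
  let ?c = "cyl R p r h"
  let ?f = "\<lambda>y. R (y - p) $ 3 - \<gamma> (R (y - p) $ 1, R (y - p) $ 2)"
  note c = chart_cont[OF R]
  have o: "open ?c" by (rule open_cyl[OF R])
  have gc: "continuous_on (ball 0 r) \<gamma>" by (rule lipschitz_on_continuous_on[OF \<gamma>])
  have "continuous_on ?c (\<lambda>y. \<gamma> (R (y - p) $ 1, R (y - p) $ 2))"
    by (rule continuous_on_compose2[OF gc]) (auto intro!: continuous_intros continuous_on_subset[OF c] simp: cyl_def)
  then have fc: "continuous_on ?c ?f" by (intro continuous_intros continuous_on_subset[OF c]) auto
  have oL: "open (?c \<inter> ?f -` {..<0})" by (rule continuous_open_preimage[OF fc o]) simp
  have oG: "open (?c \<inter> ?f -` {0<..})" by (rule continuous_open_preimage[OF fc o]) simp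
  have "\<not> ?f q < 0"
  proof
    assume "?f q < 0"
    then have "q \<in> ?c \<inter> ?f -` {..<0}" using q(2) by simp
    moreover have "?c \<inter> ?f -` {..<0} \<subseteq> D" using D by auto
    ultimately have "q \<in> interior D" using oL by (meson interiorI)
    then show False using q(1) by (simp add: frontier_def)
  qed
  moreover have "\<not> ?f q > 0"
  proof
    assume "?f q > 0"
    then have "q \<in> ?c \<inter> ?f -` {0<..}" using q(2) by simp
    moreover have "?c \<inter> ?f -` {0<..} \<subseteq> - D" using D by auto
    ultimately have "q \<in> interior (- D)" using oG by (meson interiorI)
    then show False using q(1) by (simp add: frontier_def interior_complement)
  qed
  ultimately show ?thesis by simp
qed

lemma lipschitz_chart:
  assumes D: "lipschitz_bdry D" and p: "p \<in> frontier D"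
  obtains R r h \<gamma> L where "orthogonal_transformation R" "r > 0" "h > 0" "L-lipschitz_on (ball 0 r) \<gamma>"
    "\<And>y. y \<in> cyl R p r h \<Longrightarrow> y \<in> D \<longleftrightarrow> R (y - p) $ 3 < \<gamma> (R (y - p) $ 1, R (y - p) $ 2)"
proof -
  obtain R :: "real^3 \<Rightarrow> real^3" and r h L :: real and \<gamma> :: "real \<times> real \<Rightarrow> real"
    where "orthogonal_transformation R" "r > 0" "h > 0" "L-lipschitz_on (ball 0 r) \<gamma>"
    "\<forall>y. let z = R (y - p) in norm (z$1, z$2) < r \<and> \<bar>z$3\<bar> < h \<longrightarrow> (y \<in> D \<longleftrightarrow> z$3 < \<gamma> (z$1, z$2))"
    using D p unfolding lipschitz_bdry_def loc_graph_bdry_def by blast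
  then show ?thesis using that[of R r h L \<gamma>] by (auto simp: cyl_def Let_def)
qed

lemma center_cyl:
  assumes "orthogonal_transformation R" "r > 0" "h > 0" shows "p \<in> cyl R p r h"
  using linear_0[OF orthogonal_transformation_linear[OF assms(1)]] assms(2,3) by (simp add: cyl_def zero_prod_def[symmetric])

text \<open>Near each of its points the frontier is a graph, and vertical translates of a graph are
  disjoint; nullity is a local property.\<close>

lemma lipschitz_frontier_negligible:
  assumes "lipschitz_bdry D" shows "negligible (frontier D)"
  unfolding locally_negligible_alt[of "frontier D"]
proof
  fix p assume p: "p \<in> frontier D"
  obtain R r h \<gamma> L where R: "orthogonal_transformation R" "r > 0" "h > 0" "L-lipschitz_on (ball 0 r) \<gamma>"
    and D: "\<And>y. y \<in> cyl R p r h \<Longrightarrow> y \<in> D \<longleftrightarrow> R (y - p) $ 3 < \<gamma> (R (y - p) $ 1, R (y - p) $ 2)"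
    by (rule lipschitz_chart[OF assms p]) (rule that)
  have lin: "linear R" by (rule orthogonal_transformation_linear[OF R(1)])
  obtain \<rho> where \<rho>: "\<rho> > 0" "cball p \<rho> \<subseteq> cyl R p r h" using open_contains_cball open_cyl[OF R(1)] center_cyl[OF R(1-3)] by blast
  define S where "S = frontier D \<inter> cball p \<rho>"
  have S: "compact S" unfolding S_def by (rule closed_Int_compact) auto
  \<comment> \<open>The direction that becomes vertical in the chart.\<close>
  obtain u where u: "R u = axis 3 1" using orthogonal_transformation_surj[OF R(1)] by (metis surjD)
  have "negligible S"
  proof (rule translates_negligible[OF S, of u])
    fix y y' t t' assume y: "y \<in> S" "y' \<in> S" and e: "y + t *\<^sub>R u = y' + t' *\<^sub>R u"
    have g: "R (y - p) $ 3 = \<gamma> (R (y - p) $ 1, R (y - p) $ 2)" "R (y' - p) $ 3 = \<gamma> (R (y' - p) $ 1, R (y' - p) $ 2)"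
      using frontier_graph[OF R(1,4) D] y \<rho>(2) unfolding S_def by blast+
    have "(y - p) + t *\<^sub>R u = (y' - p) + t' *\<^sub>R u" using e by (simp add: algebra_simps)
    then have "R ((y - p) + t *\<^sub>R u) = R ((y' - p) + t' *\<^sub>R u)" by (rule arg_cong)
    then have e2: "R (y - p) + t *\<^sub>R axis 3 1 = R (y' - p) + t' *\<^sub>R axis 3 1"
      by (simp add: linear_add[OF lin] linear_scale[OF lin] u)
    have e3: "R (y - p) $ i + t * (axis 3 1 :: real^3) $ i = R (y' - p) $ i + t' * (axis 3 1 :: real^3) $ i" for i
      using arg_cong[OF e2, of "\<lambda>z. z $ i"] by simp
    have "R (y - p) $ 1 = R (y' - p) $ 1" "R (y - p) $ 2 = R (y' - p) $ 2" "R (y - p) $ 3 + t = R (y' - p) $ 3 + t'"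
      using e3[of 1] e3[of 2] e3[of 3] by (simp_all add: axis_def)
    then show "t = t'" using g by simp
  qed
  then have "negligible (frontier D \<inter> ball p \<rho>)" by (rule negligible_subset) (auto simp: S_def)
  moreover have "openin (top_of_set (frontier D)) (frontier D \<inter> ball p \<rho>)" by (rule openin_open_Int) simp
  ultimately show "\<exists>U. openin (top_of_set (frontier D)) U \<and> p \<in> U \<and> negligible U" using p \<rho>(1) by (intro exI[of _ "frontier D \<inter> ball p \<rho>"]) auto
qed

section \<open>The dipole near a Lipschitz boundary point\<close>

lemma dG_eq:
  assumes "z \<noteq> 0" shows "dG j z = - (z $ j) / (4 * pi * norm z ^ 3)"
proof -
  have n: "norm z > 0" using assms by simp
  have "((\<lambda>z. 1 / (4 * pi * norm z)) has_derivative (\<lambda>v. - (v \<bullet> sgn z) / (4 * pi * (norm z)\<^sup>2))) (at z)"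
    using assms by (auto intro!: derivative_eq_intros has_derivative_norm simp: field_simps power2_eq_square)
  moreover have "G = (\<lambda>z. 1 / (4 * pi * norm z))" by (rule ext) (simp add: G_def)
  ultimately have "(G has_derivative (\<lambda>v. - (v \<bullet> sgn z) / (4 * pi * (norm z)\<^sup>2))) (at z)" by simp
  then have "frechet_derivative G (at z) = (\<lambda>v. - (v \<bullet> sgn z) / (4 * pi * (norm z)\<^sup>2))" by (rule frechet_derivative_at[symmetric])
  moreover have "axis j 1 \<bullet> sgn z = z $ j / norm z" by (simp add: sgn_div_norm inner_axis' divide_inverse_commute)
  ultimately show ?thesis unfolding dG_def using n by (simp add: power2_eq_square power3_eq_cube)
qed

text \<open>The vector \<open>y0\<close> lies inside the cone below the Lipschitz graph and off the plane on which \<open>dG j\<close> vanishes.\<close>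
lemma cone_balls:
  assumes D: "open D" "lipschitz_bdry D" and x: "x \<in> frontier D"
  obtains y0 \<rho> m t0 where "\<rho> > 0" "m > 0" "t0 > 0"
    "\<And>t. 0 < t \<Longrightarrow> t \<le> t0 \<Longrightarrow> cball (x + t *\<^sub>R y0) (t * \<rho>) \<subseteq> D"
    "\<And>t y. 0 < t \<Longrightarrow> y \<in> cball (x + t *\<^sub>R y0) (t * \<rho>) \<Longrightarrow> y \<noteq> x \<and> m / t ^ 4 \<le> (dG j (y - x))\<^sup>2"
proof -
  obtain R r h \<gamma> L where R: "orthogonal_transformation R" "r > 0" "h > 0" and \<gamma>: "L-lipschitz_on (ball 0 r) \<gamma>"
    and Dc: "\<And>y. y \<in> cyl R x r h \<Longrightarrow> y \<in> D \<longleftrightarrow> R (y - x) $ 3 < \<gamma> (R (y - x) $ 1, R (y - x) $ 2)"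
    by (rule lipschitz_chart[OF D(2) x]) (rule that)
  have lin: "linear R" by (rule orthogonal_transformation_linear[OF R(1)])
  have L0: "L \<ge> 0" by (rule lipschitz_on_nonneg[OF \<gamma>])
  have g0: "\<gamma> (0, 0) = 0"
    using frontier_graph[OF R(1) \<gamma> Dc x center_cyl[OF R]] by (simp add: linear_0[OF lin])
  \<comment> \<open>An open cone of slope \<open>L + 1\<close>. It is invariant under positive
    scaling and lies below every graph through its vertex with Lipschitz constant
    \<open>L\<close>.\<close>
  define Q where "Q = {y. R (y - 0) $ 3 + (L + 1) * norm (R (y - 0) $ 1, R (y - 0) $ 2) < 0}"
  have oO: "open Q" unfolding Q_def by (intro open_Collect_less continuous_intros chart_cont[OF R(1)])
  obtain c where c: "R c = - axis 3 1" using orthogonal_transformation_surj[OF R(1)] by (metis surjD)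
  have cO: "c \<in> Q" unfolding Q_def by (simp add: c axis_def zero_prod_def[symmetric])
  obtain \<delta> where \<delta>: "\<delta> > 0" "ball c \<delta> \<subseteq> Q" using oO cO open_contains_ball by blast
  \<comment> \<open>The axis of the cone may lie in the plane where the \<open>j\<close>-th
    coordinate vanishes; a small shift inside the cone leaves that plane.\<close>
  define y0 where "y0 = (if c $ j \<noteq> 0 then c else c + (\<delta> / 2) *\<^sub>R axis j 1)"
  have y0: "y0 \<in> Q" "y0 $ j \<noteq> 0"
  proof -
    have "y0 \<in> ball c \<delta>" using \<delta>(1) by (auto simp: y0_def dist_norm)
    then show "y0 \<in> Q" using \<delta>(2) by blast
    show "y0 $ j \<noteq> 0" using \<delta>(1) by (auto simp: y0_def axis_def)
  qed
  define a where "a = \<bar>y0 $ j\<bar>"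
  have a: "a > 0" using y0(2) by (simp add: a_def)
  obtain \<rho>' where \<rho>': "\<rho>' > 0" "cball y0 \<rho>' \<subseteq> Q" using oO y0(1) open_contains_cball by blast
  define \<rho> where "\<rho> = min \<rho>' (a / 2)"
  have \<rho>: "\<rho> > 0" "cball y0 \<rho> \<subseteq> Q" "\<rho> \<le> a / 2" using \<rho>' a by (auto simp: \<rho>_def)
  define b where "b = norm y0 + \<rho>"
  have b: "b > 0" using \<rho>(1) by (simp add: b_def add_nonneg_pos)
  \<comment> \<open>\<open>dG j\<close> is homogeneous of degree \<open>-2\<close>, so its square at
    \<open>t *\<^sub>R y'\<close> is its square at \<open>y'\<close> divided by
    \<open>t ^ 4\<close>. The numbers \<open>a / 2\<close> and \<open>b\<close> bound the coordinate
    of \<open>y'\<close> from below and its norm from above.\<close>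
  define m where "m = (a / 2)\<^sup>2 / (4 * pi * b ^ 3)\<^sup>2"
  have m: "m > 0" using a b by (simp add: m_def)
  \<comment> \<open>Up to this scale the balls stay inside the chart cylinder.\<close>
  define t0 where "t0 = min r h / (2 * b)"
  have t0: "t0 > 0" using R b by (simp add: t0_def)
  have par: "\<exists>y'\<in>cball y0 \<rho>. y - x = t *\<^sub>R y'" if t: "0 < t" and y: "y \<in> cball (x + t *\<^sub>R y0) (t * \<rho>)" for t y
  proof (rule bexI[of _ "(1 / t) *\<^sub>R (y - x)"])
    show "y - x = t *\<^sub>R (1 / t) *\<^sub>R (y - x)" using t by simp
    have "y0 - (1 / t) *\<^sub>R (y - x) = (1 / t) *\<^sub>R ((x + t *\<^sub>R y0) - y)" using t by (simp add: algebra_simps)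
    then have "norm (y0 - (1 / t) *\<^sub>R (y - x)) = (1 / t) * norm ((x + t *\<^sub>R y0) - y)" using t by simp
    also have "\<dots> \<le> (1 / t) * (t * \<rho>)" using y t by (intro mult_left_mono) (auto simp: dist_norm)
    finally show "(1 / t) *\<^sub>R (y - x) \<in> cball y0 \<rho>" using t by (simp add: dist_norm)
  qed
  have y'b: "norm y' \<le> b" "\<bar>y' $ j\<bar> \<ge> a / 2" if "y' \<in> cball y0 \<rho>" for y'
  proof -
    have d: "norm (y' - y0) \<le> \<rho>" using that by (simp add: dist_norm norm_minus_commute)
    then show "norm y' \<le> b" using norm_triangle_sub[of y' y0] by (simp add: b_def)
    have "\<bar>(y' - y0) $ j\<bar> \<le> \<rho>" using component_le_norm_cart[of "y' - y0" j] d by linarith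
    then show "\<bar>y' $ j\<bar> \<ge> a / 2" using \<rho>(3) by (simp add: a_def)
  qed
  show ?thesis
  proof (rule that[OF \<rho>(1) m t0])
    fix t :: real assume t: "0 < t" "t \<le> t0"
    show "cball (x + t *\<^sub>R y0) (t * \<rho>) \<subseteq> D"
    proof
      fix y assume "y \<in> cball (x + t *\<^sub>R y0) (t * \<rho>)"
      then obtain y' where y': "y' \<in> cball y0 \<rho>" "y - x = t *\<^sub>R y'" using par t by blast
      let ?z = "R (y - x)"
      have z: "?z = t *\<^sub>R R y'" using y'(2) by (simp add: linear_scale[OF lin])
      have nz: "norm ?z \<le> t * b"
        using y'b(1)[OF y'(1)] t y'(2) by (simp add: orthogonal_transformation_norm[OF R(1)])
      also have "\<dots> \<le> t0 * b" using t b by (intro mult_right_mono) auto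
      also have "\<dots> = min r h / 2" using b by (simp add: t0_def)
      finally have n1: "norm ?z \<le> min r h / 2" .
      have n12: "norm (?z $ 1, ?z $ 2) \<le> norm ?z"
      proof -
        have "(?z $ 1)\<^sup>2 + (?z $ 2)\<^sup>2 \<le> (norm ?z)\<^sup>2" unfolding power2_norm_eq_inner by (simp add: inner_vec_def sum_3 power2_eq_square)
        then show ?thesis unfolding norm_Pair by (simp add: real_le_lsqrt)
      qed
      have r1: "norm (?z $ 1, ?z $ 2) < r" using n1 n12 R(2,3) by linarith
      have "\<bar>?z $ 3\<bar> < h" using n1 component_le_norm_cart[of ?z 3] R(2,3) by linarith
      then have cy: "y \<in> cyl R x r h" using r1 by (simp add: cyl_def)
      have "R y' $ 3 + (L + 1) * norm (R y' $ 1, R y' $ 2) < 0" using y'(1) \<rho>(2) by (auto simp: Q_def)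
      then have "t * (R y' $ 3 + (L + 1) * norm (R y' $ 1, R y' $ 2)) < 0" using t by (simp add: mult_pos_neg)
      moreover have "t * (R y' $ 3 + (L + 1) * norm (R y' $ 1, R y' $ 2)) = t * R y' $ 3 + (L + 1) * (t * norm (R y' $ 1, R y' $ 2))"
        by (simp add: distrib_left)
      ultimately have zz: "t * R y' $ 3 < - ((L + 1) * (t * norm (R y' $ 1, R y' $ 2)))" by linarith
      have nn: "norm (?z $ 1, ?z $ 2) = t * norm (R y' $ 1, R y' $ 2)"
      proof -
        have e: "(?z $ 1, ?z $ 2) = t *\<^sub>R (R y' $ 1, R y' $ 2)" by (simp add: z)
        show ?thesis unfolding e norm_scaleR using t by simp
      qed
      have "?z $ 3 = t * R y' $ 3" by (simp add: z)
      then have z3: "?z $ 3 < - (L + 1) * norm (?z $ 1, ?z $ 2)" unfolding nn using zz by (simp only: mult_minus_left)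
      have "dist (\<gamma> (?z $ 1, ?z $ 2)) (\<gamma> (0, 0)) \<le> L * dist (?z $ 1, ?z $ 2) (0, 0)"
      proof (rule lipschitz_onD[OF \<gamma>])
        show "(?z $ 1, ?z $ 2) \<in> ball 0 r" using r1 by (simp only: mem_ball_0)
        show "(0, 0) \<in> ball (0 :: real \<times> real) r" using R(2) by (simp add: zero_prod_def[symmetric])
      qed
      then have "\<gamma> (?z $ 1, ?z $ 2) \<ge> - L * norm (?z $ 1, ?z $ 2)" using g0 by (simp add: dist_norm zero_prod_def[symmetric])
      moreover have "- (L + 1) * norm (?z $ 1, ?z $ 2) \<le> - L * norm (?z $ 1, ?z $ 2)" by (simp add: algebra_simps)
      ultimately show "y \<in> D" using Dc[OF cy] z3 by linarith
    qed
  next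
    fix t y assume t: "0 < t" and y: "y \<in> cball (x + t *\<^sub>R y0) (t * \<rho>)"
    obtain y' where y': "y' \<in> cball y0 \<rho>" "y - x = t *\<^sub>R y'" using par[OF t y] by blast
    have nz: "y' \<noteq> 0" using y'b(2)[OF y'(1)] a by auto
    then have ne: "y - x \<noteq> 0" using y'(2) t by simp
    have "\<bar>dG j (y - x)\<bar> = \<bar>y' $ j\<bar> / (4 * pi * norm y' ^ 3) / t\<^sup>2"
      unfolding dG_eq[OF ne] unfolding y'(2) using t by (simp add: abs_mult power_mult_distrib power2_eq_square power3_eq_cube)
    also have "\<dots> \<ge> (a / 2) / (4 * pi * b ^ 3) / t\<^sup>2"
      using y'b[OF y'(1)] a b nz by (intro divide_right_mono frac_le mult_left_mono power_mono) auto
    finally have "((a / 2) / (4 * pi * b ^ 3) / t\<^sup>2)\<^sup>2 \<le> \<bar>dG j (y - x)\<bar>\<^sup>2" using a b by (intro power_mono) auto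
    moreover have "((a / 2) / (4 * pi * b ^ 3) / t\<^sup>2)\<^sup>2 = m / t ^ 4" by (simp add: m_def power_divide power_mult_distrib flip: power_mult)
    ultimately show "y \<noteq> x \<and> m / t ^ 4 \<le> (dG j (y - x))\<^sup>2" using ne by simp
  qed
qed

section \<open>A regularised dipole\<close>

text \<open>At the joint both branches share value and slope, so each branch supplies the remainder
  estimate on its own side.\<close>

lemma glue_deriv:
  fixes P T P' T' :: "real \<Rightarrow> real"
  assumes P: "\<And>s. s \<ge> a \<Longrightarrow> (P has_real_derivative P' s) (at s)" and T: "\<And>s. (T has_real_derivative T' s) (at s)"
    and eq: "P a = T a" "P' a = T' a"
  shows "((\<lambda>s. if s \<ge> a then P s else T s) has_real_derivative (if s \<ge> a then P' s else T' s)) (at s)"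
proof -
  consider "s > a" | "s < a" | "s = a" by linarith
  then show ?thesis
  proof cases
    case 1
    have "(P has_real_derivative P' s) (at s)" using P 1 by simp
    then have "((\<lambda>s. if s \<ge> a then P s else T s) has_real_derivative P' s) (at s)"
      by (rule has_field_derivative_transform_within_open[of _ _ _ "{a<..}"]) (use 1 in auto)
    then show ?thesis using 1 by simp
  next
    case 2
    have "((\<lambda>s. if s \<ge> a then P s else T s) has_real_derivative T' s) (at s)"
      by (rule has_field_derivative_transform_within_open[OF T, of "{..<a}"]) (use 2 in auto)
    then show ?thesis using 2 by simp
  next
    case 3
    let ?f = "\<lambda>s. if s \<ge> a then P s else T s"
    have dP: "(P has_derivative (*) (P' a)) (at a)" and dT: "(T has_derivative (*) (P' a)) (at a)"
      using P[of a] T[of a] eq by (simp_all add: has_field_derivative_def)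
    have "(?f has_derivative (*) (P' a)) (at a)"
      unfolding has_derivative_at_alt
    proof (intro conjI allI impI)
      show "bounded_linear ((*) (P' a))" by (rule bounded_linear_mult_right)
      fix e :: real assume e: "e > 0"
      obtain d1 where d1: "d1 > 0" "\<And>y. norm (y - a) < d1 \<Longrightarrow> norm (P y - P a - P' a * (y - a)) \<le> e * norm (y - a)"
        using dP e unfolding has_derivative_at_alt by blast
      obtain d2 where d2: "d2 > 0" "\<And>y. norm (y - a) < d2 \<Longrightarrow> norm (T y - T a - P' a * (y - a)) \<le> e * norm (y - a)"
        using dT e unfolding has_derivative_at_alt by blast
      show "\<exists>d>0. \<forall>y. norm (y - a) < d \<longrightarrow> norm (?f y - ?f a - P' a * (y - a)) \<le> e * norm (y - a)"
      proof (intro exI[of _ "min d1 d2"] conjI allI impI)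
        show "min d1 d2 > 0" using d1 d2 by simp
        fix y assume y: "norm (y - a) < min d1 d2"
        show "norm (?f y - ?f a - P' a * (y - a)) \<le> e * norm (y - a)"
        proof (cases "y \<ge> a")
          case True
          then have e: "?f y - ?f a = P y - P a" by simp
          show ?thesis unfolding e by (rule d1(2)) (use y in simp)
        next
          case False
          then have e: "?f y - ?f a = T y - T a" using eq by simp
          show ?thesis unfolding e by (rule d2(2)) (use y in simp)
        qed
      qed
    qed
    then show ?thesis using 3 by (simp add: has_field_derivative_def)
  qed
qed

text \<open>The second-order Taylor continuation of \<open>- (s powr (-3/2))\<close> below \<open>s = a\<close>. With \<open>s = (norm (y - x))\<^sup>2\<close> it
  replaces the dipole, up to the factor \<open>4 * pi\<close>, by a twice continuously differentiable function.\<close>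
definition dip :: "real \<Rightarrow> real \<Rightarrow> real" where
  "dip a s = (if s \<ge> a then - (s powr (-3/2))
     else - (a powr (-3/2)) + 3/2 * a powr (-5/2) * (s - a) - 15/8 * a powr (-7/2) * (s - a)\<^sup>2)"
definition dip1 :: "real \<Rightarrow> real \<Rightarrow> real" where
  "dip1 a s = (if s \<ge> a then 3/2 * s powr (-5/2) else 3/2 * a powr (-5/2) - 15/4 * a powr (-7/2) * (s - a))"
definition dip2 :: "real \<Rightarrow> real \<Rightarrow> real" where
  "dip2 a s = - 15/4 * (max s a) powr (-7/2)"

lemma dip_deriv:
  assumes a: "a > 0"
  shows "(dip a has_real_derivative dip1 a s) (at s)" "(dip1 a has_real_derivative dip2 a s) (at s)" "continuous_on UNIV (dip1 a)" "continuous_on UNIV (dip2 a)"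
proof -
  have p: "((\<lambda>s. s powr q) has_real_derivative q * s powr (q - 1)) (at s)" if "s \<ge> a" for q s
    using that a by (auto intro!: derivative_eq_intros)
  show "(dip a has_real_derivative dip1 a s) (at s)" for s
    unfolding dip_def dip1_def
  proof (rule glue_deriv)
    show "((\<lambda>s. - (s powr (-3/2))) has_real_derivative 3/2 * s powr (-5/2)) (at s)" if "s \<ge> a" for s
      using DERIV_minus[OF p[OF that, of "-3/2"]] by simp
    show "((\<lambda>s. - (a powr (-3/2)) + 3/2 * a powr (-5/2) * (s - a) - 15/8 * a powr (-7/2) * (s - a)\<^sup>2) has_real_derivative
       3/2 * a powr (-5/2) - 15/4 * a powr (-7/2) * (s - a)) (at s)" for s
      by (auto intro!: derivative_eq_intros)
  qed simp_all
  have e: "dip2 a s = (if s \<ge> a then - 15/4 * s powr (-7/2) else - 15/4 * a powr (-7/2))" for s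
    by (simp add: dip2_def max_def)
  show d: "(dip1 a has_real_derivative dip2 a s) (at s)" for s
    unfolding dip1_def e
  proof (rule glue_deriv)
    show "((\<lambda>s. 3/2 * s powr (-5/2)) has_real_derivative - 15/4 * s powr (-7/2)) (at s)" if "s \<ge> a" for s
      using DERIV_cmult[OF p[OF that, of "-5/2"], of "3/2"] by simp
    show "((\<lambda>s. 3/2 * a powr (-5/2) - 15/4 * a powr (-7/2) * (s - a)) has_real_derivative - 15/4 * a powr (-7/2)) (at s)" for s
      by (auto intro!: derivative_eq_intros)
  qed simp_all
  show "continuous_on UNIV (dip1 a)" using d by (auto intro!: continuous_at_imp_continuous_on DERIV_isCont)
  show "continuous_on UNIV (dip2 a)" unfolding dip2_def
    using a by (intro continuous_intros) (auto simp: max_def)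
qed

text \<open>With \<open>s\<close> the squared distance to \<open>x\<close>, the left side is the
  factor of \<open>y $ j - x $ j\<close> in the Laplacian of
  \<open>(y $ j - x $ j) * dip a s\<close> in dimension three. It vanishes for the power
  \<open>s powr (-3/2)\<close>; the Taylor continuation leaves a positive density below
  \<open>a\<close>.\<close>

lemma dip_comb:
  assumes a: "a > 0"
  shows "4 * s * dip2 a s + 10 * dip1 a s = (if s \<ge> a then 0 else 105/2 * a powr (-7/2) * (a - s))"
proof -
  have m: "t * t powr (-7/2) = t powr (-5/2)" if "t > 0" for t :: real
  proof -
    have "t * t powr (-7/2) = t powr 1 * t powr (-7/2)" using that by simp
    also have "\<dots> = t powr (1 + (-7/2))" by (rule powr_add[symmetric])
    finally show ?thesis by simp
  qed
  show ?thesis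
  proof (cases "s \<ge> a")
    case True
    then have "4 * s * dip2 a s = - 15 * (s * s powr (-7/2))" by (simp add: dip2_def max_def)
    then show ?thesis using True a m[of s] by (simp add: dip1_def)
  next
    case False
    then show ?thesis using m[OF a, symmetric] by (simp add: dip1_def dip2_def max_def algebra_simps diff_divide_distrib add_divide_distrib)
  qed
qed

lemma pd_sqdist: "pd i (\<lambda>y. (norm (y - x))\<^sup>2) y = 2 * (y $ i - x $ i)"
proof -
  have "((\<lambda>y. (y - x) \<bullet> (y - x)) has_derivative (\<lambda>v. (y - x) \<bullet> v + v \<bullet> (y - x))) (at y)"
    by (auto intro!: derivative_eq_intros)
  then have "((\<lambda>y. (norm (y - x))\<^sup>2) has_derivative (\<lambda>v. (y - x) \<bullet> v + v \<bullet> (y - x))) (at y)"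
    by (simp add: power2_norm_eq_inner)
  from pd_eq[OF this] show ?thesis by (simp add: inner_axis inner_axis')
qed

lemma lin_c1: "c1 (\<lambda>y. y $ k - x $ k)" "pd i (\<lambda>y. y $ k - x $ k) y = (if i = k then 1 else 0)"
proof -
  show "c1 (\<lambda>y. y $ k - x $ k)" by (intro smooth3_c1 smooth3_minus smooth3_coord smooth3_const)
  have "pd i (\<lambda>y. y $ k + (- x $ k)) y = (if i = k then 1 else 0)"
    by (subst pd_add[OF pd_coord(1)]) (auto simp: pd_coord)
  then show "pd i (\<lambda>y. y $ k - x $ k) y = (if i = k then 1 else 0)" by simp
qed

lemma c1_add:
  assumes "c1 f" "c1 g" shows "c1 (\<lambda>y. f y + g y)"
proof -
  have "pd i (\<lambda>y. f y + g y) = (\<lambda>y. pd i f y + pd i g y)" for i by (intro ext pd_add c1D assms)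
  moreover have "continuous_on UNIV (\<lambda>y. pd i f y + pd i g y)" for i by (intro continuous_intros c1D assms)
  ultimately have "continuous_on UNIV (pd i (\<lambda>y. f y + g y))" for i by simp
  moreover have "(\<lambda>y. f y + g y) differentiable (at y)" for y by (rule differentiable_add[OF c1D(1)[OF assms(1)] c1D(1)[OF assms(2)]])
  ultimately show ?thesis unfolding c1_def by blast
qed

lemma c1_const: "c1 (\<lambda>_. c)" by (rule smooth3_c1) simp

lemma c1_comp:
  assumes f: "c1 f" and H: "\<And>s. (H has_real_derivative H' s) (at s)" "continuous_on UNIV H'"
  shows "c1 (\<lambda>y. H (f y))" "pd i (\<lambda>y. H (f y)) y = H' (f y) * pd i f y"
proof -
  note d = pd_comp[OF c1D(1)[OF f] H(1)]
  show "pd i (\<lambda>y. H (f y)) y = H' (f y) * pd i f y" for i y by (rule d(2))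
  have e: "pd i (\<lambda>y. H (f y)) = (\<lambda>y. H' (f y) * pd i f y)" for i by (rule ext) (rule d(2))
  have "continuous_on UNIV (\<lambda>y. H' (f y))" by (rule continuous_on_compose2[OF H(2) c1D(3)[OF f]]) simp
  then have "continuous_on UNIV (pd i (\<lambda>y. H (f y)))" for i unfolding e by (intro continuous_intros c1D[OF f])
  then show "c1 (\<lambda>y. H (f y))" unfolding c1_def using d(1) by blast
qed

definition dipole :: "real \<Rightarrow> 3 \<Rightarrow> real^3 \<Rightarrow> real^3 \<Rightarrow> real" where
  "dipole a j x y = (y $ j - x $ j) * dip a ((norm (y - x))\<^sup>2)"

text \<open>The Laplacian is a smeared dipole charge: it lives in the ball of squared radius
  \<open>a\<close> and has the sign of \<open>y $ j - x $ j\<close>. Two continuous derivatives are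
  enough to move the Laplacian onto a test function.\<close>

lemma dipole_facts:
  assumes a: "a > 0"
  shows "c1 (dipole a j x)" "c1 (pd i (dipole a j x))"
    "(\<Sum>i\<in>UNIV. pd i (pd i (dipole a j x)) y) = (y $ j - x $ j) * (if (norm (y - x))\<^sup>2 \<ge> a then 0 else 105/2 * a powr (-7/2) * (a - (norm (y - x))\<^sup>2))"
proof -
  let ?q = "\<lambda>y. (norm (y - x))\<^sup>2" and ?L = "\<lambda>k y. y $ k - x $ k"
  note H = dip_deriv[OF a]
  have q: "c1 ?q" by (rule smooth3_c1[OF smooth3_sqdist])
  note h0 = c1_comp[OF q H(1,3)] and h1 = c1_comp[OF q H(2,4)]
  note L = lin_c1(1)
  have dipole: "dipole a j x = (\<lambda>y. ?L j y * dip a (?q y))" by (rule ext) (simp add: dipole_def)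
  show E: "c1 (dipole a j x)" unfolding dipole by (rule c1_mult[OF L h0(1)])
  define d where "d i = (if i = j then 1 else 0 :: real)" for i
  let ?B = "\<lambda>i y. dip1 a (?q y) * (2 * ?L i y)"
  have L2a: "c1 (\<lambda>y. 2 * ?L i y)" for i by (rule c1_mult[OF c1_const L])
  have L2b: "pd k (\<lambda>y. 2 * ?L i y) y = (if k = i then 2 else 0)" for i k y
    by (subst pd_mult[OF c1D(1)[OF c1_const] c1D(1)[OF L]]) (simp add: lin_c1(2))
  note L2 = L2a L2b
  have B: "c1 (?B i)" for i by (rule c1_mult[OF h1(1) L2(1)])
  have pB: "pd i (?B i) y = dip1 a (?q y) * 2 + (dip2 a (?q y) * (2 * ?L i y)) * (2 * ?L i y)" for i y
    unfolding pd_mult[OF c1D(1)[OF h1(1)] c1D(1)[OF L2(1)]] L2(2) h1(2) pd_sqdist by simp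
  have p1: "pd i (dipole a j x) = (\<lambda>y. ?L j y * ?B i y + d i * dip a (?q y))" for i
    unfolding dipole by (rule ext) (subst pd_mult[OF c1D(1)[OF L] c1D(1)[OF h0(1)]], simp add: h0(2) pd_sqdist lin_c1(2) d_def)
  have LB: "c1 (\<lambda>y. ?L j y * ?B i y)" and dH: "c1 (\<lambda>y. d i * dip a (?q y))" for i
    by (rule c1_mult[OF L B], rule c1_mult[OF c1_const h0(1)])
  show "c1 (pd i (dipole a j x))" for i unfolding p1 by (rule c1_add[OF LB dH])
  have p2: "pd i (pd i (dipole a j x)) y = ?L j y * (dip1 a (?q y) * 2 + 4 * dip2 a (?q y) * (?L i y * ?L i y)) + 4 * d i * (dip1 a (?q y) * ?L i y)" for i
    unfolding p1 pd_add[OF c1D(1)[OF LB] c1D(1)[OF dH]] pd_mult[OF c1D(1)[OF L] c1D(1)[OF B]]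
      pd_mult[OF c1D(1)[OF c1_const] c1D(1)[OF h0(1)]] pB h0(2) pd_sqdist lin_c1(2)
    by (simp add: d_def algebra_simps)
  have sq: "(\<Sum>i\<in>UNIV. ?L i y * ?L i y) = ?q y" by (simp add: power2_norm_eq_inner inner_vec_def)
  have sd: "(\<Sum>i\<in>UNIV. 4 * d i * (dip1 a (?q y) * ?L i y)) = 4 * (dip1 a (?q y) * ?L j y)"
    by (simp add: d_def if_distrib if_distribR cong: if_cong)
  have "(\<Sum>i\<in>UNIV. pd i (pd i (dipole a j x)) y) = (\<Sum>i\<in>(UNIV::3 set). ?L j y * (dip1 a (?q y) * 2 + 4 * dip2 a (?q y) * (?L i y * ?L i y))) + 4 * (dip1 a (?q y) * ?L j y)"
    unfolding p2 sum.distrib sd ..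
  also have "(\<Sum>i\<in>(UNIV::3 set). ?L j y * (dip1 a (?q y) * 2 + 4 * dip2 a (?q y) * (?L i y * ?L i y))) = ?L j y * (6 * dip1 a (?q y) + 4 * dip2 a (?q y) * ?q y)"
    unfolding sum_distrib_left[symmetric] sum.distrib sq by simp
  also have "?L j y * (6 * dip1 a (?q y) + 4 * dip2 a (?q y) * ?q y) + 4 * (dip1 a (?q y) * ?L j y) = ?L j y * (4 * ?q y * dip2 a (?q y) + 10 * dip1 a (?q y))"
    by (simp add: algebra_simps)
  finally show "(\<Sum>i\<in>UNIV. pd i (pd i (dipole a j x)) y) = ?L j y * (if ?q y \<ge> a then 0 else 105/2 * a powr (-7/2) * (a - ?q y))"
    unfolding dip_comb[OF a] .
qed

lemma dipole_eq_dG: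
  assumes r: "r > 0" and y: "norm (y - x) \<ge> r"
  shows "(1 / (4 * pi)) * dipole (r\<^sup>2) j x y = dG j (y - x)"
proof -
  define n where "n = norm (y - x)"
  have n: "n > 0" "n \<ge> r" using r y by (auto simp: n_def)
  have "n\<^sup>2 \<ge> r\<^sup>2" using n r by (intro power_mono) auto
  then have "dip (r\<^sup>2) (n\<^sup>2) = - ((n\<^sup>2) powr (-3/2))" by (simp add: dip_def)
  also have "(n\<^sup>2) powr (-3/2) = inverse (n ^ 3)"
  proof -
    have "(n\<^sup>2) powr (-3/2) = (n powr 2) powr (-3/2)" using n by (simp add: powr_numeral)
    also have "\<dots> = n powr (- 3)" by (simp add: powr_powr)
    also have "\<dots> = inverse (n powr 3)" by (rule powr_minus)
    also have "n powr 3 = n ^ 3" using n by (simp add: powr_numeral)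
    finally show ?thesis .
  qed
  finally have H: "dip (r\<^sup>2) (n\<^sup>2) = - inverse (n ^ 3)" .
  have "y - x \<noteq> 0" using n by (auto simp: n_def)
  then have g: "dG j (y - x) = - (y $ j - x $ j) / (4 * pi * n ^ 3)" unfolding n_def by (subst dG_eq) simp_all
  have e: "dipole (r\<^sup>2) j x y = (y $ j - x $ j) * - inverse (n ^ 3)" unfolding dipole_def n_def[symmetric] H ..
  have ar: "(1 / c) * (l * - inverse N) = - l / (c * N)" for c l N :: real by (simp add: divide_inverse)
  show ?thesis unfolding g e ar ..
qed

section \<open>Testing the Laplacian of the dipole\<close>

context bdom begin

lemma int_pos:
  fixes h :: "real^3 \<Rightarrow> real"
  assumes c: "continuous_on UNIV h" and h: "\<And>y. 0 \<le> h y" and y0: "y0 \<in> U" "h y0 > 0"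
  shows "integral\<^sup>L M h > 0"
proof -
  have i: "integrable M h" by (rule l2_integrable[OF fin cont_l2[OF c bd leb]])
  have "integral\<^sup>L M h \<noteq> 0"
  proof
    assume "integral\<^sup>L M h = 0"
    then have "AE y in M. h y = 0" using integral_nonneg_eq_0_iff_AE[OF i] h by simp
    then have ae: "AE y in lebesgue. y \<in> U \<longrightarrow> h y = 0" by (simp add: AE_on[OF leb])
    define Q where "Q = U \<inter> {y. 0 < h y}"
    have oQ: "open Q" unfolding Q_def by (intro open_Int op open_Collect_less continuous_on_const c)
    have "AE y in lebesgue. y \<notin> Q" using ae by eventually_elim (auto simp: Q_def)
    then have "emeasure lebesgue Q = 0" using AE_iff_measurable[OF open_leb[OF oQ], of "\<lambda>y. y \<notin> Q"] by simp
    then have "negligible Q" unfolding negligible_iff_null_sets using open_leb[OF oQ] by auto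
    then show False using open_not_negligible[OF oQ] y0 by (auto simp: Q_def)
  qed
  moreover have "integral\<^sup>L M h \<ge> 0" by (rule Bochner_Integration.integral_nonneg) (rule h)
  ultimately show ?thesis by simp
qed

definition "lap \<phi> y = (\<Sum>i\<in>(UNIV::3 set). pd i (pd i \<phi>) y)"

lemma lap_test:
  assumes "test_fun U \<phi>" shows "test_fun U (lap \<phi>)"
proof (rule test_funI[OF _ test_funD(2,3)[OF assms]])
  show "smooth3 (lap \<phi>)" unfolding lap_def[abs_def] by (intro smooth3_sum smooth3_pd test_funD(1)[OF assms]) simp
  show "y \<in> tsupp \<phi>" if "lap \<phi> y \<noteq> 0" for y
  proof (rule ccontr)
    assume y: "y \<notin> tsupp \<phi>"
    have o: "open (- tsupp \<phi>)" unfolding tsupp_def by (rule open_Compl) (rule closed_closure)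
    have "pd i (pd i \<phi>) y = pd i (\<lambda>_. 0) y" for i by (rule pd_local[OF o]) (use y pd_tsupp in auto)
    then show False using that by (simp add: lap_def)
  qed
qed

lemma lap_ibp:
  assumes E: "c1 E" "\<And>i. c1 (pd i E)" and t: "test_fun U \<phi>"
  shows "ip M E (lap \<phi>) = integral\<^sup>L M (\<lambda>y. (\<Sum>i\<in>UNIV. pd i (pd i E) y) * \<phi> y)"
proof -
  have i1: "integrable M (\<lambda>y. E y * pd i (pd i \<phi>) y)" for i
    using l2_inner[OF c1_l2[OF E(1)] test_l2(2)[OF test_pd[OF t]]] by simp
  have i2: "integrable M (\<lambda>y. pd i (pd i E) y * \<phi> y)" for i
    using l2_inner[OF c1_l2_pd[OF E(2)] test_l2(1)[OF t]] by simp
  have s: "integral\<^sup>L M (\<lambda>y. E y * pd i (pd i \<phi>) y) = integral\<^sup>L M (\<lambda>y. pd i (pd i E) y * \<phi> y)" for i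
    using IBP_test[OF E(1) test_pd[OF t] leb, of i i] IBP_test[OF E(2) t leb, of i i] by simp
  have "ip M E (lap \<phi>) = (LINT y|M. (\<Sum>i\<in>UNIV. E y * pd i (pd i \<phi>) y))"
    unfolding ip_real lap_def sum_distrib_left ..
  also have "\<dots> = (\<Sum>i\<in>UNIV. integral\<^sup>L M (\<lambda>y. E y * pd i (pd i \<phi>) y))" by (rule Bochner_Integration.integral_sum) (rule i1)
  also have "\<dots> = (\<Sum>i\<in>UNIV. integral\<^sup>L M (\<lambda>y. pd i (pd i E) y * \<phi> y))" unfolding s ..
  also have "\<dots> = (LINT y|M. (\<Sum>i\<in>UNIV. pd i (pd i E) y * \<phi> y))" by (rule Bochner_Integration.integral_sum[symmetric]) (rule i2)
  finally show ?thesis unfolding sum_distrib_right .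
qed

text \<open>Where the smeared charge lives, \<open>\<phi>\<close> is the linear function
  \<open>y $ j - x $ j\<close>, so after integration by parts the integrand is its square times a
  nonnegative density.\<close>

lemma lap_pos:
  assumes r: "r > 0" and ball: "ball x r \<subseteq> U" and t: "test_fun U \<phi>" and \<phi>: "\<And>y. y \<in> ball x r \<Longrightarrow> \<phi> y = y $ j - x $ j"
  shows "ip M (dipole (r\<^sup>2) j x) (lap \<phi>) > 0"
proof -
  have a: "r\<^sup>2 > 0" using r by simp
  note E = dipole_facts[OF a]
  define k where "k = 105/2 * (r\<^sup>2) powr (-7/2)"
  have k: "k > 0" using r by (simp add: k_def)
  define h where "h y = (y $ j - x $ j)\<^sup>2 * (k * max 0 (r\<^sup>2 - (norm (y - x))\<^sup>2))" for y
  have "(\<Sum>i\<in>UNIV. pd i (pd i (dipole (r\<^sup>2) j x)) y) * \<phi> y = h y" for y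
  proof (cases "norm (y - x) < r")
    case True
    then have l: "(norm (y - x))\<^sup>2 < r\<^sup>2" by (intro power_strict_mono) auto
    have "\<phi> y = y $ j - x $ j" by (rule \<phi>) (use True in \<open>simp add: dist_norm norm_minus_commute\<close>)
    then show ?thesis unfolding E(3) h_def k_def using l by (simp add: power2_eq_square)
  next
    case False
    then have "(norm (y - x))\<^sup>2 \<ge> r\<^sup>2" using r by (intro power_mono) auto
    then show ?thesis unfolding E(3) h_def by simp
  qed
  then have e: "ip M (dipole (r\<^sup>2) j x) (lap \<phi>) = integral\<^sup>L M h" unfolding lap_ibp[OF E(1,2) t] by simp
  \<comment> \<open>A point of the ball off the plane where the \<open>j\<close>-th difference
    vanishes; the integrand is positive there.\<close>
  define y0 where "y0 = x + (r / 2) *\<^sub>R axis j 1"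
  have n: "norm (y0 - x) = r / 2" using r by (simp add: y0_def)
  have "integral\<^sup>L M h > 0"
  proof (rule int_pos)
    show "continuous_on UNIV h" unfolding h_def by (intro continuous_intros)
    show "0 \<le> h y" for y unfolding h_def using k by simp
    show "y0 \<in> U" using ball n r by (auto simp: dist_norm norm_minus_commute subset_eq)
    have "(r / 2)\<^sup>2 < r\<^sup>2" using r by (intro power_strict_mono) auto
    then show "h y0 > 0" unfolding h_def n using k r by (simp add: y0_def axis_def)
  qed
  then show ?thesis unfolding e .
qed

section \<open>Blow-up of needle sequences\<close>

lemma ind_meas: "A \<in> sets lebesgue \<Longrightarrow> (indicator A :: real^3 \<Rightarrow> real) \<in> borel_measurable M"
  by (intro measurable_restrict_space1 borel_measurable_indicator)

lemma ind_mult_l2: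
  fixes f :: "real^3 \<Rightarrow> real"
  assumes "A \<in> sets lebesgue" "l2 M f" shows "l2 M (\<lambda>y. indicator A y * f y)" "nrm M (\<lambda>y. indicator A y * f y) \<le> nrm M f"
proof -
  show l: "l2 M (\<lambda>y. indicator A y * f y)"
  proof (rule l2_bounded_by[OF assms(2)])
    show "(\<lambda>y. indicator A y * f y) \<in> borel_measurable M" by (intro borel_measurable_times ind_meas assms l2_meas[OF assms(2)])
    show "norm (indicator A y * f y) \<le> norm (f y)" for y by (simp add: indicator_def)
  qed
  show "nrm M (\<lambda>y. indicator A y * f y) \<le> nrm M f"
    by (rule nrm_bounded_by[OF assms(2) l]) (simp add: indicator_def)
qed

text \<open>The neighbourhoods decrease to the closed null set \<open>S\<close>, so dominated
  convergence applies.\<close>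

lemma shrinking_tail:
  fixes S :: "(real^3) set" and \<phi> :: "real^3 \<Rightarrow> real"
  assumes S: "compact S" "S \<noteq> {}" "negligible S" and \<phi>: "l2 M \<phi>"
  shows "(\<lambda>k. nrm M (\<lambda>y. indicator {y. infdist y S < 1 / (real k + 1)} y * \<phi> y)) \<longlonglongrightarrow> 0"
proof -
  define N where "N k = {y. infdist y S < 1 / (real k + 1)}" for k
  have "open (N k)" for k unfolding N_def by (intro open_Collect_less continuous_intros)
  then have Nl: "N k \<in> sets lebesgue" for k by (rule open_leb)
  have aeS: "AE y in M. y \<notin> S"
    unfolding AE_on[OF leb] using S(3) by (auto simp: negligible_iff_null_sets dest!: AE_not_in elim!: eventually_mono)
  have "(\<lambda>k. LINT y|M. (indicator (N k) y * \<phi> y) * (indicator (N k) y * \<phi> y)) \<longlonglongrightarrow> (LINT y|M. 0)"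
  proof (rule integral_dominated_convergence[where w = "\<lambda>y. \<phi> y * \<phi> y"])
    show "(\<lambda>y. (indicator (N k) y * \<phi> y) * (indicator (N k) y * \<phi> y)) \<in> borel_measurable M" for k
      by (intro borel_measurable_times ind_meas Nl l2_meas[OF \<phi>])
    show "integrable M (\<lambda>y. \<phi> y * \<phi> y)" using l2_inner[OF \<phi> \<phi>] by simp
    show "AE y in M. norm ((indicator (N k) y * \<phi> y) * (indicator (N k) y * \<phi> y)) \<le> \<phi> y * \<phi> y" for k
      by (simp add: indicator_def)
    show "AE y in M. (\<lambda>k. (indicator (N k) y * \<phi> y) * (indicator (N k) y * \<phi> y)) \<longlonglongrightarrow> 0"
      using aeS
    proof eventually_elim
      case (elim y)
      have pos: "infdist y S > 0"
        using infdist_pos_not_in_closed[OF compact_imp_closed[OF S(1)] S(2) elim] .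
      obtain K where K: "1 / (real K + 1) < infdist y S" using reals_Archimedean[OF pos] by (auto simp: inverse_eq_divide add.commute)
      have "indicator (N k) y = (0::real)" if "k \<ge> K" for k
      proof -
        have "1 / (real k + 1) \<le> 1 / (real K + 1)" using that by (intro divide_left_mono) auto
        then show ?thesis using K by (simp add: N_def)
      qed
      then have "\<forall>\<^sub>F k in sequentially. (indicator (N k) y * \<phi> y) * (indicator (N k) y * \<phi> y) = 0"
        unfolding eventually_sequentially by (intro exI[of _ K] allI impI) simp
      then show ?case by (rule tendsto_eventually)
    qed
  qed simp
  then have "(\<lambda>k. sqrt (ip M (\<lambda>y. indicator (N k) y * \<phi> y) (\<lambda>y. indicator (N k) y * \<phi> y))) \<longlonglongrightarrow> sqrt 0"
    by (intro tendsto_real_sqrt) (simp add: ip_real)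
  then show ?thesis unfolding nrm_def N_def by simp
qed

text \<open>Split at a thin neighbourhood of \<open>S\<close>. Outside it a compact set away from
  \<open>S\<close> remains, where \<open>f n\<close> tends to zero in norm; inside it
  \<open>\<phi>\<close> has small norm while \<open>f n\<close> stays bounded.\<close>

lemma weak_null:
  fixes f :: "nat \<Rightarrow> real^3 \<Rightarrow> real"
  assumes S: "compact S" "S \<noteq> {}" "negligible S" and Kc: "compact Kc"
    and f: "\<And>n. l2 M (f n)" "\<And>n y. y \<notin> Kc \<Longrightarrow> f n y = 0" "\<And>n. nrm M (f n) \<le> B"
    and K: "\<And>K. compact K \<Longrightarrow> K \<subseteq> Kc - S \<Longrightarrow> (\<lambda>n. nrm M (\<lambda>y. indicator K y * f n y)) \<longlonglongrightarrow> 0"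
    and \<phi>: "l2 M \<phi>"
  shows "(\<lambda>n. ip M (f n) \<phi>) \<longlonglongrightarrow> 0"
proof (rule LIMSEQ_I)
  fix e :: real assume e: "e > 0"
  define N where "N k = {y. infdist y S < 1 / (real k + 1)}" for k
  have No: "open (N k)" for k unfolding N_def by (intro open_Collect_less continuous_intros)
  note Nl = open_leb[OF No]
  have "(\<lambda>k. B * nrm M (\<lambda>y. indicator (N k) y * \<phi> y)) \<longlonglongrightarrow> B * 0"
    unfolding N_def by (intro tendsto_mult_left shrinking_tail S \<phi>)
  then obtain k where k: "B * nrm M (\<lambda>y. indicator (N k) y * \<phi> y) < e / 2"
    using order_tendstoD(2)[of _ "B * 0" sequentially "e/2"] e by (fastforce simp: eventually_sequentially)
  define K' where "K' = Kc - N k"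
  have cK: "compact K'" unfolding K'_def by (rule compact_diff[OF Kc No])
  note Kl = compact_leb[OF cK]
  have KS: "K' \<subseteq> Kc - S" by (auto simp: K'_def N_def)
  have "(\<lambda>n. nrm M (\<lambda>y. indicator K' y * f n y) * nrm M \<phi>) \<longlonglongrightarrow> 0 * nrm M \<phi>"
    by (intro tendsto_mult_right K cK KS)
  then obtain n0 where n0: "\<And>n. n \<ge> n0 \<Longrightarrow> nrm M (\<lambda>y. indicator K' y * f n y) * nrm M \<phi> < e / 2"
    using order_tendstoD(2)[of _ "0 * nrm M \<phi>" sequentially "e/2"] e by (fastforce simp: eventually_sequentially)
  show "\<exists>no. \<forall>n\<ge>no. norm (ip M (f n) \<phi> - 0) < e"
  proof (intro exI[of _ n0] allI impI)
    fix n assume n: "n \<ge> n0"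
    have "f n = (\<lambda>y. indicator K' y * f n y + indicator (N k) y * f n y)"
      by (rule ext) (auto simp: K'_def indicator_def f(2))
    then have "ip M (f n) \<phi> = ip M (\<lambda>y. indicator K' y * f n y + indicator (N k) y * f n y) \<phi>" by simp
    also have "\<dots> = ip M (\<lambda>y. indicator K' y * f n y) \<phi> + ip M (\<lambda>y. indicator (N k) y * f n y) \<phi>"
      by (intro ip_add_left ind_mult_l2 Kl Nl f \<phi>)
    also have "ip M (\<lambda>y. indicator (N k) y * f n y) \<phi> = ip M (f n) (\<lambda>y. indicator (N k) y * \<phi> y)"
      unfolding ip_real by (intro Bochner_Integration.integral_cong) auto
    finally have e1: "ip M (f n) \<phi> = ip M (\<lambda>y. indicator K' y * f n y) \<phi> + ip M (f n) (\<lambda>y. indicator (N k) y * \<phi> y)" .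
    have "\<bar>ip M (f n) (\<lambda>y. indicator (N k) y * \<phi> y)\<bar> \<le> nrm M (f n) * nrm M (\<lambda>y. indicator (N k) y * \<phi> y)"
      by (intro ip_CS f ind_mult_l2 Nl \<phi>)
    also have "\<dots> \<le> B * nrm M (\<lambda>y. indicator (N k) y * \<phi> y)" by (intro mult_right_mono f nrm_nonneg)
    finally have b2: "\<bar>ip M (f n) (\<lambda>y. indicator (N k) y * \<phi> y)\<bar> < e / 2" using k by linarith
    have "\<bar>ip M (\<lambda>y. indicator K' y * f n y) \<phi>\<bar> \<le> nrm M (\<lambda>y. indicator K' y * f n y) * nrm M \<phi>"
      by (intro ip_CS f ind_mult_l2 Kl \<phi>)
    then have b1: "\<bar>ip M (\<lambda>y. indicator K' y * f n y) \<phi>\<bar> < e / 2" using n0[OF n] by linarith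
    show "norm (ip M (f n) \<phi> - 0) < e" using b1 b2 e1 by simp
  qed
qed

lemma ind_l2:
  fixes f :: "real^3 \<Rightarrow> real"
  assumes K: "K \<in> sets lebesgue" "K \<subseteq> U" and f: "l2 (lebesgue_on K) f"
  shows "l2 M (\<lambda>y. indicator K y * f y)" "nrm M (\<lambda>y. indicator K y * f y) = nrm (lebesgue_on K) f"
proof -
  have KU: "indicator U y * (indicator K y * r) = indicator K y * r" for y and r :: real
    using K(2) by (auto simp: indicator_def)
  have m: "set_borel_measurable lebesgue K f" and i: "set_integrable lebesgue K (\<lambda>y. (f y)\<^sup>2)"
    using f L2_on[OF K(1), of f] by (simp_all add: L2_def)
  have sq: "(indicator K y * f y)\<^sup>2 = indicator K y * (f y)\<^sup>2" for y by (simp add: indicator_def)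
  have "(\<lambda>y. indicator K y * f y) \<in> borel_measurable lebesgue" using m by (simp add: set_borel_measurable_def)
  moreover have "integrable M (\<lambda>y. indicator K y * (f y)\<^sup>2)"
    unfolding set_int_on[OF leb, symmetric] using i by (simp add: set_integrable_def KU)
  ultimately show "l2 M (\<lambda>y. indicator K y * f y)"
    unfolding l2_def by (intro conjI measurable_restrict_space1) (auto simp: sq)
  have "ip M (\<lambda>y. indicator K y * f y) (\<lambda>y. indicator K y * f y) = (LINT y|M. indicator K y * (f y)\<^sup>2)"
    unfolding ip_real by (intro Bochner_Integration.integral_cong) (auto simp: power2_eq_square indicator_def)
  also have "\<dots> = (LINT y:K|lebesgue. (f y)\<^sup>2)"
    unfolding LINT_on[OF leb, symmetric] by (simp add: set_lebesgue_integral_def KU)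
  also have "\<dots> = ip (lebesgue_on K) f f" unfolding LINT_on[OF K(1)] ip_real by (simp add: power2_eq_square)
  finally show "nrm M (\<lambda>y. indicator K y * f y) = nrm (lebesgue_on K) f" by (simp add: nrm_def)
qed

lemma conv_K:
  assumes v: "H1loc_conv (U - S) v g" and K: "compact K" "K \<subseteq> U - S"
  shows "l2 M (\<lambda>y. indicator K y * v n y)" "l2 M (\<lambda>y. indicator K y * g y)"
    "(\<lambda>n. nrm M (\<lambda>y. indicator K y * (v n y - g y))) \<longlonglongrightarrow> 0"
proof -
  note Kl = compact_leb[OF K(1)]
  have KU: "K \<subseteq> U" using K(2) by auto
  have loc: "H1loc (U - S) (v n)" "H1loc (U - S) g" for n using v by (auto simp: H1loc_conv_def)
  have lf: "l2 (lebesgue_on K) f" "l2 (lebesgue_on K) (wgrad (U - S) f)" if "H1loc (U - S) f" for f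
    using that K by (auto simp: H1loc_def L2_on[OF Kl] intro!: l2_vec)
  show "l2 M (\<lambda>y. indicator K y * v n y)" "l2 M (\<lambda>y. indicator K y * g y)"
    by (intro ind_l2[OF Kl KU] lf loc)+
  let ?d = "\<lambda>n y. v n y - g y" and ?G = "\<lambda>n y. wgrad (U - S) (v n) y - wgrad (U - S) g y"
  have ld: "l2 (lebesgue_on K) (?d n)" "l2 (lebesgue_on K) (?G n)" for n by (intro l2_diff lf loc)+
  have id: "integrable (lebesgue_on K) (\<lambda>y. (?d n y)\<^sup>2)" "integrable (lebesgue_on K) (\<lambda>y. (norm (?G n y))\<^sup>2)" for n
    using ld[of n] by (simp_all add: l2_def)
  have "(\<lambda>n. (nrm (lebesgue_on K) (?d n))\<^sup>2) \<longlonglongrightarrow> 0"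
  proof (rule null_sandwich)
    show "\<bar>(nrm (lebesgue_on K) (?d n))\<^sup>2\<bar> \<le> (LINT y:K|lebesgue. (?d n y)\<^sup>2 + (norm (?G n y))\<^sup>2)" for n
    proof -
      have "\<bar>(nrm (lebesgue_on K) (?d n))\<^sup>2\<bar> = (LINT y|lebesgue_on K. (?d n y)\<^sup>2)"
        unfolding nrm_sq abs_of_nonneg[OF ip_nonneg] by (simp add: ip_real power2_eq_square)
      also have "\<dots> \<le> (LINT y|lebesgue_on K. (?d n y)\<^sup>2 + (norm (?G n y))\<^sup>2)"
        by (intro integral_mono id Bochner_Integration.integrable_add) auto
      finally show ?thesis by (simp add: LINT_on[OF Kl])
    qed
    show "(\<lambda>n. LINT y:K|lebesgue. (?d n y)\<^sup>2 + (norm (?G n y))\<^sup>2) \<longlonglongrightarrow> 0" using v K by (simp add: H1loc_conv_def)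
  qed
  then have "(\<lambda>n. sqrt ((nrm (lebesgue_on K) (?d n))\<^sup>2)) \<longlonglongrightarrow> sqrt 0" by (rule tendsto_real_sqrt)
  then show "(\<lambda>n. nrm M (\<lambda>y. indicator K y * (v n y - g y))) \<longlonglongrightarrow> 0"
    by (simp add: ind_l2(2)[OF Kl KU ld(1)])
qed

text \<open>A second integration by parts puts both derivatives on \<open>\<phi>\<close>, so that
  later limits involve only values of the harmonic functions and not their gradients.\<close>

lemma harmonic_lap:
  assumes u: "weakly_harmonic U u" and \<phi>: "test_fun U \<phi>"
  shows "l2 M u" "ip M u (lap \<phi>) = 0"
proof -
  have H: "H1 U u" and z: "\<And>w. w \<in> h10 U \<Longrightarrow> aform M (\<lambda>_. 0) (pr u) w = 0"
    using u unfolding weakly_harmonic_def weak_sol_iff[OF ess_bdd_0] by auto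
  note pu = H1_pr[OF H]
  show lu: "l2 M u" by (rule pu)
  note lp = test_l2[OF \<phi>]
  have lpp: "l2 M (pd i (pd i \<phi>))" for i by (rule test_l2(1)[OF test_pd[OF test_pd[OF \<phi>]]])
  have "ip M u (lap \<phi>) = (\<Sum>i\<in>UNIV. ip M u (pd i (pd i \<phi>)))"
  proof -
    have "ip M u (lap \<phi>) = (LINT y|M. (\<Sum>i\<in>UNIV. u y * pd i (pd i \<phi>) y))"
      by (simp add: ip_real lap_def sum_distrib_left)
    also have "\<dots> = (\<Sum>i\<in>UNIV. (LINT y|M. u y * pd i (pd i \<phi>) y))"
      by (rule Bochner_Integration.integral_sum) (use l2_inner[OF lu lpp] in simp)
    finally show ?thesis by (simp add: ip_real)
  qed
  also have "\<dots> = (\<Sum>i\<in>UNIV. - ip M (\<lambda>y. wgrad U u y $ i) (pd i \<phi>))"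
    using h1_ibp[OF pu(1) test_pd[OF \<phi>]] by (simp add: pr_def)
  also have "\<dots> = - ip M (wgrad U u) (grad3 \<phi>)"
  proof -
    have "l2 M (grad3 \<phi>)" using l2_snd[OF lp(3)] by (simp add: jet_def)
    then show ?thesis using ip_vec[OF pu(3), of "grad3 \<phi>"] by (simp add: sum_negf grad3_def)
  qed
  also have "\<dots> = - aform M (\<lambda>_. 0) (pr u) (jet \<phi>)" by (simp add: aform_def pr_def jet_def)
  also have "\<dots> = 0" by (simp add: z[OF test_h10[OF \<phi>]])
  finally show "ip M u (lap \<phi>) = 0" .
qed

text \<open>If the norms stayed bounded, \<open>v n\<close> would converge weakly to the dipole near \<open>\<sigma> t\<close>, and the distributional
  Laplacian of \<open>v n\<close>, localised to the end piece of the needle, would converge to that of the dipole, which is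
  not zero. The linear function in \<open>\<phi>\<close> detects the dipole at \<open>x\<close>.\<close>
lemma needle_blowup:
  fixes v :: "nat \<Rightarrow> real^3 \<Rightarrow> real" and \<sigma> :: "real \<Rightarrow> real^3"
  assumes cont: "continuous_on {0..1} \<sigma>" and neg: "negligible (\<sigma> ` {0..1})" and inj: "inj_on \<sigma> {0..1}"
    and end1: "\<sigma> 1 = x" and inU: "\<And>t. t \<in> {0<..1} \<Longrightarrow> \<sigma> t \<in> U"
    and harm: "\<And>n. weakly_harmonic U (v n)" and conv: "H1loc_conv (U - \<sigma> ` {0..1}) v (\<lambda>z. dG j (z - x))"
    and t: "0 < t" "t < 1" and D: "open D" "\<sigma> t \<in> D" and X: "D \<subseteq> X" "X \<subseteq> U" "X \<in> sets lebesgue"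
  shows "filterlim (\<lambda>n. nrm M (\<lambda>y. indicator X y * v n y)) at_top sequentially"
proof (rule ccontr)
  define S where "S = \<sigma> ` {0..1}"
  define z where "z = \<sigma> t"
  have cS: "compact S" unfolding S_def by (intro compact_continuous_image cont compact_Icc)
  have nS: "S \<noteq> {}" by (auto simp: S_def)
  note conv = conv[folded S_def]
  have lv: "l2 M (v n)" for n by (rule harmonic_lap(1)[OF harm test_zero])
  assume "\<not> ?thesis"
  then obtain Z where "\<not> (\<forall>\<^sub>F n in sequentially. Z \<le> nrm M (\<lambda>y. indicator X y * v n y))"
    unfolding filterlim_at_top by blast
  then have inf: "infinite {n. nrm M (\<lambda>y. indicator X y * v n y) < Z}"
    by (auto simp: infinite_nat_iff_unbounded_le eventually_sequentially not_le)
  \<comment> \<open>A subsequence along which the norms stay below \<open>Z\<close>.\<close>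
  define s :: "nat \<Rightarrow> nat" where "s = enumerate {n. nrm M (\<lambda>y. indicator X y * v n y) < Z}"
  have s: "strict_mono s" unfolding s_def by (rule strict_mono_enumerate[OF inf])
  have sZ: "nrm M (\<lambda>y. indicator X y * v (s n) y) \<le> Z" for n using enumerate_in_set[OF inf, of n] by (simp add: s_def)
  have zx: "z \<noteq> x" using inj_onD[OF inj, of t 1] t end1 by (auto simp: z_def)
  have "open (D - {x})" using D by auto
  moreover have "z \<in> D - {x}" using D zx by (simp add: z_def)
  ultimately obtain \<rho> where \<rho>: "\<rho> > 0" "cball z \<rho> \<subseteq> D - {x}" unfolding open_contains_cball by blast
  \<comment> \<open>The needle before and after its passage at \<open>z\<close>, with the ball
    removed; injectivity keeps the two pieces apart, so a cutoff can separate them.\<close>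
  define P where "P = \<sigma> ` {0..t} - ball z \<rho>"
  define Q where "Q = \<sigma> ` {t..1} - ball z \<rho>"
  have cP: "compact P" "compact Q"
    unfolding P_def Q_def by (intro compact_diff compact_continuous_image continuous_on_subset[OF cont] compact_Icc; use t in auto)+
  have SPQ: "S \<subseteq> P \<union> Q \<union> ball z \<rho>"
  proof
    fix y assume "y \<in> S"
    then obtain r where "r \<in> {0..1}" "y = \<sigma> r" by (auto simp: S_def)
    then have "y \<in> \<sigma> ` {0..t} \<or> y \<in> \<sigma> ` {t..1}" by (cases "r \<le> t") auto
    then show "y \<in> P \<union> Q \<union> ball z \<rho>" by (auto simp: P_def Q_def)
  qed
  have disj: "P \<inter> Q = {}"
  proof (rule ccontr)
    assume "P \<inter> Q \<noteq> {}"
    then obtain y where "y \<in> P" "y \<in> Q" by blast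
    then obtain r r' where "r \<in> {0..t}" "y = \<sigma> r" "r' \<in> {t..1}" "y = \<sigma> r'" "y \<notin> ball z \<rho>" unfolding P_def Q_def by blast
    then have r: "r \<in> {0..t}" "r' \<in> {t..1}" "\<sigma> r = \<sigma> r'" "\<sigma> r \<notin> ball z \<rho>" by auto
    then have "r = r'" using inj_onD[OF inj r(3)] t by auto
    then have "r = t" using r by auto
    then show False using r(4) \<rho> by (simp add: z_def)
  qed
  have "x \<notin> ball z \<rho>" using \<rho>(2) ball_subset_cball[of z \<rho>] by blast
  then have xQ: "x \<in> Q" using end1 t by (auto simp: Q_def image_iff intro!: bexI[of _ 1])
  have QU: "Q \<subseteq> U - P" using disj inU t by (auto simp: Q_def)
  have oU: "open (U - P)" using op compact_imp_closed[OF cP(1)] by auto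
  \<comment> \<open>One near the end piece \<open>Q\<close>, which contains \<open>x\<close>, and
    zero near \<open>P\<close>: the piece of the needle that runs to the boundary is never
    tested.\<close>
  obtain ch V0 where ch: "test_fun (U - P) ch" "open V0" "Q \<subseteq> V0" "V0 \<subseteq> U - P" "\<And>y. y \<in> V0 \<Longrightarrow> ch y = 1"
    by (rule cutoff[OF cP(2) oU QU]) (rule that)
  define \<phi> where "\<phi> y = ch y * (y $ j - x $ j)" for y :: "real^3"
  have sm: "smooth3 (\<lambda>y :: real^3. y $ j - x $ j)" by (intro smooth3_minus smooth3_coord smooth3_const)
  have tP: "test_fun (U - P) \<phi>" unfolding \<phi>_def by (rule test_mult[OF ch(1) sm])
  then have t\<phi>: "test_fun U \<phi>" by (auto simp: test_fun_def)
  have lin: "\<phi> y = y $ j - x $ j" if "y \<in> V0" for y using ch(5)[OF that] by (simp add: \<phi>_def)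
  \<comment> \<open>Linear functions are harmonic, so \<open>\<psi>\<close> vanishes near
    \<open>Q\<close>; the needle can meet its support only inside the ball around
    \<open>z\<close>.\<close>
  define \<psi> where "\<psi> = lap \<phi>"
  have t\<psi>: "test_fun U \<psi>" unfolding \<psi>_def by (rule lap_test[OF t\<phi>])
  have l\<psi>: "l2 M \<psi>" by (rule test_l2(1)[OF t\<psi>])
  have \<psi>V: "\<psi> y = 0" if y: "y \<in> V0" for y
  proof -
    have p1: "pd i \<phi> y = (if i = j then 1 else 0)" if "y \<in> V0" for i y
      using pd_local[OF ch(2) lin that] lin_c1(2) by simp
    have "pd i (pd i \<phi>) y = pd i (\<lambda>_. if i = j then 1 else 0) y" for i
      by (rule pd_local[OF ch(2) _ y]) (rule p1)
    then show ?thesis by (simp add: \<psi>_def lap_def)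
  qed
  define T1 where "T1 = tsupp \<phi> - V0"
  have T1: "\<psi> y = 0" if "y \<notin> T1" for y
  proof (cases "y \<in> V0")
    case False
    then have y: "y \<notin> tsupp \<phi>" using that by (simp add: T1_def)
    have "open (- tsupp \<phi>)" by (auto simp: tsupp_def)
    then have "pd i (pd i \<phi>) y = pd i (\<lambda>_. 0) y" for i
      by (rule pd_local) (use pd_tsupp y in auto)
    then show ?thesis by (simp add: \<psi>_def lap_def)
  qed (rule \<psi>V)
  \<comment> \<open>Outside the ball the support of \<open>\<psi>\<close> stays away from the
    needle, so convergence there is strong.\<close>
  define K1 where "K1 = T1 - ball z \<rho>"
  have cT: "compact T1" unfolding T1_def by (rule compact_diff[OF test_funD(2)[OF t\<phi>] ch(2)])
  have cK: "compact K1" unfolding K1_def by (rule compact_diff[OF cT]) simp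
  have T1UP: "T1 \<subseteq> U - P" using test_funD(3)[OF tP] by (auto simp: T1_def)
  have K1S: "K1 \<subseteq> U - S" using T1UP SPQ ch(3) by (auto simp: K1_def T1_def)
  have "open (V0 - cball z \<rho>)" using ch(2) by auto
  moreover have "x \<in> V0 - cball z \<rho>" using xQ ch(3) \<rho> by auto
  ultimately obtain r where r: "r > 0" "ball x r \<subseteq> V0 - cball z \<rho>" unfolding open_contains_ball by blast
  \<comment> \<open>The dipole is altered only in a ball inside \<open>V0\<close>, where
    \<open>\<psi>\<close> vanishes, so the pairing with \<open>\<psi>\<close> does not notice the
    regularisation.\<close>
  define E where "E y = (1 / (4 * pi)) * dipole (r\<^sup>2) j x y" for y
  have EG: "E y = dG j (y - x)" if "y \<notin> ball x r" for y
    unfolding E_def by (rule dipole_eq_dG[OF r(1)]) (use that in \<open>simp add: dist_norm norm_minus_commute\<close>)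
  have lEg: "l2 M (dipole (r\<^sup>2) j x)" by (rule c1_l2) (rule dipole_facts, use r in simp)
  have lE: "l2 M E" using l2_scale[OF lEg, of "1 / (4 * pi)"] by (simp add: E_def[abs_def])
  define f where "f n = (\<lambda>y. indicator (cball z \<rho>) y * (v (s n) y - E y))" for n
  note cbl = compact_leb[OF compact_cball[of z \<rho>]]
  have lf: "l2 M (f n)" for n unfolding f_def by (intro ind_mult_l2 cbl l2_diff lv lE)
  have convS: "(\<lambda>n. nrm M (\<lambda>y. indicator K y * (v (s n) y - E y))) \<longlonglongrightarrow> 0"
    if K: "compact K" "K \<subseteq> U - S" "K \<inter> ball x r = {}" for K
  proof -
    have e: "indicator K y * (v n y - E y) = indicator K y * (v n y - dG j (y - x))" for n y
    proof (cases "y \<in> K")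
      case True
      then have "y \<notin> ball x r" using K(3) by blast
      then show ?thesis using EG by simp
    qed simp
    show ?thesis unfolding e using LIMSEQ_subseq_LIMSEQ[OF conv_K(3)[OF conv K(1,2)] s] by (simp add: o_def)
  qed
  \<comment> \<open>Weak convergence across the needle; this is where the bound along the
    subsequence enters.\<close>
  have wk: "(\<lambda>n. ip M (f n) \<psi>) \<longlonglongrightarrow> 0"
  proof (rule weak_null[OF cS nS neg[folded S_def] compact_cball[of z \<rho>] lf _ _ _ l\<psi>])
    show "f n y = 0" if "y \<notin> cball z \<rho>" for n y using that by (simp add: f_def)
    show "nrm M (f n) \<le> Z + nrm M E" for n
    proof -
      have eq: "f n = (\<lambda>y. indicator (cball z \<rho>) y * (indicator X y * v (s n) y) - indicator (cball z \<rho>) y * E y)"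
        using \<rho> X by (intro ext) (auto simp: f_def indicator_def)
      have lX: "l2 M (\<lambda>y. indicator X y * v (s n) y)" by (intro ind_mult_l2 X lv)
      have "nrm M (f n) \<le> nrm M (\<lambda>y. indicator (cball z \<rho>) y * (indicator X y * v (s n) y)) + nrm M (\<lambda>y. indicator (cball z \<rho>) y * E y)"
        unfolding eq by (intro nrm_diff ind_mult_l2 cbl lX lE)
      also have "\<dots> \<le> nrm M (\<lambda>y. indicator X y * v (s n) y) + nrm M E"
        by (intro add_mono ind_mult_l2 cbl lX lE)
      finally show ?thesis using sZ[of n] by linarith
    qed
    fix K assume K: "compact K" "K \<subseteq> cball z \<rho> - S"
    have "cball z \<rho> \<subseteq> U" using \<rho> X by auto
    then have "(\<lambda>n. nrm M (\<lambda>y. indicator K y * (v (s n) y - E y))) \<longlonglongrightarrow> 0"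
      using K r by (intro convS) auto
    moreover have eqf: "indicator K y * f n y = indicator K y * (v (s n) y - E y)" for n y
      using K(2) by (auto simp: f_def indicator_def)
    ultimately show "(\<lambda>n. nrm M (\<lambda>y. indicator K y * f n y)) \<longlonglongrightarrow> 0" by (simp only: eqf)
  qed
  have K1B: "K1 \<inter> ball x r = {}" using r by (auto simp: K1_def T1_def)
  have lK: "l2 M (\<lambda>y. indicator K1 y * (v (s n) y - E y))" for n
    by (intro ind_mult_l2 compact_leb cK l2_diff lv lE)
  have wk2: "(\<lambda>n. ip M (\<lambda>y. indicator K1 y * (v (s n) y - E y)) \<psi>) \<longlonglongrightarrow> 0"
  proof (rule null_sandwich)
    show "\<bar>ip M (\<lambda>y. indicator K1 y * (v (s n) y - E y)) \<psi>\<bar> \<le> nrm M (\<lambda>y. indicator K1 y * (v (s n) y - E y)) * nrm M \<psi>" for n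
      by (rule ip_CS[OF lK l\<psi>])
    show "(\<lambda>n. nrm M (\<lambda>y. indicator K1 y * (v (s n) y - E y)) * nrm M \<psi>) \<longlonglongrightarrow> 0"
      by (rule tendsto_mult_left_zero[OF convS[OF cK K1S K1B]])
  qed
  \<comment> \<open>The left side is the pairing of \<open>v (s n)\<close> with
    \<open>\<psi>\<close>, zero by harmonicity. On the support of \<open>\<psi>\<close>,
    \<open>v (s n)\<close> is \<open>E\<close> plus its deviation on \<open>K1\<close> and on the
    ball.\<close>
  have split: "0 = ip M E \<psi> + ip M (\<lambda>y. indicator K1 y * (v (s n) y - E y)) \<psi> + ip M (\<lambda>y. indicator (ball z \<rho>) y * (v (s n) y - E y)) \<psi>" for n
  proof -
    have lb: "l2 M (\<lambda>y. indicator (ball z \<rho>) y * (v (s n) y - E y))" by (intro ind_mult_l2 open_leb l2_diff lv lE) simp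
    have "0 = ip M (v (s n)) \<psi>" unfolding \<psi>_def by (rule harmonic_lap(2)[OF harm t\<phi>, symmetric])
    also have "\<dots> = ip M (\<lambda>y. E y + indicator K1 y * (v (s n) y - E y) + indicator (ball z \<rho>) y * (v (s n) y - E y)) \<psi>"
      unfolding ip_real
    proof (rule Bochner_Integration.integral_cong[OF refl])
      show "v (s n) y * \<psi> y = (E y + indicator K1 y * (v (s n) y - E y) + indicator (ball z \<rho>) y * (v (s n) y - E y)) * \<psi> y" for y
        using T1[of y] by (cases "y \<in> T1"; cases "y \<in> ball z \<rho>") (simp_all add: K1_def)
    qed
    also have "\<dots> = ip M E \<psi> + ip M (\<lambda>y. indicator K1 y * (v (s n) y - E y)) \<psi> + ip M (\<lambda>y. indicator (ball z \<rho>) y * (v (s n) y - E y)) \<psi>"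
      using lE lK lb l\<psi> by (simp add: ip_add_left)
    finally show ?thesis .
  qed
  \<comment> \<open>Open and closed ball differ by the sphere, which is null.\<close>
  have sph: "ip M (\<lambda>y. indicator (ball z \<rho>) y * (v (s n) y - E y)) \<psi> = ip M (f n) \<psi>" for n
  proof (rule ip_cong_AE[OF _ lf l\<psi> l\<psi>])
    show "l2 M (\<lambda>y. indicator (ball z \<rho>) y * (v (s n) y - E y))" by (intro ind_mult_l2 open_leb l2_diff lv lE) simp
    have "AE y in M. y \<notin> sphere z \<rho>"
      unfolding AE_on[OF leb] using negligible_sphere[of z \<rho>]
      by (auto simp: negligible_iff_null_sets dest!: AE_not_in elim!: eventually_mono)
    then show "AE y in M. indicator (ball z \<rho>) y * (v (s n) y - E y) = f n y"
      by eventually_elim (auto simp: f_def indicator_def)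
  qed simp
  have "(\<lambda>n. ip M E \<psi> + ip M (\<lambda>y. indicator K1 y * (v (s n) y - E y)) \<psi> + ip M (f n) \<psi>) \<longlonglongrightarrow> ip M E \<psi> + 0 + 0"
    by (intro tendsto_add wk wk2 tendsto_const)
  then have "(\<lambda>n::nat. 0) \<longlonglongrightarrow> ip M E \<psi>" using split unfolding sph by simp
  then have "ip M E \<psi> = 0" using LIMSEQ_unique tendsto_const by blast
  moreover have "ip M E \<psi> = (1 / (4 * pi)) * ip M (dipole (r\<^sup>2) j x) \<psi>"
    using ip_scale_left[of M "1 / (4 * pi)" "dipole (r\<^sup>2) j x" \<psi>] by (simp add: E_def[abs_def])
  moreover have "ip M (dipole (r\<^sup>2) j x) \<psi> > 0"
    unfolding \<psi>_def by (rule lap_pos[OF r(1) _ t\<phi> lin]) (use r ch in auto)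
  ultimately show False by simp
qed

text \<open>On balls approaching the vertex the squared dipole is at least of order
  \<open>1 / t ^ 4\<close>, while the volume is of order \<open>t ^ 3\<close>. Each fixed ball is a
  compact subset of \<open>D\<close> off the needle, where \<open>v n\<close> converges to the
  dipole.\<close>

lemma boundary_blowup:
  fixes v :: "nat \<Rightarrow> real^3 \<Rightarrow> real"
  assumes D: "open D" "lipschitz_bdry D" "x \<in> frontier D" and S: "S \<inter> D = {}"
    and lv: "\<And>n. l2 M (v n)" and conv: "H1loc_conv (U - S) v (\<lambda>z. dG j (z - x))"
    and X: "D \<subseteq> X" "X \<subseteq> U" "X \<in> sets lebesgue"
  shows "filterlim (\<lambda>n. nrm M (\<lambda>y. indicator X y * v n y)) at_top sequentially"
  unfolding filterlim_at_top_gt[where c = 0]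
proof (intro allI impI)
  fix Z :: real assume Z: "Z > 0"
  obtain y0 \<rho> m t0 where c: "\<rho> > 0" "m > 0" "t0 > 0"
    and cb: "\<And>t. 0 < t \<Longrightarrow> t \<le> t0 \<Longrightarrow> cball (x + t *\<^sub>R y0) (t * \<rho>) \<subseteq> D"
    and cm: "\<And>t y. 0 < t \<Longrightarrow> y \<in> cball (x + t *\<^sub>R y0) (t * \<rho>) \<Longrightarrow> y \<noteq> x \<and> m / t ^ 4 \<le> (dG j (y - x))\<^sup>2"
    by (rule cone_balls[OF D]) (rule that)
  define c3 where "c3 = m * (unit_ball_vol (real DIM(real^3)) * \<rho> ^ 3)"
  have c3: "c3 > 0" unfolding c3_def using c unit_ball_vol_pos[of "real DIM(real^3)"] by (intro mult_pos_pos) auto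
  \<comment> \<open>Makes the lower bound \<open>c3 / t\<close> for the integral at least
    \<open>(Z + 1)\<^sup>2\<close>; the extra one gives a strict inequality that survives the
    passage from the limit to large \<open>n\<close>.\<close>
  define t where "t = min t0 (c3 / (Z + 1)\<^sup>2)"
  have t: "0 < t" "t \<le> t0" using c c3 Z by (auto simp: t_def)
  define K where "K = cball (x + t *\<^sub>R y0) (t * \<rho>)"
  have K: "compact K" "K \<subseteq> D" using cb[OF t] by (auto simp: K_def)
  have KU: "K \<subseteq> U - S" using K X S by auto
  note Kl = compact_leb[OF K(1)]
  note cK = conv_K[OF conv K(1) KU]
  let ?g = "\<lambda>y. indicator K y * dG j (y - x)"
  have "(Z + 1)\<^sup>2 \<le> c3 / t"
  proof -
    have "t \<le> c3 / (Z + 1)\<^sup>2" by (simp add: t_def)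
    then show ?thesis using t Z by (simp add: field_simps)
  qed
  also have "c3 / t = m / t ^ 4 * measure lborel K"
  proof -
    have "measure lborel K = unit_ball_vol (real DIM(real^3)) * (t * \<rho>) ^ DIM(real^3)"
      unfolding K_def by (rule content_cball) (use t c in simp)
    then show ?thesis using t by (simp add: c3_def power_mult_distrib field_simps power_numeral_reduce)
  qed
  also have "\<dots> = (LINT y|M. m / t ^ 4 * indicator K y)"
  proof -
    have "measure M K = measure lborel K"
      using measure_restrict_space[of U lebesgue K] leb KU Kl measure_completion[of K lborel] borel_compact[OF K(1)] by auto
    moreover have "K \<inter> space M = K" using KU by auto
    ultimately show ?thesis by simp
  qed
  also have "\<dots> \<le> (LINT y|M. ?g y * ?g y)"
  proof (rule integral_mono)
    show "integrable M (\<lambda>y. ?g y * ?g y)" using l2_inner[OF cK(2) cK(2)] by simp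
    show "integrable M (\<lambda>y. m / t ^ 4 * indicator K y)"
      using l2_integrable[OF fin ind_mult_l2(1)[OF Kl one_l2[of "m / t ^ 4"]]] by (simp add: mult.commute)
    show "m / t ^ 4 * indicator K y \<le> ?g y * ?g y" for y
      using cm[OF t(1), of y] by (auto simp: K_def indicator_def power2_eq_square)
  qed
  also have "\<dots> = (nrm M ?g)\<^sup>2" by (simp add: nrm_sq ip_real)
  finally have "Z + 1 \<le> nrm M ?g" using power2_le_imp_le nrm_nonneg by blast
  moreover have "(\<lambda>n. nrm M (\<lambda>y. indicator K y * v n y)) \<longlonglongrightarrow> nrm M ?g"
    by (rule nrm_tendsto[OF cK(1,2)]) (use cK(3) in \<open>simp add: right_diff_distrib\<close>)
  ultimately have "\<forall>\<^sub>F n in sequentially. Z < nrm M (\<lambda>y. indicator K y * v n y)" by (intro order_tendstoD(1)) auto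
  then show "\<forall>\<^sub>F n in sequentially. Z \<le> nrm M (\<lambda>y. indicator X y * v n y)"
  proof eventually_elim
    case (elim n)
    have "nrm M (\<lambda>y. indicator K y * v n y) \<le> nrm M (\<lambda>y. indicator X y * v n y)"
      by (rule nrm_bounded_by[OF ind_mult_l2(1)[OF X(3) lv] cK(1)]) (use K X in \<open>auto simp: indicator_def\<close>)
    then show ?case using elim by simp
  qed
qed

end

theorem theorem3p1:
  fixes \<Omega> D \<Gamma>0 :: "(real^3) set" and V :: "real^3 \<Rightarrow> real" and x :: "real^3"
    and \<sigma> :: "real \<Rightarrow> real^3" and j :: 3 and v :: "nat \<Rightarrow> real^3 \<Rightarrow> real"
  assumes "open \<Omega>" and "connected \<Omega>" and "bounded \<Omega>" and "connected (frontier \<Omega>)"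
    and "C11_bdry \<Omega>"
    and "open D" and "lipschitz_bdry D" and "closure D \<subseteq> \<Omega>"
    and "Linfty \<Omega> V" and "AE y in lebesgue. y \<in> \<Omega> - closure D \<longrightarrow> V y = 0"
    and "\<not> dirichlet_eigenvalue_0 \<Omega> V"
    and "openin (top_of_set (frontier \<Omega>)) \<Gamma>0" and "\<Gamma>0 \<noteq> {}"
    and "x \<in> \<Omega>" and "Ncurves \<Omega> x \<sigma>"
    and "x \<in> closure D \<or> (x \<in> \<Omega> - closure D \<and> \<sigma> ` {0..1} \<inter> D \<noteq> {})"
    and "needle_seq \<Omega> \<Gamma>0 x \<sigma> j v"
  shows "(positive_jump D V \<longrightarrow>
            filterlim (probe_ind \<Omega> V v) at_top sequentially \<and>
            filterlim (singular_sources_ind \<Omega> V j x v) at_top sequentially \<and>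
            filterlim (completely_integrated_ind \<Omega> V j x v) at_top sequentially) \<and>
         (negative_jump D V \<longrightarrow>
            filterlim (probe_ind \<Omega> V v) at_bot sequentially \<and>
            filterlim (singular_sources_ind \<Omega> V j x v) at_bot sequentially \<and>
            filterlim (completely_integrated_ind \<Omega> V j x v) at_bot sequentially)"
proof -
  interpret bdom \<Omega> by unfold_locales (fact assms)+
  define S where "S = \<sigma> ` {0..1}"
  define X where "X = closure D"
  have pl: "piecewise_linear \<sigma>" and inj: "inj_on \<sigma> {0..1}" and \<sigma>: "\<sigma> 0 \<in> frontier \<Omega>" "\<sigma> 1 = x" "\<And>t. t \<in> {0<..<1} \<Longrightarrow> \<sigma> t \<in> \<Omega>"
    using \<open>Ncurves \<Omega> x \<sigma>\<close> by (auto simp: Ncurves_def)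
  note cont = piecewise_linear_facts(1)[OF pl] and neg = piecewise_linear_facts(2)[OF pl]
  have cS: "compact S" "S \<noteq> {}" unfolding S_def by (auto intro!: compact_continuous_image cont compact_Icc)
  have harm: "\<And>n. weakly_harmonic \<Omega> (v n)" and conv: "H1loc_conv (\<Omega> - S) v (\<lambda>z. dG j (z - x))"
    using \<open>needle_seq \<Omega> \<Gamma>0 x \<sigma> j v\<close> by (auto simp: needle_seq_def S_def)
  have X\<Omega>: "X \<subseteq> \<Omega>" using \<open>closure D \<subseteq> \<Omega>\<close> by (simp add: X_def)
  have cX: "compact X" using bounded_subset[OF bd X\<Omega>] by (simp add: X_def compact_eq_bounded_closed)
  note Xl = compact_leb[OF cX]
  have DX: "D \<subseteq> X" by (simp add: X_def closure_subset)
  have V: "ess_bdd M V" using \<open>Linfty \<Omega> V\<close> by (simp add: Linfty_ess_bdd)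
  have no_kernel: "no_kernel V" by (rule no_kernel_if_no_eigenvalue[OF V]) fact
  have V0: "AE y in M. y \<notin> X \<longrightarrow> V y = 0"
    unfolding AE_on[OF leb] X_def using \<open>AE y in lebesgue. y \<in> \<Omega> - closure D \<longrightarrow> V y = 0\<close> by eventually_elim auto
  have lv: "l2 M (v n)" for n by (rule harmonic_lap(1)[OF harm test_zero])
  define a where "a n = nrm M (\<lambda>y. indicator X y * v n y)" for n
  have lX: "l2 M (\<lambda>y. indicator X y * v n y)" for n by (intro ind_mult_l2 Xl lv)
  have ainf: "filterlim a at_top sequentially"
  proof (cases "S \<inter> D = {}")
    case True
    have "x \<in> S" using \<sigma>(2) by (auto simp: S_def)
    \<comment> \<open>The tip belongs to the needle, which avoids \<open>D\<close> in this case.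
      Alternative (ii) is thus excluded, and \<open>x\<close> lies in the closure of
      \<open>D\<close> but not in \<open>D\<close>.\<close>
    then have "x \<in> frontier D"
      using assms(16) True \<open>open D\<close> by (auto simp: S_def frontier_def interior_open)
    then show ?thesis unfolding a_def
      by (rule boundary_blowup[OF \<open>open D\<close> \<open>lipschitz_bdry D\<close> _ True lv conv DX X\<Omega> Xl])
  next
    case False
    then obtain t1 where t1: "t1 \<in> {0..1}" "\<sigma> t1 \<in> D" unfolding S_def by blast
    \<comment> \<open>The needle starts on the frontier of an open set, hence outside it, so
      \<open>t1\<close> is not the initial parameter.\<close>
    have "\<sigma> 0 \<notin> \<Omega>" using \<sigma>(1) \<open>open \<Omega>\<close> by (simp add: frontier_def interior_open)
    then have t10: "t1 \<noteq> 0" using t1 DX X\<Omega> by auto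
    \<comment> \<open>If the parameter found is that of the tip, continuity and openness of
      \<open>D\<close> provide an earlier one.\<close>
    obtain t where t: "0 < t" "t < 1" "\<sigma> t \<in> D"
    proof (cases "t1 = 1")
      case True
      obtain e where e: "e > 0" "ball (\<sigma> 1) e \<subseteq> D" using \<open>open D\<close> t1 True unfolding open_contains_ball by blast
      obtain d where d: "d > 0" "\<And>r. r \<in> {0..1} \<Longrightarrow> dist r 1 < d \<Longrightarrow> dist (\<sigma> r) (\<sigma> 1) < e"
        using cont e(1) unfolding continuous_on_iff by force
      \<comment> \<open>Within \<open>d\<close> of the end, below one and positive.\<close>
      define r where "r = max (1/2) (1 - d/2)"
      have "\<sigma> r \<in> ball (\<sigma> 1) e" using d(2)[of r] d(1) by (simp add: r_def dist_real_def dist_commute)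
      then show thesis by (intro that[of r]) (use e d in \<open>auto simp: r_def\<close>)
    next
      case False
      then show thesis using that[of t1] t1 t10 by auto
    qed
    have in\<Omega>: "\<sigma> r \<in> \<Omega>" if "r \<in> {0<..1}" for r using \<sigma> that \<open>x \<in> \<Omega>\<close> by (cases "r = 1") auto
    show ?thesis unfolding a_def
      by (rule needle_blowup[OF cont neg inj \<sigma>(2) in\<Omega> harm conv[unfolded S_def] t(1,2) \<open>open D\<close> t(3) DX X\<Omega> Xl])
  qed
  \<comment> \<open>On compact subsets of \<open>X\<close> off the needle \<open>v n\<close>
    converges in norm, so division by \<open>a n\<close>, which tends to infinity, sends it to zero
    there; the divided functions have norm at most one.\<close>
  have weak: "(\<lambda>n. ip M (\<lambda>y. indicator X y * v n y) \<phi> / a n) \<longlonglongrightarrow> 0" if \<phi>: "l2 M \<phi>" for \<phi>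
  proof -
    have "(\<lambda>n. ip M (\<lambda>y. (1 / a n) *\<^sub>R (indicator X y * v n y)) \<phi>) \<longlonglongrightarrow> 0"
    proof (rule weak_null[OF cS neg[folded S_def] cX _ _ _ _ \<phi>])
      show "l2 M (\<lambda>y. (1 / a n) *\<^sub>R (indicator X y * v n y))" for n by (rule l2_scale[OF lX])
      show "(1 / a n) *\<^sub>R (indicator X y * v n y) = 0" if "y \<notin> X" for n y using that by simp
      show "nrm M (\<lambda>y. (1 / a n) *\<^sub>R (indicator X y * v n y)) \<le> 1" for n
        unfolding nrm_scale a_def[symmetric] by (simp add: a_def)
      fix K assume K: "compact K" "K \<subseteq> X - S"
      have KS: "K \<subseteq> \<Omega> - S" using K X\<Omega> by auto
      note cK = conv_K[OF conv K(1) KS]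
      have eq: "(\<lambda>y. indicator K y * ((1 / a n) *\<^sub>R (indicator X y * v n y))) = (\<lambda>y. (1 / a n) *\<^sub>R (indicator K y * v n y))" for n
        using K(2) by (intro ext) (auto simp: indicator_def)
      have "(\<lambda>n. nrm M (\<lambda>y. indicator K y * v n y) / a n) \<longlonglongrightarrow> 0"
      proof (rule tendsto_divide_0)
        show "(\<lambda>n. nrm M (\<lambda>y. indicator K y * v n y)) \<longlonglongrightarrow> nrm M (\<lambda>y. indicator K y * dG j (y - x))"
          by (rule nrm_tendsto[OF cK(1,2)]) (use cK(3) in \<open>simp add: right_diff_distrib\<close>)
        show "filterlim a at_infinity sequentially" by (rule filterlim_at_top_imp_at_infinity[OF ainf])
      qed
      then show "(\<lambda>n. nrm M (\<lambda>y. indicator K y * ((1 / a n) *\<^sub>R (indicator X y * v n y)))) \<longlonglongrightarrow> 0"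
        unfolding eq nrm_scale by (simp add: a_def abs_of_nonneg)
    qed
    then show ?thesis unfolding ip_scale_left by simp
  qed
  obtain r where r: "r > 0" "cball x r \<subseteq> \<Omega>" using \<open>open \<Omega>\<close> \<open>x \<in> \<Omega>\<close> unfolding open_contains_cball by blast
  \<comment> \<open>The closed ball lies in \<open>\<Omega>\<close>, so the regularised dipole
    agrees with \<open>dG\<close> near the boundary.\<close>
  define E where "E y = (1 / (4 * pi)) * dipole (r\<^sup>2) j x y" for y
  have cE: "c1 E" unfolding E_def[abs_def] by (intro c1_mult c1_const dipole_facts) (use r in simp)
  have EG: "E y = dG j (y - x)" if "y \<notin> cball x r" for y
    unfolding E_def by (rule dipole_eq_dG[OF r(1)]) (use that in \<open>simp add: dist_norm norm_minus_commute\<close>)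
  obtain w e0 uE where W: "\<And>n. w n \<in> h10 \<Omega>"
    "\<And>n \<phi>. \<phi> \<in> h10 \<Omega> \<Longrightarrow> aform M V (w n) \<phi> = - ip M (\<lambda>y. V y * v n y) (\<lambda>y. fst (\<phi> y))"
    "l2 M e0" "l2 M uE"
    "\<And>n. probe_ind \<Omega> V v n = ip M (\<lambda>y. V y * (v n y + fst (w n y))) (v n)"
    "\<And>n. singular_sources_ind \<Omega> V j x v n = - ip M (\<lambda>y. V y * (v n y + fst (w n y))) (\<lambda>y. e0 y - v n y)"
    "\<And>n. completely_integrated_ind \<Omega> V j x v n = ip M (\<lambda>y. V y * (uE y - (v n y + fst (w n y)))) (\<lambda>y. e0 y - v n y)"
    by (rule indicator_formulas[OF V no_kernel harm cE compact_cball r(2) EG]) (assumption, rule that)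
  have lims: "filterlim (\<lambda>n. s * probe_ind \<Omega> V v n) at_top sequentially"
    "filterlim (\<lambda>n. s * singular_sources_ind \<Omega> V j x v n) at_top sequentially"
    "filterlim (\<lambda>n. s * completely_integrated_ind \<Omega> V j x v n) at_top sequentially"
    if s: "\<bar>s\<bar> = 1" and C: "C > 0" and VC: "AE y in lebesgue. y \<in> D \<longrightarrow> C \<le> s * V y" for s C
  proof -
    \<comment> \<open>The jump is prescribed on \<open>D\<close>, while the norms are taken over its
      closure; the difference is the null frontier.\<close>
    have "AE y in lebesgue. y \<notin> frontier D"
      using lipschitz_frontier_negligible[OF \<open>lipschitz_bdry D\<close>] by (simp add: negligible_iff_null_sets AE_not_in)
    then have VX: "AE y in M. y \<in> X \<longrightarrow> C \<le> s * V y"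
      unfolding AE_on[OF leb] using VC
      by eventually_elim (use \<open>open D\<close> in \<open>auto simp: X_def frontier_def interior_open\<close>)
    note il = indicator_limits[OF V no_kernel W(1,2,3,4) lv Xl V0 s C VX ainf[unfolded a_def[abs_def]] weak[unfolded a_def]]
    show "filterlim (\<lambda>n. s * probe_ind \<Omega> V v n) at_top sequentially"
      "filterlim (\<lambda>n. s * singular_sources_ind \<Omega> V j x v n) at_top sequentially"
      "filterlim (\<lambda>n. s * completely_integrated_ind \<Omega> V j x v n) at_top sequentially"
      unfolding W(5-7) by (rule il; assumption)+
  qed
  show ?thesis
  proof (intro conjI impI)
    assume "positive_jump D V"
    then obtain C where C: "C > 0" "AE y in lebesgue. y \<in> D \<longrightarrow> C \<le> 1 * V y" by (auto simp: positive_jump_def)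
    note l = lims[OF _ C]
    show "filterlim (probe_ind \<Omega> V v) at_top sequentially" "filterlim (singular_sources_ind \<Omega> V j x v) at_top sequentially"
      "filterlim (completely_integrated_ind \<Omega> V j x v) at_top sequentially" using l by simp_all
  next
    assume "negative_jump D V"
    then obtain C where C: "C > 0" "AE y in lebesgue. y \<in> D \<longrightarrow> C \<le> (-1) * V y" by (auto simp: negative_jump_def)
    note l = lims[OF _ C]
    show "filterlim (probe_ind \<Omega> V v) at_bot sequentially" "filterlim (singular_sources_ind \<Omega> V j x v) at_bot sequentially"
      "filterlim (completely_integrated_ind \<Omega> V j x v) at_bot sequentially"
      unfolding filterlim_uminus_at_bot using l by simp_all
  qed
qed

end
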